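(* Let $g\ge1$ and let $\mu$ be a universal genus-$g$ polarization of degree $d$. Then the poset $\mathcal{QD}_{\mu,g}$ has pure dimension $4g-2$ and is connected in codimension $1$. Moreover, the natural forgetful map $f\colon\mathcal{QD}_{\mu,g}\to\mathcal{SG}_{g,1}$ is continuous, and for every stable genus-$g$ weighted graph $\Gamma$ with $1$ leg we have $$f^{-1}([\Gamma])=\mathcal{QD}_{v_0,\mu_\Gamma}(\Gamma)/\mathrm{Aut}(\Gamma)$$ (the identification being induced by the natural map $(\mathcal E,D)\mapsto[(\Gamma,\mathcal E,D)]$).
   Context: **Graphs.** Graphs are finite and connected, with loops and multiple edges allowed. For $\mathcal E\subset E(\Gamma)$, $\Gamma^{\mathcal E}$ is obtained by inserting exactly one vertex (exceptional) in the interior of each edge of $\mathcal E$. A specialization $\iota\colon\Gamma\to\Gamma'$ is a contraction of a set of edges followed by an isomorphism; it induces a surjection $\iota\colon V(\Gamma)\to V(\Gamma')$ and an inclusion $E(\Gamma')\subset E(\Gamma)$. For a function $h$ on $V(\Gamma)$, $\iota_*(h)(v')=\sum_{v\in\iota^{-1}(v')}h(v)$. A weighted graph with $1$ leg is $(\Gamma,w,v_0)$, $w\colon V(\Gamma)\to\mathbb Z_{\ge0}$, $v_0\in V(\Gamma)$ the vertex of the leg; its genus is $\sum_vw(v)+b_1(\Gamma)$; it is stable if $\mathrm{val}(v)+2w(v)+|L(v)|\ge3$ for every $v$, where $|L(v)|=1$ if $v=v_0$ and $0$ otherwise. Specializations of weighted graphs with $1$ leg satisfy $\iota(v_0)=v_0'$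 and $w'(v')=$ genus of $\iota^{-1}(v')$ (vertices over $v'$ together with the contracted edges between them). $\mathcal{SG}_{g,1}$ is the poset of isomorphism classes of stable weighted genus-$g$ graphs with $1$ leg, with $[\Gamma]\ge[\Gamma']$ if $\Gamma$ specializes to $\Gamma'$. **Quasistability.** A degree-$d$ polarization on $\Gamma$ is $\mu\colon V(\Gamma)\to\mathbb R$ with total sum $d$. A degree-$d$ divisor $D\colon V(\Gamma)\to\mathbb Z$ is $(v_0,\mu)$-quasistable if $\beta_D(V)=\sum_{v\in V}(D(v)-\mu(v))+\delta_V/2\ge0$ for every $V\subsetneq V(\Gamma)$, with strict inequality if $v_0\in V$; $\delta_V$ is the number of edges joining $V$ to $V^c$. A pseudo-divisor on $\Gamma$ is $(\mathcal E,D)$, $\mathcal E\subset E(\Gamma)$, $D$ a divisor on $\Gamma^{\mathcal E}$ with value $-1$ on all exceptional vertices; it is $(v_0,\mu)$-quasistable if $D$ is $(v_0,\mu^{\mathcal E})$-quasistable on $\Gamma^{\mathcal E}$, where $\mu^{\mathcal E}$ extends $\mu$ by $0$. A universal genus-$g$ polarization of degree $d$ is a collection $\mu=(\mu_\Gamma)$ of degree-$d$ polarizations, one for each stable weighted genus-$g$ graph with $1$ leg, with $\mu_{\Gamma'}=\iota_*(\mu_\Gamma)$ for every specialization $\iota\colon\Gamma\to\Gamma'$. **Posets.** A specialization $(\Gamma,\mathcal E,D)\to(\Gamma',\mathcal E',D')$ is a specialization $\iota\colon\Gamma\to\Gamma'$ with $\mathcal E'\subset\mathcal E\cap E(\Gamma')$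 together with a specialization $\iota^{\mathcal E}\colon\Gamma^{\mathcal E}\to\Gamma'^{\mathcal E'}$ compatible with $\iota$ (agreeing with $\iota$ on $V(\Gamma)\subset V(\Gamma^{\mathcal E})$ and whose edge inclusion sends edges over $e\in E(\Gamma')$ to edges over $e$), such that $\iota^{\mathcal E}_*(D)=D'$. $\mathcal{QD}_{v_0,\mu_\Gamma}(\Gamma)$ is the set of $(v_0,\mu_\Gamma)$-quasistable degree-$d$ pseudo-divisors on $\Gamma$, with $(\mathcal E,D)\ge(\mathcal E',D')$ if $(\mathcal E,D)$ specializes to $(\mathcal E',D')$ over the identity of $\Gamma$. $\mathcal{QD}_{\mu,g}$ is the set of isomorphism classes of triples $(\Gamma,\mathcal E,D)$, with $\Gamma$ a stable weighted genus-$g$ graph with $1$ leg and $(\mathcal E,D)\in\mathcal{QD}_{v_0,\mu_\Gamma}(\Gamma)$, ordered by specialization ($\ge$ means "specializes to"); $f$ sends $[(\Gamma,\mathcal E,D)]$ to $[\Gamma]$. $\mathrm{Aut}(\Gamma)$ is the automorphism group of $\Gamma$ as weighted graph with leg. A poset has the topology whose closed sets are the lower sets. The dimension of $x$ is the maximal length $n$ of a chain $x_0<\dots<x_n=x$; the poset has pure dimension $n$ if all maximal elements have dimension $n$, and is ranked of length $n$ if all maximal chains have length $n$ (then codimension of $x$ is $n-\dim x$). A ranked poset is connected in codimension $1$ if for any maximal $y,y'$ there are maximal $y=y_0,\dots,y_m=y'$ and codimension-$1$ elements $x_1,\dots,x_m$ with $x_i<y_{i-1}$ and $x_i<y_i$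 for $i=1,\dots,m$. *)

theory Defs
  imports
    "HOL-Library.Extended_Nat"
    "HOL-Library.FuncSet"
    "HOL-Analysis.Abstract_Topology"
begin

section \<open>Multigraphs\<close>

text \<open>
  An edge \<open>e\<close> consists of two half-edges, labelled \<open>False\<close> and \<open>True\<close>, and \<open>att G e b\<close> is the
  vertex to which the half-edge \<open>b\<close> of \<open>e\<close> is attached.  Loops and parallel edges are allowed.
  The labelling of the half-edges is auxiliary: isomorphisms only see the end set
  \<open>ends G e\<close>, which is a singleton exactly for loops.
\<close>

record ('v, 'e) mgraph =
  verts :: "'v set"
  edges :: "'e set"
  att :: "'e \<Rightarrow> bool \<Rightarrow> 'v"

definition ends :: "('v, 'e, 'm) mgraph_scheme \<Rightarrow> 'e \<Rightarrow> 'v set" where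
  "ends G e = range (att G e)"

definition comp :: "('v, 'e, 'm) mgraph_scheme \<Rightarrow> 'e set \<Rightarrow> 'v \<Rightarrow> 'v set" where
  "comp G S v = {u. (v, u) \<in> (\<Union>e\<in>S. ends G e \<times> ends G e)\<^sup>*}"

definition finite_connected_graph :: "('v, 'e, 'm) mgraph_scheme \<Rightarrow> bool" where
  "finite_connected_graph G \<longleftrightarrow>
     finite (verts G) \<and> finite (edges G) \<and> verts G \<noteq> {} \<and>
     (\<forall>e\<in>edges G. ends G e \<subseteq> verts G) \<and>
     (\<forall>u\<in>verts G. \<forall>v\<in>verts G. v \<in> comp G (edges G) u)"

definition b1 :: "('v, 'e, 'm) mgraph_scheme \<Rightarrow> int" where
  "b1 G = int (card (edges G)) - int (card (verts G))
            + int (card (comp G (edges G) ` verts G))"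

definition val :: "('v, 'e, 'm) mgraph_scheme \<Rightarrow> 'v \<Rightarrow> nat" where
  "val G v = card {(e, b). e \<in> edges G \<and> att G e b = v}"

definition cut :: "('v, 'e, 'm) mgraph_scheme \<Rightarrow> 'v set \<Rightarrow> 'e set" where
  "cut G X = {e \<in> edges G. ends G e \<inter> X \<noteq> {} \<and> ends G e - X \<noteq> {}}"

definition graph_iso ::
  "('v, 'e, 'm) mgraph_scheme \<Rightarrow> ('w, 'f, 'n) mgraph_scheme \<Rightarrow> ('v \<Rightarrow> 'w) \<Rightarrow> ('e \<Rightarrow> 'f) \<Rightarrow> bool" where
  "graph_iso G H \<phi> \<psi> \<longleftrightarrow>
     bij_betw \<phi> (verts G) (verts H) \<and> bij_betw \<psi> (edges G) (edges H) \<and>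
     (\<forall>e\<in>edges G. ends H (\<psi> e) = \<phi> ` ends G e)"

text \<open>The vertices of \<open>contract G S\<close> are the connected components of the graph with vertex set
  \<open>verts G\<close> and edge set \<open>S\<close>.\<close>

definition contract :: "('v, 'e, 'm) mgraph_scheme \<Rightarrow> 'e set \<Rightarrow> ('v set, 'e) mgraph" where
  "contract G S = \<lparr>verts = comp G S ` verts G, edges = edges G - S,
                   att = (\<lambda>e b. comp G S (att G e b))\<rparr>"

text \<open>A contraction of a set \<open>S\<close> of edges followed by an isomorphism \<open>(h, k)\<close>, recorded by the
  induced surjection \<open>\<phi>\<close> on vertices and the induced inclusion \<open>\<epsilon>\<close> of edges, which goes
  backwards.\<close>

definition specialization ::
  "('v, 'e, 'm) mgraph_scheme \<Rightarrow> ('w, 'f, 'n) mgraph_scheme \<Rightarrow> ('v \<Rightarrow> 'w) \<Rightarrow> ('f \<Rightarrow> 'e) \<Rightarrow> bool" where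
  "specialization G H \<phi> \<epsilon> \<longleftrightarrow>
     (\<exists>S h k. S \<subseteq> edges G \<and> graph_iso (contract G S) H h k \<and>
        (\<forall>v\<in>verts G. \<phi> v = h (comp G S v)) \<and>
        (\<forall>e\<in>edges G - S. \<epsilon> (k e) = e))"

definition pushforward ::
  "('v, 'e, 'm) mgraph_scheme \<Rightarrow> ('v \<Rightarrow> 'w) \<Rightarrow> ('v \<Rightarrow> 'a::comm_monoid_add) \<Rightarrow> 'w \<Rightarrow> 'a" where
  "pushforward G \<phi> h w = (\<Sum>v\<in>{v \<in> verts G. \<phi> v = w}. h v)"


section \<open>Weighted graphs with one leg\<close>

record ('v, 'e) wgraph = "('v, 'e) mgraph" +
  weight :: "'v \<Rightarrow> nat"
  leg :: 'v

definition genus :: "('v, 'e) wgraph \<Rightarrow> int" where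
  "genus \<Gamma> = (\<Sum>v\<in>verts \<Gamma>. int (weight \<Gamma> v)) + b1 \<Gamma>"

definition stable :: "('v, 'e) wgraph \<Rightarrow> bool" where
  "stable \<Gamma> \<longleftrightarrow>
     (\<forall>v\<in>verts \<Gamma>. val \<Gamma> v + 2 * weight \<Gamma> v + (if v = leg \<Gamma> then 1 else 0) \<ge> 3)"

text \<open>Every finite graph is isomorphic to one whose vertices and edges are natural numbers.\<close>

definition stable_graphs :: "nat \<Rightarrow> (nat, nat) wgraph set" where
  "stable_graphs g =
     {\<Gamma>. finite_connected_graph \<Gamma> \<and> leg \<Gamma> \<in> verts \<Gamma> \<and> genus \<Gamma> = int g \<and> stable \<Gamma>}"

definition wgraph_iso ::
  "('v, 'e) wgraph \<Rightarrow> ('w, 'f) wgraph \<Rightarrow> ('v \<Rightarrow> 'w) \<Rightarrow> ('e \<Rightarrow> 'f) \<Rightarrow> bool" where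
  "wgraph_iso \<Gamma> \<Gamma>' \<phi> \<psi> \<longleftrightarrow>
     graph_iso \<Gamma> \<Gamma>' \<phi> \<psi> \<and> \<phi> (leg \<Gamma>) = leg \<Gamma>' \<and> (\<forall>v\<in>verts \<Gamma>. weight \<Gamma>' (\<phi> v) = weight \<Gamma> v)"

definition Aut :: "('v, 'e) wgraph \<Rightarrow> (('v \<Rightarrow> 'v) \<times> ('e \<Rightarrow> 'e)) set" where
  "Aut \<Gamma> = {(\<phi>, \<psi>). wgraph_iso \<Gamma> \<Gamma> \<phi> \<psi>}"

definition subgraph :: "('v, 'e) wgraph \<Rightarrow> 'v set \<Rightarrow> 'e set \<Rightarrow> ('v, 'e) wgraph" where
  "subgraph \<Gamma> X S = \<Gamma>\<lparr>verts := X, edges := {e \<in> S. ends \<Gamma> e \<subseteq> X}\<rparr>"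

definition wspecialization ::
  "('v, 'e) wgraph \<Rightarrow> ('w, 'f) wgraph \<Rightarrow> ('v \<Rightarrow> 'w) \<Rightarrow> ('f \<Rightarrow> 'e) \<Rightarrow> bool" where
  "wspecialization \<Gamma> \<Gamma>' \<phi> \<epsilon> \<longleftrightarrow>
     specialization \<Gamma> \<Gamma>' \<phi> \<epsilon> \<and> \<phi> (leg \<Gamma>) = leg \<Gamma>' \<and>
     (\<forall>v'\<in>verts \<Gamma>'. int (weight \<Gamma>' v') =
        genus (subgraph \<Gamma> {v \<in> verts \<Gamma>. \<phi> v = v'} (edges \<Gamma> - \<epsilon> ` edges \<Gamma>')))"

definition graph_iso_rel :: "nat \<Rightarrow> (nat, nat) wgraph rel" where
  "graph_iso_rel g =
     {(\<Gamma>, \<Gamma>'). \<Gamma> \<in> stable_graphs g \<and> \<Gamma>' \<in> stable_graphs g \<and> (\<exists>\<phi> \<psi>. wgraph_iso \<Gamma> \<Gamma>' \<phi> \<psi>)}"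

definition graph_class :: "nat \<Rightarrow> (nat, nat) wgraph \<Rightarrow> (nat, nat) wgraph set" where
  "graph_class g \<Gamma> = graph_iso_rel g `` {\<Gamma>}"

definition SG :: "nat \<Rightarrow> (nat, nat) wgraph set set" where
  "SG g = stable_graphs g // graph_iso_rel g"

text \<open>Order relations are sets of pairs \<open>(x, y)\<close> meaning \<open>x \<le> y\<close>, that is, \<open>y\<close> specializes
  to \<open>x\<close>.\<close>

definition SG_le :: "nat \<Rightarrow> (nat, nat) wgraph set rel" where
  "SG_le g = {(A', A). A' \<in> SG g \<and> A \<in> SG g \<and>
     (\<exists>\<Gamma>\<in>A. \<exists>\<Gamma>'\<in>A'. \<exists>\<phi> \<epsilon>. wspecialization \<Gamma> \<Gamma>' \<phi> \<epsilon>)}"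


section \<open>Subdivisions and quasistable pseudo-divisors\<close>

datatype ('v, 'e) svert = Orig 'v | Exc 'e

text \<open>For a subdivided edge \<open>e\<close>, the edge \<open>Half e b\<close> joins the exceptional vertex \<open>Exc e\<close> to the
  vertex at which the half-edge \<open>b\<close> of \<open>e\<close> is attached.\<close>

datatype 'e sedge = Whole (over: 'e) | Half (over: 'e) bool

definition subdivide :: "('v, 'e, 'm) mgraph_scheme \<Rightarrow> 'e set \<Rightarrow> (('v, 'e) svert, 'e sedge) mgraph" where
  "subdivide G \<E> =
     \<lparr>verts = Orig ` verts G \<union> Exc ` \<E>,
      edges = Whole ` (edges G - \<E>) \<union> {Half e b |e b. e \<in> \<E>},
      att = (\<lambda>x c. case x of
               Whole e \<Rightarrow> Orig (att G e c)
             | Half e b \<Rightarrow> (if c then Exc e else Orig (att G e b)))\<rparr>"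

definition beta ::
  "('v, 'e, 'm) mgraph_scheme \<Rightarrow> ('v \<Rightarrow> real) \<Rightarrow> ('v \<Rightarrow> int) \<Rightarrow> 'v set \<Rightarrow> real" where
  "beta G \<mu> D X = (\<Sum>v\<in>X. real_of_int (D v) - \<mu> v) + real (card (cut G X)) / 2"

definition quasistable ::
  "('v, 'e, 'm) mgraph_scheme \<Rightarrow> 'v \<Rightarrow> ('v \<Rightarrow> real) \<Rightarrow> ('v \<Rightarrow> int) \<Rightarrow> bool" where
  "quasistable G v0 \<mu> D \<longleftrightarrow>
     (\<forall>X. X \<subset> verts G \<longrightarrow> beta G \<mu> D X \<ge> 0 \<and> (v0 \<in> X \<longrightarrow> beta G \<mu> D X > 0))"

definition subdivide_pol :: "('v \<Rightarrow> real) \<Rightarrow> ('v, 'e) svert \<Rightarrow> real" where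
  "subdivide_pol \<mu> x = (case x of Orig v \<Rightarrow> \<mu> v | Exc e \<Rightarrow> 0)"

text \<open>Divisors are taken extensional, so that equality of divisors is equality on vertices.\<close>

type_synonym ('v, 'e) pseudo_divisor = "'e set \<times> (('v, 'e) svert \<Rightarrow> int)"

definition pseudo_divisors :: "('v, 'e, 'm) mgraph_scheme \<Rightarrow> int \<Rightarrow> ('v, 'e) pseudo_divisor set" where
  "pseudo_divisors G d =
     {(\<E>, D). \<E> \<subseteq> edges G \<and> D \<in> extensional (verts (subdivide G \<E>)) \<and>
        (\<forall>e\<in>\<E>. D (Exc e) = -1) \<and> (\<Sum>x\<in>verts (subdivide G \<E>). D x) = d}"

definition QD :: "int \<Rightarrow> ('v, 'e) wgraph \<Rightarrow> ('v \<Rightarrow> real) \<Rightarrow> ('v, 'e) pseudo_divisor set" where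
  "QD d \<Gamma> \<mu> =
     {(\<E>, D) \<in> pseudo_divisors \<Gamma> d.
        quasistable (subdivide \<Gamma> \<E>) (Orig (leg \<Gamma>)) (subdivide_pol \<mu>) D}"

definition universal_polarization ::
  "nat \<Rightarrow> int \<Rightarrow> ((nat, nat) wgraph \<Rightarrow> nat \<Rightarrow> real) \<Rightarrow> bool" where
  "universal_polarization g d \<mu> \<longleftrightarrow>
     (\<forall>\<Gamma>\<in>stable_graphs g. (\<Sum>v\<in>verts \<Gamma>. \<mu> \<Gamma> v) = real_of_int d) \<and>
     (\<forall>\<Gamma>\<in>stable_graphs g. \<forall>\<Gamma>'\<in>stable_graphs g. \<forall>\<phi> \<epsilon>. wspecialization \<Gamma> \<Gamma>' \<phi> \<epsilon> \<longrightarrow>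
        (\<forall>v'\<in>verts \<Gamma>'. \<mu> \<Gamma>' v' = pushforward \<Gamma> \<phi> (\<mu> \<Gamma>) v'))"


section \<open>Specializations and isomorphisms of pseudo-divisors\<close>

text \<open>Specialization of \<open>(\<Gamma>, \<E>, D)\<close> to \<open>(\<Gamma>', \<E>', D')\<close> lying over the specialization
  \<open>(\<phi>, \<epsilon>)\<close> of graphs.\<close>

definition pd_specialization ::
  "('v, 'e) wgraph \<Rightarrow> ('v, 'e) pseudo_divisor \<Rightarrow> ('w, 'f) wgraph \<Rightarrow> ('w, 'f) pseudo_divisor \<Rightarrow>
     ('v \<Rightarrow> 'w) \<Rightarrow> ('f \<Rightarrow> 'e) \<Rightarrow> bool" where
  "pd_specialization \<Gamma> = (\<lambda>(\<E>, D) \<Gamma>' (\<E>', D') \<phi> \<epsilon>.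
     wspecialization \<Gamma> \<Gamma>' \<phi> \<epsilon> \<and> \<epsilon> ` \<E>' \<subseteq> \<E> \<and>
     (\<exists>\<phi>s \<epsilon>s. specialization (subdivide \<Gamma> \<E>) (subdivide \<Gamma>' \<E>') \<phi>s \<epsilon>s \<and>
        (\<forall>v\<in>verts \<Gamma>. \<phi>s (Orig v) = Orig (\<phi> v)) \<and>
        (\<forall>x\<in>edges (subdivide \<Gamma>' \<E>'). over (\<epsilon>s x) = \<epsilon> (over x)) \<and>
        (\<forall>y\<in>verts (subdivide \<Gamma>' \<E>'). D' y = pushforward (subdivide \<Gamma> \<E>) \<phi>s D y)))"

definition QD_le :: "int \<Rightarrow> ('v, 'e) wgraph \<Rightarrow> ('v \<Rightarrow> real) \<Rightarrow> ('v, 'e) pseudo_divisor rel" where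
  "QD_le d \<Gamma> \<mu> =
     {(p', p). p' \<in> QD d \<Gamma> \<mu> \<and> p \<in> QD d \<Gamma> \<mu> \<and> pd_specialization \<Gamma> p \<Gamma> p' id id}"

text \<open>The isomorphism \<open>(\<phi>, \<psi>)\<close> of graphs induces \<open>map_svert \<phi> \<psi>\<close> on the vertices of
  subdivisions.\<close>

definition pd_transport ::
  "('v, 'e) wgraph \<Rightarrow> ('w, 'f) wgraph \<Rightarrow> ('v \<Rightarrow> 'w) \<times> ('e \<Rightarrow> 'f) \<Rightarrow>
     ('v, 'e) pseudo_divisor \<Rightarrow> ('w, 'f) pseudo_divisor" where
  "pd_transport \<Gamma> \<Gamma>' = (\<lambda>(\<phi>, \<psi>) (\<E>, D).
     (\<psi> ` \<E>, restrict (pushforward (subdivide \<Gamma> \<E>) (map_svert \<phi> \<psi>) D)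
                (verts (subdivide \<Gamma>' (\<psi> ` \<E>)))))"

definition Aut_orbit :: "('v, 'e) wgraph \<Rightarrow> ('v, 'e) pseudo_divisor \<Rightarrow> ('v, 'e) pseudo_divisor set" where
  "Aut_orbit \<Gamma> p = (\<lambda>\<sigma>. pd_transport \<Gamma> \<Gamma> \<sigma> p) ` Aut \<Gamma>"

definition QD_mod_Aut :: "int \<Rightarrow> ('v, 'e) wgraph \<Rightarrow> ('v \<Rightarrow> real) \<Rightarrow> ('v, 'e) pseudo_divisor set set" where
  "QD_mod_Aut d \<Gamma> \<mu> = Aut_orbit \<Gamma> ` QD d \<Gamma> \<mu>"

definition QD_mod_Aut_le ::
  "int \<Rightarrow> ('v, 'e) wgraph \<Rightarrow> ('v \<Rightarrow> real) \<Rightarrow> ('v, 'e) pseudo_divisor set rel" where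
  "QD_mod_Aut_le d \<Gamma> \<mu> =
     {(P', P). P' \<in> QD_mod_Aut d \<Gamma> \<mu> \<and> P \<in> QD_mod_Aut d \<Gamma> \<mu> \<and>
        (\<exists>p'\<in>P'. \<exists>p\<in>P. (p', p) \<in> QD_le d \<Gamma> \<mu>)}"


section \<open>The universal poset\<close>

type_synonym triple = "(nat, nat) wgraph \<times> (nat, nat) pseudo_divisor"

context
  fixes g :: nat and d :: int and \<mu> :: "(nat, nat) wgraph \<Rightarrow> nat \<Rightarrow> real"
begin

definition QD_triples :: "triple set" where
  "QD_triples = {(\<Gamma>, p). \<Gamma> \<in> stable_graphs g \<and> p \<in> QD d \<Gamma> (\<mu> \<Gamma>)}"

definition triple_iso_rel :: "triple rel" where
  "triple_iso_rel = {((\<Gamma>, p), (\<Gamma>', p')).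
     (\<Gamma>, p) \<in> QD_triples \<and> (\<Gamma>', p') \<in> QD_triples \<and>
     (\<exists>\<phi> \<psi>. wgraph_iso \<Gamma> \<Gamma>' \<phi> \<psi> \<and> pd_transport \<Gamma> \<Gamma>' (\<phi>, \<psi>) p = p')}"

definition triple_class :: "triple \<Rightarrow> triple set" where
  "triple_class t = triple_iso_rel `` {t}"

definition QD_univ :: "triple set set" where
  "QD_univ = QD_triples // triple_iso_rel"

definition QD_univ_le :: "triple set rel" where
  "QD_univ_le = {(A', A). A' \<in> QD_univ \<and> A \<in> QD_univ \<and>
     (\<exists>(\<Gamma>, p)\<in>A. \<exists>(\<Gamma>', p')\<in>A'. \<exists>\<phi> \<epsilon>. pd_specialization \<Gamma> p \<Gamma>' p' \<phi> \<epsilon>)}"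

end

text \<open>All representatives \<open>(\<Gamma>, \<E>, D)\<close> of an element of \<open>QD_univ\<close> have the same \<open>[\<Gamma>]\<close>; this
  common value is the image under the forgetful map.\<close>

definition forget :: "nat \<Rightarrow> triple set \<Rightarrow> (nat, nat) wgraph set" where
  "forget g A = the_elem ((\<lambda>(\<Gamma>, p). graph_class g \<Gamma>) ` A)"


section \<open>Posets\<close>

definition lower_set :: "'a set \<Rightarrow> 'a rel \<Rightarrow> 'a set \<Rightarrow> bool" where
  "lower_set A r L \<longleftrightarrow> L \<subseteq> A \<and> (\<forall>x\<in>L. \<forall>y\<in>A. (y, x) \<in> r \<longrightarrow> y \<in> L)"

definition poset_topology :: "'a set \<Rightarrow> 'a rel \<Rightarrow> 'a topology" where
  "poset_topology A r = topology (\<lambda>U. U \<subseteq> A \<and> lower_set A r (A - U))"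

lemma openin_poset_topology:
  "openin (poset_topology A r) U \<longleftrightarrow> U \<subseteq> A \<and> lower_set A r (A - U)"
proof -
  have "istopology (\<lambda>U. U \<subseteq> A \<and> lower_set A r (A - U))"
    unfolding istopology_def lower_set_def by blast
  then show ?thesis
    by (simp add: poset_topology_def topology_inverse')
qed

lemma topspace_poset_topology: "topspace (poset_topology A r) = A"
proof -
  have "openin (poset_topology A r) A"
    by (simp add: openin_poset_topology lower_set_def)
  then show ?thesis
    by (metis openin_poset_topology openin_subset openin_topspace subset_antisym)
qed

lemma closedin_poset_topology: "closedin (poset_topology A r) L \<longleftrightarrow> lower_set A r L"
  by (auto simp: closedin_def topspace_poset_topology openin_poset_topology
      lower_set_def double_diff)

definition is_chain :: "'a set \<Rightarrow> 'a rel \<Rightarrow> 'a set \<Rightarrow> bool" where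
  "is_chain A r C \<longleftrightarrow> C \<subseteq> A \<and> C \<in> Chains r"

definition maximal_elt :: "'a set \<Rightarrow> 'a rel \<Rightarrow> 'a \<Rightarrow> bool" where
  "maximal_elt A r x \<longleftrightarrow> x \<in> A \<and> (\<forall>y\<in>A. (x, y) \<in> r \<longrightarrow> y = x)"

text \<open>A chain with \<open>n + 1\<close> elements has length \<open>n\<close>.\<close>

definition poset_dim :: "'a set \<Rightarrow> 'a rel \<Rightarrow> 'a \<Rightarrow> enat" where
  "poset_dim A r x =
     (SUP C\<in>{C. is_chain A r C \<and> finite C \<and> x \<in> C \<and> (\<forall>y\<in>C. (y, x) \<in> r)}. enat (card C - 1))"

definition pure_dimension :: "'a set \<Rightarrow> 'a rel \<Rightarrow> nat \<Rightarrow> bool" where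
  "pure_dimension A r n \<longleftrightarrow>
     partial_order_on A r \<and> (\<forall>x. maximal_elt A r x \<longrightarrow> poset_dim A r x = enat n)"

definition ranked :: "'a set \<Rightarrow> 'a rel \<Rightarrow> nat \<Rightarrow> bool" where
  "ranked A r n \<longleftrightarrow>
     partial_order_on A r \<and>
     (\<forall>C. is_chain A r C \<and> (\<forall>C'. is_chain A r C' \<and> C \<subseteq> C' \<longrightarrow> C' = C) \<longrightarrow>
        finite C \<and> card C = n + 1)"

definition connected_in_codim1 :: "'a set \<Rightarrow> 'a rel \<Rightarrow> bool" where
  "connected_in_codim1 A r \<longleftrightarrow>
     (\<exists>n. ranked A r n \<and>
       (\<forall>y y'. maximal_elt A r y \<and> maximal_elt A r y' \<longrightarrow>
         (\<exists>m (ys :: nat \<Rightarrow> 'a) (xs :: nat \<Rightarrow> 'a).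
            ys 0 = y \<and> ys m = y' \<and> (\<forall>i\<le>m. maximal_elt A r (ys i)) \<and>
            (\<forall>i\<in>{1..m}. xs i \<in> A \<and> enat n - poset_dim A r (xs i) = 1 \<and>
               (xs i, ys (i - 1)) \<in> r \<and> xs i \<noteq> ys (i - 1) \<and>
               (xs i, ys i) \<in> r \<and> xs i \<noteq> ys i))))"

end

theory Submission
  imports Defs "HOL-Library.Multiset"
begin

text \<open>
  A pseudo-divisor \<open>(E, D)\<close> is encoded by \<open>E\<close> and the values \<open>a\<close> of \<open>D\<close> on the original vertices.
  Its quasistability becomes positivity of a submodular function \<open>gam\<close> on sets of original vertices,
  and its rank is the number of edges of the subdivided graph.  A specialization can be factored
  into steps that lower the rank by one.  Conversely an element of rank less than \<open>4g - 2\<close> can be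
  raised: a positive weight is traded for a loop or a vertex of high valence is split, where
  submodularity leaves a half-open window of length at least one for the new value of \<open>a\<close>; or,
  on a trivalent graph, a non-exceptional edge on a cycle is subdivided.

  A maximal element is a trivalent graph together with a spanning tree, the complement of \<open>E\<close>; the
  divisor is then determined.  Contracting and re-expanding a tree edge passes through an element of
  codimension one and swaps two half-edges.  Such flips turn the tree into a Hamiltonian path
  starting at the leg and permute the remaining half-edges arbitrarily, so every maximal element is
  connected to one normal form.
\<close>

section \<open>Graded posets\<close>

text \<open>\<open>gam\<close> is the least value of \<open>beta\<close> over all ways of adding
  exceptional vertices to a set of original ones. On all vertices it is \<open>0\<close>, so its
  values on a set and on the complement add up to the number of non-exceptional edges leaving the
  set. Strictness at the leg makes this sum positive: the edges outside \<open>E\<close> connect all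
  vertices, hence \<open>card E\<close> plus the total weight is at most \<open>g\<close>. Stability
  bounds edges plus weight by \<open>3g - 2\<close>, and together these give \<open>4g - 2\<close>.
  The strict inequality at the leg is also the obstacle in both existence arguments: it decides
  which end of the window is open when an edge is expanded, and a small modular perturbation absorbs
  it when an edge is subdivided. Each argument ends with one submodularity inequality in which an
  edge between the two differences supplies the decisive \<open>1\<close>. Order and rank are
  handled on representatives: a specialization between triples of equal rank is an isomorphism, and
  this makes the quotient a graded partial order.\<close>

locale graded_poset =
  fixes P :: "'a set" and r :: "'a rel" and \<rho> :: "'a \<Rightarrow> nat" and n :: nat
  assumes po: "partial_order_on P r"
    and nonempty: "P \<noteq> {}"
    and rank_less: "(x, y) \<in> r \<Longrightarrow> x \<noteq> y \<Longrightarrow> \<rho> x < \<rho> y"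
    and rank_le: "x \<in> P \<Longrightarrow> \<rho> x \<le> n"
    and between: "(x, y) \<in> r \<Longrightarrow> x \<noteq> y \<Longrightarrow> \<exists>z. (x, z) \<in> r \<and> (z, y) \<in> r \<and> Suc (\<rho> z) = \<rho> y"
    and down: "y \<in> P \<Longrightarrow> 0 < \<rho> y \<Longrightarrow> \<exists>z. (z, y) \<in> r \<and> Suc (\<rho> z) = \<rho> y"
    and up: "x \<in> P \<Longrightarrow> \<rho> x < n \<Longrightarrow> \<exists>z. (x, z) \<in> r \<and> \<rho> x < \<rho> z"
begin

lemma le_in: "(x, y) \<in> r \<Longrightarrow> x \<in> P \<and> y \<in> P"
  using po by (auto simp: partial_order_on_def preorder_on_def refl_on_def)

lemma le_refl: "x \<in> P \<Longrightarrow> (x, x) \<in> r"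
  using po by (auto simp: partial_order_on_def preorder_on_def refl_on_def)

lemma le_trans: "(x, y) \<in> r \<Longrightarrow> (y, z) \<in> r \<Longrightarrow> (x, z) \<in> r"
  using po unfolding partial_order_on_def preorder_on_def by (meson transD)

lemma chain_inj:
  assumes "is_chain P r C"
  shows "inj_on \<rho> C"
proof (rule inj_onI)
  fix x y assume xy: "x \<in> C" "y \<in> C" and e: "\<rho> x = \<rho> y"
  have "(x, y) \<in> r \<or> (y, x) \<in> r"
    using assms xy by (auto simp: is_chain_def Chains_def)
  with rank_less e show "x = y" by (metis less_irrefl)
qed

lemma chain_le:
  assumes "is_chain P r C" "x \<in> C" "y \<in> C" "\<rho> x < \<rho> y"
  shows "(x, y) \<in> r"
proof -
  have "(x, y) \<in> r \<or> (y, x) \<in> r"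
    using assms by (auto simp: is_chain_def Chains_def)
  with rank_less assms(4) show ?thesis by (metis less_asym less_irrefl)
qed

lemma chain_finite:
  assumes "is_chain P r C"
  shows "finite C"
proof (rule inj_on_finite[OF chain_inj[OF assms]])
  show "\<rho> ` C \<subseteq> {..n}" using assms rank_le by (auto simp: is_chain_def)
qed simp

lemma chain_insert:
  assumes "is_chain P r C" "z \<in> P" "\<And>y. y \<in> C \<Longrightarrow> (y, z) \<in> r \<or> (z, y) \<in> r"
  shows "is_chain P r (insert z C)"
  using assms le_refl by (auto simp: is_chain_def Chains_def)

text \<open>Iterating \<open>down\<close> from \<open>x\<close> gives one element of every rank from
  \<open>0\<close> to \<open>\<rho> x\<close>; this chain attains the bound on the
  dimension.\<close>

lemma chain_below: "x \<in> P \<Longrightarrow> \<exists>C. is_chain P r C \<and> finite C \<and> x \<in> C \<and> (\<forall>y\<in>C. (y, x) \<in> r) \<and> card C = Suc (\<rho> x)"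
proof (induction "\<rho> x" arbitrary: x)
  case 0
  then show ?case
    by (intro exI[of _ "{x}"]) (auto simp: is_chain_def Chains_def le_refl)
next
  case (Suc k)
  then obtain z where z: "(z, x) \<in> r" "Suc (\<rho> z) = \<rho> x"
    using down[of x] by auto
  then obtain C where C: "is_chain P r C" "finite C" "z \<in> C" "\<forall>y\<in>C. (y, z) \<in> r" "card C = Suc (\<rho> z)"
    using Suc(1)[of z] Suc(2) le_in by auto
  have xC: "x \<notin> C"
    using C(4) z rank_less by (metis Suc_n_not_le_n less_imp_le_nat n_not_Suc_n)
  have le: "(y, x) \<in> r" if "y \<in> C" for y
    using that C(4) z(1) le_trans by blast
  show ?case
    using C xC z le le_refl[OF Suc(3)] Suc(3)
    by (intro exI[of _ "insert x C"]) (auto intro!: chain_insert)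
qed

text \<open>Ranks are injective on a chain and, below \<open>x\<close>, bounded by
  \<open>\<rho> x\<close>, so a chain has at most \<open>\<rho> x + 1\<close> elements;
  \<open>chain_below\<close> attains this.\<close>

lemma poset_dim_eq:
  assumes "x \<in> P"
  shows "poset_dim P r x = enat (\<rho> x)"
  unfolding poset_dim_def
proof (rule antisym)
  show "(SUP C\<in>{C. is_chain P r C \<and> finite C \<and> x \<in> C \<and> (\<forall>y\<in>C. (y, x) \<in> r)}. enat (card C - 1)) \<le> enat (\<rho> x)"
  proof (rule SUP_least)
    fix C assume C: "C \<in> {C. is_chain P r C \<and> finite C \<and> x \<in> C \<and> (\<forall>y\<in>C. (y, x) \<in> r)}"
    have "card C = card (\<rho> ` C)" using C chain_inj by (simp add: card_image)
    also have "\<dots> \<le> card {..\<rho> x}"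
    proof (rule card_mono)
      show "\<rho> ` C \<subseteq> {..\<rho> x}"
        using C rank_less by (force intro: less_imp_le)
    qed simp
    finally show "enat (card C - 1) \<le> enat (\<rho> x)" by simp
  qed
  obtain C where C: "is_chain P r C \<and> finite C \<and> x \<in> C \<and> (\<forall>y\<in>C. (y, x) \<in> r)" "card C = Suc (\<rho> x)"
    using chain_below[OF assms] by blast
  show "enat (\<rho> x) \<le> (SUP C\<in>{C. is_chain P r C \<and> finite C \<and> x \<in> C \<and> (\<forall>y\<in>C. (y, x) \<in> r)}. enat (card C - 1))"
    by (rule SUP_upper2[of C]) (use C in auto)
qed

text \<open>\<open>up\<close> raises the rank by an unspecified positive amount. That already
  excludes maximal elements of rank below \<open>n\<close>, and \<open>rank_le\<close> excludes
  anything above an element of rank \<open>n\<close>.\<close>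

lemma maximal_iff: "maximal_elt P r x \<longleftrightarrow> x \<in> P \<and> \<rho> x = n"
proof
  assume m: "maximal_elt P r x"
  show "x \<in> P \<and> \<rho> x = n"
  proof (rule ccontr)
    assume "\<not> ?thesis"
    then have "\<rho> x < n" using m rank_le[of x] by (auto simp: maximal_elt_def)
    then obtain z where "(x, z) \<in> r" "\<rho> x < \<rho> z" using up m by (auto simp: maximal_elt_def)
    then show False using m le_in by (auto simp: maximal_elt_def)
  qed
next
  assume "x \<in> P \<and> \<rho> x = n"
  then show "maximal_elt P r x"
    unfolding maximal_elt_def using rank_less rank_le by (metis leD)
qed

lemma pure_dimension: "pure_dimension P r n"
  using po poset_dim_eq maximal_iff by (auto simp: pure_dimension_def)

text \<open>Maximality forces every rank \<open>k \<le> n\<close> to occur: at a missing rank the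
  chain splits into an upper and a lower part, and a further element fits between them or on
  top.\<close>

lemma ranked: "ranked P r n"
  unfolding ranked_def
proof (intro conjI allI impI po)
  fix C assume "is_chain P r C \<and> (\<forall>C'. is_chain P r C' \<and> C \<subseteq> C' \<longrightarrow> C' = C)"
  then have C: "is_chain P r C" and maxC: "\<And>C'. is_chain P r C' \<Longrightarrow> C \<subseteq> C' \<Longrightarrow> C' = C"
    by blast+
  show fin: "finite C" using C by (rule chain_finite)
  have ins: "z \<in> C" if "z \<in> P" "\<And>y. y \<in> C \<Longrightarrow> (y, z) \<in> r \<or> (z, y) \<in> r" for z
    using maxC[OF chain_insert[OF C that]] by blast
  have CP: "C \<subseteq> P" using C by (simp add: is_chain_def)
  have "C \<noteq> {}" using ins nonempty by auto
  have "k \<in> \<rho> ` C" if k: "k \<le> n" for k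
  proof (rule ccontr)
    assume no: "k \<notin> \<rho> ` C"
    define U L where "U = {y \<in> C. k < \<rho> y}" and "L = {y \<in> C. \<rho> y < k}"
    have CUL: "C = U \<union> L" using no unfolding U_def L_def by (force simp: neq_iff)
    have fUL: "finite U" "finite L" using fin by (auto simp: U_def L_def)
    have topL: "\<exists>x\<in>L. \<forall>y\<in>L. (y, x) \<in> r" if "L \<noteq> {}"
    proof -
      have "Max (\<rho> ` L) \<in> \<rho> ` L"
        using fUL that by (intro Max_in) auto
      then obtain x where x: "x \<in> L" "Max (\<rho> ` L) = \<rho> x" by blast
      have x2: "\<forall>y\<in>L. \<rho> y \<le> \<rho> x" using fUL by (simp flip: x(2))
      have "(y, x) \<in> r" if "y \<in> L" for y
      proof (cases "y = x")
        case True
        then show ?thesis using that CP by (auto simp: L_def intro!: le_refl)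
      next
        case False
        then have "\<rho> y \<noteq> \<rho> x" using chain_inj[OF C] that x(1) by (auto simp: L_def inj_on_def)
        then show ?thesis using x x2 that chain_le[OF C, of y x] by (auto simp: L_def order_less_le)
      qed
      with x(1) show ?thesis by blast
    qed
    have botU: "\<exists>x\<in>U. \<forall>y\<in>U. (x, y) \<in> r" if "U \<noteq> {}"
    proof -
      have "Min (\<rho> ` U) \<in> \<rho> ` U"
        using fUL that by (intro Min_in) auto
      then obtain x where x: "x \<in> U" "Min (\<rho> ` U) = \<rho> x" by blast
      have x2: "\<forall>y\<in>U. \<rho> x \<le> \<rho> y" using fUL by (simp flip: x(2))
      have "(x, y) \<in> r" if "y \<in> U" for y
      proof (cases "y = x")
        case True
        then show ?thesis using that CP by (auto simp: U_def intro!: le_refl)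
      next
        case False
        then have "\<rho> y \<noteq> \<rho> x" using chain_inj[OF C] that x(1) by (auto simp: U_def inj_on_def)
        then show ?thesis using x x2 that chain_le[OF C, of x y] by (auto simp: U_def order_less_le)
      qed
      with x(1) show ?thesis by blast
    qed
    show False
    proof (cases "U = {}")
      \<comment> \<open>All ranks of the chain lie below \<open>k \<le> n\<close>, so
        \<open>up\<close> extends it beyond its greatest element.\<close>
      case True
      then have "L \<noteq> {}" using CUL \<open>C \<noteq> {}\<close> by auto
      then obtain x where x: "x \<in> L" "\<forall>y\<in>L. (y, x) \<in> r" using topL by blast
      then have "\<rho> x < n" "x \<in> P" using k CP by (auto simp: L_def)
      then obtain z where z: "(x, z) \<in> r" "\<rho> x < \<rho> z" using up by blast
      have "z \<in> C"
        using x z CUL True le_in[OF z(1)] by (intro ins) (auto intro: le_trans)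
      then have "(z, x) \<in> r" using x CUL True by auto
      then show False using z rank_less by (metis less_asym less_irrefl)
    next
      case U: False
      then obtain y where y: "y \<in> U" "\<forall>w\<in>U. (y, w) \<in> r" using botU by blast
      have yP: "y \<in> P" using y CP by (auto simp: U_def)
      \<comment> \<open>\<open>z\<close> sits directly under the least element \<open>y\<close> of
        \<open>U\<close> and above all of \<open>L\<close>. By maximality \<open>z\<close> is in the
        chain, hence in \<open>L\<close>, and then
        \<open>\<rho> z < k < \<rho> y = \<rho> z + 1\<close>.\<close>
      obtain z where z: "(z, y) \<in> r" "Suc (\<rho> z) = \<rho> y" "\<forall>w\<in>L. (w, z) \<in> r"
      proof (cases "L = {}")
        case True
        then show ?thesis using that down[OF yP] y by (auto simp: U_def)
      next
        case False
        then obtain x where x: "x \<in> L" "\<forall>y\<in>L. (y, x) \<in> r" using topL by blast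
        have "(x, y) \<in> r" "x \<noteq> y"
          using x y chain_le[OF C, of x y] by (auto simp: U_def L_def)
        then show ?thesis using between[of x y] that x by (meson le_trans)
      qed
      have zC: "z \<in> C"
        using y z CUL le_in[OF z(1)] by (intro ins) (auto intro: le_trans)
      have "z \<notin> U"
      proof
        assume "z \<in> U"
        then have "(y, z) \<in> r" using y(2) by blast
        moreover have "\<rho> z < \<rho> y" using z(2) by simp
        ultimately show False using rank_less[of y z] by fastforce
      qed
      then have "z \<in> L" using zC CUL by blast
      then have "\<rho> z < k" by (simp add: L_def)
      moreover have "k < \<rho> y" using y(1) by (simp add: U_def)
      ultimately show False using z(2) by simp
    qed
  qed
  then have "\<rho> ` C = {..n}" using CP rank_le by auto
  then show "card C = n + 1"
    using card_image[OF chain_inj[OF C]] by simp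
qed

text \<open>A walk in the reflexive transitive closure is unrolled into the indexed sequences of the
  definition; \<open>xs i\<close> is an element of rank \<open>n - 1\<close> under both
  \<open>ys (i - 1)\<close> and \<open>ys i\<close>.\<close>

lemma connected_in_codim1I:
  assumes "\<And>y y'. y \<in> P \<Longrightarrow> y' \<in> P \<Longrightarrow> \<rho> y = n \<Longrightarrow> \<rho> y' = n \<Longrightarrow>
     (y, y') \<in> {(y, y'). y \<in> P \<and> y' \<in> P \<and> \<rho> y = n \<and> \<rho> y' = n \<and>
        (\<exists>x. Suc (\<rho> x) = n \<and> (x, y) \<in> r \<and> (x, y') \<in> r)}\<^sup>*"
  shows "connected_in_codim1 P r"
  unfolding connected_in_codim1_def
proof (rule exI[of _ n], intro conjI ranked allI impI)
  let ?R = "{(y, y'). y \<in> P \<and> y' \<in> P \<and> \<rho> y = n \<and> \<rho> y' = n \<and>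
        (\<exists>x. Suc (\<rho> x) = n \<and> (x, y) \<in> r \<and> (x, y') \<in> r)}"
  fix y y' assume yy: "maximal_elt P r y \<and> maximal_elt P r y'"
  then have "(y, y') \<in> ?R\<^sup>*" using assms maximal_iff by blast
  then obtain m where "(y, y') \<in> ?R ^^ m" using rtrancl_imp_relpow by blast
  then obtain ys where ys: "ys 0 = y" "ys m = y'" "\<forall>i<m. (ys i, ys (Suc i)) \<in> ?R"
    unfolding relpow_fun_conv by blast
  have mx: "maximal_elt P r (ys i)" if "i \<le> m" for i
  proof (cases i)
    case 0
    then show ?thesis using ys yy by simp
  next
    case (Suc j)
    then show ?thesis using ys(3) that maximal_iff by auto
  qed
  have "\<forall>i\<in>{1..m}. \<exists>x. Suc (\<rho> x) = n \<and> (x, ys (i - 1)) \<in> r \<and> (x, ys i) \<in> r"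
  proof
    fix i assume "i \<in> {1..m}"
    then have "i - 1 < m" "Suc (i - 1) = i" by auto
    then show "\<exists>x. Suc (\<rho> x) = n \<and> (x, ys (i - 1)) \<in> r \<and> (x, ys i) \<in> r"
      using ys(3) by fastforce
  qed
  then obtain xs where xs: "\<forall>i\<in>{1..m}. Suc (\<rho> (xs i)) = n \<and> (xs i, ys (i - 1)) \<in> r \<and> (xs i, ys i) \<in> r"
    by metis
  have "xs i \<in> P \<and> enat n - poset_dim P r (xs i) = 1 \<and>
               (xs i, ys (i - 1)) \<in> r \<and> xs i \<noteq> ys (i - 1) \<and>
               (xs i, ys i) \<in> r \<and> xs i \<noteq> ys i" (is "?Q i") if i: "i \<in> {1..m}" for i
  proof -
    have a: "Suc (\<rho> (xs i)) = n" "(xs i, ys (i - 1)) \<in> r" "(xs i, ys i) \<in> r" using xs i by auto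
    have b: "xs i \<in> P" using a le_in by blast
    have "i \<le> m" "i - 1 \<le> m" using i by auto
    then have "\<rho> (ys i) = n" "\<rho> (ys (i - 1)) = n" using mx maximal_iff by blast+
    moreover have "enat n - poset_dim P r (xs i) = 1"
    proof -
      have "n - \<rho> (xs i) = 1" using a(1) by arith
      then show ?thesis using poset_dim_eq[OF b] by (simp add: one_enat_def)
    qed
    ultimately show ?thesis using a b by (metis n_not_Suc_n)
  qed
  then have *: "\<forall>i\<in>{1..m}. ?Q i" by blast
  have "\<forall>i\<le>m. maximal_elt P r (ys i)" using mx by blast
  with * show "\<exists>m (ys :: nat \<Rightarrow> 'a) (xs :: nat \<Rightarrow> 'a). ys 0 = y \<and> ys m = y' \<and> (\<forall>i\<le>m. maximal_elt P r (ys i)) \<and>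
            (\<forall>i\<in>{1..m}. xs i \<in> P \<and> enat n - poset_dim P r (xs i) = 1 \<and>
               (xs i, ys (i - 1)) \<in> r \<and> xs i \<noteq> ys (i - 1) \<and>
               (xs i, ys i) \<in> r \<and> xs i \<noteq> ys i)"
    using ys(1,2) by - (rule exI[of _ m], rule exI[of _ ys], rule exI[of _ xs], intro conjI)
qed

end

text \<open>The grading is checked on representatives. \<open>I\<close> is the isomorphism relation,
  and \<open>sp s t\<close> reads "\<open>s\<close> specializes to \<open>t\<close>", so it points
  downwards in the order \<open>le\<close> of the quotient.\<close>

locale graded_preorder =
  fixes T :: "'a set" and I :: "'a rel" and sp :: "'a \<Rightarrow> 'a \<Rightarrow> bool" and rk :: "'a \<Rightarrow> nat" and n :: nat
  assumes eqv: "equiv T I"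
    and T_nonempty: "T \<noteq> {}"
    and iso_sp: "(s, t) \<in> I \<Longrightarrow> sp s t"
    and sp_trans: "s \<in> T \<Longrightarrow> t \<in> T \<Longrightarrow> u \<in> T \<Longrightarrow> sp s t \<Longrightarrow> sp t u \<Longrightarrow> sp s u"
    and sp_rk: "s \<in> T \<Longrightarrow> t \<in> T \<Longrightarrow> sp s t \<Longrightarrow> rk t \<le> rk s"
    and sp_iso: "s \<in> T \<Longrightarrow> t \<in> T \<Longrightarrow> sp s t \<Longrightarrow> rk t = rk s \<Longrightarrow> (s, t) \<in> I"
    and rk_le: "t \<in> T \<Longrightarrow> rk t \<le> n"
    and sp_between: "s \<in> T \<Longrightarrow> t \<in> T \<Longrightarrow> sp s t \<Longrightarrow> rk t < rk s \<Longrightarrow>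
       \<exists>z\<in>T. sp s z \<and> sp z t \<and> Suc (rk z) = rk s"
    and sp_down: "t \<in> T \<Longrightarrow> 0 < rk t \<Longrightarrow> \<exists>z\<in>T. sp t z \<and> Suc (rk z) = rk t"
    and sp_up: "t \<in> T \<Longrightarrow> rk t < n \<Longrightarrow> \<exists>z\<in>T. sp z t \<and> rk t < rk z"
begin

definition le :: "'a set rel" where
  "le = {(A', A). A' \<in> T // I \<and> A \<in> T // I \<and> (\<exists>s\<in>A. \<exists>t\<in>A'. sp s t)}"

definition class_rk :: "'a set \<Rightarrow> nat" where
  "class_rk A = rk (SOME t. t \<in> A)"

lemma I_in: "(s, t) \<in> I \<Longrightarrow> s \<in> T \<and> t \<in> T"
  using eqv by (auto simp: equiv_def refl_on_def)

lemma I_sym: "(s, t) \<in> I \<Longrightarrow> (t, s) \<in> I"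
  using eqv by (auto simp: equiv_def sym_def)

lemma I_refl: "t \<in> T \<Longrightarrow> (t, t) \<in> I"
  using eqv by (auto simp: equiv_def refl_on_def)

lemma class_in: "t \<in> T \<Longrightarrow> I `` {t} \<in> T // I"
  by (rule quotientI)

lemma I_rk: "(s, t) \<in> I \<Longrightarrow> rk s = rk t"
  using iso_sp sp_rk I_in I_sym by (metis le_antisym)

lemma class_rk_class: "t \<in> T \<Longrightarrow> class_rk (I `` {t}) = rk t"
  unfolding class_rk_def using I_rk I_refl by (metis Image_singleton_iff someI_ex)

text \<open>Isomorphisms are specializations in both directions, so composing with them moves the
  witnesses inside the classes to any prescribed representatives.\<close>

lemma le_class_iff:
  assumes "s \<in> T" "t \<in> T"
  shows "(I `` {t}, I `` {s}) \<in> le \<longleftrightarrow> sp s t"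
proof
  assume "(I `` {t}, I `` {s}) \<in> le"
  then obtain s' t' where "(s, s') \<in> I" "(t, t') \<in> I" "sp s' t'" by (auto simp: le_def)
  then show "sp s t" using assms iso_sp sp_trans I_in I_sym by metis
next
  assume "sp s t"
  then show "(I `` {t}, I `` {s}) \<in> le"
    using assms I_refl class_in by (auto simp: le_def)
qed

lemma leE:
  assumes "(B, A) \<in> le"
  obtains s t where "s \<in> T" "t \<in> T" "A = I `` {s}" "B = I `` {t}" "sp s t"
proof -
  obtain s t where "s \<in> T" "t \<in> T" "A = I `` {s}" "B = I `` {t}"
    using assms by (auto simp: le_def elim!: quotientE)
  with assms that le_class_iff show ?thesis by blast
qed

lemma class_eq: "(s, t) \<in> I \<Longrightarrow> I `` {s} = I `` {t}"
  using eqv equiv_class_eq by metis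

lemma partial_order_le: "partial_order_on (T // I) le"
proof -
  have "le \<subseteq> (T // I) \<times> (T // I)" by (auto simp: le_def)
  moreover have "(A, A) \<in> le" if "A \<in> T // I" for A
    using that le_class_iff iso_sp I_refl by (auto elim!: quotientE)
  moreover have "trans le"
  proof (rule transI)
    fix A B C assume "(A, B) \<in> le" "(B, C) \<in> le"
    then show "(A, C) \<in> le"
      by (smt (verit) leE le_class_iff sp_trans)
  qed
  \<comment> \<open>Mutual specialization forces equal ranks, and \<open>sp_iso\<close> turns a
    rank-preserving specialization into an isomorphism.\<close>
  moreover have "antisym le"
  proof (rule antisymI)
    fix A B assume AB: "(A, B) \<in> le" "(B, A) \<in> le"
    then obtain s t where st: "s \<in> T" "t \<in> T" "B = I `` {s}" "A = I `` {t}" "sp s t"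
      by (elim leE)
    then have "sp t s" using AB le_class_iff by simp
    then show "A = B" using st sp_rk sp_iso class_eq by (metis le_antisym)
  qed
  ultimately show ?thesis
    by (auto simp: partial_order_on_def preorder_on_def refl_on_def)
qed

sublocale graded_poset "T // I" le class_rk n
proof
  show "partial_order_on (T // I) le" by (rule partial_order_le)
  show "T // I \<noteq> {}" using T_nonempty by (simp add: quotient_def)
next
  fix A B assume "(A, B) \<in> le" "A \<noteq> B"
  then obtain s t where st: "s \<in> T" "t \<in> T" "B = I `` {s}" "A = I `` {t}" "sp s t"
    by (elim leE)
  have ne: "rk t \<noteq> rk s" using st sp_iso class_eq \<open>A \<noteq> B\<close> by metis
  then have less: "rk t < rk s" using st sp_rk by (metis le_neq_implies_less)
  then show "class_rk A < class_rk B" using st class_rk_class by simp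
  obtain z where "z \<in> T" "sp s z" "sp z t" "Suc (rk z) = rk s"
    using sp_between[OF st(1,2,5) less] by blast
  then show "\<exists>z. (A, z) \<in> le \<and> (z, B) \<in> le \<and> Suc (class_rk z) = class_rk B"
    using st le_class_iff class_rk_class by (intro exI[of _ "I `` {z}"]) auto
next
  fix A assume "A \<in> T // I"
  then obtain t where t: "t \<in> T" "A = I `` {t}" by (elim quotientE)
  show "class_rk A \<le> n" using t rk_le class_rk_class by simp
  show "\<exists>z. (A, z) \<in> le \<and> class_rk A < class_rk z" if "class_rk A < n"
    using that t sp_up[of t] class_rk_class le_class_iff by (metis)
  show "\<exists>z. (z, A) \<in> le \<and> Suc (class_rk z) = class_rk A" if "0 < class_rk A"
    using that t sp_down[of t] class_rk_class le_class_iff by (metis)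
qed

text \<open>A step along \<open>I\<close> becomes equality of classes, so isomorphisms cost nothing
  in a walk.\<close>

lemma connected_in_codim1_quotient:
  assumes "\<And>s t. s \<in> T \<Longrightarrow> t \<in> T \<Longrightarrow> rk s = n \<Longrightarrow> rk t = n \<Longrightarrow>
     (s, t) \<in> {(s, t). s \<in> T \<and> t \<in> T \<and> rk s = n \<and> rk t = n \<and>
        ((s, t) \<in> I \<or> (\<exists>x\<in>T. Suc (rk x) = n \<and> sp s x \<and> sp t x))}\<^sup>*"
  shows "connected_in_codim1 (T // I) le"
proof (rule connected_in_codim1I)
  let ?R = "{(s, t). s \<in> T \<and> t \<in> T \<and> rk s = n \<and> rk t = n \<and>
        ((s, t) \<in> I \<or> (\<exists>x\<in>T. Suc (rk x) = n \<and> sp s x \<and> sp t x))}"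
  let ?S = "{(y, y'). y \<in> T // I \<and> y' \<in> T // I \<and> class_rk y = n \<and> class_rk y' = n \<and>
        (\<exists>x. Suc (class_rk x) = n \<and> (x, y) \<in> le \<and> (x, y') \<in> le)}"
  have steps1: "(I `` {s}, I `` {t}) \<in> ?S\<^sup>*" if st: "(s, t) \<in> ?R" for s t
  proof (cases "(s, t) \<in> I")
    case True
    then show ?thesis using class_eq by simp
  next
    case False
    then obtain x where x: "x \<in> T" "Suc (rk x) = n" "sp s x" "sp t x" using st by auto
    have "(I `` {s}, I `` {t}) \<in> ?S"
      using x st le_class_iff class_rk_class class_in
      by (auto intro!: exI[of _ "I `` {x}"])
    then show ?thesis by blast
  qed
  have steps: "(s, t) \<in> ?R\<^sup>* \<Longrightarrow> (I `` {s}, I `` {t}) \<in> ?S\<^sup>*" for s t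
  proof (induction rule: rtrancl_induct)
    case (step y z)
    then show ?case using steps1[of y z] by (meson rtrancl_trans)
  qed simp
  fix A B assume A: "A \<in> T // I" and B: "B \<in> T // I" and rks: "class_rk A = n" "class_rk B = n"
  obtain s where s: "s \<in> T" "A = I `` {s}" using A by (elim quotientE)
  obtain t where t: "t \<in> T" "B = I `` {t}" using B by (elim quotientE)
  show "(A, B) \<in> ?S\<^sup>*"
    using steps[OF assms[of s t]] s t rks class_rk_class by simp
qed

end

section \<open>Connected multigraphs\<close>

definition well_attached :: "('v, 'e, 'm) mgraph_scheme \<Rightarrow> bool" where
  "well_attached G \<longleftrightarrow> finite (verts G) \<and> finite (edges G) \<and> (\<forall>e\<in>edges G. ends G e \<subseteq> verts G)"

lemma ends_eq: "ends G e = {att G e False, att G e True}"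
  by (auto simp: ends_def UNIV_bool)

lemma att_in_ends [simp]: "att G e b \<in> ends G e"
  by (auto simp: ends_def)

lemma endsE: "x \<in> ends G e \<Longrightarrow> (\<And>b. x = att G e b \<Longrightarrow> thesis) \<Longrightarrow> thesis"
  by (auto simp: ends_def)

lemma comp_refl [simp]: "v \<in> comp G S v"
  by (simp add: comp_def)

lemma comp_trans: "v \<in> comp G S u \<Longrightarrow> w \<in> comp G S v \<Longrightarrow> w \<in> comp G S u"
  by (auto simp: comp_def)

lemma comp_sym:
  assumes "v \<in> comp G S u" shows "u \<in> comp G S v"
proof -
  have "sym (\<Union>e\<in>S. ends G e \<times> ends G e)" by (auto simp: sym_def)
  from symD[OF sym_rtrancl[OF this]] show ?thesis using assms by (simp add: comp_def)
qed

lemma comp_eq_iff: "comp G S u = comp G S v \<longleftrightarrow> v \<in> comp G S u"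
proof
  assume uv: "v \<in> comp G S u"
  have "x \<in> comp G S v" if "x \<in> comp G S u" for x
    by (rule comp_trans[OF comp_sym[OF uv] that])
  moreover have "x \<in> comp G S u" if "x \<in> comp G S v" for x
    by (rule comp_trans[OF uv that])
  ultimately show "comp G S u = comp G S v" by blast
next
  assume "comp G S u = comp G S v"
  then show "v \<in> comp G S u" by (simp only: comp_refl)
qed

lemma comp_edge: "e \<in> S \<Longrightarrow> x \<in> ends G e \<Longrightarrow> y \<in> ends G e \<Longrightarrow> y \<in> comp G S x"
  by (auto simp: comp_def)

lemma comp_mono: "S \<subseteq> S' \<Longrightarrow> comp G S v \<subseteq> comp G S' v"
  unfolding comp_def using rtrancl_mono[of "\<Union>e\<in>S. ends G e \<times> ends G e" "\<Union>e\<in>S'. ends G e \<times> ends G e"]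
  by blast

lemma comp_induct [consumes 1, case_names base step]:
  assumes "v \<in> comp G S u"
    and "P u"
    and "\<And>x y e. x \<in> comp G S u \<Longrightarrow> e \<in> S \<Longrightarrow> x \<in> ends G e \<Longrightarrow> y \<in> ends G e \<Longrightarrow> P x \<Longrightarrow> P y"
  shows "P v"
proof -
  have "(u, v) \<in> (\<Union>e\<in>S. ends G e \<times> ends G e)\<^sup>*" using assms(1) by (simp add: comp_def)
  then show ?thesis
    by (induction rule: rtrancl_induct) (use assms(2,3) in \<open>auto simp: comp_def\<close>)
qed

lemma comp_sub:
  assumes "v \<in> comp G S u" "u \<in> X" "\<And>e. e \<in> S \<Longrightarrow> ends G e \<subseteq> X"
  shows "v \<in> X"
  using assms(1) by (induction rule: comp_induct) (use assms(2,3) in auto)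

text \<open>Connectedness tested on cuts, which is the form that quasistability delivers. The end
  sets are an arbitrary function \<open>en\<close>, so that the notion applies after merging
  vertices without building a new graph.\<close>

definition linked :: "('e \<Rightarrow> 'v set) \<Rightarrow> 'v set \<Rightarrow> 'e set \<Rightarrow> bool" where
  "linked en V S \<longleftrightarrow> (\<forall>X. X \<subset> V \<and> X \<noteq> {} \<longrightarrow> (\<exists>e\<in>S. en e \<inter> X \<noteq> {} \<and> en e - X \<noteq> {}))"

lemma linkedD: "linked en V S \<Longrightarrow> X \<subset> V \<Longrightarrow> X \<noteq> {} \<Longrightarrow> \<exists>e\<in>S. en e \<inter> X \<noteq> {} \<and> en e - X \<noteq> {}"
  by (simp add: linked_def)

lemma linked_iff_comp:
  assumes S: "\<And>e. e \<in> S \<Longrightarrow> ends G e \<subseteq> V"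
  shows "linked (ends G) V S \<longleftrightarrow> (\<forall>u\<in>V. \<forall>v\<in>V. v \<in> comp G S u)"
proof (intro iffI ballI)
  fix u v assume L: "linked (ends G) V S" and uv: "u \<in> V" "v \<in> V"
  have sub: "comp G S u \<subseteq> V" using comp_sub[of _ G S u V] S uv by blast
  show "v \<in> comp G S u"
  proof (rule ccontr)
    assume "v \<notin> comp G S u"
    then have "comp G S u \<subset> V" using sub uv by blast
    moreover have "comp G S u \<noteq> {}" using comp_refl[of u G S] by (metis empty_iff)
    ultimately obtain e where e: "e \<in> S" "ends G e \<inter> comp G S u \<noteq> {}" "ends G e - comp G S u \<noteq> {}"
      using linkedD[OF L, of "comp G S u"] by metis
    then obtain x y where "x \<in> ends G e" "x \<in> comp G S u" "y \<in> ends G e" "y \<notin> comp G S u" by blast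
    with e(1) show False using comp_edge comp_trans by metis
  qed
next
  assume C: "\<forall>u\<in>V. \<forall>v\<in>V. v \<in> comp G S u"
  show "linked (ends G) V S"
    unfolding linked_def
  proof (intro allI impI)
    fix X assume X: "X \<subset> V \<and> X \<noteq> {}"
    then obtain u v where uv: "u \<in> X" "v \<in> V" "v \<notin> X" by blast
    show "\<exists>e\<in>S. ends G e \<inter> X \<noteq> {} \<and> ends G e - X \<noteq> {}"
    proof (rule ccontr)
      assume no: "\<not> ?thesis"
      have "v \<in> comp G S u" using C uv X by blast
      then have "v \<in> X"
        by (induction rule: comp_induct) (use no uv in blast)+
      then show False using uv by simp
    qed
  qed
qed

lemma fcg_iff:
  "finite_connected_graph G \<longleftrightarrow> well_attached G \<and> verts G \<noteq> {} \<and> linked (ends G) (verts G) (edges G)"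
  using linked_iff_comp[of "edges G" G "verts G"]
  by (auto simp: finite_connected_graph_def well_attached_def)

section \<open>Merging two vertices, and edge counts of connected graphs\<close>

definition merge :: "'v \<Rightarrow> 'v \<Rightarrow> 'v \<Rightarrow> 'v" where
  "merge u w x = (if x = w then u else x)"

lemma merge_simps [simp]: "merge u w w = u" "x \<noteq> w \<Longrightarrow> merge u w x = x" "merge u w u = u"
  by (auto simp: merge_def)

lemma merge_crossing:
  assumes "u \<noteq> w" "u \<in> X \<longleftrightarrow> w \<in> X"
  shows "(\<lambda>x. merge u w x) ` A \<inter> (X - {w}) \<noteq> {} \<longleftrightarrow> A \<inter> X \<noteq> {}"
    and "(\<lambda>x. merge u w x) ` A - (X - {w}) \<noteq> {} \<longleftrightarrow> A - X \<noteq> {}"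
  using assms by (auto simp: merge_def)

text \<open>A set separating \<open>u\<close> from \<open>w\<close> is crossed by \<open>e\<close>
  itself. The remaining sets contain both or neither and correspond to subsets of
  \<open>V - {w}\<close> with the same crossing edges.\<close>

lemma linked_merge_iff:
  assumes e: "e \<in> S" "en e = {u, w}" "u \<noteq> w" "u \<in> V" "w \<in> V"
  shows "linked (\<lambda>x. merge u w ` en x) (V - {w}) (S - {e}) \<longleftrightarrow> linked en V S"
proof
  assume L: "linked (\<lambda>x. merge u w ` en x) (V - {w}) (S - {e})"
  show "linked en V S"
    unfolding linked_def
  proof (intro allI impI)
    fix X assume X: "X \<subset> V \<and> X \<noteq> {}"
    show "\<exists>e\<in>S. en e \<inter> X \<noteq> {} \<and> en e - X \<noteq> {}"
    proof (cases "u \<in> X \<longleftrightarrow> w \<in> X")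
      case False
      then show ?thesis using e by (intro bexI[of _ e]) auto
    next
      case True
      have "X - {w} \<subset> V - {w}" "X - {w} \<noteq> {}" using X True e by auto
      then obtain x where x: "x \<in> S - {e}" "merge u w ` en x \<inter> (X - {w}) \<noteq> {}" "merge u w ` en x - (X - {w}) \<noteq> {}"
        using linkedD[OF L, of "X - {w}"] by metis
      have "en x \<inter> X \<noteq> {}" by (rule merge_crossing(1)[OF e(3) True, THEN iffD1, OF x(2)])
      moreover have "en x - X \<noteq> {}" by (rule merge_crossing(2)[OF e(3) True, THEN iffD1, OF x(3)])
      ultimately show ?thesis using x(1) by (intro bexI[of _ x] conjI) simp_all
    qed
  qed
next
  assume L: "linked en V S"
  show "linked (\<lambda>x. merge u w ` en x) (V - {w}) (S - {e})"
    unfolding linked_def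
  proof (intro allI impI)
    fix X assume X: "X \<subset> V - {w} \<and> X \<noteq> {}"
    define Y where "Y = (if u \<in> X then insert w X else X)"
    have Y: "u \<in> Y \<longleftrightarrow> w \<in> Y" "Y - {w} = X" using X e(3) by (auto simp: Y_def)
    have "Y \<subset> V" "Y \<noteq> {}" using X e by (auto simp: Y_def)
    then obtain x where x: "x \<in> S" "en x \<inter> Y \<noteq> {}" "en x - Y \<noteq> {}" using linkedD[OF L] by blast
    then have "x \<noteq> e" using e Y by auto
    then show "\<exists>x\<in>S - {e}. merge u w ` en x \<inter> X \<noteq> {} \<and> merge u w ` en x - X \<noteq> {}"
      using x merge_crossing[OF e(3) Y(1), unfolded Y(2)] by blast
  qed
qed

text \<open>At most two ends: otherwise a single \<open>en e\<close> could join many vertices and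
  the edge counts below would fail.\<close>

definition edge_like :: "'v set \<Rightarrow> bool" where
  "edge_like A \<longleftrightarrow> (\<exists>x y. A = {x, y})"

lemma edge_like_ends [simp]: "edge_like (ends G e)"
  by (auto simp: edge_like_def ends_eq)

lemma edge_like_image: "edge_like A \<Longrightarrow> edge_like (f ` A)"
  by (auto simp: edge_like_def)

lemma linked_crossing_edge:
  assumes "finite V" "linked en V S" "card V = Suc (Suc n)" "\<And>e. e \<in> S \<Longrightarrow> en e \<subseteq> V \<and> edge_like (en e)"
  obtains e u w where "e \<in> S" "en e = {u, w}" "u \<noteq> w" "u \<in> V" "w \<in> V"
proof -
  obtain v where "v \<in> V" using assms(3) by fastforce
  moreover have "{v} \<noteq> V" using assms(3) by auto
  ultimately have "{v} \<subset> V" by blast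
  then obtain e where e: "e \<in> S" "en e \<inter> {v} \<noteq> {}" "en e - {v} \<noteq> {}"
    using linkedD[OF assms(2), of "{v}"] by auto
  obtain x y where xy: "en e = {x, y}" using assms(4)[OF e(1)] by (auto simp: edge_like_def)
  then have "x \<noteq> y" using e(2,3) by auto
  moreover have "x \<in> V" "y \<in> V" using assms(4)[OF e(1)] xy by auto
  ultimately show ?thesis using that e(1) xy by blast
qed

text \<open>Merging the ends of an edge that is not a loop removes one vertex and one edge and keeps
  the graph connected.\<close>

lemma linked_card_ge:
  assumes "finite S" "finite V" "linked en V S" "\<And>e. e \<in> S \<Longrightarrow> en e \<subseteq> V \<and> edge_like (en e)"
  shows "card V \<le> card S + 1"
  using assms
proof (induction "card V" arbitrary: V S en)
  case (Suc n)
  show ?case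
  proof (cases n)
    case (Suc n')
    obtain e u w where e: "e \<in> S" "en e = {u, w}" "u \<noteq> w" "u \<in> V" "w \<in> V"
      using linked_crossing_edge[OF Suc.prems(2,3) _ Suc.prems(4)] Suc.hyps(2) Suc by metis
    have "card (V - {w}) \<le> card (S - {e}) + 1"
    proof (rule Suc.hyps(1))
      show "linked (\<lambda>x. merge u w ` en x) (V - {w}) (S - {e})"
        using linked_merge_iff[of e S en u w V] e Suc.prems by simp
      show "merge u w ` en x \<subseteq> V - {w} \<and> edge_like (merge u w ` en x)" if "x \<in> S - {e}" for x
      proof
        have x: "en x \<subseteq> V" "edge_like (en x)" using Suc.prems(4)[of x] that by auto
        show "merge u w ` en x \<subseteq> V - {w}" using x(1) e(3,4) by (auto simp: merge_def)
        show "edge_like (merge u w ` en x)" using x(2) by (rule edge_like_image)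
      qed
      show "n = card (V - {w})" using Suc.hyps(2) Suc.prems(2) e(5) by simp
      show "finite (S - {e})" "finite (V - {w})" using Suc.prems(1,2) by simp_all
    qed
    moreover have "0 < card S" using e(1) Suc.prems(1) card_gt_0_iff by blast
    ultimately show ?thesis using e Suc.prems by simp
  qed (use Suc.hyps(2) in simp)
qed simp

text \<open>Such a graph has a cycle, but the induction never exhibits one: merge along some edge
  \<open>e\<close> and remove an edge \<open>x\<close> of the smaller graph; deleting and merging
  commute, so \<open>x\<close> can be removed before. With a single vertex every edge is a loop and
  any of them may go.\<close>

lemma linked_removable_edge:
  assumes "finite S" "finite V" "V \<noteq> {}" "linked en V S" "\<And>e. e \<in> S \<Longrightarrow> en e \<subseteq> V \<and> edge_like (en e)"
    and "card V \<le> card S"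
  obtains e where "e \<in> S" "linked en V (S - {e})"
proof -
  have "\<exists>e\<in>S. linked en V (S - {e})"
    using assms
  proof (induction "card V" arbitrary: V S en)
    case 0
    then show ?case by simp
  next
    case (Suc n)
    show ?case
    proof (cases n)
      case 0
      then have "card V = 1" using Suc.hyps(2) by simp
      then obtain v where v: "V = {v}" by (rule card_1_singletonE)
      have "S \<noteq> {}" using Suc.prems(6) Suc.hyps(2) by auto
      moreover have "linked en V S'" for S' unfolding linked_def v by blast
      ultimately show ?thesis by blast
    next
      case (Suc n')
      obtain e u w where e: "e \<in> S" "en e = {u, w}" "u \<noteq> w" "u \<in> V" "w \<in> V"
        using linked_crossing_edge[OF Suc.prems(2,4) _ Suc.prems(5)] Suc.hyps(2) Suc by metis
      have "\<exists>x\<in>S - {e}. linked (\<lambda>x. merge u w ` en x) (V - {w}) (S - {e} - {x})"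
      proof (rule Suc.hyps(1))
        show "linked (\<lambda>x. merge u w ` en x) (V - {w}) (S - {e})"
          using linked_merge_iff[of e S en u w V] e Suc.prems by simp
        show "merge u w ` en x \<subseteq> V - {w} \<and> edge_like (merge u w ` en x)" if "x \<in> S - {e}" for x
        proof
        have x: "en x \<subseteq> V" "edge_like (en x)" using Suc.prems(5)[of x] that by auto
        show "merge u w ` en x \<subseteq> V - {w}" using x(1) e(3,4) by (auto simp: merge_def)
        show "edge_like (merge u w ` en x)" using x(2) by (rule edge_like_image)
      qed
        show "n = card (V - {w})" using Suc.hyps(2) Suc.prems(2) e(5) by simp
        show "finite (S - {e})" "finite (V - {w})" using Suc.prems(1,2) by simp_all
        show "V - {w} \<noteq> {}" using e(3,4) by blast
        show "card (V - {w}) \<le> card (S - {e})" using Suc.prems(1,2,6) e(1,5) by simp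
      qed
      then obtain x where x: "x \<in> S" "x \<noteq> e" "linked (\<lambda>x. merge u w ` en x) (V - {w}) (S - {x} - {e})"
        by (metis DiffE Diff_insert Diff_insert2 singletonI)
      then have "linked en V (S - {x})"
        using linked_merge_iff[of e "S - {x}" en u w V] e by simp
      then show ?thesis using x by blast
    qed
  qed
  then show ?thesis using that by blast
qed

section \<open>Specializations as pairs of maps\<close>

text \<open>The contracted set is recovered as the edges outside the image of
  \<open>\<epsilon>\<close>, so no witnesses remain; the fibres of \<open>\<phi>\<close> are the
  components of that set.\<close>

definition gspec ::
  "('v, 'e, 'm) mgraph_scheme \<Rightarrow> ('w, 'f, 'n) mgraph_scheme \<Rightarrow> ('v \<Rightarrow> 'w) \<Rightarrow> ('f \<Rightarrow> 'e) \<Rightarrow> bool" where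
  "gspec G H \<phi> \<epsilon> \<longleftrightarrow>
     inj_on \<epsilon> (edges H) \<and> \<epsilon> ` edges H \<subseteq> edges G \<and> \<phi> ` verts G = verts H \<and>
     (\<forall>e\<in>edges H. ends H e = \<phi> ` ends G (\<epsilon> e)) \<and>
     (\<forall>u\<in>verts G. \<forall>v\<in>verts G. \<phi> u = \<phi> v \<longleftrightarrow> v \<in> comp G (edges G - \<epsilon> ` edges H) u)"

lemma ends_contract: "ends (contract G S) e = comp G S ` ends G e"
  by (auto simp: contract_def ends_def)

lemma specialization_iff:
  assumes wa: "\<forall>e\<in>edges G. ends G e \<subseteq> verts G"
  shows "specialization G H \<phi> \<epsilon> \<longleftrightarrow> gspec G H \<phi> \<epsilon>"
proof
  assume "specialization G H \<phi> \<epsilon>"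
  then obtain S h k where S: "S \<subseteq> edges G" and iso: "graph_iso (contract G S) H h k"
    and \<phi>: "\<forall>v\<in>verts G. \<phi> v = h (comp G S v)" and \<epsilon>: "\<forall>e\<in>edges G - S. \<epsilon> (k e) = e"
    unfolding specialization_def by blast
  have h: "bij_betw h (comp G S ` verts G) (verts H)" and k: "bij_betw k (edges G - S) (edges H)"
    and en: "\<forall>e\<in>edges G - S. ends H (k e) = h ` comp G S ` ends G e"
    using iso by (simp_all add: graph_iso_def ends_contract) (simp_all add: contract_def)
  have kH: "edges H = k ` (edges G - S)" using k by (simp add: bij_betw_def)
  have "\<epsilon> ` edges H = edges G - S" unfolding kH image_image using \<epsilon> by auto
  moreover from this have "edges G - \<epsilon> ` edges H = S" using S by auto
  moreover have "inj_on \<epsilon> (edges H)" unfolding kH using \<epsilon> by (auto intro!: inj_onI)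
  moreover have "\<phi> ` verts G = verts H"
    using \<phi> h by (auto simp: bij_betw_def image_image)
  moreover have "ends H e = \<phi> ` ends G (\<epsilon> e)" if "e \<in> edges H" for e
  proof -
    have "e \<in> k ` (edges G - S)" using that kH by simp
    then obtain e' where e': "e = k e'" "e' \<in> edges G - S" by (rule imageE)
    have "\<phi> ` ends G e' = h ` comp G S ` ends G e'"
      unfolding image_image using \<phi> wa e' by (intro image_cong) auto
    then show ?thesis using en e' \<epsilon> by simp
  qed
  moreover have "\<phi> u = \<phi> v \<longleftrightarrow> v \<in> comp G S u" if "u \<in> verts G" "v \<in> verts G" for u v
  proof -
    have "\<phi> u = \<phi> v \<longleftrightarrow> comp G S u = comp G S v"
      using \<phi> h that by (auto simp: bij_betw_def inj_on_def)
    then show ?thesis by (simp add: comp_eq_iff)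
  qed
  ultimately show "gspec G H \<phi> \<epsilon>" by (simp add: gspec_def)
next
  assume g: "gspec G H \<phi> \<epsilon>"
  define S where "S = edges G - \<epsilon> ` edges H"
  \<comment> \<open>\<open>h\<close> evaluates \<open>\<phi>\<close> at a chosen vertex of the
    component; the value is independent of the choice by the condition on fibres.\<close>
  define h where "h C = \<phi> (SOME v. v \<in> verts G \<and> comp G S v = C)" for C
  define k where "k = inv_into (edges H) \<epsilon>"
  have inj: "inj_on \<epsilon> (edges H)" and sub: "\<epsilon> ` edges H \<subseteq> edges G" and surj: "\<phi> ` verts G = verts H"
    and en: "\<And>e. e \<in> edges H \<Longrightarrow> ends H e = \<phi> ` ends G (\<epsilon> e)"
    and fib: "\<And>u v. u \<in> verts G \<Longrightarrow> v \<in> verts G \<Longrightarrow> \<phi> u = \<phi> v \<longleftrightarrow> comp G S u = comp G S v"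
    using g by (auto simp: gspec_def comp_eq_iff S_def)
  have GS: "edges G - S = \<epsilon> ` edges H" using sub by (auto simp: S_def)
  have h: "h (comp G S v) = \<phi> v" if "v \<in> verts G" for v
  proof -
    have "(SOME u. u \<in> verts G \<and> comp G S u = comp G S v) \<in> verts G \<and>
       comp G S (SOME u. u \<in> verts G \<and> comp G S u = comp G S v) = comp G S v"
      by (rule someI[of _ v]) (use that in simp)
    then show ?thesis unfolding h_def using fib that by blast
  qed
  have k: "k (\<epsilon> e) = e" if "e \<in> edges H" for e using inj that by (simp add: k_def)
  have "bij_betw h (comp G S ` verts G) (verts H)"
    unfolding bij_betw_def inj_on_def image_image using h fib surj by (auto simp: image_iff)
  moreover have "bij_betw k (edges G - S) (edges H)"
    unfolding GS k_def using inj by (simp add: bij_betw_inv_into inj_on_imp_bij_betw)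
  moreover have "ends H (k e) = h ` comp G S ` ends G e" if "e \<in> edges G - S" for e
  proof -
    have "e \<in> \<epsilon> ` edges H" using that GS by simp
    then obtain e' where e': "e = \<epsilon> e'" "e' \<in> edges H" by (rule imageE)
    have "h ` comp G S ` ends G e = \<phi> ` ends G e"
      unfolding image_image using h wa that by (intro image_cong) auto
    then show ?thesis using en e' k by simp
  qed
  ultimately have "graph_iso (contract G S) H h k"
    unfolding graph_iso_def ends_contract by (simp add: contract_def)
  moreover have "\<forall>e\<in>edges G - S. \<epsilon> (k e) = e" unfolding GS using k by auto
  ultimately show "specialization G H \<phi> \<epsilon>"
    unfolding specialization_def using h by (intro exI[of _ S] exI[of _ h] exI[of _ k]) (auto simp: S_def)
qed

lemma gspec_in:
  assumes "gspec G H \<phi> \<epsilon>"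
  shows "e \<in> edges H \<Longrightarrow> \<epsilon> e \<in> edges G" "v \<in> verts G \<Longrightarrow> \<phi> v \<in> verts H"
  using assms by (auto simp: gspec_def)

lemma gspec_inj: "gspec G H \<phi> \<epsilon> \<Longrightarrow> inj_on \<epsilon> (edges H)"
  by (simp add: gspec_def)

lemma gspec_fibre:
  assumes "gspec G H \<phi> \<epsilon>" "u \<in> verts G" "v \<in> verts G"
  shows "\<phi> u = \<phi> v \<longleftrightarrow> v \<in> comp G (edges G - \<epsilon> ` edges H) u"
  using assms by (simp add: gspec_def)

lemma gspec_ends: "gspec G H \<phi> \<epsilon> \<Longrightarrow> e \<in> edges H \<Longrightarrow> ends H e = \<phi> ` ends G (\<epsilon> e)"
  by (simp add: gspec_def)

lemma gspec_contracted:
  assumes "gspec G H \<phi> \<epsilon>" "well_attached G" "e \<in> edges G" "e \<notin> \<epsilon> ` edges H" "x \<in> ends G e" "y \<in> ends G e"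
  shows "\<phi> x = \<phi> y"
proof -
  have "y \<in> comp G (edges G - \<epsilon> ` edges H) x" using assms by (intro comp_edge) auto
  moreover have "x \<in> verts G" "y \<in> verts G" using assms by (auto simp: well_attached_def)
  ultimately show ?thesis using gspec_fibre[OF assms(1)] by blast
qed

lemma gspec_well_attached:
  assumes "gspec G H \<phi> \<epsilon>" "well_attached G"
  shows "well_attached H"
proof -
  have "finite (verts H)" using assms by (metis gspec_def well_attached_def finite_imageI)
  moreover have "finite (edges H)"
    using assms by (auto simp: gspec_def well_attached_def intro: inj_on_finite)
  moreover have "ends H e \<subseteq> verts H" if "e \<in> edges H" for e
  proof -
    have "ends G (\<epsilon> e) \<subseteq> verts G" using assms that by (auto simp: gspec_def well_attached_def)
    then show ?thesis using assms(1) that by (auto simp: gspec_def)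
  qed
  ultimately show ?thesis by (simp add: well_attached_def)
qed

lemma gspec_comp:
  assumes g1: "gspec G H \<phi> \<epsilon>" and g2: "gspec H K \<phi>' \<epsilon>'" and wa: "well_attached G"
  shows "gspec G K (\<phi>' \<circ> \<phi>) (\<epsilon> \<circ> \<epsilon>')"
  unfolding gspec_def
proof (intro conjI ballI)
  have waH: "well_attached H" using gspec_well_attached[OF g1 wa] .
  show "inj_on (\<epsilon> \<circ> \<epsilon>') (edges K)"
    using g1 g2 unfolding gspec_def by (meson comp_inj_on inj_on_subset)
  show "(\<epsilon> \<circ> \<epsilon>') ` edges K \<subseteq> edges G"
    using g1 g2 by (auto simp: gspec_def)
  show "(\<phi>' \<circ> \<phi>) ` verts G = verts K"
    using g1 g2 by (simp add: gspec_def flip: image_image image_comp)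
  show "ends K e = (\<phi>' \<circ> \<phi>) ` ends G ((\<epsilon> \<circ> \<epsilon>') e)" if "e \<in> edges K" for e
    using g1 g2 that gspec_in[OF g2] by (simp add: gspec_def image_comp)
  let ?S1 = "edges G - \<epsilon> ` edges H" and ?S2 = "edges H - \<epsilon>' ` edges K"
    and ?S = "edges G - (\<epsilon> \<circ> \<epsilon>') ` edges K"
  have S1: "?S1 \<subseteq> ?S" using g2 by (auto simp: gspec_def)
  fix u v assume uv: "u \<in> verts G" "v \<in> verts G"
  show "(\<phi>' \<circ> \<phi>) u = (\<phi>' \<circ> \<phi>) v \<longleftrightarrow> v \<in> comp G ?S u"
  proof
    assume "(\<phi>' \<circ> \<phi>) u = (\<phi>' \<circ> \<phi>) v"
    then have "\<phi> v \<in> comp H ?S2 (\<phi> u)"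
      using g2 uv gspec_in(2)[OF g1] by (simp add: gspec_def)
    \<comment> \<open>The induction claims reachability of the whole fibre over the current vertex,
      because an edge of \<open>H\<close> lifts to an edge of \<open>G\<close> that may end anywhere
      in that fibre.\<close>
    then have "\<forall>x\<in>verts G. \<phi> x = \<phi> v \<longrightarrow> x \<in> comp G ?S u"
    proof (induction rule: comp_induct)
      case base
      show ?case
      proof (intro ballI impI)
        fix x assume "x \<in> verts G" "\<phi> x = \<phi> u"
        then have "x \<in> comp G ?S1 u" using gspec_fibre[OF g1, of u x] uv by simp
        then show "x \<in> comp G ?S u" by (rule subsetD[OF comp_mono[OF S1]])
      qed
    next
      case (step y z e)
      have eG: "\<epsilon> e \<in> ?S"
      proof
        have e: "e \<in> edges H" "e \<notin> \<epsilon>' ` edges K" using step(2) by simp_all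
        show "\<epsilon> e \<in> edges G" using gspec_in(1)[OF g1 e(1)] .
        show "\<epsilon> e \<notin> (\<epsilon> \<circ> \<epsilon>') ` edges K"
        proof
          assume "\<epsilon> e \<in> (\<epsilon> \<circ> \<epsilon>') ` edges K"
          then obtain f where f: "f \<in> edges K" "\<epsilon> e = \<epsilon> (\<epsilon>' f)" by auto
          then have "e = \<epsilon>' f" using gspec_inj[OF g1] e(1) gspec_in(1)[OF g2 f(1)] by (meson inj_onD)
          then show False using e(2) f(1) by blast
        qed
      qed
      have "ends H e = \<phi> ` ends G (\<epsilon> e)" using g1 step(2) by (simp add: gspec_def)
      then obtain y0 z0 where yz: "y0 \<in> ends G (\<epsilon> e)" "z0 \<in> ends G (\<epsilon> e)" "\<phi> y0 = y" "\<phi> z0 = z"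
        using step(3,4) by auto
      have in_G: "y0 \<in> verts G" "z0 \<in> verts G" using eG yz wa by (auto simp: well_attached_def)
      have "y0 \<in> comp G ?S u" using step(5) yz in_G by blast
      then have z0: "z0 \<in> comp G ?S u" using comp_edge[OF eG] yz comp_trans by metis
      show ?case
      proof (intro ballI impI)
        fix x assume "x \<in> verts G" "\<phi> x = z"
        then have "x \<in> comp G ?S1 z0" using gspec_fibre[OF g1, of z0 x] yz in_G by simp
        then have "x \<in> comp G ?S z0" by (rule subsetD[OF comp_mono[OF S1]])
        then show "x \<in> comp G ?S u" by (rule comp_trans[OF z0])
      qed
    qed
    then show "v \<in> comp G ?S u" using uv by blast
  next
    assume "v \<in> comp G ?S u"
    then show "(\<phi>' \<circ> \<phi>) u = (\<phi>' \<circ> \<phi>) v"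
    proof (induction rule: comp_induct)
      case (step x y e)
      have "\<phi>' (\<phi> x) = \<phi>' (\<phi> y)"
      proof (cases "e \<in> \<epsilon> ` edges H")
        case True
        then obtain e' where e': "e' \<in> edges H" "e = \<epsilon> e'" by blast
        then have "ends H e' = \<phi> ` ends G e" using g1 by (simp add: gspec_def)
        then have "\<phi> x \<in> ends H e'" "\<phi> y \<in> ends H e'" using step by auto
        moreover have "e' \<notin> \<epsilon>' ` edges K" using step(2) e' by auto
        ultimately show ?thesis using gspec_contracted[OF g2 waH e'(1)] by blast
      next
        case False
        then show ?thesis using gspec_contracted[OF g1 wa _ False] step by (metis DiffD1)
      qed
      then show ?case using step by simp
    qed simp
  qed
qed

text \<open>Cancellation on the left: paths are pushed forward along \<open>\<phi>\<close> in one
  direction and lifted edge by edge in the other. It supplies the second factor when a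
  specialization is split at a single contraction.\<close>

lemma gspec_factor:
  assumes g1: "gspec G H \<phi> \<epsilon>" and g: "gspec G K \<chi> \<eta>" and wa: "well_attached G"
    and \<phi>': "\<And>v. v \<in> verts G \<Longrightarrow> \<phi>' (\<phi> v) = \<chi> v"
    and \<epsilon>': "\<And>e. e \<in> edges K \<Longrightarrow> \<epsilon>' e \<in> edges H \<and> \<epsilon> (\<epsilon>' e) = \<eta> e"
  shows "gspec H K \<phi>' \<epsilon>'"
  unfolding gspec_def
proof (intro conjI ballI)
  have waH: "well_attached H" using gspec_well_attached[OF g1 wa] .
  show "inj_on \<epsilon>' (edges K)"
  proof (rule inj_onI)
    fix x y assume "x \<in> edges K" "y \<in> edges K" "\<epsilon>' x = \<epsilon>' y"
    then have "\<eta> x = \<eta> y" using \<epsilon>' by metis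
    then show "x = y" using g \<open>x \<in> edges K\<close> \<open>y \<in> edges K\<close> by (simp add: gspec_def inj_on_def)
  qed
  show "\<epsilon>' ` edges K \<subseteq> edges H" using \<epsilon>' by auto
  show "\<phi>' ` verts H = verts K"
  proof -
    have "\<phi>' ` verts H = \<phi>' ` \<phi> ` verts G" using g1 by (simp add: gspec_def)
    also have "\<dots> = \<chi> ` verts G" using \<phi>' by (auto simp: image_image)
    finally show ?thesis using g by (simp add: gspec_def)
  qed
  show "ends K e = \<phi>' ` ends H (\<epsilon>' e)" if "e \<in> edges K" for e
  proof -
    have "\<phi>' ` ends H (\<epsilon>' e) = \<phi>' ` \<phi> ` ends G (\<eta> e)"
      using g1 \<epsilon>'[OF that] by (auto simp: gspec_def)
    also have "\<dots> = \<chi> ` ends G (\<eta> e)"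
      unfolding image_image using \<phi>' wa gspec_in(1)[OF g that] by (intro image_cong) (auto simp: well_attached_def)
    finally show ?thesis using g that by (simp add: gspec_def)
  qed
  let ?S = "edges G - \<eta> ` edges K" and ?S2 = "edges H - \<epsilon>' ` edges K"
  fix u v assume "u \<in> verts H" "v \<in> verts H"
  then have "u \<in> \<phi> ` verts G" "v \<in> \<phi> ` verts G" using g1 by (simp_all add: gspec_def)
  then obtain u0 v0 where uv: "u0 \<in> verts G" "v0 \<in> verts G" "u = \<phi> u0" "v = \<phi> v0"
    by (elim imageE)
  show "\<phi>' u = \<phi>' v \<longleftrightarrow> v \<in> comp H ?S2 u"
  proof
    assume "\<phi>' u = \<phi>' v"
    then have "v0 \<in> comp G ?S u0" using uv \<phi>' g by (simp add: gspec_def)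
    then show "v \<in> comp H ?S2 u"
      unfolding uv(3,4)
    proof (induction rule: comp_induct)
      case (step x y e)
      show ?case
      proof (cases "e \<in> \<epsilon> ` edges H")
        case True
        then obtain e' where e': "e' \<in> edges H" "e = \<epsilon> e'" by blast
        then have "ends H e' = \<phi> ` ends G e" using g1 by (simp add: gspec_def)
        then have "\<phi> x \<in> ends H e'" "\<phi> y \<in> ends H e'" using step by auto
        moreover have "e' \<in> ?S2" using step(2) e' \<epsilon>' by auto
        ultimately show ?thesis using step(5) comp_edge comp_trans by metis
      next
        case False
        have "\<phi> x = \<phi> y" by (rule gspec_contracted[OF g1 wa _ False]) (use step in auto)
        then show ?thesis using step(5) by simp
      qed
    qed simp
  next
    assume "v \<in> comp H ?S2 u"
    then show "\<phi>' u = \<phi>' v"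
    proof (induction rule: comp_induct)
      case (step x y e)
      have "ends H e = \<phi> ` ends G (\<epsilon> e)" using g1 step(2) by (simp add: gspec_def)
      then obtain x0 y0 where xy: "x0 \<in> ends G (\<epsilon> e)" "y0 \<in> ends G (\<epsilon> e)" "\<phi> x0 = x" "\<phi> y0 = y"
        using step(3,4) by auto
      have "\<epsilon> e \<in> edges G" using step(2) gspec_in(1)[OF g1] by blast
      moreover have "\<epsilon> e \<notin> \<eta> ` edges K"
      proof
        assume "\<epsilon> e \<in> \<eta> ` edges K"
        then obtain f where f: "f \<in> edges K" "\<epsilon> e = \<epsilon> (\<epsilon>' f)" using \<epsilon>' by auto
        then have "e = \<epsilon>' f" using gspec_inj[OF g1] step(2) \<epsilon>' by (meson DiffD1 inj_onD)
        then show False using step(2) f(1) by blast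
      qed
      ultimately have "\<chi> x0 = \<chi> y0" using gspec_contracted[OF g wa] xy by blast
      moreover have "x0 \<in> verts G" "y0 \<in> verts G"
        using \<open>\<epsilon> e \<in> edges G\<close> xy wa by (auto simp: well_attached_def)
      ultimately have "\<phi>' x = \<phi>' y" using \<phi>'[of x0] \<phi>'[of y0] xy(3,4) by simp
      then show ?case using step(5) by simp
    qed simp
  qed
qed

section \<open>Weighted specializations\<close>

text \<open>Subtracting \<open>1\<close> from the weights makes the genus of the fibres additive.\<close>

definition wsp ::
  "('v, 'e) wgraph \<Rightarrow> ('w, 'f) wgraph \<Rightarrow> ('v \<Rightarrow> 'w) \<Rightarrow> ('f \<Rightarrow> 'e) \<Rightarrow> bool" where
  "wsp \<Gamma> \<Gamma>' \<phi> \<epsilon> \<longleftrightarrow> gspec \<Gamma> \<Gamma>' \<phi> \<epsilon> \<and> \<phi> (leg \<Gamma>) = leg \<Gamma>' \<and>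
     (\<forall>v'\<in>verts \<Gamma>'. int (weight \<Gamma>' v') - 1 =
        (\<Sum>v\<in>{v \<in> verts \<Gamma>. \<phi> v = v'}. int (weight \<Gamma> v) - 1)
        + int (card {e \<in> edges \<Gamma> - \<epsilon> ` edges \<Gamma>'. \<phi> (att \<Gamma> e False) = v'}))"

lemma att_in_verts: "well_attached G \<Longrightarrow> e \<in> edges G \<Longrightarrow> att G e b \<in> verts G"
  using att_in_ends[of G e b] unfolding well_attached_def by blast

lemma subgraph_simps [simp]:
  "verts (subgraph G X S) = X" "edges (subgraph G X S) = {e \<in> S. ends G e \<subseteq> X}"
  "weight (subgraph G X S) = weight G" "ends (subgraph G X S) = ends G"
  by (simp_all add: subgraph_def ends_def fun_eq_iff)

text \<open>A fibre is connected by the contracted edges inside it, so its first Betti number is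
  edges minus vertices plus \<open>1\<close>; the vertex count is absorbed by lowering each weight
  by \<open>1\<close>.\<close>

lemma genus_fibre:
  fixes \<Gamma> :: "('v, 'e) wgraph" and H :: "('w, 'f) wgraph"
  assumes g: "gspec \<Gamma> H \<phi> \<epsilon>" and wa: "well_attached \<Gamma>" and v': "v' \<in> verts H"
  defines "S \<equiv> edges \<Gamma> - \<epsilon> ` edges H" and "X \<equiv> {v \<in> verts \<Gamma>. \<phi> v = v'}"
  shows "genus (subgraph \<Gamma> X S) - 1 =
    (\<Sum>v\<in>X. int (weight \<Gamma> v) - 1) + int (card {e \<in> S. \<phi> (att \<Gamma> e False) = v'})"
proof -
  \<comment> \<open>Both ends of a contracted edge lie in the same fibre, so the half-edge
    \<open>False\<close> decides where the edge is counted.\<close>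
  have eq: "{e \<in> S. ends \<Gamma> e \<subseteq> X} = {e \<in> S. \<phi> (att \<Gamma> e False) = v'}"
  proof (intro Collect_cong conj_cong refl)
    fix e assume e: "e \<in> S"
    then have eG: "e \<in> edges \<Gamma>" "e \<notin> \<epsilon> ` edges H" by (auto simp: S_def)
    have "\<phi> (att \<Gamma> e True) = \<phi> (att \<Gamma> e False)"
      by (rule gspec_contracted[OF g wa eG]) auto
    then show "ends \<Gamma> e \<subseteq> X \<longleftrightarrow> \<phi> (att \<Gamma> e False) = v'"
      using att_in_verts[OF wa eG(1)] by (auto simp: ends_eq X_def)
  qed
  let ?G = "subgraph \<Gamma> X S"
  have "v' \<in> \<phi> ` verts \<Gamma>" using g v' by (simp add: gspec_def)
  then obtain x where x: "x \<in> X" by (auto simp: X_def)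
  have comp: "comp ?G (edges ?G) u = X" if u: "u \<in> X" for u
  proof (intro equalityI subsetI)
    fix v assume "v \<in> comp ?G (edges ?G) u"
    then show "v \<in> X" by (rule comp_sub) (use u in auto)
  next
    fix v assume v: "v \<in> X"
    have "v \<in> comp \<Gamma> S u" using gspec_fibre[OF g, of u v] u v by (simp add: X_def S_def)
    then have "v \<in> X \<and> v \<in> comp ?G (edges ?G) u"
    proof (induction rule: comp_induct)
      case (step x y e)
      have eG: "e \<in> edges \<Gamma>" "e \<notin> \<epsilon> ` edges H" using step(2) by (auto simp: S_def)
      have "\<phi> z = v'" if "z \<in> ends \<Gamma> e" for z
        using gspec_contracted[OF g wa eG that step(3)] step(5) by (simp add: X_def)
      then have "ends \<Gamma> e \<subseteq> X" using wa eG by (auto simp: X_def well_attached_def)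
      then have e: "e \<in> edges ?G" using step(2) by simp
      have "y \<in> comp ?G (edges ?G) x" by (rule comp_edge[OF e]) (use step in auto)
      then show ?case using step \<open>ends \<Gamma> e \<subseteq> X\<close> comp_trans[of x ?G "edges ?G" u y] by blast
    qed (use u in simp)
    then show "v \<in> comp ?G (edges ?G) u" by simp
  qed
  have "comp ?G (edges ?G) ` X = {X}" using comp x by auto
  moreover have "finite X" using wa by (simp add: X_def well_attached_def)
  ultimately have "genus ?G = (\<Sum>v\<in>X. int (weight \<Gamma> v)) + int (card {e \<in> S. \<phi> (att \<Gamma> e False) = v'}) - int (card X) + 1"
    by (simp add: genus_def b1_def eq)
  then show ?thesis by (simp add: sum_subtractf)
qed

lemma wspecialization_iff:
  assumes "well_attached \<Gamma>"
  shows "wspecialization \<Gamma> \<Gamma>' \<phi> \<epsilon> \<longleftrightarrow> wsp \<Gamma> \<Gamma>' \<phi> \<epsilon>"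
proof -
  have "specialization \<Gamma> \<Gamma>' \<phi> \<epsilon> \<longleftrightarrow> gspec \<Gamma> \<Gamma>' \<phi> \<epsilon>"
    using assms by (intro specialization_iff) (simp add: well_attached_def)
  moreover have "int (weight \<Gamma>' v') = genus (subgraph \<Gamma> {v \<in> verts \<Gamma>. \<phi> v = v'} (edges \<Gamma> - \<epsilon> ` edges \<Gamma>'))
     \<longleftrightarrow> int (weight \<Gamma>' v') - 1 = (\<Sum>v\<in>{v \<in> verts \<Gamma>. \<phi> v = v'}. int (weight \<Gamma> v) - 1)
        + int (card {e \<in> edges \<Gamma> - \<epsilon> ` edges \<Gamma>'. \<phi> (att \<Gamma> e False) = v'})"
    if "gspec \<Gamma> \<Gamma>' \<phi> \<epsilon>" "v' \<in> verts \<Gamma>'" for v'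
    using genus_fibre[OF that(1) assms that(2)] by linarith
  ultimately show ?thesis
    unfolding wspecialization_def wsp_def by auto
qed

text \<open>With a membership predicate for \<open>h\<close> and \<open>c = True\<close> this
  becomes a sum over the preimage of a set of vertices.\<close>

lemma sum_fibres:
  assumes "finite A" "finite B" "g ` A \<subseteq> B"
  shows "(\<Sum>b\<in>{b \<in> B. h b = c}. \<Sum>a\<in>{a \<in> A. g a = b}. f a) = (\<Sum>a\<in>{a \<in> A. h (g a) = c}. f a)"
proof -
  have "(\<Sum>b\<in>{b \<in> B. h b = c}. \<Sum>a\<in>{a \<in> A. g a = b}. f a) =
      (\<Sum>b\<in>{b \<in> B. h b = c}. \<Sum>a\<in>{a \<in> {a \<in> A. h (g a) = c}. g a = b}. f a)"
    by (intro sum.cong) auto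
  also have "\<dots> = (\<Sum>a\<in>{a \<in> A. h (g a) = c}. f a)"
    using assms by (intro sum.group) auto
  finally show ?thesis .
qed

lemma card_fibres:
  assumes "finite A" "finite B" "g ` A \<subseteq> B"
  shows "(\<Sum>b\<in>{b \<in> B. h b = c}. int (card {a \<in> A. g a = b})) = int (card {a \<in> A. h (g a) = c})"
  using sum_fibres[OF assms, of "\<lambda>_. 1 :: int" h c] by simp

text \<open>The composite contracts the edges lost in the first step and the lifts of those lost in
  the second. Since \<open>\<chi>\<close> and \<open>\<eta>\<close> agree with the composites just
  on the graph, the count serves composition and factorization alike.\<close>

lemma contracted_card:
  assumes g1: "gspec G H \<phi> \<epsilon>" and g2: "gspec H K \<phi>' \<epsilon>'" and wa: "well_attached G"
    and \<chi>: "\<And>v. v \<in> verts G \<Longrightarrow> \<chi> v = \<phi>' (\<phi> v)"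
    and \<eta>: "\<And>e. e \<in> edges K \<Longrightarrow> \<eta> e = \<epsilon> (\<epsilon>' e)"
  shows "card {e \<in> edges G - \<eta> ` edges K. \<chi> (att G e False) = c} =
    card {e \<in> edges G - \<epsilon> ` edges H. \<phi>' (\<phi> (att G e False)) = c} +
    card {e \<in> edges H - \<epsilon>' ` edges K. \<phi>' (att H e False) = c}"
proof -
  have waH: "well_attached H" using gspec_well_attached[OF g1 wa] .
  let ?A = "{e \<in> edges G - \<epsilon> ` edges H. \<phi>' (\<phi> (att G e False)) = c}"
    and ?B = "{e \<in> edges H - \<epsilon>' ` edges K. \<phi>' (att H e False) = c}"
  have \<eta>K: "\<eta> ` edges K = \<epsilon> ` \<epsilon>' ` edges K" using \<eta> by (simp add: image_image)
  have key: "\<phi>' (\<phi> (att G (\<epsilon> e) False)) = \<phi>' (att H e False)" if e: "e \<in> edges H" "e \<notin> \<epsilon>' ` edges K" for e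
  proof (rule gspec_contracted[OF g2 waH e])
    show "\<phi> (att G (\<epsilon> e) False) \<in> ends H e" using gspec_ends[OF g1 e(1)] by simp
  qed simp
  have split: "edges G - \<eta> ` edges K = (edges G - \<epsilon> ` edges H) \<union> \<epsilon> ` (edges H - \<epsilon>' ` edges K)"
  proof -
    have "\<epsilon> ` (edges H - \<epsilon>' ` edges K) = \<epsilon> ` edges H - \<epsilon> ` \<epsilon>' ` edges K"
      using g1 g2 by (intro inj_on_image_set_diff[of \<epsilon> "edges H"]) (auto simp: gspec_def)
    moreover have "\<epsilon>' ` edges K \<subseteq> edges H" "\<epsilon> ` edges H \<subseteq> edges G" using g1 g2 by (auto simp: gspec_def)
    ultimately show ?thesis unfolding \<eta>K by blast
  qed
  have "{e \<in> edges G - \<eta> ` edges K. \<chi> (att G e False) = c} = ?A \<union> \<epsilon> ` ?B"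
  proof -
    have "{e \<in> edges G - \<eta> ` edges K. \<chi> (att G e False) = c} = {e \<in> edges G - \<eta> ` edges K. \<phi>' (\<phi> (att G e False)) = c}"
      using \<chi> att_in_verts[OF wa] by auto
    also have "\<dots> = ?A \<union> {e \<in> \<epsilon> ` (edges H - \<epsilon>' ` edges K). \<phi>' (\<phi> (att G e False)) = c}"
      unfolding split by blast
    also have "{e \<in> \<epsilon> ` (edges H - \<epsilon>' ` edges K). \<phi>' (\<phi> (att G e False)) = c} = \<epsilon> ` ?B"
      using key by force
    finally show ?thesis .
  qed
  moreover have "finite ?A" "finite ?B" using wa waH by (auto simp: well_attached_def)
  moreover have "?A \<inter> \<epsilon> ` ?B = {}" by auto
  moreover have "card (\<epsilon> ` ?B) = card ?B"
    using gspec_inj[OF g1] by (intro card_image) (auto simp: inj_on_def)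
  ultimately show ?thesis by (simp add: card_Un_disjoint)
qed

text \<open>With \<open>q\<close> standing for weight minus \<open>1\<close>, the genus of a fibre
  is a plain sum plus an edge count, and both add up over the fibres of a second map.\<close>

lemma weight_comp:
  assumes g1: "gspec G H \<phi> \<epsilon>" and g2: "gspec H K \<phi>' \<epsilon>'" and wa: "well_attached G"
    and \<chi>: "\<And>v. v \<in> verts G \<Longrightarrow> \<chi> v = \<phi>' (\<phi> v)"
    and \<eta>: "\<And>e. e \<in> edges K \<Longrightarrow> \<eta> e = \<epsilon> (\<epsilon>' e)"
    and q: "\<And>b. b \<in> verts H \<Longrightarrow> q' b = (\<Sum>v\<in>{v \<in> verts G. \<phi> v = b}. q v :: int)
        + int (card {e \<in> edges G - \<epsilon> ` edges H. \<phi> (att G e False) = b})"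
  shows "(\<Sum>b\<in>{b \<in> verts H. \<phi>' b = c}. q' b) + int (card {e \<in> edges H - \<epsilon>' ` edges K. \<phi>' (att H e False) = c})
     = (\<Sum>v\<in>{v \<in> verts G. \<chi> v = c}. q v) + int (card {e \<in> edges G - \<eta> ` edges K. \<chi> (att G e False) = c})"
proof -
  have waH: "well_attached H" using gspec_well_attached[OF g1 wa] .
  have fin: "finite (verts G)" "finite (verts H)" "finite (edges G)" using wa waH by (auto simp: well_attached_def)
  have "(\<Sum>b\<in>{b \<in> verts H. \<phi>' b = c}. q' b) =
     (\<Sum>b\<in>{b \<in> verts H. \<phi>' b = c}. \<Sum>v\<in>{v \<in> verts G. \<phi> v = b}. q v) +
     (\<Sum>b\<in>{b \<in> verts H. \<phi>' b = c}. int (card {e \<in> edges G - \<epsilon> ` edges H. \<phi> (att G e False) = b}))"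
    unfolding sum.distrib[symmetric] by (intro sum.cong) (auto simp: q)
  also have "(\<Sum>b\<in>{b \<in> verts H. \<phi>' b = c}. \<Sum>v\<in>{v \<in> verts G. \<phi> v = b}. q v) =
      (\<Sum>v\<in>{v \<in> verts G. \<phi>' (\<phi> v) = c}. q v)"
    using g1 fin by (intro sum_fibres) (auto simp: gspec_def)
  also have "\<dots> = (\<Sum>v\<in>{v \<in> verts G. \<chi> v = c}. q v)"
    using \<chi> by (intro sum.cong) auto
  also have "(\<Sum>b\<in>{b \<in> verts H. \<phi>' b = c}. int (card {e \<in> edges G - \<epsilon> ` edges H. \<phi> (att G e False) = b})) =
      int (card {e \<in> edges G - \<epsilon> ` edges H. \<phi>' (\<phi> (att G e False)) = c})"
  proof (rule card_fibres)
    show "(\<lambda>e. \<phi> (att G e False)) ` (edges G - \<epsilon> ` edges H) \<subseteq> verts H"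
      using att_in_verts[OF wa] gspec_in(2)[OF g1] by auto
  qed (use fin in auto)
  finally show ?thesis
    using contracted_card[OF g1 g2 wa \<chi> \<eta>, of c] by simp
qed

lemma wsp_comp:
  assumes w1: "wsp G H \<phi> \<epsilon>" and w2: "wsp H K \<phi>' \<epsilon>'" and wa: "well_attached G"
  shows "wsp G K (\<phi>' \<circ> \<phi>) (\<epsilon> \<circ> \<epsilon>')"
  unfolding wsp_def
proof (intro conjI ballI)
  have g: "gspec G H \<phi> \<epsilon>" "gspec H K \<phi>' \<epsilon>'" using w1 w2 by (auto simp: wsp_def)
  show "gspec G K (\<phi>' \<circ> \<phi>) (\<epsilon> \<circ> \<epsilon>')" by (rule gspec_comp[OF g wa])
  show "(\<phi>' \<circ> \<phi>) (leg G) = leg K" using w1 w2 by (simp add: wsp_def)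
  fix c assume "c \<in> verts K"
  then have "int (weight K c) - 1 = (\<Sum>b\<in>{b \<in> verts H. \<phi>' b = c}. int (weight H b) - 1)
      + int (card {e \<in> edges H - \<epsilon>' ` edges K. \<phi>' (att H e False) = c})"
    using w2 by (simp add: wsp_def)
  also have "\<dots> = (\<Sum>v\<in>{v \<in> verts G. (\<phi>' \<circ> \<phi>) v = c}. int (weight G v) - 1)
      + int (card {e \<in> edges G - (\<epsilon> \<circ> \<epsilon>') ` edges K. (\<phi>' \<circ> \<phi>) (att G e False) = c})"
    by (rule weight_comp[OF g wa]) (use w1 in \<open>auto simp: wsp_def\<close>)
  finally show "int (weight K c) - 1 = (\<Sum>v\<in>{v \<in> verts G. (\<phi>' \<circ> \<phi>) v = c}. int (weight G v) - 1)
      + int (card {e \<in> edges G - (\<epsilon> \<circ> \<epsilon>') ` edges K. (\<phi>' \<circ> \<phi>) (att G e False) = c})" .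
qed

text \<open>\<open>weight_comp\<close> read backwards: the weights of \<open>K\<close> computed from
  \<open>G\<close> are regrouped over the vertices of \<open>H\<close>.\<close>

lemma wsp_factor:
  assumes w1: "wsp G H \<phi> \<epsilon>" and w: "wsp G K \<chi> \<eta>" and wa: "well_attached G" and leg: "leg G \<in> verts G"
    and \<phi>': "\<And>v. v \<in> verts G \<Longrightarrow> \<phi>' (\<phi> v) = \<chi> v"
    and \<epsilon>': "\<And>e. e \<in> edges K \<Longrightarrow> \<epsilon>' e \<in> edges H \<and> \<epsilon> (\<epsilon>' e) = \<eta> e"
  shows "wsp H K \<phi>' \<epsilon>'"
  unfolding wsp_def
proof (intro conjI ballI)
  have g: "gspec G H \<phi> \<epsilon>" "gspec G K \<chi> \<eta>" using w1 w by (auto simp: wsp_def)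
  show g2: "gspec H K \<phi>' \<epsilon>'" by (rule gspec_factor[OF g wa \<phi>' \<epsilon>'])
  show "\<phi>' (leg H) = leg K" using w1 w \<phi>'[OF leg] by (simp add: wsp_def)
  fix c assume "c \<in> verts K"
  then have "int (weight K c) - 1 = (\<Sum>v\<in>{v \<in> verts G. \<chi> v = c}. int (weight G v) - 1)
      + int (card {e \<in> edges G - \<eta> ` edges K. \<chi> (att G e False) = c})"
    using w by (simp add: wsp_def)
  also have "\<dots> = (\<Sum>b\<in>{b \<in> verts H. \<phi>' b = c}. int (weight H b) - 1)
      + int (card {e \<in> edges H - \<epsilon>' ` edges K. \<phi>' (att H e False) = c})"
    by (rule weight_comp[OF g(1) g2 wa, symmetric]) (use w1 \<phi>' \<epsilon>' in \<open>auto simp: wsp_def\<close>)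
  finally show "int (weight K c) - 1 = (\<Sum>b\<in>{b \<in> verts H. \<phi>' b = c}. int (weight H b) - 1)
      + int (card {e \<in> edges H - \<epsilon>' ` edges K. \<phi>' (att H e False) = c})" .
qed

lemma comp_empty: "comp G {} u = {u}"
  by (simp add: comp_def)

lemma wsp_iso:
  assumes iso: "wgraph_iso \<Gamma> \<Gamma>' \<phi> \<psi>" and wa: "well_attached \<Gamma>"
  shows "wsp \<Gamma> \<Gamma>' \<phi> (inv_into (edges \<Gamma>) \<psi>)"
proof -
  let ?\<epsilon> = "inv_into (edges \<Gamma>) \<psi>"
  have \<phi>: "bij_betw \<phi> (verts \<Gamma>) (verts \<Gamma>')" and \<psi>: "bij_betw \<psi> (edges \<Gamma>) (edges \<Gamma>')"
    and en: "\<And>e. e \<in> edges \<Gamma> \<Longrightarrow> ends \<Gamma>' (\<psi> e) = \<phi> ` ends \<Gamma> e"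
    and leg: "\<phi> (leg \<Gamma>) = leg \<Gamma>'" and w: "\<And>v. v \<in> verts \<Gamma> \<Longrightarrow> weight \<Gamma>' (\<phi> v) = weight \<Gamma> v"
    using iso by (auto simp: wgraph_iso_def graph_iso_def)
  have im: "?\<epsilon> ` edges \<Gamma>' = edges \<Gamma>" using \<psi> by (metis bij_betw_imp_surj_on bij_betw_inv_into)
  have \<psi>\<epsilon>: "\<psi> (?\<epsilon> e) = e" "?\<epsilon> e \<in> edges \<Gamma>" if "e \<in> edges \<Gamma>'" for e
    using that \<psi> im by (auto simp: bij_betw_inv_into_right)
  have "gspec \<Gamma> \<Gamma>' \<phi> ?\<epsilon>"
    unfolding gspec_def
  proof (intro conjI ballI)
    show "inj_on ?\<epsilon> (edges \<Gamma>')" using \<psi> by (metis bij_betw_imp_inj_on bij_betw_inv_into)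
    show "ends \<Gamma>' e = \<phi> ` ends \<Gamma> (?\<epsilon> e)" if "e \<in> edges \<Gamma>'" for e
      using en[OF \<psi>\<epsilon>(2)[OF that]] \<psi>\<epsilon>(1)[OF that] by simp
    show "\<phi> u = \<phi> v \<longleftrightarrow> v \<in> comp \<Gamma> (edges \<Gamma> - ?\<epsilon> ` edges \<Gamma>') u" if "u \<in> verts \<Gamma>" "v \<in> verts \<Gamma>" for u v
      using that \<phi> by (auto simp: im comp_empty bij_betw_def inj_on_def)
  qed (use im \<phi> in \<open>auto simp: bij_betw_def\<close>)
  moreover have "int (weight \<Gamma>' v') - 1 = (\<Sum>v\<in>{v \<in> verts \<Gamma>. \<phi> v = v'}. int (weight \<Gamma> v) - 1)" if "v' \<in> verts \<Gamma>'" for v'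
  proof -
    have "v' \<in> \<phi> ` verts \<Gamma>" using that \<phi> by (simp add: bij_betw_def)
    then obtain v where v: "v' = \<phi> v" "v \<in> verts \<Gamma>" by (rule imageE)
    then have "{v \<in> verts \<Gamma>. \<phi> v = v'} = {v}" using \<phi> by (auto simp: bij_betw_def inj_on_def)
    then show ?thesis using v w by simp
  qed
  ultimately show ?thesis using leg by (simp add: wsp_def im)
qed

text \<open>Equal finite edge counts make \<open>\<epsilon>\<close> a bijection; nothing is
  contracted, so the fibres are single vertices and the weights agree.\<close>

lemma wsp_imp_iso:
  assumes w: "wsp \<Gamma> \<Gamma>' \<phi> \<epsilon>" and wa: "well_attached \<Gamma>" and card: "card (edges \<Gamma>') = card (edges \<Gamma>)"
  shows "wgraph_iso \<Gamma> \<Gamma>' \<phi> (inv_into (edges \<Gamma>') \<epsilon>)" "\<epsilon> ` edges \<Gamma>' = edges \<Gamma>"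
proof -
  have g: "gspec \<Gamma> \<Gamma>' \<phi> \<epsilon>" using w by (simp add: wsp_def)
  have fin: "finite (edges \<Gamma>)" using wa by (simp add: well_attached_def)
  show im: "\<epsilon> ` edges \<Gamma>' = edges \<Gamma>"
    using g card_image[OF gspec_inj[OF g]] card by (intro card_subset_eq[OF fin]) (auto simp: gspec_def)
  have inj: "inj_on \<phi> (verts \<Gamma>)"
    using gspec_fibre[OF g] by (intro inj_onI) (simp add: im comp_empty)
  have \<epsilon>: "bij_betw \<epsilon> (edges \<Gamma>') (edges \<Gamma>)" using gspec_inj[OF g] im by (simp add: bij_betw_def)
  show "wgraph_iso \<Gamma> \<Gamma>' \<phi> (inv_into (edges \<Gamma>') \<epsilon>)"
    unfolding wgraph_iso_def graph_iso_def
  proof (intro conjI ballI)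
    show "bij_betw \<phi> (verts \<Gamma>) (verts \<Gamma>')" using inj g by (simp add: bij_betw_def gspec_def)
    show "bij_betw (inv_into (edges \<Gamma>') \<epsilon>) (edges \<Gamma>) (edges \<Gamma>')" by (rule bij_betw_inv_into[OF \<epsilon>])
    show "ends \<Gamma>' (inv_into (edges \<Gamma>') \<epsilon> e) = \<phi> ` ends \<Gamma> e" if e: "e \<in> edges \<Gamma>" for e
    proof -
      have "inv_into (edges \<Gamma>') \<epsilon> e \<in> edges \<Gamma>'" using e im by (simp add: inv_into_into)
      moreover have "\<epsilon> (inv_into (edges \<Gamma>') \<epsilon> e) = e" using e im by (simp add: f_inv_into_f)
      ultimately show ?thesis using gspec_ends[OF g, of "inv_into (edges \<Gamma>') \<epsilon> e"] by simp
    qed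
    show "\<phi> (leg \<Gamma>) = leg \<Gamma>'" using w by (simp add: wsp_def)
    show "weight \<Gamma>' (\<phi> v) = weight \<Gamma> v" if v: "v \<in> verts \<Gamma>" for v
    proof -
      have "\<phi> v \<in> verts \<Gamma>'" using gspec_in(2)[OF g v] .
      then have "int (weight \<Gamma>' (\<phi> v)) - 1 = (\<Sum>u\<in>{u \<in> verts \<Gamma>. \<phi> u = \<phi> v}. int (weight \<Gamma> u) - 1)"
        using w by (simp add: wsp_def im)
      moreover have "{u \<in> verts \<Gamma>. \<phi> u = \<phi> v} = {v}" using inj v by (auto simp: inj_on_def)
      ultimately show ?thesis by simp
    qed
  qed
qed

section \<open>Pseudo-divisors without subdivisions\<close>

text \<open>A pseudo-divisor \<open>(E, D)\<close> is determined by \<open>E\<close> and the restriction \<open>a\<close> of \<open>D\<close> to the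
  original vertices.  In a specialization every exceptional vertex over a lost edge \<open>e\<close> merges
  with one of the ends \<open>t e\<close> of \<open>e\<close>.\<close>

definition pds ::
  "('v, 'e) wgraph \<Rightarrow> 'e set \<Rightarrow> ('v \<Rightarrow> int) \<Rightarrow> ('w, 'f) wgraph \<Rightarrow> 'f set \<Rightarrow> ('w \<Rightarrow> int) \<Rightarrow>
     ('v \<Rightarrow> 'w) \<Rightarrow> ('f \<Rightarrow> 'e) \<Rightarrow> bool" where
  "pds \<Gamma> E a \<Gamma>' E' a' \<phi> \<epsilon> \<longleftrightarrow> wsp \<Gamma> \<Gamma>' \<phi> \<epsilon> \<and> \<epsilon> ` E' \<subseteq> E \<and>
     (\<exists>t. (\<forall>e\<in>E. t e \<in> ends \<Gamma> e) \<and>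
       (\<forall>v'\<in>verts \<Gamma>'. a' v' = (\<Sum>v\<in>{v \<in> verts \<Gamma>. \<phi> v = v'}. a v) - int (card {e \<in> E - \<epsilon> ` E'. \<phi> (t e) = v'})))"

text \<open>An exceptional edge lost in the second step must be given an absorbing end in
  \<open>G\<close>. Since \<open>\<phi>\<close> maps the ends of its lift onto its ends in
  \<open>H\<close>, the end \<open>t2 e\<close> lifts to some \<open>s e\<close>.\<close>

lemma pds_comp:
  assumes p1: "pds G E a H E' a' \<phi> \<epsilon>" and p2: "pds H E' a' K E'' a'' \<phi>' \<epsilon>'"
    and wa: "well_attached G" and E: "E \<subseteq> edges G" and E': "E' \<subseteq> edges H" and E'': "E'' \<subseteq> edges K"
  shows "pds G E a K E'' a'' (\<phi>' \<circ> \<phi>) (\<epsilon> \<circ> \<epsilon>')"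
proof -
  have w: "wsp G H \<phi> \<epsilon>" "wsp H K \<phi>' \<epsilon>'" and sub: "\<epsilon> ` E' \<subseteq> E" "\<epsilon>' ` E'' \<subseteq> E'"
    using p1 p2 by (auto simp: pds_def)
  have g1: "gspec G H \<phi> \<epsilon>" and g2: "gspec H K \<phi>' \<epsilon>'" using w by (auto simp: wsp_def)
  have waH: "well_attached H" using gspec_well_attached[OF g1 wa] .
  have inj: "inj_on \<epsilon> E'" using gspec_inj[OF g1] E' by (rule inj_on_subset)
  obtain t1 where t1: "\<forall>e\<in>E. t1 e \<in> ends G e"
    "\<forall>v'\<in>verts H. a' v' = (\<Sum>v\<in>{v \<in> verts G. \<phi> v = v'}. a v) - int (card {e \<in> E - \<epsilon> ` E'. \<phi> (t1 e) = v'})"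
    using p1 by (auto simp: pds_def)
  obtain t2 where t2: "\<forall>e\<in>E'. t2 e \<in> ends H e"
    "\<forall>v'\<in>verts K. a'' v' = (\<Sum>v\<in>{v \<in> verts H. \<phi>' v = v'}. a' v) - int (card {e \<in> E' - \<epsilon>' ` E''. \<phi>' (t2 e) = v'})"
    using p2 by (auto simp: pds_def)
  have "\<forall>e\<in>E'. \<exists>x\<in>ends G (\<epsilon> e). \<phi> x = t2 e"
  proof
    fix e assume e: "e \<in> E'"
    then have "t2 e \<in> \<phi> ` ends G (\<epsilon> e)" using t2(1) gspec_ends[OF g1] E' by blast
    then show "\<exists>x\<in>ends G (\<epsilon> e). \<phi> x = t2 e" by (metis imageE)
  qed
  then obtain s where s: "\<forall>e\<in>E'. s e \<in> ends G (\<epsilon> e) \<and> \<phi> (s e) = t2 e" by metis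
  define t where "t e = (if e \<in> \<epsilon> ` E' then s (inv_into E' \<epsilon> e) else t1 e)" for e
  have t\<epsilon>: "t (\<epsilon> e) = s e" if "e \<in> E'" for e using that inj by (simp add: t_def)
  have tE: "\<forall>e\<in>E. t e \<in> ends G e"
  proof
    fix e assume e: "e \<in> E"
    show "t e \<in> ends G e"
    proof (cases "e \<in> \<epsilon> ` E'")
      case True
      then obtain e' where "e = \<epsilon> e'" "e' \<in> E'" by (rule imageE)
      then show ?thesis using t\<epsilon> s by simp
    next
      case False
      then show ?thesis using t1(1) e by (simp add: t_def)
    qed
  qed
  have fin: "finite E" "finite E'" "finite (verts G)" "finite (verts H)"
    using wa waH E E' by (auto simp: well_attached_def intro: finite_subset)
  have "a'' c = (\<Sum>v\<in>{v \<in> verts G. (\<phi>' \<circ> \<phi>) v = c}. a v) - int (card {e \<in> E - (\<epsilon> \<circ> \<epsilon>') ` E''. (\<phi>' \<circ> \<phi>) (t e) = c})"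
    if c: "c \<in> verts K" for c
  proof -
    let ?A = "{e \<in> E - \<epsilon> ` E'. \<phi>' (\<phi> (t1 e)) = c}" and ?B = "{e \<in> E' - \<epsilon>' ` E''. \<phi>' (t2 e) = c}"
    have split: "E - (\<epsilon> \<circ> \<epsilon>') ` E'' = (E - \<epsilon> ` E') \<union> \<epsilon> ` (E' - \<epsilon>' ` E'')"
    proof -
      have "\<epsilon> ` (E' - \<epsilon>' ` E'') = \<epsilon> ` E' - \<epsilon> ` \<epsilon>' ` E''"
        using inj sub(2) by (intro inj_on_image_set_diff[of \<epsilon> E']) auto
      then show ?thesis using sub by (auto simp: image_comp)
    qed
    have "{e \<in> E - (\<epsilon> \<circ> \<epsilon>') ` E''. (\<phi>' \<circ> \<phi>) (t e) = c} =
       {e \<in> E - \<epsilon> ` E'. \<phi>' (\<phi> (t e)) = c} \<union> {e \<in> \<epsilon> ` (E' - \<epsilon>' ` E''). \<phi>' (\<phi> (t e)) = c}"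
      unfolding split by auto
    also have "{e \<in> E - \<epsilon> ` E'. \<phi>' (\<phi> (t e)) = c} = ?A" by (auto simp: t_def)
    also have "{e \<in> \<epsilon> ` (E' - \<epsilon>' ` E''). \<phi>' (\<phi> (t e)) = c} = \<epsilon> ` ?B"
      using t\<epsilon> s by force
    finally have "card {e \<in> E - (\<epsilon> \<circ> \<epsilon>') ` E''. (\<phi>' \<circ> \<phi>) (t e) = c} = card (?A \<union> \<epsilon> ` ?B)" by simp
    also have "\<dots> = card ?A + card (\<epsilon> ` ?B)" using fin by (intro card_Un_disjoint) auto
    also have "card (\<epsilon> ` ?B) = card ?B" using inj by (intro card_image) (auto simp: inj_on_def)
    finally have cd: "card {e \<in> E - (\<epsilon> \<circ> \<epsilon>') ` E''. (\<phi>' \<circ> \<phi>) (t e) = c} = card ?A + card ?B" .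
    have "(\<Sum>b\<in>{b \<in> verts H. \<phi>' b = c}. a' b) =
       (\<Sum>b\<in>{b \<in> verts H. \<phi>' b = c}. \<Sum>v\<in>{v \<in> verts G. \<phi> v = b}. a v) -
       (\<Sum>b\<in>{b \<in> verts H. \<phi>' b = c}. int (card {e \<in> E - \<epsilon> ` E'. \<phi> (t1 e) = b}))"
      unfolding sum_subtractf[symmetric] using t1(2) by (intro sum.cong) auto
    also have "(\<Sum>b\<in>{b \<in> verts H. \<phi>' b = c}. \<Sum>v\<in>{v \<in> verts G. \<phi> v = b}. a v) =
        (\<Sum>v\<in>{v \<in> verts G. \<phi>' (\<phi> v) = c}. a v)"
      using g1 fin by (intro sum_fibres) (auto simp: gspec_def)
    also have "(\<Sum>b\<in>{b \<in> verts H. \<phi>' b = c}. int (card {e \<in> E - \<epsilon> ` E'. \<phi> (t1 e) = b})) = int (card ?A)"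
    proof (rule card_fibres)
      show "(\<lambda>e. \<phi> (t1 e)) ` (E - \<epsilon> ` E') \<subseteq> verts H"
      proof
        fix x assume "x \<in> (\<lambda>e. \<phi> (t1 e)) ` (E - \<epsilon> ` E')"
        then obtain e where e: "e \<in> E" "x = \<phi> (t1 e)" by auto
        then have "t1 e \<in> verts G" using t1(1) E wa by (auto simp: well_attached_def)
        then show "x \<in> verts H" using gspec_in(2)[OF g1] e by simp
      qed
    qed (use fin in auto)
    finally show ?thesis using t2(2) c cd by simp
  qed
  moreover have "(\<epsilon> \<circ> \<epsilon>') ` E'' \<subseteq> E" using sub by fastforce
  ultimately show ?thesis
    unfolding pds_def using wsp_comp[OF w wa] tE by blast
qed

section \<open>Specializations of subdivided graphs expressed on the original graphs\<close>

lemma subdivide_simps [simp]: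
  "verts (subdivide G E) = Orig ` verts G \<union> Exc ` E"
  "edges (subdivide G E) = Whole ` (edges G - E) \<union> {Half e b |e b. e \<in> E}"
  "att (subdivide G E) (Whole e) c = Orig (att G e c)"
  "att (subdivide G E) (Half e b) c = (if c then Exc e else Orig (att G e b))"
  by (simp_all add: subdivide_def)

lemma ends_subdivide [simp]:
  "ends (subdivide G E) (Whole e) = Orig ` ends G e"
  "ends (subdivide G E) (Half e b) = {Orig (att G e b), Exc e}"
  by (simp_all add: ends_eq)

lemma well_attached_subdivide:
  assumes wa: "well_attached G" and E: "E \<subseteq> edges G"
  shows "well_attached (subdivide G E)"
proof -
  have fin: "finite E" "finite (edges G)" "finite (verts G)"
    using assms by (auto simp: well_attached_def intro: finite_subset)
  have "{Half e b |e b. e \<in> E} = (\<lambda>(e, b). Half e b) ` (E \<times> UNIV)" by auto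
  then have "finite {Half e b |e b. e \<in> E}" using fin by simp
  moreover have "ends (subdivide G E) x \<subseteq> verts (subdivide G E)" if "x \<in> edges (subdivide G E)" for x
  proof (cases x)
    case (Whole e)
    then have "ends G e \<subseteq> verts G" using that wa by (auto simp: well_attached_def)
    then show ?thesis using Whole by auto
  next
    case (Half e b)
    then have "e \<in> E" "att G e b \<in> verts G" using that E att_in_verts[OF wa] by auto
    then show ?thesis using Half by auto
  qed
  ultimately show ?thesis using fin by (simp add: well_attached_def)
qed

text \<open>The data of a specialization of subdivisions over \<open>(\<phi>, \<epsilon>)\<close>: the half \<open>c e\<close> of a lost
  exceptional edge \<open>e\<close> is contracted, and \<open>k\<close> records whether \<open>\<epsilon>\<close> exchanges the half-edges.\<close>

definition sub_vert ::
  "('v, 'e) wgraph \<Rightarrow> 'f set \<Rightarrow> ('v \<Rightarrow> 'w) \<Rightarrow> ('f \<Rightarrow> 'e) \<Rightarrow> ('e \<Rightarrow> bool) \<Rightarrow> ('v, 'e) svert \<Rightarrow> ('w, 'f) svert" where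
  "sub_vert \<Gamma> E' \<phi> \<epsilon> c x = (case x of Orig v \<Rightarrow> Orig (\<phi> v)
     | Exc e \<Rightarrow> if e \<in> \<epsilon> ` E' then Exc (inv_into E' \<epsilon> e) else Orig (\<phi> (att \<Gamma> e (c e))))"

definition sub_edge :: "'e set \<Rightarrow> ('f \<Rightarrow> 'e) \<Rightarrow> ('e \<Rightarrow> bool) \<Rightarrow> ('f \<Rightarrow> bool) \<Rightarrow> 'f sedge \<Rightarrow> 'e sedge" where
  "sub_edge E \<epsilon> c k x = (case x of
      Whole e \<Rightarrow> if \<epsilon> e \<in> E then Half (\<epsilon> e) (\<not> c (\<epsilon> e)) else Whole (\<epsilon> e)
    | Half e b \<Rightarrow> Half (\<epsilon> e) (b \<noteq> k e))"

context
  fixes \<Gamma> :: "('v, 'e) wgraph" and E :: "'e set" and \<Gamma>' :: "('w, 'f) wgraph" and E' :: "'f set"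
    and \<phi> :: "'v \<Rightarrow> 'w" and \<epsilon> :: "'f \<Rightarrow> 'e"
  assumes g: "gspec \<Gamma> \<Gamma>' \<phi> \<epsilon>" and wa: "well_attached \<Gamma>" and E: "E \<subseteq> edges \<Gamma>"
    and E': "E' \<subseteq> edges \<Gamma>'" and sub: "\<epsilon> ` E' \<subseteq> E"
begin

lemma inj_E': "inj_on \<epsilon> E'"
  using gspec_inj[OF g] E' by (rule inj_on_subset)

lemma sub_vert_simps [simp]:
  "sub_vert \<Gamma> E' \<phi> \<epsilon> c (Orig v) = Orig (\<phi> v)"
  "e \<in> E' \<Longrightarrow> sub_vert \<Gamma> E' \<phi> \<epsilon> c (Exc (\<epsilon> e)) = Exc e"
  "f \<notin> \<epsilon> ` E' \<Longrightarrow> sub_vert \<Gamma> E' \<phi> \<epsilon> c (Exc f) = Orig (\<phi> (att \<Gamma> f (c f)))"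
  using inj_E' by (auto simp: sub_vert_def)

lemma eps_eq_iff: "e \<in> edges \<Gamma>' \<Longrightarrow> f \<in> edges \<Gamma>' \<Longrightarrow> \<epsilon> e = \<epsilon> f \<longleftrightarrow> e = f"
  using gspec_inj[OF g] by (auto simp: inj_on_def)

text \<open>Every choice \<open>c\<close> of an absorbing half for the lost exceptional edges is
  realized by a specialization of the subdivisions. The twist \<open>k\<close> is needed because
  graph maps respect end sets, not the labels of half-edges.\<close>

lemma gspec_subdivide:
  assumes k: "\<And>e b. e \<in> E' \<Longrightarrow> att \<Gamma>' e b = \<phi> (att \<Gamma> (\<epsilon> e) (b \<noteq> k e))"
  shows "gspec (subdivide \<Gamma> E) (subdivide \<Gamma>' E') (sub_vert \<Gamma> E' \<phi> \<epsilon> c) (sub_edge E \<epsilon> c k)"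
proof -
  let ?G = "subdivide \<Gamma> E" and ?H = "subdivide \<Gamma>' E'" and ?p = "sub_vert \<Gamma> E' \<phi> \<epsilon> c" and ?q = "sub_edge E \<epsilon> c k"
  let ?S = "edges \<Gamma> - \<epsilon> ` edges \<Gamma>'" and ?T = "edges ?G - ?q ` edges ?H"
  have q_whole: "?q (Whole e) = (if \<epsilon> e \<in> E then Half (\<epsilon> e) (\<not> c (\<epsilon> e)) else Whole (\<epsilon> e))" for e
    by (simp add: sub_edge_def)
  have q_half: "?q (Half e b) = Half (\<epsilon> e) (b \<noteq> k e)" for e b
    by (simp add: sub_edge_def)
  have eE: "\<epsilon> e \<in> \<epsilon> ` E' \<longleftrightarrow> e \<in> E'" if "e \<in> edges \<Gamma>'" for e
    using that eps_eq_iff E' by blast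
  have inj: "inj_on ?q (edges ?H)"
  proof (rule inj_onI)
    fix x y assume x: "x \<in> edges ?H" and y: "y \<in> edges ?H" and eq: "?q x = ?q y"
    have over: "over (?q z) = \<epsilon> (over z)" for z by (cases z) (auto simp: sub_edge_def)
    have "over x \<in> edges \<Gamma>'" "over y \<in> edges \<Gamma>'" using x y E' by auto
    then have "over x = over y" using eq over eps_eq_iff by metis
    then show "x = y" using x y eq by (auto simp: q_whole q_half)
  qed
  have img: "?q ` edges ?H \<subseteq> edges ?G"
  proof (rule image_subsetI)
    fix x assume x: "x \<in> edges ?H"
    show "?q x \<in> edges ?G"
    proof (cases x)
      case (Whole e)
      then show ?thesis using x gspec_in(1)[OF g, of e] by (cases "\<epsilon> e \<in> E") (auto simp: q_whole)
    next
      case (Half e b)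
      then show ?thesis using x sub by (auto simp: q_half)
    qed
  qed
  have surj: "?p ` verts ?G = verts ?H"
  proof (intro equalityI subsetI)
    fix y assume "y \<in> ?p ` verts ?G"
    then obtain x where x: "x \<in> verts ?G" "y = ?p x" by auto
    show "y \<in> verts ?H"
    proof (cases x)
      case (Orig v)
      then show ?thesis using x gspec_in(2)[OF g] by auto
    next
      case (Exc e)
      then have e: "e \<in> E" using x by auto
      show ?thesis
      proof (cases "e \<in> \<epsilon> ` E'")
        case True
        then show ?thesis using x Exc by auto
      next
        case False
        then show ?thesis using x Exc e E gspec_in(2)[OF g] att_in_verts[OF wa] by auto
      qed
    qed
  next
    fix y assume y: "y \<in> verts ?H"
    show "y \<in> ?p ` verts ?G"
    proof (cases y)
      case (Orig w)
      then have "w \<in> \<phi> ` verts \<Gamma>" using y g by (auto simp: gspec_def)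
      then obtain v where "w = \<phi> v" "v \<in> verts \<Gamma>" by (rule imageE)
      then show ?thesis using Orig by (intro image_eqI[of _ _ "Orig v"]) auto
    next
      case (Exc e)
      then show ?thesis using y sub by (intro image_eqI[of _ _ "Exc (\<epsilon> e)"]) auto
    qed
  qed
  have ends: "ends ?H x = ?p ` ends ?G (?q x)" if x: "x \<in> edges ?H" for x
  proof (cases x)
    case (Whole e)
    then have e: "e \<in> edges \<Gamma>'" "e \<notin> E'" using x by auto
    have en: "ends \<Gamma>' e = \<phi> ` ends \<Gamma> (\<epsilon> e)" using gspec_ends[OF g e(1)] .
    show ?thesis
    proof (cases "\<epsilon> e \<in> E")
      case True
      have "ends \<Gamma> (\<epsilon> e) = {att \<Gamma> (\<epsilon> e) (\<not> c (\<epsilon> e)), att \<Gamma> (\<epsilon> e) (c (\<epsilon> e))}"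
        by (cases "c (\<epsilon> e)") (auto simp: ends_eq)
      then show ?thesis using Whole True en e eE by (simp add: q_whole)
    next
      case False
      then show ?thesis using Whole en by (simp add: q_whole image_image)
    qed
  next
    case (Half e b)
    then have e: "e \<in> E'" using x by auto
    then show ?thesis using Half k[OF e] by (simp add: q_half)
  qed
  \<comment> \<open>For a lost exceptional edge both halves are contracted if the edge itself is,
    and only the half \<open>c e\<close> if the edge survives without its exceptional
    vertex.\<close>
  have half_T: "Half e b \<in> ?T \<longleftrightarrow> e \<in> E - \<epsilon> ` E' \<and> (e \<in> \<epsilon> ` edges \<Gamma>' \<longrightarrow> b = c e)" for e b
  proof (cases "e \<in> \<epsilon> ` edges \<Gamma>'")
    case True
    then obtain e' where e': "e = \<epsilon> e'" "e' \<in> edges \<Gamma>'" by (rule imageE)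
    have "Half e b \<in> ?q ` edges ?H \<longleftrightarrow> e' \<in> E' \<or> (e \<in> E \<and> b = (\<not> c e))"
    proof
      assume "Half e b \<in> ?q ` edges ?H"
      then obtain x where x: "x \<in> edges ?H" "Half e b = ?q x" by (rule imageE) blast
      then show "e' \<in> E' \<or> (e \<in> E \<and> b = (\<not> c e))"
        using e' E' eps_eq_iff by (cases x) (auto simp: q_whole q_half split: if_splits)
    next
      assume "e' \<in> E' \<or> (e \<in> E \<and> b = (\<not> c e))"
      then show "Half e b \<in> ?q ` edges ?H"
      proof (cases "e' \<in> E'")
        case True
        then have "Half e' (b \<noteq> k e') \<in> edges ?H" by auto
        moreover have "?q (Half e' (b \<noteq> k e')) = Half e b" using e' by (auto simp: q_half)
        ultimately show ?thesis by (metis image_eqI)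
      next
        case False
        then have "Whole e' \<in> edges ?H" "e \<in> E" "b = (\<not> c e)"
          using e' \<open>e' \<in> E' \<or> (e \<in> E \<and> b = (\<not> c e))\<close> by auto
        moreover from this have "?q (Whole e') = Half e b" using e' by (auto simp: q_whole)
        ultimately show ?thesis by (metis image_eqI)
      qed
    qed
    moreover have "e \<in> \<epsilon> ` E' \<longleftrightarrow> e' \<in> E'" using eE e' by simp
    ultimately show ?thesis using True by auto
  next
    case False
    then have "Half e b \<notin> ?q ` edges ?H" using E' by (auto simp: q_whole q_half split: if_splits)
    moreover have "e \<notin> \<epsilon> ` E'" using False E' by auto
    ultimately show ?thesis using False by auto
  qed
  have whole_T: "Whole e \<in> ?T \<longleftrightarrow> e \<in> ?S - E" for e
  proof -
    have "Whole e \<in> ?q ` edges ?H \<longleftrightarrow> e \<in> \<epsilon> ` edges \<Gamma>'" if "e \<notin> E"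
    proof
      assume "Whole e \<in> ?q ` edges ?H"
      then show "e \<in> \<epsilon> ` edges \<Gamma>'" by (auto simp: q_whole q_half split: if_splits)
    next
      assume "e \<in> \<epsilon> ` edges \<Gamma>'"
      then obtain e' where e': "e = \<epsilon> e'" "e' \<in> edges \<Gamma>'" by (rule imageE)
      then have "e' \<notin> E'" using that sub by auto
      then have "Whole e' \<in> edges ?H" "?q (Whole e') = Whole e" using e' that by (auto simp: q_whole)
      then show "Whole e \<in> ?q ` edges ?H" by (metis image_eqI)
    qed
    then show ?thesis by auto
  qed
  have const: "?p x = ?p y" if z: "z \<in> ?T" "x \<in> ends ?G z" "y \<in> ends ?G z" for x y z
  proof (cases z)
    case (Whole e)
    then have e: "e \<in> edges \<Gamma>" "e \<notin> \<epsilon> ` edges \<Gamma>'" using z(1) whole_T[of e] by auto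
    obtain x0 y0 where xy: "x = Orig x0" "y = Orig y0" "x0 \<in> ends \<Gamma> e" "y0 \<in> ends \<Gamma> e"
      using z(2,3) Whole by auto
    then have "\<phi> x0 = \<phi> y0" by (intro gspec_contracted[OF g wa e])
    then show ?thesis using xy by simp
  next
    case (Half e b)
    then have e: "e \<in> E" "e \<notin> \<epsilon> ` E'" "e \<in> \<epsilon> ` edges \<Gamma>' \<longrightarrow> b = c e" using z(1) half_T[of e b] by auto
    have "\<phi> (att \<Gamma> e b) = \<phi> (att \<Gamma> e (c e))"
    proof (cases "e \<in> \<epsilon> ` edges \<Gamma>'")
      case False
      show ?thesis by (rule gspec_contracted[OF g wa _ False]) (use e E in auto)
    qed (use e in simp)
    then show ?thesis using z Half e by auto
  qed
  have exc: "Exc e \<in> comp ?G ?T (Orig (att \<Gamma> e (c e)))" if "e \<in> E - \<epsilon> ` E'" for e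
  proof (rule comp_edge)
    show "Half e (c e) \<in> ?T" using that half_T[of e "c e"] by blast
  qed auto
  have orig: "Orig v \<in> comp ?G ?T (Orig u)" if "v \<in> comp \<Gamma> ?S u" for u v
    using that
  proof (induction rule: comp_induct)
    case (step x y e)
    have "Orig y \<in> comp ?G ?T (Orig x)"
    proof (cases "e \<in> E")
      case True
      then have h: "Half e b \<in> ?T" for b using step(2) half_T[of e b] E' by auto
      obtain b b' where b: "x = att \<Gamma> e b" "y = att \<Gamma> e b'" using step(3,4) by (elim endsE)
      have "Exc e \<in> comp ?G ?T (Orig x)" by (rule comp_edge[OF h[of b]]) (auto simp: b)
      moreover have "Orig y \<in> comp ?G ?T (Exc e)" by (rule comp_edge[OF h[of b']]) (auto simp: b)
      ultimately show ?thesis by (rule comp_trans)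
    next
      case False
      then have w: "Whole e \<in> ?T" using step(2) whole_T[of e] by blast
      show ?thesis by (rule comp_edge[OF w]) (use step in auto)
    qed
    then show ?case using step(5) comp_trans by metis
  qed simp
  have fib: "?p x = ?p y \<longleftrightarrow> y \<in> comp ?G ?T x" if xy: "x \<in> verts ?G" "y \<in> verts ?G" for x y
  proof
    assume eq: "?p x = ?p y"
    have toorig: "\<exists>v\<in>verts \<Gamma>. x \<in> comp ?G ?T (Orig v) \<and> ?p x = Orig (\<phi> v)"
      if "x \<in> verts ?G" "x \<notin> Exc ` \<epsilon> ` E'" for x
    proof (cases x)
      case (Orig v)
      then show ?thesis using that by (intro bexI[of _ v]) auto
    next
      case (Exc e)
      then have e: "e \<in> E - \<epsilon> ` E'" using that by auto
      then show ?thesis using exc[OF e] Exc E att_in_verts[OF wa]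
        by (intro bexI[of _ "att \<Gamma> e (c e)"]) auto
    qed
    show "y \<in> comp ?G ?T x"
    proof (cases "x \<in> Exc ` \<epsilon> ` E' \<or> y \<in> Exc ` \<epsilon> ` E'")
      case True
      \<comment> \<open>A surviving exceptional vertex is alone in its fibre.\<close>
      have "x = y" if xE: "x \<in> Exc ` \<epsilon> ` E'" and that: "?p x = ?p y" for x y
      proof -
        obtain e where e: "e \<in> E'" "x = Exc (\<epsilon> e)" using xE by blast
        show ?thesis
        proof (cases y)
          case (Exc f)
          show ?thesis
          proof (cases "f \<in> \<epsilon> ` E'")
            case True
            then show ?thesis using e that Exc by auto
          next
            case False
            then show ?thesis using e that Exc by simp
          qed
        qed (use e that in simp)
      qed
      then have "x = y" using True eq xy by metis
      then show ?thesis by simp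
    next
      case False
      then obtain u v where u: "u \<in> verts \<Gamma>" "x \<in> comp ?G ?T (Orig u)" "?p x = Orig (\<phi> u)"
        and v: "v \<in> verts \<Gamma>" "y \<in> comp ?G ?T (Orig v)" "?p y = Orig (\<phi> v)"
        using toorig xy by meson
      then have "\<phi> u = \<phi> v" using eq by simp
      then have "v \<in> comp \<Gamma> ?S u" using gspec_fibre[OF g u(1) v(1)] by blast
      from comp_trans[OF comp_trans[OF comp_sym[OF u(2)] orig[OF this]] v(2)] show ?thesis .
    qed
  next
    assume "y \<in> comp ?G ?T x"
    then show "?p x = ?p y"
    proof (induction rule: comp_induct)
      case (step u v e)
      then show ?case using const[OF step(2,3,4)] by simp
    qed simp
  qed
  show ?thesis
    unfolding gspec_def using inj img surj ends fib by blast
qed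

text \<open>The two halves of a lost exceptional edge cannot both survive, because at most one edge
  of the target lies over it; a contracted half moves the exceptional vertex to an end. Only the
  kept exceptional vertices are then left to cover those of the target.\<close>

lemma gspec_subdivide_exc:
  assumes gs: "gspec (subdivide \<Gamma> E) (subdivide \<Gamma>' E') p q"
    and p: "\<And>v. v \<in> verts \<Gamma> \<Longrightarrow> p (Orig v) = Orig (\<phi> v)"
    and q: "\<And>x. x \<in> edges (subdivide \<Gamma>' E') \<Longrightarrow> over (q x) = \<epsilon> (over x)"
  shows "e \<in> E - \<epsilon> ` E' \<Longrightarrow> \<exists>x\<in>ends \<Gamma> e. p (Exc e) = Orig (\<phi> x)"
    and "e' \<in> E' \<Longrightarrow> p (Exc (\<epsilon> e')) = Exc e'"
proof -
  let ?G = "subdivide \<Gamma> E" and ?H = "subdivide \<Gamma>' E'"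
  have waG: "well_attached ?G" by (rule well_attached_subdivide[OF wa E])
  have contr: "p (Exc e) = Orig (\<phi> (att \<Gamma> e b))" if "e \<in> E" "Half e b \<notin> q ` edges ?H" for e b
  proof -
    have "p (Exc e) = p (Orig (att \<Gamma> e b))"
      by (rule gspec_contracted[OF gs waG _ that(2)]) (use that(1) in auto)
    then show ?thesis using p att_in_verts[OF wa] that(1) E by auto
  qed
  have lost: "\<exists>x\<in>ends \<Gamma> e. p (Exc e) = Orig (\<phi> x)" if e: "e \<in> E" "e \<notin> \<epsilon> ` E'" for e
  proof -
    have "\<exists>b. Half e b \<notin> q ` edges ?H"
    proof (rule ccontr)
      assume no: "\<not> ?thesis"
      then have "Half e False \<in> q ` edges ?H" by blast
      then obtain x where x: "Half e False = q x" "x \<in> edges ?H" by (rule imageE)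
      have "Half e True \<in> q ` edges ?H" using no by blast
      then obtain y where y: "Half e True = q y" "y \<in> edges ?H" by (rule imageE)
      have ov: "\<epsilon> (over x) = e" "\<epsilon> (over y) = e" using q[OF x(2)] q[OF y(2)] by (simp_all flip: x(1) y(1))
      then have nE: "over x \<notin> E'" "over y \<notin> E'" using e(2) by (metis imageI)+
      then have "over x \<in> edges \<Gamma>'" "over y \<in> edges \<Gamma>'" using x(2) y(2) by auto
      then have "over x = over y" using ov eps_eq_iff by metis
      then have "x = y" using nE x(2) y(2) by auto
      then have "Half e False = Half e True" using x(1) y(1) by simp
      then show False by simp
    qed
    then obtain b where "Half e b \<notin> q ` edges ?H" by blast
    then have "p (Exc e) = Orig (\<phi> (att \<Gamma> e b))" by (rule contr[OF e(1)])
    then show ?thesis by (intro bexI[of _ "att \<Gamma> e b"]) auto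
  qed
  then show "e \<in> E - \<epsilon> ` E' \<Longrightarrow> \<exists>x\<in>ends \<Gamma> e. p (Exc e) = Orig (\<phi> x)" by blast
  assume e': "e' \<in> E'"
  then have "Exc e' \<in> p ` verts ?G" using gs by (simp add: gspec_def)
  then obtain x where x: "Exc e' = p x" "x \<in> verts ?G" by (rule imageE)
  obtain f where f: "x = Exc f" "f \<in> E" using x p by (cases x) auto
  \<comment> \<open>Lost exceptional vertices go to original vertices, so the preimage of
    \<open>Exc e'\<close> is a kept one; its half \<open>False\<close>, which is not contracted,
    shows which exceptional vertex it is sent to.\<close>
  have "f \<in> \<epsilon> ` E'" using lost[of f] f x by (metis svert.distinct(1))
  then obtain f' where f': "f = \<epsilon> f'" "f' \<in> E'" by (rule imageE)
  have "p (Exc f) \<noteq> Orig v" for v using f x by (metis svert.distinct(1))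
  then have "Half f False \<in> q ` edges ?H" using contr[of f False] f(2) by blast
  then obtain z where z: "Half f False = q z" "z \<in> edges ?H" by (rule imageE)
  have "\<epsilon> (over z) = \<epsilon> f'" using q[OF z(2)] f' by (simp flip: z(1))
  moreover have "over z \<in> edges \<Gamma>'" using z(2) E' by auto
  ultimately have "over z = f'" using eps_eq_iff[of "over z" f'] f' E' by auto
  then obtain b where b: "z = Half f' b" using z(2) f'(2) by auto
  have "ends ?H z = p ` ends ?G (Half f False)" using gspec_ends[OF gs z(2)] by (simp flip: z(1))
  then have "p (Exc f) \<in> {Orig (att \<Gamma>' f' b), Exc f'}" using b by auto
  then have "e' = f'" using x f by auto
  then show "p (Exc (\<epsilon> e')) = Exc e'" using x f f' by simp
qed

text \<open>A lost exceptional vertex carries its value \<open>-1\<close> to the vertex that absorbs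
  it; this is the cardinality term in \<open>pds\<close>.\<close>

lemma pushforward_subdivide:
  assumes D: "\<And>e. e \<in> E \<Longrightarrow> D (Exc e) = (-1 :: int)"
    and p: "\<And>v. v \<in> verts \<Gamma> \<Longrightarrow> p (Orig v) = Orig (\<phi> v)"
    and p': "\<And>e. e \<in> E' \<Longrightarrow> p (Exc (\<epsilon> e)) = Exc e"
    and t: "\<And>e. e \<in> E - \<epsilon> ` E' \<Longrightarrow> p (Exc e) = Orig (\<phi> (t e))"
  shows "pushforward (subdivide \<Gamma> E) p D (Orig w) =
       (\<Sum>v\<in>{v \<in> verts \<Gamma>. \<phi> v = w}. D (Orig v)) - int (card {e \<in> E - \<epsilon> ` E'. \<phi> (t e) = w})"
    and "e' \<in> E' \<Longrightarrow> pushforward (subdivide \<Gamma> E) p D (Exc e') = -1"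
proof -
  have fin: "finite E" "finite (verts \<Gamma>)" using wa E by (auto simp: well_attached_def intro: finite_subset)
  have "{x \<in> verts (subdivide \<Gamma> E). p x = Orig w} =
     Orig ` {v \<in> verts \<Gamma>. \<phi> v = w} \<union> Exc ` {e \<in> E - \<epsilon> ` E'. \<phi> (t e) = w}" (is "?L = ?R")
  proof (rule set_eqI)
    fix x
    show "x \<in> ?L \<longleftrightarrow> x \<in> ?R"
    proof (cases x)
      case (Orig v)
      then show ?thesis using p by auto
    next
      case (Exc e)
      show ?thesis
      proof (cases "e \<in> \<epsilon> ` E'")
        case True
        then show ?thesis using Exc p' by auto
      next
        case False
        then show ?thesis using Exc t by auto
      qed
    qed
  qed
  then have "pushforward (subdivide \<Gamma> E) p D (Orig w) =
     (\<Sum>x\<in>Orig ` {v \<in> verts \<Gamma>. \<phi> v = w}. D x) + (\<Sum>x\<in>Exc ` {e \<in> E - \<epsilon> ` E'. \<phi> (t e) = w}. D x)"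
    unfolding pushforward_def using fin by (simp, intro sum.union_disjoint) auto
  also have "\<dots> = (\<Sum>v\<in>{v \<in> verts \<Gamma>. \<phi> v = w}. D (Orig v)) + (\<Sum>e\<in>{e \<in> E - \<epsilon> ` E'. \<phi> (t e) = w}. D (Exc e))"
    by (simp add: sum.reindex inj_on_def)
  also have "(\<Sum>e\<in>{e \<in> E - \<epsilon> ` E'. \<phi> (t e) = w}. D (Exc e)) = - int (card {e \<in> E - \<epsilon> ` E'. \<phi> (t e) = w})"
    using D by (simp add: sum.cong[of _ _ "\<lambda>e. D (Exc e)" "\<lambda>_. -1"])
  finally show "pushforward (subdivide \<Gamma> E) p D (Orig w) =
       (\<Sum>v\<in>{v \<in> verts \<Gamma>. \<phi> v = w}. D (Orig v)) - int (card {e \<in> E - \<epsilon> ` E'. \<phi> (t e) = w})" by simp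
  assume e': "e' \<in> E'"
  have "{x \<in> verts (subdivide \<Gamma> E). p x = Exc e'} = {Exc (\<epsilon> e')}" (is "?L = ?R")
  proof (rule set_eqI)
    fix x
    show "x \<in> ?L \<longleftrightarrow> x \<in> ?R"
    proof (cases x)
      case (Orig v)
      then show ?thesis using p by auto
    next
      case (Exc e)
      show ?thesis
      proof (cases "e \<in> \<epsilon> ` E'")
        case True
        then obtain f where "e = \<epsilon> f" "f \<in> E'" by (rule imageE)
        moreover from this have "f = e' \<longleftrightarrow> \<epsilon> f = \<epsilon> e'" using eps_eq_iff[of f e'] e' E' by blast
        ultimately show ?thesis using Exc p' e' sub by auto
      next
        case False
        then show ?thesis using Exc t e' by auto
      qed
    qed
  qed
  then show "pushforward (subdivide \<Gamma> E) p D (Exc e') = -1"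
    using D sub e' unfolding pushforward_def by auto
qed

end

text \<open>From here on the choice of \<open>t\<close> replaces the pair of maps between
  subdivisions, so specializations can be composed and factored on the original graphs.\<close>

lemma pd_specialization_iff:
  assumes wa: "well_attached \<Gamma>" and E: "E \<subseteq> edges \<Gamma>" and E': "E' \<subseteq> edges \<Gamma>'"
    and D: "\<And>e. e \<in> E \<Longrightarrow> D (Exc e) = -1" and D': "\<And>e. e \<in> E' \<Longrightarrow> D' (Exc e) = -1"
  shows "pd_specialization \<Gamma> (E, D) \<Gamma>' (E', D') \<phi> \<epsilon> \<longleftrightarrow>
    pds \<Gamma> E (\<lambda>v. D (Orig v)) \<Gamma>' E' (\<lambda>v. D' (Orig v)) \<phi> \<epsilon>"
proof
  let ?G = "subdivide \<Gamma> E" and ?H = "subdivide \<Gamma>' E'"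
  have waG: "well_attached ?G" by (rule well_attached_subdivide[OF wa E])
  {
    assume "pd_specialization \<Gamma> (E, D) \<Gamma>' (E', D') \<phi> \<epsilon>"
    then obtain p q where w: "wsp \<Gamma> \<Gamma>' \<phi> \<epsilon>" and sub: "\<epsilon> ` E' \<subseteq> E"
      and gs: "gspec ?G ?H p q" and p: "\<And>v. v \<in> verts \<Gamma> \<Longrightarrow> p (Orig v) = Orig (\<phi> v)"
      and q: "\<And>x. x \<in> edges ?H \<Longrightarrow> over (q x) = \<epsilon> (over x)"
      and push: "\<And>y. y \<in> verts ?H \<Longrightarrow> D' y = pushforward ?G p D y"
      using waG unfolding pd_specialization_def case_prod_conv wspecialization_iff[OF wa]
      by (auto simp: specialization_iff well_attached_def)
    have g: "gspec \<Gamma> \<Gamma>' \<phi> \<epsilon>" using w by (simp add: wsp_def)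
    have "\<exists>x\<in>ends \<Gamma> e. p (Exc e) = Orig (\<phi> x)" if "e \<in> E - \<epsilon> ` E'" for e
      by (rule gspec_subdivide_exc(1)[OF g wa E E' sub gs p q that])
    then have "\<forall>e\<in>E - \<epsilon> ` E'. \<exists>x\<in>ends \<Gamma> e. p (Exc e) = Orig (\<phi> x)" by blast
    then obtain s where s: "\<forall>e\<in>E - \<epsilon> ` E'. s e \<in> ends \<Gamma> e \<and> p (Exc e) = Orig (\<phi> (s e))" by metis
    define t where "t e = (if e \<in> \<epsilon> ` E' then att \<Gamma> e False else s e)" for e
    have t: "\<forall>e\<in>E. t e \<in> ends \<Gamma> e" "\<And>e. e \<in> E - \<epsilon> ` E' \<Longrightarrow> p (Exc e) = Orig (\<phi> (t e))"
      using s by (auto simp: t_def)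
    have exc: "p (Exc (\<epsilon> e)) = Exc e" if "e \<in> E'" for e
      by (rule gspec_subdivide_exc(2)[OF g wa E E' sub gs p q that])
    have "D' (Orig w) = (\<Sum>v\<in>{v \<in> verts \<Gamma>. \<phi> v = w}. D (Orig v)) - int (card {e \<in> E - \<epsilon> ` E'. \<phi> (t e) = w})"
      if "w \<in> verts \<Gamma>'" for w
    proof -
      have "D' (Orig w) = pushforward ?G p D (Orig w)" using push[of "Orig w"] that by simp
      also have "\<dots> = (\<Sum>v\<in>{v \<in> verts \<Gamma>. \<phi> v = w}. D (Orig v)) - int (card {e \<in> E - \<epsilon> ` E'. \<phi> (t e) = w})"
        by (rule pushforward_subdivide(1)[OF g wa E E' sub]) (use D p exc t(2) in auto)
      finally show ?thesis .
    qed
    then show "pds \<Gamma> E (\<lambda>v. D (Orig v)) \<Gamma>' E' (\<lambda>v. D' (Orig v)) \<phi> \<epsilon>"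
      unfolding pds_def using w sub t(1) by blast
  }
  {
    assume "pds \<Gamma> E (\<lambda>v. D (Orig v)) \<Gamma>' E' (\<lambda>v. D' (Orig v)) \<phi> \<epsilon>"
    then obtain t where w: "wsp \<Gamma> \<Gamma>' \<phi> \<epsilon>" and sub: "\<epsilon> ` E' \<subseteq> E" and t: "\<forall>e\<in>E. t e \<in> ends \<Gamma> e"
      and a: "\<forall>w\<in>verts \<Gamma>'. D' (Orig w) = (\<Sum>v\<in>{v \<in> verts \<Gamma>. \<phi> v = w}. D (Orig v)) - int (card {e \<in> E - \<epsilon> ` E'. \<phi> (t e) = w})"
      unfolding pds_def by blast
    have g: "gspec \<Gamma> \<Gamma>' \<phi> \<epsilon>" using w by (simp add: wsp_def)
    have "\<forall>e\<in>E. \<exists>b. t e = att \<Gamma> e b" using t by (metis endsE)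
    then obtain c where c: "\<forall>e\<in>E. t e = att \<Gamma> e (c e)" by metis
    \<comment> \<open>The end sets agree as unordered pairs, so the half-edges match either directly
      or crosswise.\<close>
    have "\<forall>e\<in>E'. \<exists>k. \<forall>b. att \<Gamma>' e b = \<phi> (att \<Gamma> (\<epsilon> e) (b \<noteq> k))"
    proof
      fix e assume "e \<in> E'"
      then have "ends \<Gamma>' e = \<phi> ` ends \<Gamma> (\<epsilon> e)" using gspec_ends[OF g] E' by blast
      then have "{att \<Gamma>' e False, att \<Gamma>' e True} = {\<phi> (att \<Gamma> (\<epsilon> e) False), \<phi> (att \<Gamma> (\<epsilon> e) True)}"
        by (simp add: ends_eq)
      then have "(att \<Gamma>' e False = \<phi> (att \<Gamma> (\<epsilon> e) False) \<and> att \<Gamma>' e True = \<phi> (att \<Gamma> (\<epsilon> e) True)) \<or>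
         (att \<Gamma>' e False = \<phi> (att \<Gamma> (\<epsilon> e) True) \<and> att \<Gamma>' e True = \<phi> (att \<Gamma> (\<epsilon> e) False))"
        by (simp add: doubleton_eq_iff)
      then show "\<exists>k. \<forall>b. att \<Gamma>' e b = \<phi> (att \<Gamma> (\<epsilon> e) (b \<noteq> k))"
        unfolding all_bool_eq ex_bool_eq by auto
    qed
    then obtain k where k: "\<And>e b. e \<in> E' \<Longrightarrow> att \<Gamma>' e b = \<phi> (att \<Gamma> (\<epsilon> e) (b \<noteq> k e))" by metis
    let ?p = "sub_vert \<Gamma> E' \<phi> \<epsilon> c" and ?q = "sub_edge E \<epsilon> c k"
    note simps = sub_vert_simps[OF g wa E E' sub]
    have gs: "gspec ?G ?H ?p ?q" by (rule gspec_subdivide[OF g wa E E' sub k])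
    have "specialization ?G ?H ?p ?q"
      using waG gs by (subst specialization_iff) (auto simp: well_attached_def)
    moreover have "\<forall>v\<in>verts \<Gamma>. ?p (Orig v) = Orig (\<phi> v)" using simps by simp
    moreover have "\<forall>x\<in>edges ?H. over (?q x) = \<epsilon> (over x)"
      by (auto simp: sub_edge_def)
    moreover have "D' y = pushforward ?G ?p D y" if "y \<in> verts ?H" for y
    proof (cases y)
      case (Orig w)
      have "pushforward ?G ?p D (Orig w) =
         (\<Sum>v\<in>{v \<in> verts \<Gamma>. \<phi> v = w}. D (Orig v)) - int (card {e \<in> E - \<epsilon> ` E'. \<phi> (t e) = w})"
        by (rule pushforward_subdivide(1)[OF g wa E E' sub]) (use simps c D in auto)
      then show ?thesis using Orig a that by auto
    next
      case (Exc e)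
      then have "e \<in> E'" using that by auto
      moreover from this have "pushforward ?G ?p D (Exc e) = -1"
        by (intro pushforward_subdivide(2)[OF g wa E E' sub, where t = t]) (use simps c D in auto)
      ultimately show ?thesis using Exc D' by simp
    qed
    ultimately show "pd_specialization \<Gamma> (E, D) \<Gamma>' (E', D') \<phi> \<epsilon>"
      unfolding pd_specialization_def case_prod_conv wspecialization_iff[OF wa]
      using w sub by blast
  }
qed

text \<open>The value of \<open>beta\<close> on \<open>X\<close> together with the exceptional
  vertices of all edges of \<open>E\<close> meeting \<open>X\<close>: each of them contributes
  \<open>-1\<close>, and the cut in the subdivision is then as large as the cut in
  \<open>G\<close>.\<close>

definition gam :: "('v, 'e, 'm) mgraph_scheme \<Rightarrow> ('v \<Rightarrow> real) \<Rightarrow> 'e set \<Rightarrow> ('v \<Rightarrow> int) \<Rightarrow> 'v set \<Rightarrow> real" where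
  "gam G \<mu> E a X = (\<Sum>v\<in>X. real_of_int (a v) - \<mu> v) - real (card {e \<in> E. ends G e \<inter> X \<noteq> {}})
     + real (card (cut G X)) / 2"

definition qs :: "('v, 'e, 'm) mgraph_scheme \<Rightarrow> 'v \<Rightarrow> ('v \<Rightarrow> real) \<Rightarrow> 'e set \<Rightarrow> ('v \<Rightarrow> int) \<Rightarrow> bool" where
  "qs G v0 \<mu> E a \<longleftrightarrow> (\<forall>X. X \<subset> verts G \<longrightarrow> 0 \<le> gam G \<mu> E a X \<and> (v0 \<in> X \<longrightarrow> 0 < gam G \<mu> E a X))"

lemma qsD: "qs G v0 \<mu> E a \<Longrightarrow> X \<subset> verts G \<Longrightarrow> 0 \<le> gam G \<mu> E a X"
  "qs G v0 \<mu> E a \<Longrightarrow> X \<subset> verts G \<Longrightarrow> v0 \<in> X \<Longrightarrow> 0 < gam G \<mu> E a X"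
  by (auto simp: qs_def)

section \<open>Submodularity of \<open>gam\<close> and its relation to \<open>beta\<close>\<close>

lemma card_sum_of_bool: "finite S \<Longrightarrow> real (card {e \<in> S. P e}) = (\<Sum>e\<in>S. of_bool (P e))"
  by (simp add: sum.If_cases of_bool_def Int_def)

definition hits :: "('v, 'e, 'm) mgraph_scheme \<Rightarrow> 'e \<Rightarrow> 'v set \<Rightarrow> bool" where
  "hits G e X \<longleftrightarrow> att G e False \<in> X \<or> att G e True \<in> X"

definition crosses :: "('v, 'e, 'm) mgraph_scheme \<Rightarrow> 'e \<Rightarrow> 'v set \<Rightarrow> bool" where
  "crosses G e X \<longleftrightarrow> (att G e False \<in> X) \<noteq> (att G e True \<in> X)"

lemma hits_iff: "ends G e \<inter> X \<noteq> {} \<longleftrightarrow> hits G e X"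
  by (auto simp: ends_eq hits_def)

lemma crosses_iff: "ends G e \<inter> X \<noteq> {} \<and> ends G e - X \<noteq> {} \<longleftrightarrow> crosses G e X"
  by (auto simp: ends_eq crosses_def)

lemma cut_eq: "cut G X = {e \<in> edges G. crosses G e X}"
  unfolding cut_def crosses_iff ..

lemma gam_sum:
  assumes "finite (edges G)" "E \<subseteq> edges G"
  shows "gam G \<mu> E a X = (\<Sum>v\<in>X. real_of_int (a v) - \<mu> v) - (\<Sum>e\<in>E. of_bool (hits G e X))
     + (\<Sum>e\<in>edges G. of_bool (crosses G e X)) / 2"
proof -
  have "finite E" using assms finite_subset by blast
  then show ?thesis
    unfolding gam_def hits_iff cut_eq using assms by (simp only: card_sum_of_bool)
qed

text \<open>An edge between \<open>X - Y\<close> and \<open>Y - X\<close> is cut by both sets but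
  neither by the intersection nor by the union, a gain of \<open>1\<close> on the left. If it is
  exceptional, the penalty takes this back: it is counted twice on the left and once on the
  right.\<close>

lemma gam_submodular:
  assumes fin: "finite (edges G)" "finite X" "finite Y" and E: "E \<subseteq> edges G"
  shows "gam G \<mu> E a X + gam G \<mu> E a Y = gam G \<mu> E a (X \<inter> Y) + gam G \<mu> E a (X \<union> Y)
     + real (card {e \<in> edges G - E. ends G e \<inter> (X - Y) \<noteq> {} \<and> ends G e \<inter> (Y - X) \<noteq> {}})"
proof -
  let ?f = "\<lambda>v. real_of_int (a v) - \<mu> v"
  have finE: "finite E" using fin E finite_subset by blast
  define p where "p e \<longleftrightarrow> hits G e (X - Y) \<and> hits G e (Y - X)" for e
  have vs: "sum ?f X + sum ?f Y = sum ?f (X \<inter> Y) + sum ?f (X \<union> Y)"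
    using sum.union_inter[OF fin(2,3), of ?f] by linarith
  have pt: "of_bool (hits G e X) + of_bool (hits G e Y) =
      (of_bool (hits G e (X \<inter> Y)) + of_bool (hits G e (X \<union> Y)) + of_bool (p e) :: real)"
    "of_bool (crosses G e X) + of_bool (crosses G e Y) =
      (of_bool (crosses G e (X \<inter> Y)) + of_bool (crosses G e (X \<union> Y)) + 2 * of_bool (p e) :: real)" for e
    by (cases "att G e False \<in> X"; cases "att G e False \<in> Y"; cases "att G e True \<in> X"; cases "att G e True \<in> Y";
        simp add: hits_def crosses_def p_def)+
  have h: "(\<Sum>e\<in>E. of_bool (hits G e X)) + (\<Sum>e\<in>E. of_bool (hits G e Y)) =
     (\<Sum>e\<in>E. of_bool (hits G e (X \<inter> Y))) + (\<Sum>e\<in>E. of_bool (hits G e (X \<union> Y))) + (\<Sum>e\<in>E. of_bool (p e) :: real)"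
    unfolding sum.distrib[symmetric] by (intro sum.cong refl pt)
  have c: "(\<Sum>e\<in>edges G. of_bool (crosses G e X)) + (\<Sum>e\<in>edges G. of_bool (crosses G e Y)) =
     (\<Sum>e\<in>edges G. of_bool (crosses G e (X \<inter> Y))) + (\<Sum>e\<in>edges G. of_bool (crosses G e (X \<union> Y))) + 2 * (\<Sum>e\<in>edges G. of_bool (p e) :: real)"
    unfolding sum.distrib[symmetric] sum_distrib_left by (intro sum.cong refl pt)
  have "(\<Sum>e\<in>edges G. of_bool (p e) :: real) = (\<Sum>e\<in>edges G - E. of_bool (p e)) + (\<Sum>e\<in>E. of_bool (p e))"
    using sum.subset_diff[OF E fin(1)] by simp
  moreover have "(\<Sum>e\<in>edges G - E. of_bool (p e)) = real (card {e \<in> edges G - E. ends G e \<inter> (X - Y) \<noteq> {} \<and> ends G e \<inter> (Y - X) \<noteq> {}})"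
    using fin unfolding hits_iff p_def by (simp only: card_sum_of_bool finite_Diff)
  ultimately show ?thesis
    unfolding gam_sum[OF fin(1) E] using vs h c by linarith
qed

lemma gam_verts:
  assumes wa: "well_attached G" and E: "E \<subseteq> edges G"
  shows "gam G \<mu> E a (verts G) = (\<Sum>v\<in>verts G. real_of_int (a v) - \<mu> v) - real (card E)"
proof -
  have "{e \<in> E. ends G e \<inter> verts G \<noteq> {}} = E"
    using E wa by (auto simp: well_attached_def ends_eq)
  moreover have "cut G (verts G) = {}"
    using wa unfolding cut_def well_attached_def by blast
  ultimately show ?thesis by (simp add: gam_def)
qed

lemma gam_empty: "gam G \<mu> E a {} = 0"
  by (simp add: gam_def cut_def)

text \<open>Submodularity for two disjoint sets whose union has value \<open>0\<close>; the defect
  is then the number of non-exceptional edges in the cut.\<close>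

lemma gam_compl:
  assumes wa: "well_attached G" and E: "E \<subseteq> edges G" and X: "X \<subseteq> verts G"
    and total: "gam G \<mu> E a (verts G) = 0"
  shows "gam G \<mu> E a X + gam G \<mu> E a (verts G - X) = real (card (cut G X - E))"
proof -
  have fin: "finite (edges G)" "finite (verts G)" using wa by (auto simp: well_attached_def)
  have XX: "X \<inter> (verts G - X) = {}" "X \<union> (verts G - X) = verts G" "X - (verts G - X) = X" "verts G - X - X = verts G - X" "X \<union> verts G = verts G"
    using X by auto
  have "{e \<in> edges G - E. ends G e \<inter> X \<noteq> {} \<and> ends G e \<inter> (verts G - X) \<noteq> {}} = cut G X - E"
    using wa unfolding cut_def well_attached_def by blast
  then show ?thesis
    using gam_submodular[OF fin(1) finite_subset[OF X fin(2)] _ E, of "verts G - X" \<mu> a] fin total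
    by (simp add: XX gam_empty)
qed

text \<open>For a fixed set \<open>X\<close> of original vertices, \<open>beta\<close> is smallest when exactly the exceptional
  vertices on edges meeting \<open>X\<close> are added to \<open>X\<close>.\<close>

lemma beta_subdivide:
  assumes wa: "well_attached G" and E: "E \<subseteq> edges G" and X: "X \<subseteq> verts G" and Y: "Y \<subseteq> E"
    and D: "\<And>e. e \<in> E \<Longrightarrow> D (Exc e) = -1"
  shows "beta (subdivide G E) (subdivide_pol \<mu>) D (Orig ` X \<union> Exc ` Y) =
     gam G \<mu> E (\<lambda>v. D (Orig v)) X +
     real (card {e \<in> E - Y. att G e False \<in> X}) + real (card {e \<in> E - Y. att G e True \<in> X})"
proof -
  have fin: "finite (edges G)" "finite E" "finite X" "finite Y"
    using wa E X Y by (auto simp: well_attached_def intro: finite_subset)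
  let ?Z = "Orig ` X \<union> Exc ` Y"
  have "(\<Sum>x\<in>?Z. real_of_int (D x) - subdivide_pol \<mu> x) =
     (\<Sum>x\<in>Orig ` X. real_of_int (D x) - subdivide_pol \<mu> x) + (\<Sum>x\<in>Exc ` Y. real_of_int (D x) - subdivide_pol \<mu> x)"
    using fin by (intro sum.union_disjoint) auto
  also have "(\<Sum>x\<in>Orig ` X. real_of_int (D x) - subdivide_pol \<mu> x) = (\<Sum>v\<in>X. real_of_int (D (Orig v)) - \<mu> v)"
    by (simp add: sum.reindex inj_on_def subdivide_pol_def)
  also have "(\<Sum>x\<in>Exc ` Y. real_of_int (D x) - subdivide_pol \<mu> x) = (\<Sum>e\<in>Y. -1)"
    unfolding sum.reindex[OF inj_onI, of Y Exc, simplified] using D Y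
    by (intro sum.cong) (auto simp: subdivide_pol_def)
  also have "\<dots> = - (\<Sum>e\<in>E. of_bool (e \<in> Y))"
  proof -
    have "(\<Sum>e\<in>E. of_bool (e \<in> Y)) = real (card {e \<in> E. e \<in> Y})" using fin by (simp only: card_sum_of_bool)
    also have "{e \<in> E. e \<in> Y} = Y" using Y by auto
    finally show ?thesis by simp
  qed
  finally have s: "(\<Sum>x\<in>?Z. real_of_int (D x) - subdivide_pol \<mu> x) =
     (\<Sum>v\<in>X. real_of_int (D (Orig v)) - \<mu> v) - (\<Sum>e\<in>E. of_bool (e \<in> Y))" by simp
  have "cut (subdivide G E) ?Z = Whole ` {e \<in> edges G - E. crosses G e X}
     \<union> ((\<lambda>e. Half e False) ` {e \<in> E. (att G e False \<in> X) \<noteq> (e \<in> Y)}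
     \<union> (\<lambda>e. Half e True) ` {e \<in> E. (att G e True \<in> X) \<noteq> (e \<in> Y)})" (is "?L = ?R")
  proof (rule set_eqI)
    fix x
    show "x \<in> ?L \<longleftrightarrow> x \<in> ?R"
    proof (cases x)
      case (Whole e)
      have "crosses (subdivide G E) (Whole e) ?Z \<longleftrightarrow> crosses G e X" by (auto simp: crosses_def)
      then show ?thesis using Whole by (auto simp: cut_eq)
    next
      case (Half e b)
      have "crosses (subdivide G E) (Half e b) ?Z \<longleftrightarrow> (att G e b \<in> X) \<noteq> (e \<in> Y)" by (auto simp: crosses_def)
      then show ?thesis using Half by (cases b) (auto simp: cut_eq)
    qed
  qed
  then have "card (cut (subdivide G E) ?Z) = card (Whole ` {e \<in> edges G - E. crosses G e X})
     + card ((\<lambda>e. Half e False) ` {e \<in> E. (att G e False \<in> X) \<noteq> (e \<in> Y)}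
     \<union> (\<lambda>e. Half e True) ` {e \<in> E. (att G e True \<in> X) \<noteq> (e \<in> Y)})"
    using fin by (simp, intro card_Un_disjoint) auto
  also have "card ((\<lambda>e. Half e False) ` {e \<in> E. (att G e False \<in> X) \<noteq> (e \<in> Y)}
     \<union> (\<lambda>e. Half e True) ` {e \<in> E. (att G e True \<in> X) \<noteq> (e \<in> Y)})
     = card ((\<lambda>e. Half e False) ` {e \<in> E. (att G e False \<in> X) \<noteq> (e \<in> Y)})
     + card ((\<lambda>e. Half e True) ` {e \<in> E. (att G e True \<in> X) \<noteq> (e \<in> Y)})"
    using fin by (intro card_Un_disjoint) auto
  finally have "real (card (cut (subdivide G E) ?Z)) = real (card {e \<in> edges G - E. crosses G e X})
     + real (card {e \<in> E. (att G e False \<in> X) \<noteq> (e \<in> Y)}) + real (card {e \<in> E. (att G e True \<in> X) \<noteq> (e \<in> Y)})"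
    by (simp add: card_image inj_on_def)
  also have "\<dots> = (\<Sum>e\<in>edges G - E. of_bool (crosses G e X)) + (\<Sum>e\<in>E. of_bool ((att G e False \<in> X) \<noteq> (e \<in> Y)))
     + (\<Sum>e\<in>E. of_bool ((att G e True \<in> X) \<noteq> (e \<in> Y)))"
    using fin by (simp only: card_sum_of_bool finite_Diff)
  finally have cu: "real (card (cut (subdivide G E) ?Z)) = (\<Sum>e\<in>edges G - E. of_bool (crosses G e X)) + (\<Sum>e\<in>E. of_bool ((att G e False \<in> X) \<noteq> (e \<in> Y)))
     + (\<Sum>e\<in>E. of_bool ((att G e True \<in> X) \<noteq> (e \<in> Y)))" .
  have r: "real (card {e \<in> E - Y. att G e b \<in> X}) = (\<Sum>e\<in>E. of_bool (e \<notin> Y \<and> att G e b \<in> X))" for b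
  proof -
    have "{e \<in> E - Y. att G e b \<in> X} = {e \<in> E. e \<notin> Y \<and> att G e b \<in> X}" by auto
    then show ?thesis using fin by (simp only: card_sum_of_bool)
  qed
  have sp: "(\<Sum>e\<in>edges G. of_bool (crosses G e X) :: real) = (\<Sum>e\<in>edges G - E. of_bool (crosses G e X)) + (\<Sum>e\<in>E. of_bool (crosses G e X))"
    using sum.subset_diff[OF E fin(1)] by simp
  \<comment> \<open>The comparison is made for each exceptional edge separately, according to which
    of its ends lie in \<open>X\<close> and whether its exceptional vertex is added.\<close>
  have pt: "2 * of_bool (hits G e X) + of_bool ((att G e False \<in> X) \<noteq> (e \<in> Y)) + of_bool ((att G e True \<in> X) \<noteq> (e \<in> Y)) =
     2 * of_bool (e \<in> Y) + of_bool (crosses G e X)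
     + 2 * of_bool (e \<notin> Y \<and> att G e False \<in> X) + (2 * of_bool (e \<notin> Y \<and> att G e True \<in> X) :: real)" for e
    by (cases "att G e False \<in> X"; cases "att G e True \<in> X"; cases "e \<in> Y"; simp add: hits_def crosses_def)
  have arith: "s - y + (k1 + c1 + c2) / 2 = s - h + k / 2 + r1 + r2"
    if "2 * h + c1 + c2 = 2 * y + cr + 2 * r1 + 2 * r2" "k = k1 + cr" for s y k1 c1 c2 h k r1 r2 cr :: real
    using that by (simp add: field_simps)
  have "2 * (\<Sum>e\<in>E. of_bool (hits G e X)) + (\<Sum>e\<in>E. of_bool ((att G e False \<in> X) \<noteq> (e \<in> Y)))
     + (\<Sum>e\<in>E. of_bool ((att G e True \<in> X) \<noteq> (e \<in> Y))) =
     2 * (\<Sum>e\<in>E. of_bool (e \<in> Y)) + (\<Sum>e\<in>E. of_bool (crosses G e X))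
     + 2 * (\<Sum>e\<in>E. of_bool (e \<notin> Y \<and> att G e False \<in> X)) + 2 * (\<Sum>e\<in>E. of_bool (e \<notin> Y \<and> att G e True \<in> X) :: real)"
    unfolding sum.distrib[symmetric] sum_distrib_left by (intro sum.cong refl pt)
  then show ?thesis
    unfolding beta_def gam_sum[OF fin(1) E] s cu r by (rule arith) (rule sp)
qed

lemma quasistable_subdivide_iff:
  assumes wa: "well_attached G" and E: "E \<subseteq> edges G"
    and D: "\<And>e. e \<in> E \<Longrightarrow> D (Exc e) = -1"
    and total: "gam G \<mu> E (\<lambda>v. D (Orig v)) (verts G) = 0"
  shows "quasistable (subdivide G E) (Orig v0) (subdivide_pol \<mu>) D \<longleftrightarrow> qs G v0 \<mu> E (\<lambda>v. D (Orig v))"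
proof
  assume Q: "quasistable (subdivide G E) (Orig v0) (subdivide_pol \<mu>) D"
  show "qs G v0 \<mu> E (\<lambda>v. D (Orig v))"
    unfolding qs_def
  proof (intro allI impI)
    fix X assume X: "X \<subset> verts G"
    \<comment> \<open>With all exceptional vertices next to \<open>X\<close> included, the two
      correction terms of \<open>beta_subdivide\<close> vanish.\<close>
    let ?Y = "{e \<in> E. hits G e X}" and ?Z = "Orig ` X \<union> Exc ` {e \<in> E. hits G e X}"
    have e: "{e \<in> E - ?Y. att G e b \<in> X} = {}" for b by (cases b) (auto simp: hits_def)
    have b: "beta (subdivide G E) (subdivide_pol \<mu>) D ?Z = gam G \<mu> E (\<lambda>v. D (Orig v)) X"
      using beta_subdivide[of G E X ?Y D \<mu>] wa E D X unfolding e by simp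
    have z: "?Z \<subset> verts (subdivide G E)"
    proof -
      obtain v where "v \<in> verts G" "v \<notin> X" using X by blast
      then have "Orig v \<in> verts (subdivide G E)" "Orig v \<notin> ?Z" by auto
      moreover have "?Z \<subseteq> verts (subdivide G E)" using X by auto
      ultimately show ?thesis by blast
    qed
    have "0 \<le> beta (subdivide G E) (subdivide_pol \<mu>) D ?Z \<and>
        (Orig v0 \<in> ?Z \<longrightarrow> 0 < beta (subdivide G E) (subdivide_pol \<mu>) D ?Z)"
      using spec[OF Q[unfolded quasistable_def], of ?Z] z by (rule mp)
    then show "0 \<le> gam G \<mu> E (\<lambda>v. D (Orig v)) X \<and> (v0 \<in> X \<longrightarrow> 0 < gam G \<mu> E (\<lambda>v. D (Orig v)) X)"
      unfolding b by blast
  qed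
next
  assume Q: "qs G v0 \<mu> E (\<lambda>v. D (Orig v))"
  show "quasistable (subdivide G E) (Orig v0) (subdivide_pol \<mu>) D"
    unfolding quasistable_def
  proof (intro allI impI)
    fix Z assume Z: "Z \<subset> verts (subdivide G E)"
    define X Y where "X = {v \<in> verts G. Orig v \<in> Z}" and "Y = {e \<in> E. Exc e \<in> Z}"
    have ZXY: "Z = Orig ` X \<union> Exc ` Y" using Z by (auto simp: X_def Y_def)
    have XY: "X \<subseteq> verts G" "Y \<subseteq> E" by (auto simp: X_def Y_def)
    have b: "beta (subdivide G E) (subdivide_pol \<mu>) D Z = gam G \<mu> E (\<lambda>v. D (Orig v)) X +
       real (card {e \<in> E - Y. att G e False \<in> X}) + real (card {e \<in> E - Y. att G e True \<in> X})"
      unfolding ZXY by (rule beta_subdivide[OF wa E XY]) (rule D)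
    show "0 \<le> beta (subdivide G E) (subdivide_pol \<mu>) D Z \<and> (Orig v0 \<in> Z \<longrightarrow> 0 < beta (subdivide G E) (subdivide_pol \<mu>) D Z)"
    proof (cases "X = verts G")
      case True
      \<comment> \<open>A proper set containing all original vertices misses an exceptional vertex.
        Here \<open>gam\<close> is \<open>0\<close>, and the correction terms give the strict
        inequality that the leg requires.\<close>
      then have "Y \<noteq> E" using Z ZXY by auto
      then have "E - Y \<noteq> {}" using XY by auto
      moreover have "{e \<in> E - Y. att G e False \<in> X} = E - Y" using True att_in_verts[OF wa] E by auto
      moreover have "finite (E - Y)" using wa E by (auto simp: well_attached_def intro: finite_subset)
      ultimately have "0 < card {e \<in> E - Y. att G e False \<in> X}" by (simp add: card_gt_0_iff)
      then show ?thesis using b total True by simp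
    next
      case False
      then have "X \<subset> verts G" using XY by blast
      moreover have "Orig v0 \<in> Z \<Longrightarrow> v0 \<in> X" using ZXY by auto
      ultimately show ?thesis using qsD[OF Q, of X] b by auto
    qed
  qed
qed

section \<open>The encoding by exceptional edges and values on original vertices\<close>

definition pdiv :: "('v, 'e, 'm) mgraph_scheme \<Rightarrow> 'e set \<Rightarrow> ('v \<Rightarrow> int) \<Rightarrow> ('v, 'e) pseudo_divisor" where
  "pdiv G E a = (E, \<lambda>x\<in>verts (subdivide G E). case x of Orig v \<Rightarrow> a v | Exc e \<Rightarrow> -1)"

text \<open>The shift by \<open>card E\<close> offsets the values \<open>-1\<close> on the
  exceptional vertices, so that the divisor on the subdivision has degree \<open>d\<close>.\<close>

definition qd :: "int \<Rightarrow> ('v, 'e) wgraph \<Rightarrow> ('v \<Rightarrow> real) \<Rightarrow> 'e set \<Rightarrow> ('v \<Rightarrow> int) \<Rightarrow> bool" where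
  "qd d \<Gamma> \<mu> E a \<longleftrightarrow> E \<subseteq> edges \<Gamma> \<and> (\<Sum>v\<in>verts \<Gamma>. a v) = d + int (card E) \<and> qs \<Gamma> (leg \<Gamma>) \<mu> E a"

lemma qs_cong:
  assumes "\<And>v. v \<in> verts G \<Longrightarrow> a v = b v"
  shows "qs G v0 \<mu> E a \<longleftrightarrow> qs G v0 \<mu> E b"
proof -
  have "gam G \<mu> E a X = gam G \<mu> E b X" if "X \<subset> verts G" for X
    unfolding gam_def using assms that by (auto intro!: sum.cong)
  then show ?thesis unfolding qs_def by auto
qed

lemma qd_cong:
  assumes "\<And>v. v \<in> verts \<Gamma> \<Longrightarrow> a v = b v"
  shows "qd d \<Gamma> \<mu> E a \<longleftrightarrow> qd d \<Gamma> \<mu> E b"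
proof -
  have "sum a (verts \<Gamma>) = sum b (verts \<Gamma>)" using assms by (rule sum.cong[OF refl])
  moreover have "qs \<Gamma> (leg \<Gamma>) \<mu> E a \<longleftrightarrow> qs \<Gamma> (leg \<Gamma>) \<mu> E b" using assms by (rule qs_cong)
  ultimately show ?thesis by (simp add: qd_def)
qed

lemma qd_gam_verts:
  assumes "qd d \<Gamma> \<mu> E a" "well_attached \<Gamma>" "(\<Sum>v\<in>verts \<Gamma>. \<mu> v) = real_of_int d"
  shows "gam \<Gamma> \<mu> E a (verts \<Gamma>) = 0"
proof -
  have "real_of_int (\<Sum>v\<in>verts \<Gamma>. a v) = real_of_int (d + int (card E))" using assms by (simp add: qd_def)
  then show ?thesis using assms by (simp add: gam_verts qd_def sum_subtractf)
qed

lemma QD_iff: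
  assumes wa: "well_attached \<Gamma>" and \<mu>: "(\<Sum>v\<in>verts \<Gamma>. \<mu> v) = real_of_int d"
  shows "p \<in> QD d \<Gamma> \<mu> \<longleftrightarrow> (\<exists>E a. p = pdiv \<Gamma> E a \<and> qd d \<Gamma> \<mu> E a)"
proof -
  have *: "(E, D) \<in> QD d \<Gamma> \<mu> \<longleftrightarrow> qd d \<Gamma> \<mu> E (\<lambda>v. D (Orig v))"
    if D: "\<forall>e\<in>E. D (Exc e) = -1" and ext: "D \<in> extensional (verts (subdivide \<Gamma> E))" for E D
  proof (cases "E \<subseteq> edges \<Gamma>")
    case E: True
    have fin: "finite E" "finite (verts \<Gamma>)" using wa E by (auto simp: well_attached_def intro: finite_subset)
    have "(\<Sum>x\<in>verts (subdivide \<Gamma> E). D x) = (\<Sum>x\<in>Orig ` verts \<Gamma>. D x) + (\<Sum>x\<in>Exc ` E. D x)"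
      using fin by (simp, intro sum.union_disjoint) auto
    also have "\<dots> = (\<Sum>v\<in>verts \<Gamma>. D (Orig v)) + (\<Sum>e\<in>E. D (Exc e))"
      by (simp add: sum.reindex inj_on_def)
    also have "(\<Sum>e\<in>E. D (Exc e)) = - int (card E)" using D by simp
    finally have tot: "(\<Sum>x\<in>verts (subdivide \<Gamma> E). D x) = (\<Sum>v\<in>verts \<Gamma>. D (Orig v)) - int (card E)" by simp
    have "quasistable (subdivide \<Gamma> E) (Orig (leg \<Gamma>)) (subdivide_pol \<mu>) D \<longleftrightarrow> qs \<Gamma> (leg \<Gamma>) \<mu> E (\<lambda>v. D (Orig v))"
      if "(\<Sum>v\<in>verts \<Gamma>. D (Orig v)) = d + int (card E)"
    proof (rule quasistable_subdivide_iff[OF wa E])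
      have "real_of_int (\<Sum>v\<in>verts \<Gamma>. D (Orig v)) = real_of_int (d + int (card E))" using that by simp
      then show "gam \<Gamma> \<mu> E (\<lambda>v. D (Orig v)) (verts \<Gamma>) = 0"
        using \<mu> by (simp add: gam_verts[OF wa E] sum_subtractf)
    qed (use D in simp)
    then show ?thesis using E D ext tot by (auto simp: QD_def pseudo_divisors_def qd_def)
  qed (auto simp: QD_def pseudo_divisors_def qd_def)
  show ?thesis
  proof
    assume p: "p \<in> QD d \<Gamma> \<mu>"
    obtain E D where ED: "p = (E, D)" by (cases p)
    have D: "\<forall>e\<in>E. D (Exc e) = -1" "D \<in> extensional (verts (subdivide \<Gamma> E))"
      using p ED by (auto simp: QD_def pseudo_divisors_def)
    have "D = (\<lambda>x\<in>verts (subdivide \<Gamma> E). case x of Orig v \<Rightarrow> D (Orig v) | Exc e \<Rightarrow> -1)"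
    proof (rule extensionalityI[OF D(2) restrict_extensional])
      fix x assume "x \<in> verts (subdivide \<Gamma> E)"
      then show "D x = (\<lambda>x\<in>verts (subdivide \<Gamma> E). case x of Orig v \<Rightarrow> D (Orig v) | Exc e \<Rightarrow> -1) x"
        using D(1) by auto
    qed
    then have "p = pdiv \<Gamma> E (\<lambda>v. D (Orig v))" unfolding ED pdiv_def by simp
    then show "\<exists>E a. p = pdiv \<Gamma> E a \<and> qd d \<Gamma> \<mu> E a" using *[OF D] p ED
      by (intro exI[of _ E] exI[of _ "\<lambda>v. D (Orig v)"]) simp
  next
    assume "\<exists>E a. p = pdiv \<Gamma> E a \<and> qd d \<Gamma> \<mu> E a"
    then obtain E a where p: "p = pdiv \<Gamma> E a" and q: "qd d \<Gamma> \<mu> E a" by blast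
    have "qd d \<Gamma> \<mu> E (\<lambda>v. snd p (Orig v))"
      using q by (subst qd_cong[of _ _ a]) (auto simp: p pdiv_def)
    moreover have "\<forall>e\<in>E. snd p (Exc e) = -1" "snd p \<in> extensional (verts (subdivide \<Gamma> E))" "p = (E, snd p)"
      by (auto simp: p pdiv_def)
    ultimately show "p \<in> QD d \<Gamma> \<mu>" using *[of E "snd p"] by metis
  qed
qed

lemma pdiv_eq_iff: "pdiv G E a = pdiv G F b \<longleftrightarrow> E = F \<and> (\<forall>v\<in>verts G. a v = b v)"
proof
  assume eq: "pdiv G E a = pdiv G F b"
  then have EF: "E = F" by (simp add: pdiv_def)
  have f: "(\<lambda>x\<in>verts (subdivide G E). case x of Orig v \<Rightarrow> a v | Exc e \<Rightarrow> -1) = (\<lambda>x\<in>verts (subdivide G F). case x of Orig v \<Rightarrow> b v | Exc e \<Rightarrow> -1)"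
    using eq unfolding pdiv_def by (rule Pair_inject)
  have "a v = b v" if "v \<in> verts G" for v using fun_cong[OF f, of "Orig v"] that by simp
  with EF show "E = F \<and> (\<forall>v\<in>verts G. a v = b v)" by blast
next
  assume "E = F \<and> (\<forall>v\<in>verts G. a v = b v)"
  then show "pdiv G E a = pdiv G F b"
    by (auto simp: pdiv_def restrict_def fun_eq_iff split: svert.splits)
qed

lemma pds_cong:
  assumes "well_attached \<Gamma>" "\<And>v. v \<in> verts \<Gamma> \<Longrightarrow> a v = b v" "\<And>v. v \<in> verts \<Gamma>' \<Longrightarrow> a' v = b' v"
  shows "pds \<Gamma> E a \<Gamma>' E' a' \<phi> \<epsilon> \<longleftrightarrow> pds \<Gamma> E b \<Gamma>' E' b' \<phi> \<epsilon>"
proof -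
  have "(\<Sum>v\<in>{v \<in> verts \<Gamma>. \<phi> v = w}. a v) = (\<Sum>v\<in>{v \<in> verts \<Gamma>. \<phi> v = w}. b v)" for w
    using assms(2) by (intro sum.cong) auto
  then show ?thesis using assms(3) by (simp add: pds_def)
qed

lemma pd_specialization_pdiv:
  assumes "well_attached \<Gamma>" "E \<subseteq> edges \<Gamma>" "E' \<subseteq> edges \<Gamma>'"
  shows "pd_specialization \<Gamma> (pdiv \<Gamma> E a) \<Gamma>' (pdiv \<Gamma>' E' a') \<phi> \<epsilon> \<longleftrightarrow> pds \<Gamma> E a \<Gamma>' E' a' \<phi> \<epsilon>"
proof -
  have "pd_specialization \<Gamma> (pdiv \<Gamma> E a) \<Gamma>' (pdiv \<Gamma>' E' a') \<phi> \<epsilon> \<longleftrightarrow>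
    pds \<Gamma> E (\<lambda>v. snd (pdiv \<Gamma> E a) (Orig v)) \<Gamma>' E' (\<lambda>v. snd (pdiv \<Gamma>' E' a') (Orig v)) \<phi> \<epsilon>"
    using pd_specialization_iff[OF assms, of "snd (pdiv \<Gamma> E a)" "snd (pdiv \<Gamma>' E' a')" \<phi> \<epsilon>]
    by (simp add: pdiv_def)
  also have "\<dots> \<longleftrightarrow> pds \<Gamma> E a \<Gamma>' E' a' \<phi> \<epsilon>"
    by (rule pds_cong[OF assms(1)]) (simp_all add: pdiv_def)
  finally show ?thesis .
qed

lemma pd_transport_pdiv:
  assumes iso: "wgraph_iso \<Gamma> \<Gamma>' \<phi> \<psi>" and wa: "well_attached \<Gamma>" and E: "E \<subseteq> edges \<Gamma>"
    and a': "\<And>v. v \<in> verts \<Gamma> \<Longrightarrow> a' (\<phi> v) = a v"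
  shows "pd_transport \<Gamma> \<Gamma>' (\<phi>, \<psi>) (pdiv \<Gamma> E a) = pdiv \<Gamma>' (\<psi> ` E) a'"
proof -
  have \<phi>: "bij_betw \<phi> (verts \<Gamma>) (verts \<Gamma>')" and \<psi>: "inj_on \<psi> E"
    using iso E by (auto simp: wgraph_iso_def graph_iso_def bij_betw_def intro: inj_on_subset)
  let ?D = "\<lambda>x\<in>verts (subdivide \<Gamma> E). case x of Orig v \<Rightarrow> a v | Exc e \<Rightarrow> -1"
  have "pushforward (subdivide \<Gamma> E) (map_svert \<phi> \<psi>) ?D x = (case x of Orig v \<Rightarrow> a' v | Exc e \<Rightarrow> -1)"
    if x: "x \<in> verts (subdivide \<Gamma>' (\<psi> ` E))" for x
  proof (cases x)
    case (Orig w)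
    then have "w \<in> \<phi> ` verts \<Gamma>" using x \<phi> by (auto simp: bij_betw_def)
    then obtain v where v: "w = \<phi> v" "v \<in> verts \<Gamma>" by (rule imageE)
    have "{y \<in> verts (subdivide \<Gamma> E). map_svert \<phi> \<psi> y = x} = {Orig v}"
      using v Orig \<phi> by (auto simp: bij_betw_def inj_on_def)
    then show ?thesis using v Orig a' by (simp add: pushforward_def)
  next
    case (Exc f)
    then have "f \<in> \<psi> ` E" using x by auto
    then obtain e where e: "f = \<psi> e" "e \<in> E" by (rule imageE)
    have "{y \<in> verts (subdivide \<Gamma> E). map_svert \<phi> \<psi> y = x} = {Exc e}"
      using e Exc \<psi> by (auto simp: inj_on_def)
    then show ?thesis using e Exc by (simp add: pushforward_def)
  qed
  then show ?thesis
    unfolding pd_transport_def pdiv_def by (auto intro!: restrict_ext)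
qed

section \<open>Pushforward preserves quasistability\<close>

text \<open>Compare a set \<open>X'\<close> with its preimage: the cuts correspond under
  \<open>\<epsilon>\<close>, and each exceptional edge charged to \<open>X'\<close>, whether kept or
  absorbed there, comes from its own exceptional edge meeting the preimage. Hence \<open>gam\<close>
  does not drop, and the leg lies in the preimage as soon as its image lies in
  \<open>X'\<close>.\<close>

lemma qd_pds:
  assumes p: "pds G E a H E' a' \<phi> \<epsilon>" and q: "qd d G \<mu> E a" and wa: "well_attached G"
    and E': "E' \<subseteq> edges H" and leg: "leg G \<in> verts G"
    and \<mu>': "\<And>w. w \<in> verts H \<Longrightarrow> \<mu>' w = (\<Sum>v\<in>{v \<in> verts G. \<phi> v = w}. \<mu> v)"
  shows "qd d H \<mu>' E' a'"
proof -
  obtain t where w: "wsp G H \<phi> \<epsilon>" and sub: "\<epsilon> ` E' \<subseteq> E" and t: "\<forall>e\<in>E. t e \<in> ends G e"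
    and a': "\<And>v'. v' \<in> verts H \<Longrightarrow> a' v' = (\<Sum>v\<in>{v \<in> verts G. \<phi> v = v'}. a v) - int (card {e \<in> E - \<epsilon> ` E'. \<phi> (t e) = v'})"
    using p by (auto simp: pds_def)
  have g: "gspec G H \<phi> \<epsilon>" using w by (simp add: wsp_def)
  have waH: "well_attached H" by (rule gspec_well_attached[OF g wa])
  have E: "E \<subseteq> edges G" using q by (simp add: qd_def)
  have fin: "finite (verts G)" "finite (verts H)" "finite (edges G)" "finite (edges H)" "finite E" "finite E'"
    using wa waH E E' by (auto simp: well_attached_def intro: finite_subset)
  have \<phi>V: "\<phi> ` verts G \<subseteq> verts H" using g by (auto simp: gspec_def)
  have tV: "t e \<in> verts G" if "e \<in> E" for e using t that E wa by (auto simp: well_attached_def)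
  have sumX: "(\<Sum>w\<in>X'. \<Sum>v\<in>{v \<in> verts G. \<phi> v = w}. f v) = (\<Sum>v\<in>{v \<in> verts G. \<phi> v \<in> X'}. f v)"
    if "X' \<subseteq> verts H" for X' and f :: "'a \<Rightarrow> real"
  proof -
    have "{w \<in> verts H. (w \<in> X') = True} = X'" using that by auto
    then show ?thesis using sum_fibres[OF fin(1,2) \<phi>V, of f "\<lambda>w. w \<in> X'" True] by simp
  qed
  have cardX: "(\<Sum>w\<in>X'. real (card {e \<in> E - \<epsilon> ` E'. \<phi> (t e) = w})) = real (card {e \<in> E - \<epsilon> ` E'. \<phi> (t e) \<in> X'})"
    if "X' \<subseteq> verts H" for X'
  proof -
    have "{w \<in> verts H. (w \<in> X') = True} = X'" using that by auto
    moreover have "(\<lambda>e. \<phi> (t e)) ` (E - \<epsilon> ` E') \<subseteq> verts H" using tV \<phi>V by auto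
    ultimately have "(\<Sum>w\<in>X'. int (card {e \<in> E - \<epsilon> ` E'. \<phi> (t e) = w})) = int (card {e \<in> E - \<epsilon> ` E'. \<phi> (t e) \<in> X'})"
      using card_fibres[of "E - \<epsilon> ` E'" "verts H" "\<lambda>e. \<phi> (t e)" "\<lambda>w. w \<in> X'" True] fin by simp
    then have "real_of_int (\<Sum>w\<in>X'. int (card {e \<in> E - \<epsilon> ` E'. \<phi> (t e) = w})) = real_of_int (int (card {e \<in> E - \<epsilon> ` E'. \<phi> (t e) \<in> X'}))"
      by (rule arg_cong)
    then show ?thesis by simp
  qed
  have sa: "(\<Sum>w\<in>X'. real_of_int (a' w)) = (\<Sum>v\<in>{v \<in> verts G. \<phi> v \<in> X'}. real_of_int (a v)) - real (card {e \<in> E - \<epsilon> ` E'. \<phi> (t e) \<in> X'})"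
    if "X' \<subseteq> verts H" for X'
  proof -
    have "(\<Sum>w\<in>X'. real_of_int (a' w)) = (\<Sum>w\<in>X'. (\<Sum>v\<in>{v \<in> verts G. \<phi> v = w}. real_of_int (a v)) - real (card {e \<in> E - \<epsilon> ` E'. \<phi> (t e) = w}))"
      using that by (intro sum.cong) (auto simp: a')
    then show ?thesis unfolding sum_subtractf sumX[OF that] cardX[OF that] .
  qed
  have cardE: "int (card (E - \<epsilon> ` E')) = int (card E) - int (card E')"
  proof -
    have "card (\<epsilon> ` E') = card E'" using inj_on_subset[OF gspec_inj[OF g] E'] by (rule card_image)
    moreover have "card (E - \<epsilon> ` E') = card E - card (\<epsilon> ` E')" using fin sub by (intro card_Diff_subset) auto
    moreover have "card (\<epsilon> ` E') \<le> card E" using fin sub by (intro card_mono)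
    ultimately show ?thesis by simp
  qed
  have total: "(\<Sum>w\<in>verts H. a' w) = d + int (card E')"
  proof -
    have "{v \<in> verts G. \<phi> v \<in> verts H} = verts G" using \<phi>V by auto
    moreover have "{e \<in> E - \<epsilon> ` E'. \<phi> (t e) \<in> verts H} = E - \<epsilon> ` E'" using tV \<phi>V by auto
    ultimately have "real_of_int (\<Sum>w\<in>verts H. a' w) = real_of_int ((\<Sum>v\<in>verts G. a v) - int (card (E - \<epsilon> ` E')))"
      using sa[of "verts H"] by simp
    then have "(\<Sum>w\<in>verts H. a' w) = (\<Sum>v\<in>verts G. a v) - int (card (E - \<epsilon> ` E'))" by linarith
    then show ?thesis using q cardE by (simp add: qd_def)
  qed
  have gam: "gam G \<mu> E a {v \<in> verts G. \<phi> v \<in> X'} \<le> gam H \<mu>' E' a' X'" if X': "X' \<subseteq> verts H" for X'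
  proof -
    let ?X = "{v \<in> verts G. \<phi> v \<in> X'}"
    have en: "ends H e \<inter> X' \<noteq> {} \<longleftrightarrow> ends G (\<epsilon> e) \<inter> ?X \<noteq> {}" "ends H e - X' \<noteq> {} \<longleftrightarrow> ends G (\<epsilon> e) - ?X \<noteq> {}"
      if "e \<in> edges H" for e
    proof -
      have "ends G (\<epsilon> e) \<subseteq> verts G" using wa gspec_in(1)[OF g that] by (simp add: well_attached_def)
      then show "ends H e \<inter> X' \<noteq> {} \<longleftrightarrow> ends G (\<epsilon> e) \<inter> ?X \<noteq> {}" "ends H e - X' \<noteq> {} \<longleftrightarrow> ends G (\<epsilon> e) - ?X \<noteq> {}"
        unfolding gspec_ends[OF g that] by auto
    qed
    have "cut G ?X = \<epsilon> ` cut H X'"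
    proof (intro equalityI subsetI)
      fix e assume e: "e \<in> cut G ?X"
      then obtain x y where xy: "x \<in> ends G e" "\<phi> x \<in> X'" "y \<in> ends G e" "y \<notin> ?X" by (auto simp: cut_def)
      have eG: "e \<in> edges G" using e by (simp add: cut_def)
      then have "y \<in> verts G" using xy wa by (auto simp: well_attached_def)
      then have "\<phi> x \<noteq> \<phi> y" using xy by auto
      then have "e \<in> \<epsilon> ` edges H" using gspec_contracted[OF g wa eG _ xy(1,3)] by blast
      then obtain f where f: "e = \<epsilon> f" "f \<in> edges H" by (rule imageE)
      then have "f \<in> cut H X'" using e en[OF f(2)] by (simp add: cut_def)
      then show "e \<in> \<epsilon> ` cut H X'" using f by blast
    next
      fix e assume "e \<in> \<epsilon> ` cut H X'"
      then obtain f where f: "e = \<epsilon> f" "f \<in> cut H X'" by (rule imageE)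
      then have "f \<in> edges H" by (simp add: cut_def)
      then show "e \<in> cut G ?X" using f en gspec_in(1)[OF g] by (simp add: cut_def)
    qed
    moreover have "inj_on \<epsilon> (cut H X')" using gspec_inj[OF g] by (rule inj_on_subset) (auto simp: cut_def)
    ultimately have c: "card (cut G ?X) = card (cut H X')" by (simp add: card_image)
    have hE': "card {e \<in> E'. ends H e \<inter> X' \<noteq> {}} = card (\<epsilon> ` {e \<in> E'. ends H e \<inter> X' \<noteq> {}})"
      using inj_on_subset[OF gspec_inj[OF g] E'] by (intro card_image[symmetric]) (auto simp: inj_on_def)
    have "card {e \<in> E - \<epsilon> ` E'. \<phi> (t e) \<in> X'} + card {e \<in> E'. ends H e \<inter> X' \<noteq> {}} =
        card ({e \<in> E - \<epsilon> ` E'. \<phi> (t e) \<in> X'} \<union> \<epsilon> ` {e \<in> E'. ends H e \<inter> X' \<noteq> {}})"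
      unfolding hE' using fin by (intro card_Un_disjoint[symmetric]) auto
    also have "\<dots> \<le> card {e \<in> E. ends G e \<inter> ?X \<noteq> {}}"
    proof (rule card_mono)
      show "{e \<in> E - \<epsilon> ` E'. \<phi> (t e) \<in> X'} \<union> \<epsilon> ` {e \<in> E'. ends H e \<inter> X' \<noteq> {}} \<subseteq> {e \<in> E. ends G e \<inter> ?X \<noteq> {}}"
      proof
        fix e assume "e \<in> {e \<in> E - \<epsilon> ` E'. \<phi> (t e) \<in> X'} \<union> \<epsilon> ` {e \<in> E'. ends H e \<inter> X' \<noteq> {}}"
        then show "e \<in> {e \<in> E. ends G e \<inter> ?X \<noteq> {}}"
        proof
          assume "e \<in> {e \<in> E - \<epsilon> ` E'. \<phi> (t e) \<in> X'}"
          then have "e \<in> E" "t e \<in> ends G e \<inter> ?X" using t tV by auto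
          then show ?thesis by blast
        next
          assume "e \<in> \<epsilon> ` {e \<in> E'. ends H e \<inter> X' \<noteq> {}}"
          then obtain f where f: "e = \<epsilon> f" "f \<in> E'" "ends H f \<inter> X' \<noteq> {}" by auto
          then have "ends G e \<inter> ?X \<noteq> {}" using en(1)[of f] E' by auto
          then show ?thesis using f sub by auto
        qed
      qed
    qed (use fin in auto)
    finally have le: "card {e \<in> E - \<epsilon> ` E'. \<phi> (t e) \<in> X'} + card {e \<in> E'. ends H e \<inter> X' \<noteq> {}} \<le> card {e \<in> E. ends G e \<inter> ?X \<noteq> {}}" .
    have "(\<Sum>w\<in>X'. \<mu>' w) = (\<Sum>v\<in>?X. \<mu> v)"
    proof -
      have "(\<Sum>w\<in>X'. \<mu>' w) = (\<Sum>w\<in>X'. \<Sum>v\<in>{v \<in> verts G. \<phi> v = w}. \<mu> v)"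
        using X' by (intro sum.cong) (auto simp: \<mu>')
      then show ?thesis unfolding sumX[OF X'] .
    qed
    then show ?thesis unfolding gam_def sum_subtractf sa[OF X'] c using le by linarith
  qed
  have "qs H (leg H) \<mu>' E' a'"
    unfolding qs_def
  proof (intro allI impI)
    fix X' assume X': "X' \<subset> verts H"
    let ?X = "{v \<in> verts G. \<phi> v \<in> X'}"
    obtain w where "w \<in> verts H" "w \<notin> X'" using X' by blast
    then have "w \<in> \<phi> ` verts G" using g by (simp add: gspec_def)
    then obtain v where "w = \<phi> v" "v \<in> verts G" by (rule imageE)
    then have X: "?X \<subset> verts G" using \<open>w \<notin> X'\<close> by auto
    have Q: "qs G (leg G) \<mu> E a" using q by (simp add: qd_def)
    have "leg H \<in> X' \<Longrightarrow> leg G \<in> ?X" using w leg by (simp add: wsp_def)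
    then show "0 \<le> gam H \<mu>' E' a' X' \<and> (leg H \<in> X' \<longrightarrow> 0 < gam H \<mu>' E' a' X')"
      using qsD[OF Q X] gam[of X'] X' by force
  qed
  then show ?thesis using total E' by (simp add: qd_def)
qed

section \<open>Contraction of a single edge\<close>

text \<open>A relation, so that it can be read backwards when a vertex is expanded and so that two
  graphs can contract to the same third one; values outside the vertices and edges are left free. A
  contracted loop becomes one unit of weight.\<close>

definition one_contraction :: "('v, 'e) wgraph \<Rightarrow> 'e \<Rightarrow> 'v \<Rightarrow> 'v \<Rightarrow> ('v, 'e) wgraph \<Rightarrow> bool" where
  "one_contraction \<Gamma> e u w \<Gamma>' \<longleftrightarrow> e \<in> edges \<Gamma> \<and> att \<Gamma> e False = u \<and> att \<Gamma> e True = w \<and>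
     verts \<Gamma>' = (if u = w then verts \<Gamma> else verts \<Gamma> - {w}) \<and> edges \<Gamma>' = edges \<Gamma> - {e} \<and>
     (\<forall>x\<in>edges \<Gamma>'. \<forall>b. att \<Gamma>' x b = merge u w (att \<Gamma> x b)) \<and> leg \<Gamma>' = merge u w (leg \<Gamma>) \<and>
     (\<forall>v\<in>verts \<Gamma>'. weight \<Gamma>' v =
        (if v = u then if u = w then Suc (weight \<Gamma> u) else weight \<Gamma> u + weight \<Gamma> w else weight \<Gamma> v))"

definition contract_edge :: "('v, 'e) wgraph \<Rightarrow> 'e \<Rightarrow> ('v, 'e) wgraph" where
  "contract_edge \<Gamma> e = (let u = att \<Gamma> e False; w = att \<Gamma> e True in
     \<lparr>verts = (if u = w then verts \<Gamma> else verts \<Gamma> - {w}), edges = edges \<Gamma> - {e},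
      att = (\<lambda>x b. merge u w (att \<Gamma> x b)),
      weight = (\<lambda>v. if v = u then if u = w then Suc (weight \<Gamma> u) else weight \<Gamma> u + weight \<Gamma> w else weight \<Gamma> v),
      leg = merge u w (leg \<Gamma>)\<rparr>)"

lemma one_contraction_contract_edge:
  "e \<in> edges \<Gamma> \<Longrightarrow> one_contraction \<Gamma> e (att \<Gamma> e False) (att \<Gamma> e True) (contract_edge \<Gamma> e)"
  by (simp add: one_contraction_def contract_edge_def Let_def)

context
  fixes \<Gamma> \<Gamma>' :: "('v, 'e) wgraph" and e u w
  assumes oc: "one_contraction \<Gamma> e u w \<Gamma>'" and wa: "well_attached \<Gamma>"
begin

lemma oc_simps:
  "e \<in> edges \<Gamma>" "att \<Gamma> e False = u" "att \<Gamma> e True = w" "edges \<Gamma>' = edges \<Gamma> - {e}"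
  "verts \<Gamma>' = (if u = w then verts \<Gamma> else verts \<Gamma> - {w})" "leg \<Gamma>' = merge u w (leg \<Gamma>)"
  "ends \<Gamma> e = {u, w}"
  using oc by (auto simp: one_contraction_def ends_eq)

lemma oc_att: "x \<in> edges \<Gamma>' \<Longrightarrow> att \<Gamma>' x b = merge u w (att \<Gamma> x b)"
  using oc by (simp add: one_contraction_def)

lemma oc_ends: "x \<in> edges \<Gamma>' \<Longrightarrow> ends \<Gamma>' x = merge u w ` ends \<Gamma> x"
  by (simp add: ends_eq oc_att)

lemma oc_weight: "v \<in> verts \<Gamma>' \<Longrightarrow> weight \<Gamma>' v =
        (if v = u then if u = w then Suc (weight \<Gamma> u) else weight \<Gamma> u + weight \<Gamma> w else weight \<Gamma> v)"
  using oc by (simp add: one_contraction_def)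

lemma oc_uw: "u \<in> verts \<Gamma>" "w \<in> verts \<Gamma>"
  using att_in_verts[OF wa oc_simps(1)] oc_simps(2,3) by auto

lemma oc_in: "v \<in> verts \<Gamma> \<Longrightarrow> merge u w v \<in> verts \<Gamma>'" "u \<in> verts \<Gamma>'"
  using oc_uw by (auto simp: oc_simps(5) merge_def)

lemma oc_fibre:
  "v \<in> verts \<Gamma>' \<Longrightarrow> {x \<in> verts \<Gamma>. merge u w x = v} = (if v = u then {u, w} else {v})"
  using oc_uw by (auto simp: oc_simps(5) merge_def split: if_splits)

lemma oc_lost: "edges \<Gamma> - id ` edges \<Gamma>' = {e}"
  using oc_simps(1,4) by auto

lemma gspec_oc: "gspec \<Gamma> \<Gamma>' (merge u w) id"
  unfolding gspec_def
proof (intro conjI ballI)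
  show "merge u w ` verts \<Gamma> = verts \<Gamma>'"
  proof (intro equalityI subsetI)
    fix x assume "x \<in> verts \<Gamma>'"
    then have "x \<in> verts \<Gamma>" "merge u w x = x" by (auto simp: oc_simps(5) merge_def split: if_splits)
    then show "x \<in> merge u w ` verts \<Gamma>" by (metis image_eqI)
  qed (use oc_in in auto)
  fix x y assume xy: "x \<in> verts \<Gamma>" "y \<in> verts \<Gamma>"
  show "merge u w x = merge u w y \<longleftrightarrow> y \<in> comp \<Gamma> (edges \<Gamma> - id ` edges \<Gamma>') x"
    unfolding oc_lost
  proof
    assume "merge u w x = merge u w y"
    then have "x = y \<or> x \<in> {u, w} \<and> y \<in> {u, w}" by (auto simp: merge_def split: if_splits)
    then show "y \<in> comp \<Gamma> {e} x"
    proof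
      assume "x \<in> {u, w} \<and> y \<in> {u, w}"
      then show ?thesis by (intro comp_edge[of e]) (simp_all add: oc_simps(7))
    qed simp
  next
    assume "y \<in> comp \<Gamma> {e} x"
    then show "merge u w x = merge u w y"
      by (induction rule: comp_induct) (use oc_simps(7) in \<open>auto simp: merge_def\<close>)
  qed
qed (use oc_ends in \<open>auto simp: oc_simps(4)\<close>)

lemma wsp_oc: "wsp \<Gamma> \<Gamma>' (merge u w) id"
  unfolding wsp_def
proof (intro conjI ballI gspec_oc)
  show "merge u w (leg \<Gamma>) = leg \<Gamma>'" by (simp add: oc_simps)
  fix v assume v: "v \<in> verts \<Gamma>'"
  have l: "{x \<in> edges \<Gamma> - id ` edges \<Gamma>'. merge u w (att \<Gamma> x False) = v} = (if v = u then {e} else {})"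
    unfolding oc_lost using oc_simps(2) by auto
  show "int (weight \<Gamma>' v) - 1 = (\<Sum>x\<in>{x \<in> verts \<Gamma>. merge u w x = v}. int (weight \<Gamma> x) - 1)
      + int (card {x \<in> edges \<Gamma> - id ` edges \<Gamma>'. merge u w (att \<Gamma> x False) = v})"
    unfolding oc_fibre[OF v] l using oc_weight[OF v] by (cases "u = w") auto
qed

lemma wa_oc: "well_attached \<Gamma>'"
  by (rule gspec_well_attached[OF gspec_oc wa])

lemma linked_oc: "linked (ends \<Gamma>') (verts \<Gamma>') (edges \<Gamma>') \<longleftrightarrow> linked (ends \<Gamma>) (verts \<Gamma>) (edges \<Gamma>)"
proof (cases "u = w")
  case True
  have "ends \<Gamma>' x = ends \<Gamma> x" if "x \<in> edges \<Gamma>'" for x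
    using oc_ends[OF that] True by (auto simp: merge_def)
  then have "linked (ends \<Gamma>') (verts \<Gamma>') (edges \<Gamma>') \<longleftrightarrow> linked (ends \<Gamma>) (verts \<Gamma>) (edges \<Gamma> - {e})"
    unfolding linked_def using True by (simp add: oc_simps(4,5))
  also have "\<dots> \<longleftrightarrow> linked (ends \<Gamma>) (verts \<Gamma>) (edges \<Gamma>)"
  proof -
    have "\<not> crosses \<Gamma> e X" for X using True oc_simps(2,3) by (simp add: crosses_def)
    then have *: "(\<exists>x\<in>edges \<Gamma> - {e}. crosses \<Gamma> x X) \<longleftrightarrow> (\<exists>x\<in>edges \<Gamma>. crosses \<Gamma> x X)" for X by auto
    show ?thesis unfolding linked_def crosses_iff * by (rule refl)
  qed
  finally show ?thesis .
next
  case False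
  have "linked (ends \<Gamma>') (verts \<Gamma>') (edges \<Gamma>') \<longleftrightarrow>
     linked (\<lambda>x. merge u w ` ends \<Gamma> x) (verts \<Gamma> - {w}) (edges \<Gamma> - {e})"
    unfolding linked_def using False oc_ends by (simp add: oc_simps(4,5))
  also have "\<dots> \<longleftrightarrow> linked (ends \<Gamma>) (verts \<Gamma>) (edges \<Gamma>)"
    by (rule linked_merge_iff[of e "edges \<Gamma>" "ends \<Gamma>" u w "verts \<Gamma>", OF oc_simps(1,7) False oc_uw])
  finally show ?thesis .
qed

lemma fcg_oc: "finite_connected_graph \<Gamma>' \<longleftrightarrow> finite_connected_graph \<Gamma>"
  using linked_oc wa wa_oc oc_uw oc_in(2) by (auto simp: fcg_iff)

end

section \<open>Genus, valence and stability under the contraction of one edge\<close>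

lemma b1_connected:
  assumes "finite_connected_graph G"
  shows "b1 G = int (card (edges G)) - int (card (verts G)) + 1"
proof -
  have wa: "well_attached G" and ne: "verts G \<noteq> {}" using assms by (simp_all add: fcg_iff)
  have co: "\<forall>u\<in>verts G. \<forall>v\<in>verts G. v \<in> comp G (edges G) u"
    using assms by (simp add: finite_connected_graph_def)
  have "comp G (edges G) u = verts G" if "u \<in> verts G" for u
    using that co comp_sub[of _ G "edges G" u "verts G"] wa by (auto simp: well_attached_def)
  then have "comp G (edges G) ` verts G = {verts G}" using ne by auto
  then show ?thesis by (simp add: b1_def)
qed

lemma genus_connected:
  assumes "finite_connected_graph \<Gamma>"
  shows "genus \<Gamma> = (\<Sum>v\<in>verts \<Gamma>. int (weight \<Gamma> v)) + int (card (edges \<Gamma>)) - int (card (verts \<Gamma>)) + 1"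
  using b1_connected[OF assms] by (simp add: genus_def)

text \<open>A loop is traded for one unit of weight; any other edge disappears together with one
  vertex.\<close>

lemma genus_oc:
  assumes oc: "one_contraction \<Gamma> e u w \<Gamma>'" and c: "finite_connected_graph \<Gamma>"
  shows "genus \<Gamma>' = genus \<Gamma>"
proof -
  have wa: "well_attached \<Gamma>" using c by (simp add: fcg_iff)
  note s = oc_simps[OF oc wa]
  have c': "finite_connected_graph \<Gamma>'" using fcg_oc[OF oc wa] c by simp
  have fin: "finite (verts \<Gamma>)" "finite (edges \<Gamma>)" using wa by (auto simp: well_attached_def)
  have uw: "u \<in> verts \<Gamma>" "w \<in> verts \<Gamma>" using oc_uw[OF oc wa] .
  have ed: "card (edges \<Gamma>) = Suc (card (edges \<Gamma>'))"
    unfolding s(4) using fin s(1) by (metis card_Suc_Diff1)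
  have "(\<Sum>v\<in>verts \<Gamma>'. int (weight \<Gamma>' v)) - int (card (verts \<Gamma>')) = (\<Sum>v\<in>verts \<Gamma>. int (weight \<Gamma> v)) - int (card (verts \<Gamma>)) + 1"
  proof (cases "u = w")
    case True
    have "(\<Sum>v\<in>verts \<Gamma>'. int (weight \<Gamma>' v)) = (\<Sum>v\<in>verts \<Gamma>. int (weight \<Gamma> v) + (if v = u then 1 else 0))"
      using oc_weight[OF oc wa] s(5) True by (intro sum.cong) auto
    also have "\<dots> = (\<Sum>v\<in>verts \<Gamma>. int (weight \<Gamma> v)) + 1" using fin uw by (simp add: sum.distrib)
    finally show ?thesis using s(5) True by simp
  next
    case False
    have "(\<Sum>v\<in>verts \<Gamma>'. int (weight \<Gamma>' v)) = (\<Sum>v\<in>verts \<Gamma> - {w}. int (weight \<Gamma> v) + (if v = u then int (weight \<Gamma> w) else 0))"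
      using oc_weight[OF oc wa] s(5) False by (intro sum.cong) auto
    also have "\<dots> = (\<Sum>v\<in>verts \<Gamma> - {w}. int (weight \<Gamma> v)) + int (weight \<Gamma> w)" using fin uw False by (simp add: sum.distrib)
    also have "\<dots> = (\<Sum>v\<in>verts \<Gamma>. int (weight \<Gamma> v))" using sum.remove[OF fin(1) uw(2), of "\<lambda>v. int (weight \<Gamma> v)"] by simp
    moreover have "card (verts \<Gamma>) = Suc (card (verts \<Gamma>'))" using s(5) False fin uw by (metis card_Suc_Diff1)
    ultimately show ?thesis by simp
  qed
  then show ?thesis using genus_connected[OF c] genus_connected[OF c'] ed by simp
qed

definition halves :: "('v, 'e, 'm) mgraph_scheme \<Rightarrow> 'v \<Rightarrow> ('e \<times> bool) set" where
  "halves G v = {(e, b). e \<in> edges G \<and> att G e b = v}"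

lemma val_halves: "val G v = card (halves G v)"
  by (simp add: val_def halves_def)

lemma finite_halves: "finite (edges G) \<Longrightarrow> finite (halves G v)"
  by (rule finite_subset[of _ "edges G \<times> UNIV"]) (auto simp: halves_def)

lemma halves_oc:
  assumes oc: "one_contraction \<Gamma> e u w \<Gamma>'" and wa: "well_attached \<Gamma>" and v: "v \<in> verts \<Gamma>'"
  shows "halves \<Gamma>' v = (if v = u then halves \<Gamma> u \<union> halves \<Gamma> w - {(e, False), (e, True)} else halves \<Gamma> v)"
proof -
  note s = oc_simps[OF oc wa]
  have "(x, b) \<in> halves \<Gamma>' v \<longleftrightarrow> x \<in> edges \<Gamma> \<and> x \<noteq> e \<and> merge u w (att \<Gamma> x b) = v" for x b
    using oc_att[OF oc wa, of x b] by (auto simp: halves_def s(4))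
  moreover have "merge u w y = v \<longleftrightarrow> (if v = u then y = u \<or> y = w else y = v)" for y
    using v s(5) by (auto simp: merge_def split: if_splits)
  moreover have "v \<noteq> u \<Longrightarrow> att \<Gamma> e b \<noteq> v" for b using v s(2,3,5) by (cases b) (auto split: if_splits)
  ultimately show ?thesis using s(2,3) by (auto simp: halves_def)
qed

lemma val_oc:
  assumes oc: "one_contraction \<Gamma> e u w \<Gamma>'" and wa: "well_attached \<Gamma>" and v: "v \<in> verts \<Gamma>'"
  shows "v \<noteq> u \<Longrightarrow> val \<Gamma>' v = val \<Gamma> v"
    and "u \<noteq> w \<Longrightarrow> val \<Gamma>' u + 2 = val \<Gamma> u + val \<Gamma> w"
    and "u = w \<Longrightarrow> val \<Gamma>' u + 2 = val \<Gamma> u"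
proof -
  note s = oc_simps[OF oc wa]
  have fin: "finite (halves \<Gamma> x)" for x using wa by (auto simp: well_attached_def intro: finite_halves)
  show "v \<noteq> u \<Longrightarrow> val \<Gamma>' v = val \<Gamma> v" using halves_oc[OF oc wa v] by (simp add: val_halves)
  have hu: "halves \<Gamma>' u = halves \<Gamma> u \<union> halves \<Gamma> w - {(e, False), (e, True)}"
    using halves_oc[OF oc wa oc_in(2)[OF oc wa]] by simp
  have sub: "{(e, False), (e, True)} \<subseteq> halves \<Gamma> u \<union> halves \<Gamma> w" using s by (auto simp: halves_def)
  have "card {(e, False), (e, True)} = 2" by simp
  then have *: "card (halves \<Gamma>' u) + 2 = card (halves \<Gamma> u \<union> halves \<Gamma> w)"
    using card_Diff_subset[OF _ sub] card_mono[OF _ sub] fin by (simp add: hu)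
  then show "u = w \<Longrightarrow> val \<Gamma>' u + 2 = val \<Gamma> u" by (simp add: val_halves)
  assume "u \<noteq> w"
  then have "halves \<Gamma> u \<inter> halves \<Gamma> w = {}" by (auto simp: halves_def)
  then show "val \<Gamma>' u + 2 = val \<Gamma> u + val \<Gamma> w" using * fin by (simp add: val_halves card_Un_disjoint)
qed

text \<open>For a loop two half-edges are traded for one unit of weight, which leaves the stability
  sum unchanged. Otherwise the sums at \<open>u\<close> and \<open>w\<close> add up with a loss of
  \<open>2\<close>, and \<open>3 + 3 - 2\<close> is still at least \<open>3\<close>.\<close>

lemma stable_oc:
  assumes oc: "one_contraction \<Gamma> e u w \<Gamma>'" and wa: "well_attached \<Gamma>" and st: "stable \<Gamma>"
  shows "stable \<Gamma>'"
  unfolding stable_def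
proof
  note s = oc_simps[OF oc wa] and uw = oc_uw[OF oc wa]
  fix v assume v: "v \<in> verts \<Gamma>'"
  have vV: "v \<in> verts \<Gamma>" using v s(5) by (auto split: if_splits)
  have stV: "val \<Gamma> x + 2 * weight \<Gamma> x + (if x = leg \<Gamma> then 1 else 0) \<ge> 3" if "x \<in> verts \<Gamma>" for x
    using st that by (simp add: stable_def)
  show "val \<Gamma>' v + 2 * weight \<Gamma>' v + (if v = leg \<Gamma>' then 1 else 0) \<ge> 3"
  proof (cases "v = u")
    case False
    have "v = leg \<Gamma>' \<longleftrightarrow> v = leg \<Gamma>" using v s(5,6) False by (auto simp: merge_def split: if_splits)
    then show ?thesis using stV[OF vV] val_oc(1)[OF oc wa v False] oc_weight[OF oc wa v] False by simp
  next
    case True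
    show ?thesis
    proof (cases "u = w")
      case uw: True
      have "u = leg \<Gamma>' \<longleftrightarrow> u = leg \<Gamma>" using s(6) uw by (auto simp: merge_def)
      then show ?thesis using stV[OF vV] val_oc(3)[OF oc wa v uw] oc_weight[OF oc wa v] uw True by simp
    next
      case False
      have "leg \<Gamma> = u \<or> leg \<Gamma> = w \<Longrightarrow> leg \<Gamma>' = u" using s(6) by auto
      then show ?thesis
        using stV[OF uw(1)] stV[OF uw(2)] val_oc(2)[OF oc wa v False] oc_weight[OF oc wa v] False True
        by (auto split: if_splits)
    qed
  qed
qed

lemma stable_graphs_oc:
  assumes oc: "one_contraction \<Gamma> e u w \<Gamma>'" and \<Gamma>: "\<Gamma> \<in> stable_graphs g"
  shows "\<Gamma>' \<in> stable_graphs g"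
proof -
  have c: "finite_connected_graph \<Gamma>" using \<Gamma> by (simp add: stable_graphs_def)
  then have wa: "well_attached \<Gamma>" by (simp add: fcg_iff)
  show ?thesis
    using \<Gamma> fcg_oc[OF oc wa] genus_oc[OF oc c] stable_oc[OF oc wa] oc_in(1)[OF oc wa] oc_simps(6)[OF oc wa]
    by (simp add: stable_graphs_def)
qed

section \<open>Factoring specializations through elementary ones\<close>

lemma wsp_refl: "wsp \<Gamma> \<Gamma> id id"
proof -
  have "{v \<in> verts \<Gamma>. id v = v'} = {v'}" if "v' \<in> verts \<Gamma>" for v' using that by auto
  then show ?thesis by (auto simp: wsp_def gspec_def comp_empty)
qed

lemma pds_drop:
  assumes wa: "well_attached \<Gamma>" and e: "e \<in> E" and x: "x \<in> ends \<Gamma> e"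
  shows "pds \<Gamma> E a \<Gamma> (E - {e}) (\<lambda>v. a v - (if v = x then 1 else 0)) id id"
  unfolding pds_def
proof (intro conjI wsp_refl exI[of _ "\<lambda>y. if y = e then x else att \<Gamma> y False"] ballI)
  fix v assume "v \<in> verts \<Gamma>"
  then have "{y \<in> verts \<Gamma>. id y = v} = {v}" by auto
  moreover have "{y \<in> E - id ` (E - {e}). id (if y = e then x else att \<Gamma> y False) = v} = (if v = x then {e} else {})"
    using e by auto
  ultimately show "a v - (if v = x then 1 else 0) = (\<Sum>y\<in>{y \<in> verts \<Gamma>. id y = v}. a y)
      - int (card {y \<in> E - id ` (E - {e}). id (if y = e then x else att \<Gamma> y False) = v})"
    by simp
qed (use x in auto)

text \<open>Forgetting the exceptional vertex on \<open>e\<close> first charges \<open>-1\<close> to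
  the end \<open>t e\<close>, which absorbs it anyway; what remains is a specialization with the
  same maps and the same \<open>t\<close>.\<close>

lemma pds_factor_exceptional:
  assumes p: "pds \<Gamma> E a \<Gamma>' E' a' \<phi> \<epsilon>" and wa: "well_attached \<Gamma>" and E: "E \<subseteq> edges \<Gamma>"
    and e: "e \<in> E" "e \<notin> \<epsilon> ` E'"
  shows "\<exists>b. pds \<Gamma> E a \<Gamma> (E - {e}) b id id \<and> pds \<Gamma> (E - {e}) b \<Gamma>' E' a' \<phi> \<epsilon>"
proof -
  obtain t where w: "wsp \<Gamma> \<Gamma>' \<phi> \<epsilon>" and sub: "\<epsilon> ` E' \<subseteq> E" and t: "\<forall>e\<in>E. t e \<in> ends \<Gamma> e"
    and a': "\<And>v'. v' \<in> verts \<Gamma>' \<Longrightarrow> a' v' = (\<Sum>v\<in>{v \<in> verts \<Gamma>. \<phi> v = v'}. a v) - int (card {e \<in> E - \<epsilon> ` E'. \<phi> (t e) = v'})"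
    using p by (auto simp: pds_def)
  have fin: "finite (verts \<Gamma>)" "finite E" using wa E by (auto simp: well_attached_def intro: finite_subset)
  have "ends \<Gamma> e \<subseteq> verts \<Gamma>" using e E wa by (auto simp: well_attached_def)
  then have te: "t e \<in> verts \<Gamma>" using t e by blast
  define b where "b v = a v - (if v = t e then 1 else 0)" for v
  have "pds \<Gamma> E a \<Gamma> (E - {e}) b id id"
    unfolding b_def by (rule pds_drop[OF wa e(1)]) (use t e in blast)
  moreover have "pds \<Gamma> (E - {e}) b \<Gamma>' E' a' \<phi> \<epsilon>"
    unfolding pds_def
  proof (intro conjI w exI[of _ t] ballI)
    show "\<epsilon> ` E' \<subseteq> E - {e}" using sub e by auto
    fix v' assume v': "v' \<in> verts \<Gamma>'"
    have s: "(\<Sum>v\<in>{v \<in> verts \<Gamma>. \<phi> v = v'}. b v) = (\<Sum>v\<in>{v \<in> verts \<Gamma>. \<phi> v = v'}. a v) - (if \<phi> (t e) = v' then 1 else 0)"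
      using fin te by (simp add: b_def sum_subtractf)
    have c: "int (card {x \<in> E - \<epsilon> ` E'. \<phi> (t x) = v'}) =
       int (card {x \<in> E - {e} - \<epsilon> ` E'. \<phi> (t x) = v'}) + (if \<phi> (t e) = v' then 1 else 0)"
    proof (cases "\<phi> (t e) = v'")
      case True
      have "{x \<in> E - \<epsilon> ` E'. \<phi> (t x) = v'} = insert e {x \<in> E - {e} - \<epsilon> ` E'. \<phi> (t x) = v'}" using e True by auto
      then show ?thesis using fin True by simp
    next
      case False
      then have "{x \<in> E - \<epsilon> ` E'. \<phi> (t x) = v'} = {x \<in> E - {e} - \<epsilon> ` E'. \<phi> (t x) = v'}" by auto
      then show ?thesis using False by simp
    qed
    show "a' v' = (\<Sum>v\<in>{v \<in> verts \<Gamma>. \<phi> v = v'}. b v) - int (card {x \<in> E - {e} - \<epsilon> ` E'. \<phi> (t x) = v'})"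
      using a'[OF v'] s c by simp
  qed (use t in auto)
  ultimately show ?thesis by blast
qed

lemma pds_contract:
  assumes oc: "one_contraction \<Gamma> e u w \<Gamma>'" and wa: "well_attached \<Gamma>"
  shows "pds \<Gamma> E a \<Gamma>' E (\<lambda>v. \<Sum>x\<in>{x \<in> verts \<Gamma>. merge u w x = v}. a x) (merge u w) id"
  unfolding pds_def using wsp_oc[OF oc wa]
  by (auto intro!: exI[of _ "\<lambda>x. att \<Gamma> x False"])

text \<open>The ends \<open>u\<close> and \<open>w\<close> of a lost edge have the same image, so
  \<open>\<phi>\<close> itself factors through \<open>merge u w\<close>. As \<open>e\<close> is not
  exceptional, \<open>E\<close> survives the contraction unchanged.\<close>

lemma pds_factor_contract:
  assumes p: "pds \<Gamma> E a \<Gamma>' E' a' \<phi> \<epsilon>" and wa: "well_attached \<Gamma>" and E: "E \<subseteq> edges \<Gamma>"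
    and leg: "leg \<Gamma> \<in> verts \<Gamma>" and e: "e \<notin> E" "e \<notin> \<epsilon> ` edges \<Gamma>'"
    and oc: "one_contraction \<Gamma> e u w \<Delta>"
  shows "pds \<Delta> E (\<lambda>v. \<Sum>x\<in>{x \<in> verts \<Gamma>. merge u w x = v}. a x) \<Gamma>' E' a' \<phi> \<epsilon>"
proof -
  note s = oc_simps[OF oc wa]
  obtain t where ws: "wsp \<Gamma> \<Gamma>' \<phi> \<epsilon>" and sub: "\<epsilon> ` E' \<subseteq> E" and t: "\<forall>e\<in>E. t e \<in> ends \<Gamma> e"
    and a': "\<And>v'. v' \<in> verts \<Gamma>' \<Longrightarrow> a' v' = (\<Sum>v\<in>{v \<in> verts \<Gamma>. \<phi> v = v'}. a v) - int (card {e \<in> E - \<epsilon> ` E'. \<phi> (t e) = v'})"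
    using p by (auto simp: pds_def)
  have g: "gspec \<Gamma> \<Gamma>' \<phi> \<epsilon>" using ws by (simp add: wsp_def)
  have fin: "finite (verts \<Gamma>)" "finite (verts \<Delta>)" using wa wa_oc[OF oc wa] by (auto simp: well_attached_def)
  have "\<phi> u = \<phi> w" by (rule gspec_contracted[OF g wa s(1) e(2)]) (simp_all add: s(7))
  then have \<phi>m: "\<phi> (merge u w v) = \<phi> v" for v by (simp add: merge_def)
  have "wsp \<Delta> \<Gamma>' \<phi> \<epsilon>"
  proof (rule wsp_factor[OF wsp_oc[OF oc wa] ws wa leg \<phi>m])
    fix x assume "x \<in> edges \<Gamma>'"
    then have "\<epsilon> x \<in> edges \<Gamma>" "\<epsilon> x \<noteq> e" using gspec_in(1)[OF g] e(2) by auto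
    then show "\<epsilon> x \<in> edges \<Delta> \<and> id (\<epsilon> x) = \<epsilon> x" by (simp add: s(4))
  qed
  moreover have "merge u w (t x) \<in> ends \<Delta> x" if "x \<in> E" for x
    using that t e(1) E oc_ends[OF oc wa, of x] by (auto simp: s(4))
  moreover have "(\<Sum>b\<in>{b \<in> verts \<Delta>. \<phi> b = c}. \<Sum>x\<in>{x \<in> verts \<Gamma>. merge u w x = b}. a x) = (\<Sum>x\<in>{x \<in> verts \<Gamma>. \<phi> x = c}. a x)" for c
  proof -
    have "merge u w ` verts \<Gamma> \<subseteq> verts \<Delta>" using oc_in(1)[OF oc wa] by auto
    from sum_fibres[OF fin this, of a \<phi> c] show ?thesis by (simp add: \<phi>m)
  qed
  ultimately show ?thesis
    unfolding pds_def using sub a' by (auto simp: \<phi>m intro!: exI[of _ "\<lambda>x. merge u w (t x)"])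
qed

section \<open>Bounds on the number of edges\<close>

lemma sum_val:
  assumes wa: "well_attached G"
  shows "(\<Sum>v\<in>verts G. val G v) = 2 * card (edges G)"
proof -
  have fin: "finite (verts G)" "finite (edges G)" using wa by (auto simp: well_attached_def)
  have "(\<Sum>v\<in>verts G. int (val G v)) = (\<Sum>v\<in>{v \<in> verts G. True = True}. int (card {h \<in> edges G \<times> UNIV. (case h of (e, b) \<Rightarrow> att G e b) = v}))"
    by (intro sum.cong) (auto simp: val_def intro!: arg_cong[of _ _ card])
  also have "\<dots> = int (card {h \<in> edges G \<times> (UNIV :: bool set). True = True})"
    using fin att_in_verts[OF wa] by (intro card_fibres) auto
  also have "\<dots> = int (2 * card (edges G))" by (simp add: card_cartesian_product)
  finally show ?thesis by (simp flip: of_nat_sum)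
qed

text \<open>One of \<open>X\<close> and its complement contains the leg, where quasistability is
  strict; hence the sum in \<open>gam_compl\<close>, the number of non-exceptional edges leaving
  \<open>X\<close>, is positive.\<close>

lemma linked_nonexceptional:
  assumes wa: "well_attached \<Gamma>" and leg: "leg \<Gamma> \<in> verts \<Gamma>" and q: "qd d \<Gamma> \<mu> E a"
    and \<mu>: "(\<Sum>v\<in>verts \<Gamma>. \<mu> v) = real_of_int d"
  shows "linked (ends \<Gamma>) (verts \<Gamma>) (edges \<Gamma> - E)"
  unfolding linked_def
proof (intro allI impI)
  fix X assume X: "X \<subset> verts \<Gamma> \<and> X \<noteq> {}"
  have E: "E \<subseteq> edges \<Gamma>" and Q: "qs \<Gamma> (leg \<Gamma>) \<mu> E a" using q by (auto simp: qd_def)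
  have Y: "verts \<Gamma> - X \<subset> verts \<Gamma>" using X by blast
  have "0 < gam \<Gamma> \<mu> E a X + gam \<Gamma> \<mu> E a (verts \<Gamma> - X)"
  proof (cases "leg \<Gamma> \<in> X")
    case True
    then show ?thesis using qsD(2)[OF Q, of X] qsD(1)[OF Q Y] X by linarith
  next
    case False
    then show ?thesis using qsD(1)[OF Q, of X] qsD(2)[OF Q Y] X leg by fastforce
  qed
  then have "card (cut \<Gamma> X - E) \<noteq> 0"
    using gam_compl[OF wa E _ qd_gam_verts[OF q wa \<mu>], of X] X by force
  then have "cut \<Gamma> X - E \<noteq> {}" by (metis card.empty)
  then show "\<exists>e\<in>edges \<Gamma> - E. ends \<Gamma> e \<inter> X \<noteq> {} \<and> ends \<Gamma> e - X \<noteq> {}" by (auto simp: cut_def)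
qed

text \<open>The connected complement of \<open>E\<close> has at least
  \<open>card (verts \<Gamma>) - 1\<close> edges, so \<open>card E\<close> is at most the first
  Betti number.\<close>

lemma card_exceptional_le:
  assumes wa: "well_attached \<Gamma>" and leg: "leg \<Gamma> \<in> verts \<Gamma>" and q: "qd d \<Gamma> \<mu> E a"
    and \<mu>: "(\<Sum>v\<in>verts \<Gamma>. \<mu> v) = real_of_int d"
  shows "card E + card (verts \<Gamma>) \<le> card (edges \<Gamma>) + 1"
proof -
  have E: "E \<subseteq> edges \<Gamma>" using q by (simp add: qd_def)
  have fin: "finite (verts \<Gamma>)" "finite (edges \<Gamma>)" using wa by (auto simp: well_attached_def)
  have "card (verts \<Gamma>) \<le> card (edges \<Gamma> - E) + 1"
    using fin wa linked_nonexceptional[OF assms] by (intro linked_card_ge) (auto simp: well_attached_def)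
  moreover have "card (edges \<Gamma> - E) = card (edges \<Gamma>) - card E" "card E \<le> card (edges \<Gamma>)"
    using E fin by (auto intro: card_Diff_subset card_mono finite_subset)
  ultimately show ?thesis by simp
qed

lemma stable_graphsD:
  assumes "\<Gamma> \<in> stable_graphs g"
  shows "finite_connected_graph \<Gamma>" "well_attached \<Gamma>" "leg \<Gamma> \<in> verts \<Gamma>" "stable \<Gamma>"
    "int g = (\<Sum>v\<in>verts \<Gamma>. int (weight \<Gamma> v)) + int (card (edges \<Gamma>)) - int (card (verts \<Gamma>)) + 1"
  using assms genus_connected[of \<Gamma>] by (auto simp: stable_graphs_def fcg_iff)

text \<open>The number of vertices is eliminated from three times the genus formula by the handshake
  identity \<open>sum_val\<close>; what remains is the sum of the excesses in the stability
  condition.\<close>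

lemma stable_bound:
  assumes \<Gamma>: "\<Gamma> \<in> stable_graphs g"
  shows "3 * int g = (\<Sum>v\<in>verts \<Gamma>. int (weight \<Gamma> v)) + int (card (edges \<Gamma>)) + 2
     + (\<Sum>v\<in>verts \<Gamma>. int (val \<Gamma> v) + 2 * int (weight \<Gamma> v) + (if v = leg \<Gamma> then 1 else 0) - 3)"
proof -
  note s = stable_graphsD[OF \<Gamma>]
  have fin: "finite (verts \<Gamma>)" using s(2) by (simp add: well_attached_def)
  have "(\<Sum>v\<in>verts \<Gamma>. int (val \<Gamma> v)) = 2 * int (card (edges \<Gamma>))"
    using sum_val[OF s(2)] by (simp flip: of_nat_sum)
  then have "(\<Sum>v\<in>verts \<Gamma>. int (val \<Gamma> v) + 2 * int (weight \<Gamma> v) + (if v = leg \<Gamma> then 1 else 0) - 3) =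
     2 * int (card (edges \<Gamma>)) + 2 * (\<Sum>v\<in>verts \<Gamma>. int (weight \<Gamma> v)) + 1 - 3 * int (card (verts \<Gamma>))"
    using fin s(3) by (simp add: sum.distrib sum_subtractf sum_distrib_left)
  then show ?thesis using s(5) by linarith
qed

lemma stable_excess_nonneg:
  assumes "\<Gamma> \<in> stable_graphs g" "v \<in> verts \<Gamma>"
  shows "0 \<le> int (val \<Gamma> v) + 2 * int (weight \<Gamma> v) + (if v = leg \<Gamma> then 1 else 0) - 3"
  using assms stable_graphsD(4)[OF assms(1)] unfolding stable_def by (force split: if_splits)

lemma stable_edges_le:
  assumes "\<Gamma> \<in> stable_graphs g"
  shows "(\<Sum>v\<in>verts \<Gamma>. int (weight \<Gamma> v)) + int (card (edges \<Gamma>)) + 2 \<le> 3 * int g"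
proof -
  have "0 \<le> (\<Sum>v\<in>verts \<Gamma>. int (val \<Gamma> v) + 2 * int (weight \<Gamma> v) + (if v = leg \<Gamma> then 1 else 0) - 3)"
    by (rule sum_nonneg) (rule stable_excess_nonneg[OF assms])
  then show ?thesis using stable_bound[OF assms] by linarith
qed

section \<open>Lifting along the contraction of an edge\<close>

text \<open>A set that does not separate \<open>u\<close> from \<open>w\<close> is the preimage of a
  set of the contracted graph, and \<open>e\<close> does not cross it.\<close>

lemma gam_oc:
  assumes oc: "one_contraction \<Gamma> e u w \<Gamma>'" and wa: "well_attached \<Gamma>" and E: "E \<subseteq> edges \<Gamma>'"
    and X: "X \<subseteq> verts \<Gamma>" "u \<in> X \<longleftrightarrow> w \<in> X"
    and a: "\<And>v. v \<in> verts \<Gamma>' \<Longrightarrow> a v = (\<Sum>x\<in>{x \<in> verts \<Gamma>. merge u w x = v}. b x)"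
    and \<mu>: "\<And>v. v \<in> verts \<Gamma>' \<Longrightarrow> \<mu>' v = (\<Sum>x\<in>{x \<in> verts \<Gamma>. merge u w x = v}. \<mu> x)"
  shows "gam \<Gamma>' \<mu>' E a (X \<inter> verts \<Gamma>') = gam \<Gamma> \<mu> E b X"
proof -
  note s = oc_simps[OF oc wa] and inn = oc_in[OF oc wa]
  have fin: "finite (verts \<Gamma>)" "finite (verts \<Gamma>')" using wa wa_oc[OF oc wa] by (auto simp: well_attached_def)
  have m: "merge u w x \<in> X \<inter> verts \<Gamma>' \<longleftrightarrow> x \<in> X" if "x \<in> verts \<Gamma>" for x
    using that inn X(2) by (auto simp: merge_def)
  have "(\<Sum>v\<in>X \<inter> verts \<Gamma>'. real_of_int (a v) - \<mu>' v) =
     (\<Sum>v\<in>{v \<in> verts \<Gamma>'. (v \<in> X \<inter> verts \<Gamma>') = True}. \<Sum>x\<in>{x \<in> verts \<Gamma>. merge u w x = v}. real_of_int (b x) - \<mu> x)"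
    by (intro sum.cong) (auto simp: a \<mu> sum_subtractf)
  also have "\<dots> = (\<Sum>x\<in>{x \<in> verts \<Gamma>. (merge u w x \<in> X \<inter> verts \<Gamma>') = True}. real_of_int (b x) - \<mu> x)"
    using inn by (intro sum_fibres fin) auto
  also have "\<dots> = (\<Sum>x\<in>X. real_of_int (b x) - \<mu> x)"
    using m X(1) by (intro sum.cong) auto
  finally have 1: "(\<Sum>v\<in>X \<inter> verts \<Gamma>'. real_of_int (a v) - \<mu>' v) = (\<Sum>x\<in>X. real_of_int (b x) - \<mu> x)" .
  have att: "att \<Gamma>' x c \<in> X \<inter> verts \<Gamma>' \<longleftrightarrow> att \<Gamma> x c \<in> X" if "x \<in> edges \<Gamma>'" for x c
    using m[OF att_in_verts[OF wa, of x c]] oc_att[OF oc wa that] that s(4) by simp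
  have h: "hits \<Gamma>' x (X \<inter> verts \<Gamma>') \<longleftrightarrow> hits \<Gamma> x X" "crosses \<Gamma>' x (X \<inter> verts \<Gamma>') \<longleftrightarrow> crosses \<Gamma> x X"
    if "x \<in> edges \<Gamma>'" for x
    using att[OF that] by (simp_all add: hits_def crosses_def)
  have "{x \<in> E. hits \<Gamma>' x (X \<inter> verts \<Gamma>')} = {x \<in> E. hits \<Gamma> x X}" using h E by auto
  moreover have "cut \<Gamma>' (X \<inter> verts \<Gamma>') = cut \<Gamma> X"
  proof -
    have "\<not> crosses \<Gamma> e X" using s(2,3) X(2) by (simp add: crosses_def)
    then show ?thesis using h(2) s(4) by (auto simp: cut_eq)
  qed
  ultimately show ?thesis unfolding gam_def hits_iff 1 by simp
qed

text \<open>Only the distribution of \<open>a u\<close> between \<open>u\<close> and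
  \<open>w\<close> is free. Sets with both or neither inherit their inequalities from
  \<open>\<Gamma>'\<close>; sets with only \<open>u\<close> ask for a large share \<open>k\<close>
  at \<open>u\<close>, sets with only \<open>w\<close> for a small one. The least share that serves
  the first kind also serves the second.\<close>

lemma qd_lift:
  assumes oc: "one_contraction \<Gamma> e u w \<Gamma>'" and wa: "well_attached \<Gamma>" and leg: "leg \<Gamma> \<in> verts \<Gamma>"
    and q: "qd d \<Gamma>' \<mu>' E a" and tot: "(\<Sum>v\<in>verts \<Gamma>'. \<mu>' v) = real_of_int d"
    and \<mu>: "\<And>v. v \<in> verts \<Gamma>' \<Longrightarrow> \<mu>' v = (\<Sum>x\<in>{x \<in> verts \<Gamma>. merge u w x = v}. \<mu> x)"
  shows "\<exists>b. qd d \<Gamma> \<mu> E b \<and> pds \<Gamma> E b \<Gamma>' E a (merge u w) id"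
proof -
  note s = oc_simps[OF oc wa] and inn = oc_in[OF oc wa] and uw = oc_uw[OF oc wa]
  have wa': "well_attached \<Gamma>'" by (rule wa_oc[OF oc wa])
  have E': "E \<subseteq> edges \<Gamma>'" and Q: "qs \<Gamma>' (leg \<Gamma>') \<mu>' E a" and deg: "(\<Sum>v\<in>verts \<Gamma>'. a v) = d + int (card E)"
    using q by (auto simp: qd_def)
  have E: "E \<subseteq> edges \<Gamma>" "e \<notin> E" using E' s(4) by auto
  have fin: "finite (verts \<Gamma>)" "finite (verts \<Gamma>')" "finite (edges \<Gamma>)" using wa wa' by (auto simp: well_attached_def)
  define b where "b k v = (if v = w \<and> u \<noteq> w then a u - k else if v = u \<and> u \<noteq> w then k else a v)" for k v
  have ab: "a v = (\<Sum>x\<in>{x \<in> verts \<Gamma>. merge u w x = v}. b k x)" if "v \<in> verts \<Gamma>'" for k v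
    using oc_fibre[OF oc wa that] that s(5) by (auto simp: b_def split: if_splits)
  have pd: "pds \<Gamma> E (b k) \<Gamma>' E a (merge u w) id" for k
    using pds_contract[OF oc wa, of E "b k"] ab by (simp add: pds_def)
  have degb: "(\<Sum>x\<in>verts \<Gamma>. b k x) = d + int (card E)" for k
  proof -
    have "(\<Sum>v\<in>verts \<Gamma>'. a v) = (\<Sum>v\<in>{v \<in> verts \<Gamma>'. True = True}. \<Sum>x\<in>{x \<in> verts \<Gamma>. merge u w x = v}. b k x)"
      by (intro sum.cong ab) auto
    also have "\<dots> = (\<Sum>x\<in>{x \<in> verts \<Gamma>. True = True}. b k x)" using inn by (intro sum_fibres fin) auto
    finally show ?thesis using deg by simp
  qed
  let ?g = "\<lambda>k. gam \<Gamma> \<mu> E (b k)"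
  define ok where "ok k X \<longleftrightarrow> 0 \<le> ?g k X \<and> (leg \<Gamma> \<in> X \<longrightarrow> 0 < ?g k X)" for k X
  have tot': "gam \<Gamma>' \<mu>' E a (verts \<Gamma>') = 0" by (rule qd_gam_verts[OF q wa' tot])
  have even: "?g k X = gam \<Gamma>' \<mu>' E a (X \<inter> verts \<Gamma>')" if "X \<subseteq> verts \<Gamma>" "u \<in> X \<longleftrightarrow> w \<in> X" for k X
    by (rule gam_oc[OF oc wa E' that, symmetric]) (use ab \<mu> in auto)
  have even_ok: "ok k X" if X: "X \<subset> verts \<Gamma>" "u \<in> X \<longleftrightarrow> w \<in> X" for k X
  proof -
    obtain v where v: "v \<in> verts \<Gamma>" "v \<notin> X" using X(1) by blast
    then have "merge u w v \<in> verts \<Gamma>'" "merge u w v \<notin> X" using X inn by (auto simp: merge_def)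
    then have sub: "X \<inter> verts \<Gamma>' \<subset> verts \<Gamma>'" by blast
    have "leg \<Gamma> \<in> X \<Longrightarrow> leg \<Gamma>' \<in> X \<inter> verts \<Gamma>'" using s(6) inn leg X by (auto simp: merge_def)
    then show ?thesis using even[of X k] X qsD[OF Q sub] by (auto simp: ok_def)
  qed
  have even_ge: "0 \<le> ?g k X" if "X \<subseteq> verts \<Gamma>" "u \<in> X \<longleftrightarrow> w \<in> X" for k X
  proof (cases "X = verts \<Gamma>")
    case True
    then have "X \<inter> verts \<Gamma>' = verts \<Gamma>'" using s(5) by auto
    then show ?thesis using even[OF that] tot' by simp
  next
    case False
    then show ?thesis using even_ok[of X k] that by (auto simp: ok_def)
  qed
  have "\<exists>k. \<forall>X. X \<subset> verts \<Gamma> \<longrightarrow> ok k X"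
  proof (cases "u = w")
    case True
    then have "ok 0 X" if "X \<subset> verts \<Gamma>" for X using even_ok[OF that, of 0] by simp
    then show ?thesis by blast
  next
    case ne: False
    have shift: "?g k X = ?g 0 X + real_of_int k * (of_bool (u \<in> X) - of_bool (w \<in> X))" if "X \<subseteq> verts \<Gamma>" for k X
    proof -
      have "finite X" using that fin finite_subset by blast
      moreover have "real_of_int (b k v) - \<mu> v = (real_of_int (b 0 v) - \<mu> v) + (if v = u then real_of_int k else 0) - (if v = w then real_of_int k else 0)" for v
        using ne by (simp add: b_def)
      ultimately have "(\<Sum>v\<in>X. real_of_int (b k v) - \<mu> v) = (\<Sum>v\<in>X. real_of_int (b 0 v) - \<mu> v) + (if u \<in> X then real_of_int k else 0) - (if w \<in> X then real_of_int k else 0)"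
        by (simp only: sum.distrib sum_subtractf sum.delta)
      then show ?thesis by (simp add: gam_def)
    qed
    define U where "U = {X. X \<subset> verts \<Gamma> \<and> u \<in> X \<and> w \<notin> X}"
    have finU: "finite U" using fin by (auto simp: U_def intro: finite_subset[of _ "Pow (verts \<Gamma>)"])
    have gU: "?g k X = ?g 0 X + real_of_int k" if "X \<in> U" for k X
      using shift[of X k] that by (auto simp: U_def)
    define P where "P k \<longleftrightarrow> (\<forall>X\<in>U. ok k X)" for k
    \<comment> \<open>A share exceeding all absolute values satisfies every set with only
      \<open>u\<close>; any such bound will do, as the least admissible share is taken
      below.\<close>
    have "P (\<lceil>\<Sum>X\<in>U. \<bar>?g 0 X\<bar>\<rceil> + 1)"
      unfolding P_def
    proof
      fix X assume X: "X \<in> U"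
      have "\<bar>?g 0 X\<bar> \<le> (\<Sum>X\<in>U. \<bar>?g 0 X\<bar>)" using X finU by (intro member_le_sum) auto
      then have "0 < ?g 0 X + real_of_int (\<lceil>\<Sum>X\<in>U. \<bar>?g 0 X\<bar>\<rceil> + 1)" by linarith
      then show "ok (\<lceil>\<Sum>X\<in>U. \<bar>?g 0 X\<bar>\<rceil> + 1) X"
        unfolding ok_def gU[OF X, of "\<lceil>\<Sum>X\<in>U. \<bar>?g 0 X\<bar>\<rceil> + 1"] by linarith
    qed
    then obtain k0 where k0: "P k0" by blast
    have uU: "{u} \<in> U" using uw ne by (auto simp: U_def)
    define k1 where "k1 = - \<lceil>\<bar>?g 0 {u}\<bar>\<rceil> - 1"
    have k1: "\<not> P k" if "k \<le> k1" for k
    proof -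
      have "?g 0 {u} + real_of_int k < 0" using that unfolding k1_def by linarith
      then have "\<not> ok k {u}" using gU[OF uU, of k] by (simp add: ok_def)
      then show ?thesis using uU by (auto simp: P_def)
    qed
    then have lt: "k1 < k0" using k0 by (metis linorder_not_le)
    \<comment> \<open>No share up to \<open>k1\<close> is admissible, because the set
      \<open>{u}\<close> fails there; so a least one exists and is described by its offset from
      \<open>k1\<close>.\<close>
    define n where "n = (LEAST n. P (k1 + int n))"
    have "P (k1 + int (nat (k0 - k1)))" using k0 lt by simp
    then have n: "P (k1 + int n)" "\<And>m. m < n \<Longrightarrow> \<not> P (k1 + int m)"
      unfolding n_def by (rule LeastI, metis not_less_Least)
    have "n \<noteq> 0" using n(1) k1[of k1] by (intro notI) simp
    define k where "k = k1 + int n"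
    have "k - 1 = k1 + int (n - 1)" using \<open>n \<noteq> 0\<close> by (simp add: k_def)
    moreover have "\<not> P (k1 + int (n - 1))" by (rule n(2)) (use \<open>n \<noteq> 0\<close> in simp)
    ultimately have "\<not> P (k - 1)" by metis
    \<comment> \<open>\<open>X\<close> fails at \<open>k - 1\<close>, so at \<open>k\<close> its
      value is at most \<open>1\<close>, and below \<open>1\<close> unless it contains the
      leg.\<close>
    then obtain X where X: "X \<in> U" "\<not> ok (k - 1) X" by (auto simp: P_def)
    have "?g (k - 1) X = ?g k X - 1" using gU[OF X(1), of k] gU[OF X(1), of "k - 1"] by simp
    then have gX: "?g k X \<le> 1" "leg \<Gamma> \<notin> X \<Longrightarrow> ?g k X < 1" using X(2) by (auto simp: ok_def)
    have "ok k Y" if Y: "Y \<subset> verts \<Gamma>" for Y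
    proof -
      consider "u \<in> Y \<longleftrightarrow> w \<in> Y" | "Y \<in> U" | "w \<in> Y" "u \<notin> Y" using Y by (auto simp: U_def)
      then show ?thesis
      proof cases
        case 1
        then show ?thesis using even_ok Y by blast
      next
        case 2
        then show ?thesis using n(1) by (simp add: P_def k_def)
      next
        case 3
        show ?thesis
        proof (rule ccontr)
          assume "\<not> ok k Y"
          then have gY: "?g k Y \<le> 0" "leg \<Gamma> \<notin> Y \<Longrightarrow> ?g k Y < 0" by (auto simp: ok_def)
          have XV: "X \<subseteq> verts \<Gamma>" "u \<in> X" "w \<notin> X" using X(1) by (auto simp: U_def)
          \<comment> \<open>If \<open>Y\<close> failed at \<open>k\<close>, the values of
            \<open>X\<close> and \<open>Y\<close> would sum to at most \<open>1\<close>, with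
            equality only if both contain the leg. But \<open>e\<close> runs between
            \<open>X - Y\<close> and \<open>Y - X\<close>, so submodularity makes the sum at least
            \<open>1\<close>, and more if the leg is in the intersection.\<close>
          let ?M = "{f \<in> edges \<Gamma> - E. ends \<Gamma> f \<inter> (X - Y) \<noteq> {} \<and> ends \<Gamma> f \<inter> (Y - X) \<noteq> {}}"
          have "?g k X + ?g k Y = ?g k (X \<inter> Y) + ?g k (X \<union> Y) + real (card ?M)"
            using fin XV Y E by (intro gam_submodular) (auto intro: finite_subset)
          moreover have "e \<in> ?M" using s(1,7) E(2) XV 3 by auto
          then have "0 < card ?M" unfolding card_gt_0_iff
            using finite_subset[of ?M, OF _ fin(3)] by blast
          then have "1 \<le> card ?M" by linarith
          moreover have "0 \<le> ?g k (X \<union> Y)" using even_ge[of "X \<union> Y" k] XV Y 3 by auto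
          moreover have "ok k (X \<inter> Y)" using even_ok[of "X \<inter> Y" k] XV Y 3 by auto
          ultimately show False using gX gY unfolding ok_def by (cases "leg \<Gamma> \<in> X"; cases "leg \<Gamma> \<in> Y") auto
        qed
      qed
    qed
    then show ?thesis by blast
  qed
  then obtain k where "\<forall>X. X \<subset> verts \<Gamma> \<longrightarrow> ok k X" by blast
  then have "qd d \<Gamma> \<mu> E (b k)" using E degb[of k] by (simp add: qd_def qs_def ok_def)
  then show ?thesis using pd by blast
qed

section \<open>Adding an exceptional vertex\<close>

text \<open>The new unit at \<open>u\<close> pays for the exceptional vertex on \<open>e\<close>
  whenever \<open>u\<close> is in \<open>X\<close>; only sets meeting \<open>e\<close> in
  \<open>w\<close> alone lose \<open>1\<close>.\<close>

lemma gam_insert: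
  assumes fin: "finite (edges G)" "finite X" and E: "E \<subseteq> edges G" and e: "e \<in> edges G" "e \<notin> E" "ends G e = {u, w}"
  shows "gam G \<mu> (insert e E) (\<lambda>v. a v + (if v = u then 1 else 0)) X =
    gam G \<mu> E a X - of_bool (w \<in> X \<and> u \<notin> X)"
proof -
  have "finite E" using fin E finite_subset by blast
  then have fE: "finite {x \<in> E. ends G x \<inter> X \<noteq> {}}" by simp
  have "{x \<in> insert e E. ends G x \<inter> X \<noteq> {}} = (if u \<in> X \<or> w \<in> X then insert e {x \<in> E. ends G x \<inter> X \<noteq> {}} else {x \<in> E. ends G x \<inter> X \<noteq> {}})"
    using e(3) by auto
  then have "card {x \<in> insert e E. ends G x \<inter> X \<noteq> {}} = card {x \<in> E. ends G x \<inter> X \<noteq> {}} + of_bool (u \<in> X \<or> w \<in> X)"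
    using fE e(2) by simp
  moreover have "real_of_int (a v + (if v = u then 1 else 0)) - \<mu> v = (real_of_int (a v) - \<mu> v) + (if v = u then 1 else 0)" for v by simp
  then have "(\<Sum>v\<in>X. real_of_int (a v + (if v = u then 1 else 0)) - \<mu> v) = (\<Sum>v\<in>X. real_of_int (a v) - \<mu> v) + of_bool (u \<in> X)"
    using fin(2) by (simp only: sum.distrib sum.delta) simp
  ultimately show ?thesis by (auto simp: gam_def)
qed

lemma qd_insert:
  assumes wa: "well_attached \<Gamma>" and q: "qd d \<Gamma> \<mu> E a" and e: "e \<in> edges \<Gamma>" "e \<notin> E" "ends \<Gamma> e = {u, w}"
    and heavy: "\<And>X. X \<subset> verts \<Gamma> \<Longrightarrow> w \<in> X \<Longrightarrow> u \<notin> X \<Longrightarrow>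
      1 \<le> gam \<Gamma> \<mu> E a X \<and> (leg \<Gamma> \<in> X \<longrightarrow> 1 < gam \<Gamma> \<mu> E a X)"
  shows "\<exists>b. qd d \<Gamma> \<mu> (insert e E) b \<and> pds \<Gamma> (insert e E) b \<Gamma> E a id id"
proof (intro exI conjI)
  let ?b = "\<lambda>v. a v + (if v = u then 1 else 0)"
  have E: "E \<subseteq> edges \<Gamma>" and Q: "qs \<Gamma> (leg \<Gamma>) \<mu> E a" using q by (auto simp: qd_def)
  have fin: "finite (verts \<Gamma>)" "finite (edges \<Gamma>)" "finite E" using wa E by (auto simp: well_attached_def intro: finite_subset)
  have u: "u \<in> verts \<Gamma>" using wa e(1,3) by (auto simp: well_attached_def)
  have "(\<Sum>v\<in>verts \<Gamma>. ?b v) = (\<Sum>v\<in>verts \<Gamma>. a v) + 1" using fin u by (simp add: sum.distrib)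
  moreover have "qs \<Gamma> (leg \<Gamma>) \<mu> (insert e E) ?b"
    unfolding qs_def
  proof (intro allI impI)
    fix X assume X: "X \<subset> verts \<Gamma>"
    then have "finite X" using fin finite_subset by blast
    from gam_insert[OF fin(2) this E e, of \<mu> a]
    have "gam \<Gamma> \<mu> (insert e E) ?b X = gam \<Gamma> \<mu> E a X - of_bool (w \<in> X \<and> u \<notin> X)" .
    then show "0 \<le> gam \<Gamma> \<mu> (insert e E) ?b X \<and> (leg \<Gamma> \<in> X \<longrightarrow> 0 < gam \<Gamma> \<mu> (insert e E) ?b X)"
      using qsD[OF Q X] heavy[OF X] by (cases "w \<in> X \<and> u \<notin> X") auto
  qed
  ultimately show "qd d \<Gamma> \<mu> (insert e E) ?b" using q e fin by (simp add: qd_def)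
  show "pds \<Gamma> (insert e E) ?b \<Gamma> E a id id"
    unfolding pds_def
  proof (intro conjI wsp_refl exI[of _ "\<lambda>x. if x = e then u else att \<Gamma> x False"] ballI)
    fix v assume "v \<in> verts \<Gamma>"
    then have "{x \<in> verts \<Gamma>. id x = v} = {v}" by auto
    moreover have "{x \<in> insert e E - id ` E. id (if x = e then u else att \<Gamma> x False) = v} = (if v = u then {e} else {})"
      using e(2) by auto
    ultimately show "a v = (\<Sum>x\<in>{x \<in> verts \<Gamma>. id x = v}. ?b x) - int (card {x \<in> insert e E - id ` E. id (if x = e then u else att \<Gamma> x False) = v})"
      by simp
  qed (use e(3) in auto)
qed

text \<open>Finitely many values leave a gap to the right of \<open>0\<close> and to the left of
  \<open>1\<close>; a correction of that size cannot spoil a strict inequality.\<close>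

lemma perturbation:
  assumes "finite A"
  shows "\<exists>\<epsilon>>0. \<forall>x\<in>A. (0 < x \<longrightarrow> \<epsilon> \<le> x) \<and> (x < 1 \<longrightarrow> \<epsilon> \<le> 1 - (x::real))"
  using assms
proof (induction A)
  case empty
  then show ?case by (intro exI[of _ 1]) simp
next
  case (insert y A)
  then obtain \<epsilon> where \<epsilon>: "\<epsilon> > 0" "\<forall>x\<in>A. (0 < x \<longrightarrow> \<epsilon> \<le> x) \<and> (x < 1 \<longrightarrow> \<epsilon> \<le> 1 - x)" by blast
  define \<epsilon>' where "\<epsilon>' = min \<epsilon> (min (if 0 < y then y else 1) (if y < 1 then 1 - y else 1))"
  have "\<epsilon>' > 0" "\<epsilon>' \<le> \<epsilon>" "(0 < y \<longrightarrow> \<epsilon>' \<le> y) \<and> (y < 1 \<longrightarrow> \<epsilon>' \<le> 1 - y)"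
    using \<epsilon>(1) by (auto simp: \<epsilon>'_def)
  then show ?case using \<epsilon>(2) by (intro exI[of _ \<epsilon>']) force
qed

text \<open>Let \<open>e\<close> with ends \<open>u, w\<close> lie on a cycle of non-exceptional edges.  If \<open>e\<close> cannot be
  subdivided, a set \<open>Z\<close> containing \<open>w\<close> but not \<open>u\<close> has small \<open>gam\<close>; for a minimizer \<open>Z\<close> some
  other edge of the cycle leaves \<open>Z\<close>, and submodularity shows that this edge can be subdivided.
  The perturbation \<open>\<gamma>\<close> of \<open>gam\<close> removes the case distinction on the vertex of the leg.\<close>

lemma qd_add_exceptional:
  assumes wa: "well_attached \<Gamma>" and leg: "leg \<Gamma> \<in> verts \<Gamma>" and q: "qd d \<Gamma> \<mu> E a"
    and \<mu>: "(\<Sum>v\<in>verts \<Gamma>. \<mu> v) = real_of_int d"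
    and lt: "card E + card (verts \<Gamma>) \<le> card (edges \<Gamma>)"
  shows "\<exists>e b. e \<in> edges \<Gamma> \<and> e \<notin> E \<and> qd d \<Gamma> \<mu> (insert e E) b \<and> pds \<Gamma> (insert e E) b \<Gamma> E a id id"
proof (rule ccontr)
  assume no: "\<not> ?thesis"
  have E: "E \<subseteq> edges \<Gamma>" and Q: "qs \<Gamma> (leg \<Gamma>) \<mu> E a" using q by (auto simp: qd_def)
  have fin: "finite (verts \<Gamma>)" "finite (edges \<Gamma>)" "finite E" using wa E by (auto simp: well_attached_def intro: finite_subset)
  let ?V = "verts \<Gamma>" and ?S = "edges \<Gamma> - E" and ?g = "gam \<Gamma> \<mu> E a"
  have gV: "?g ?V = 0" by (rule qd_gam_verts[OF q wa \<mu>])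
  \<comment> \<open>\<open>card E\<close> is below the first Betti number, so the non-exceptional
    edges contain a cycle and one of them can be removed.\<close>
  have "card ?S = card (edges \<Gamma>) - card E" using E fin by (intro card_Diff_subset) auto
  then have "card ?V \<le> card ?S" using lt by simp
  then obtain e where e: "e \<in> ?S" "linked (ends \<Gamma>) ?V (?S - {e})"
    using linked_removable_edge[of ?S ?V "ends \<Gamma>"] fin leg wa linked_nonexceptional[OF wa leg q \<mu>]
    unfolding well_attached_def by (metis DiffD1 edge_like_ends empty_iff finite_Diff)
  define u w where "u = att \<Gamma> e False" and "w = att \<Gamma> e True"
  have uw: "ends \<Gamma> e = {u, w}" by (simp add: u_def w_def ends_eq)
  \<comment> \<open>Light sets are those that cannot afford the loss of \<open>1\<close> caused by
    subdividing an edge.\<close>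
  define light where "light X \<longleftrightarrow> X \<subset> ?V \<and> (?g X < 1 \<or> (leg \<Gamma> \<in> X \<and> ?g X \<le> 1))" for X
  have blocked: "\<exists>X. light X \<and> y \<in> X \<and> x \<notin> X" if f: "f \<in> ?S" "ends \<Gamma> f = {x, y}" for f x y
  proof (rule ccontr)
    assume *: "\<not> ?thesis"
    have "1 \<le> ?g X \<and> (leg \<Gamma> \<in> X \<longrightarrow> 1 < ?g X)" if X: "X \<subset> ?V" "y \<in> X" "x \<notin> X" for X
    proof -
      have "\<not> light X" using * X(2,3) by metis
      then show ?thesis using X(1) unfolding light_def by linarith
    qed
    then have "\<exists>b. qd d \<Gamma> \<mu> (insert f E) b \<and> pds \<Gamma> (insert f E) b \<Gamma> E a id id"
      using f by (intro qd_insert[OF wa q _ _ f(2)]) auto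
    then show False using no f(1) by auto
  qed
  obtain \<epsilon> where \<epsilon>: "\<epsilon> > 0" "\<forall>x\<in>?g ` Pow ?V. (0 < x \<longrightarrow> \<epsilon> \<le> x) \<and> (x < 1 \<longrightarrow> \<epsilon> \<le> 1 - x)"
    using perturbation[of "?g ` Pow ?V"] fin by auto
  define n where "n = real (card ?V)"
  have n: "n > 0" using fin leg by (auto simp: n_def card_gt_0_iff)
  \<comment> \<open>Both corrections are modular, so \<open>\<gamma>\<close> has the same
    submodularity defect as \<open>gam\<close>. They cancel on the set of all vertices, and they
    make the inequalities uniform: \<open>\<gamma>\<close> is nonnegative everywhere and below
    \<open>1\<close> on light sets, with or without the leg.\<close>
  define \<gamma> where "\<gamma> X = ?g X - \<epsilon> * of_bool (leg \<Gamma> \<in> X) + \<epsilon> * (real (card X) / n)" for X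
  have frac: "0 \<le> \<epsilon> * (real (card X) / n)" "\<epsilon> * (real (card X) / n) \<le> \<epsilon>" "X \<noteq> ?V \<Longrightarrow> \<epsilon> * (real (card X) / n) < \<epsilon>"
    if "X \<subseteq> ?V" for X
  proof -
    have "card X \<le> card ?V" using that fin by (simp add: card_mono)
    then show "0 \<le> \<epsilon> * (real (card X) / n)" "\<epsilon> * (real (card X) / n) \<le> \<epsilon>"
      using \<epsilon>(1) n by (auto simp: n_def divide_le_eq)
    assume "X \<noteq> ?V"
    then have "card X < card ?V" using that fin by (simp add: psubset_card_mono psubsetI)
    then have "real (card X) / n < 1" using n by (simp add: n_def)
    then show "\<epsilon> * (real (card X) / n) < \<epsilon>" using \<epsilon>(1) mult_strict_left_mono[of "real (card X) / n" 1 \<epsilon>] by linarith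
  qed
  have \<gamma>_nonneg: "0 \<le> \<gamma> X" if X: "X \<subseteq> ?V" for X
  proof (cases "X = ?V")
    case True
    then show ?thesis using gV leg n by (simp add: \<gamma>_def n_def)
  next
    case False
    then have X': "X \<subset> ?V" using X by blast
    show ?thesis
    proof (cases "leg \<Gamma> \<in> X")
      case True
      then have "\<epsilon> \<le> ?g X" using qsD(2)[OF Q X'] \<epsilon>(2) X by auto
      then show ?thesis using frac(1)[OF X] True by (simp add: \<gamma>_def)
    next
      case False
      then show ?thesis using qsD(1)[OF Q X'] frac(1)[OF X] by (simp add: \<gamma>_def)
    qed
  qed
  have \<gamma>_light: "\<gamma> X < 1" if X: "light X" for X
  proof -
    have XV: "X \<subset> ?V" using X by (simp add: light_def)
    have "?g X < 1 \<Longrightarrow> \<epsilon> \<le> 1 - ?g X" using \<epsilon>(2) XV by auto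
    moreover have "\<epsilon> * (real (card X) / n) < \<epsilon>" using frac(3)[of X] XV by blast
    ultimately show ?thesis using X unfolding \<gamma>_def light_def by (cases "leg \<Gamma> \<in> X") force+
  qed
  let ?M = "\<lambda>X Y. {f \<in> ?S. ends \<Gamma> f \<inter> (X - Y) \<noteq> {} \<and> ends \<Gamma> f \<inter> (Y - X) \<noteq> {}}"
  have sub: "\<gamma> X + \<gamma> Y = \<gamma> (X \<inter> Y) + \<gamma> (X \<union> Y) + real (card (?M X Y))" if XY: "X \<subseteq> ?V" "Y \<subseteq> ?V" for X Y
  proof -
    have f: "finite X" "finite Y" using XY fin finite_subset by blast+
    have "of_bool (leg \<Gamma> \<in> X) + of_bool (leg \<Gamma> \<in> Y) = (of_bool (leg \<Gamma> \<in> X \<inter> Y) + of_bool (leg \<Gamma> \<in> X \<union> Y) :: real)" by auto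
    then have 1: "\<epsilon> * of_bool (leg \<Gamma> \<in> X) + \<epsilon> * of_bool (leg \<Gamma> \<in> Y) = \<epsilon> * of_bool (leg \<Gamma> \<in> X \<inter> Y) + \<epsilon> * of_bool (leg \<Gamma> \<in> X \<union> Y)"
      by (simp only: distrib_left[symmetric])
    have "real (card X) + real (card Y) = real (card (X \<inter> Y)) + real (card (X \<union> Y))"
      using card_Un_Int[OF f] by simp
    then have 2: "\<epsilon> * (real (card X) / n) + \<epsilon> * (real (card Y) / n) = \<epsilon> * (real (card (X \<inter> Y)) / n) + \<epsilon> * (real (card (X \<union> Y)) / n)"
      by (simp only: distrib_left[symmetric] add_divide_distrib[symmetric])
    show ?thesis unfolding \<gamma>_def using gam_submodular[OF fin(2) f E, of \<mu> a] 1 2 by linarith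
  qed
  define U where "U = {X. X \<subset> ?V \<and> w \<in> X \<and> u \<notin> X}"
  have finU: "finite U" using fin by (auto simp: U_def intro: finite_subset[of _ "Pow ?V"])
  obtain X0 where X0: "light X0" "w \<in> X0" "u \<notin> X0" using blocked[OF e(1) uw] by blast
  then have "X0 \<in> U" by (simp add: U_def light_def)
  then obtain Z where Z: "Z \<in> U" "\<And>X. X \<in> U \<Longrightarrow> \<gamma> Z \<le> \<gamma> X"
    using finU by (metis arg_min_if_finite(1) arg_min_least empty_iff)
  have \<gamma>Z: "\<gamma> Z < 1" using Z(2)[OF \<open>X0 \<in> U\<close>] \<gamma>_light[OF X0(1)] by simp
  have ZV: "Z \<subset> ?V" "w \<in> Z" "u \<notin> Z" using Z(1) by (auto simp: U_def)
  then obtain f where f: "f \<in> ?S - {e}" "ends \<Gamma> f \<inter> Z \<noteq> {}" "ends \<Gamma> f - Z \<noteq> {}"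
    using linkedD[OF e(2), of Z] by auto
  then have "crosses \<Gamma> f Z" using crosses_iff[of \<Gamma> f Z] by simp
  then obtain x y where xy: "ends \<Gamma> f = {x, y}" "x \<in> Z" "y \<notin> Z"
    unfolding crosses_def ends_eq by (metis insert_commute)
  obtain W where W: "light W" "y \<in> W" "x \<notin> W" using blocked[of f x y] f(1) xy(1) by blast
  have WV: "W \<subset> ?V" using W(1) by (simp add: light_def)
  have \<gamma>W: "\<gamma> W < 1" by (rule \<gamma>_light[OF W(1)])
  have fM: "f \<in> ?M Z W" using f(1) xy W by auto
  have finM: "finite (?M Z W)" by (rule finite_subset[OF _ fin(2)]) blast
  have "0 < card (?M Z W)" unfolding card_gt_0_iff using fM finM by blast
  then have M1: "1 \<le> card (?M Z W)" by linarith
  have eq: "\<gamma> Z + \<gamma> W = \<gamma> (Z \<inter> W) + \<gamma> (Z \<union> W) + real (card (?M Z W))" using sub ZV WV by blast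
  have nn: "0 \<le> \<gamma> (Z \<inter> W)" "0 \<le> \<gamma> (Z \<union> W)" using \<gamma>_nonneg ZV WV by (blast, blast)
  \<comment> \<open>If \<open>w\<close> lies in \<open>W\<close>, the intersection competes with
    \<open>Z\<close>; if \<open>W\<close> contains neither end of \<open>e\<close>, the union does.
    Minimality of \<open>Z\<close> then cancels one term and leaves \<open>\<gamma> W\<close> at
    least \<open>1\<close>. If \<open>W\<close> contains only \<open>u\<close>, both
    \<open>e\<close> and \<open>f\<close> count, and the defect \<open>2\<close> exceeds
    \<open>\<gamma> Z + \<gamma> W\<close>.\<close>
  show False
  proof (cases "w \<in> W")
    case True
    then have "Z \<inter> W \<in> U" using ZV by (auto simp: U_def)
    then show False using Z(2) eq nn M1 \<gamma>W by fastforce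
  next
    case wW: False
    show False
    proof (cases "u \<in> W")
      case True
      then have "e \<in> ?M Z W" using e(1) uw ZV wW by auto
      then have "card {e, f} \<le> card (?M Z W)" using fM finM by (intro card_mono) auto
      moreover have "e \<noteq> f" using f(1) by auto
      ultimately have "2 \<le> card (?M Z W)" by simp
      then show False using eq nn \<gamma>W \<gamma>Z by linarith
    next
      case False
      have "u \<in> ?V" using uw e(1) wa by (auto simp: well_attached_def)
      then have "Z \<union> W \<in> U" using ZV WV False by (auto simp: U_def)
      then show False using Z(2) eq nn M1 \<gamma>W by fastforce
    qed
  qed
qed

section \<open>Expanding a vertex\<close>

lemma stable_graphs_expand:
  assumes oc: "one_contraction \<Gamma>' e u w \<Gamma>" and \<Gamma>: "\<Gamma> \<in> stable_graphs g"
    and wa: "well_attached \<Gamma>'" and leg: "leg \<Gamma>' \<in> verts \<Gamma>'" and st: "stable \<Gamma>'"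
  shows "\<Gamma>' \<in> stable_graphs g"
proof -
  have c: "finite_connected_graph \<Gamma>'" using fcg_oc[OF oc wa] stable_graphsD(1)[OF \<Gamma>] by simp
  then show ?thesis using genus_oc[OF oc c] \<Gamma> leg st by (simp add: stable_graphs_def)
qed

text \<open>A loop at \<open>v\<close> replaces one unit of weight; its two half-edges keep the
  stability sum of \<open>v\<close>.\<close>

lemma expand_weight:
  fixes \<Gamma> :: "('v, nat) wgraph"
  assumes fc: "finite_connected_graph \<Gamma>" and st: "stable \<Gamma>" and leg: "leg \<Gamma> \<in> verts \<Gamma>"
    and v: "v \<in> verts \<Gamma>" "0 < weight \<Gamma> v"
  shows "\<exists>\<Gamma>' e u w. one_contraction \<Gamma>' e u w \<Gamma> \<and> well_attached \<Gamma>' \<and> stable \<Gamma>' \<and> leg \<Gamma>' \<in> verts \<Gamma>'"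
proof -
  have wa: "well_attached \<Gamma>" using fc by (simp add: fcg_iff)
  have fin: "finite (edges \<Gamma>)" using wa by (simp add: well_attached_def)
  obtain e where e: "e \<notin> edges \<Gamma>" using fin infinite_UNIV_nat ex_new_if_finite by blast
  define \<Gamma>' where "\<Gamma>' = \<Gamma>\<lparr>edges := insert e (edges \<Gamma>), att := (att \<Gamma>)(e := \<lambda>_. v), weight := (weight \<Gamma>)(v := weight \<Gamma> v - 1)\<rparr>"
  have oc: "one_contraction \<Gamma>' e v v \<Gamma>"
    using e v by (auto simp: one_contraction_def \<Gamma>'_def merge_def)
  have wa': "well_attached \<Gamma>'"
    using wa e v unfolding well_attached_def \<Gamma>'_def by (auto simp: ends_def)
  have "stable \<Gamma>'"
    unfolding stable_def
  proof
    fix x assume x: "x \<in> verts \<Gamma>'"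
    then have xV: "x \<in> verts \<Gamma>" by (simp add: \<Gamma>'_def)
    have sx: "3 \<le> val \<Gamma> x + 2 * weight \<Gamma> x + (if x = leg \<Gamma> then 1 else 0)" using st xV by (simp add: stable_def)
    show "3 \<le> val \<Gamma>' x + 2 * weight \<Gamma>' x + (if x = leg \<Gamma>' then 1 else 0)"
    proof (cases "x = v")
      case True
      then show ?thesis using sx v(2) val_oc(3)[OF oc wa' v(1)] by (simp add: \<Gamma>'_def)
    next
      case False
      then show ?thesis using sx val_oc(1)[OF oc wa' xV] by (simp add: \<Gamma>'_def)
    qed
  qed
  moreover have "leg \<Gamma>' \<in> verts \<Gamma>'" using leg by (simp add: \<Gamma>'_def)
  ultimately show ?thesis using oc wa' by blast
qed

text \<open>Two half-edges of \<open>v\<close> move to a new vertex \<open>w\<close> of weight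
  \<open>0\<close>, joined to \<open>v\<close> by a new edge. Then \<open>w\<close> has valence
  \<open>3\<close>, and \<open>v\<close> loses just one, which the fourth half-edge or the leg
  allows.\<close>

lemma expand_valence:
  fixes \<Gamma> :: "(nat, nat) wgraph"
  assumes fc: "finite_connected_graph \<Gamma>" and st: "stable \<Gamma>" and leg: "leg \<Gamma> \<in> verts \<Gamma>"
    and v: "v \<in> verts \<Gamma>" "4 \<le> val \<Gamma> v + (if v = leg \<Gamma> then 1 else 0)"
  shows "\<exists>\<Gamma>' e u w. one_contraction \<Gamma>' e u w \<Gamma> \<and> well_attached \<Gamma>' \<and> stable \<Gamma>' \<and> leg \<Gamma>' \<in> verts \<Gamma>'"
proof -
  have wa: "well_attached \<Gamma>" using fc by (simp add: fcg_iff)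
  have fin: "finite (edges \<Gamma>)" "finite (verts \<Gamma>)" using wa by (auto simp: well_attached_def)
  obtain e where e: "e \<notin> edges \<Gamma>" using fin infinite_UNIV_nat ex_new_if_finite by blast
  obtain w where w: "w \<notin> verts \<Gamma>" using fin infinite_UNIV_nat ex_new_if_finite by blast
  have wv: "w \<noteq> v" "w \<noteq> leg \<Gamma>" using w v leg by auto
  have "2 \<le> card (halves \<Gamma> v)" using v(2) by (auto simp: val_halves split: if_splits)
  then obtain H where H: "H \<subseteq> halves \<Gamma> v" "card H = 2" by (metis obtain_subset_with_card_n)
  then have H': "\<And>x b. (x, b) \<in> H \<Longrightarrow> x \<in> edges \<Gamma> \<and> att \<Gamma> x b = v" by (auto simp: halves_def)
  have finH: "finite H" using H(2) card.infinite by fastforce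
  define \<Gamma>' where "\<Gamma>' = \<Gamma>\<lparr>verts := insert w (verts \<Gamma>), edges := insert e (edges \<Gamma>),
     att := (\<lambda>x b. if x = e then (if b then w else v) else if (x, b) \<in> H then w else att \<Gamma> x b),
     weight := (weight \<Gamma>)(w := 0)\<rparr>"
  have attG: "att \<Gamma> x b \<noteq> w" if "x \<in> edges \<Gamma>" for x b using att_in_verts[OF wa that] w by auto
  have oc: "one_contraction \<Gamma>' e v w \<Gamma>"
    unfolding one_contraction_def
  proof (intro conjI ballI allI)
    show "att \<Gamma> x b = merge v w (att \<Gamma>' x b)" if "x \<in> edges \<Gamma>" for x b
      using that e attG[OF that] H'[of x b] by (auto simp: \<Gamma>'_def)
    show "weight \<Gamma> x = (if x = v then if v = w then Suc (weight \<Gamma>' v) else weight \<Gamma>' v + weight \<Gamma>' w else weight \<Gamma>' x)"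
      if "x \<in> verts \<Gamma>" for x using that w wv by (auto simp: \<Gamma>'_def)
  qed (use e w wv in \<open>auto simp: \<Gamma>'_def\<close>)
  have wa': "well_attached \<Gamma>'"
    unfolding well_attached_def
  proof (intro conjI ballI)
    fix x assume "x \<in> edges \<Gamma>'"
    then have "att \<Gamma>' x b \<in> verts \<Gamma>'" for b using v att_in_verts[OF wa, of x b] by (auto simp: \<Gamma>'_def)
    then show "ends \<Gamma>' x \<subseteq> verts \<Gamma>'" by (auto simp: ends_def)
  qed (use fin in \<open>auto simp: \<Gamma>'_def\<close>)
  have "halves \<Gamma>' w = insert (e, True) H"
  proof (rule set_eqI)
    fix h :: "nat \<times> bool"
    obtain x b where h: "h = (x, b)" by (cases h)
    have "(x, b) \<in> halves \<Gamma>' w \<longleftrightarrow> x = e \<and> b \<or> x \<noteq> e \<and> x \<in> edges \<Gamma> \<and> (x, b) \<in> H"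
      using wv attG[of x b] by (cases b) (auto simp: halves_def \<Gamma>'_def)
    also have "\<dots> \<longleftrightarrow> (x, b) \<in> insert (e, True) H" using H'[of x b] e by auto
    finally show "h \<in> halves \<Gamma>' w \<longleftrightarrow> h \<in> insert (e, True) H" unfolding h .
  qed
  moreover have "(e, True) \<notin> H" using H' e by auto
  ultimately have valw: "val \<Gamma>' w = 3" using finH H(2) by (simp add: val_halves)
  have valv: "val \<Gamma>' v + 1 = val \<Gamma> v" using val_oc(2)[OF oc wa' v(1)] wv valw by simp
  have "stable \<Gamma>'"
    unfolding stable_def
  proof
    fix x assume x: "x \<in> verts \<Gamma>'"
    show "3 \<le> val \<Gamma>' x + 2 * weight \<Gamma>' x + (if x = leg \<Gamma>' then 1 else 0)"
    proof (cases "x = w")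
      case True
      then show ?thesis using valw by simp
    next
      case False
      then have xV: "x \<in> verts \<Gamma>" using x by (simp add: \<Gamma>'_def)
      have sx: "3 \<le> val \<Gamma> x + 2 * weight \<Gamma> x + (if x = leg \<Gamma> then 1 else 0)" using st xV by (simp add: stable_def)
      show ?thesis
      proof (cases "x = v")
        case True
        then show ?thesis using v(2) valv by (simp add: \<Gamma>'_def split: if_splits)
      next
        case False
        then show ?thesis using sx \<open>x \<noteq> w\<close> val_oc(1)[OF oc wa' xV] by (simp add: \<Gamma>'_def)
      qed
    qed
  qed
  moreover have "leg \<Gamma>' \<in> verts \<Gamma>'" using leg by (simp add: \<Gamma>'_def)
  ultimately show ?thesis using oc wa' by blast
qed

text \<open>If no vertex has positive weight or can be split, all stability excesses vanish, and
  \<open>stable_bound\<close> gives \<open>3g - 2\<close> edges already.\<close>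

lemma stable_graphs_expandable:
  fixes \<Gamma> :: "(nat, nat) wgraph"
  assumes \<Gamma>: "\<Gamma> \<in> stable_graphs g" and lt: "card (edges \<Gamma>) + 2 < 3 * g"
  shows "\<exists>\<Gamma>'\<in>stable_graphs g. \<exists>e u w. one_contraction \<Gamma>' e u w \<Gamma>"
proof -
  note s = stable_graphsD[OF \<Gamma>]
  have "\<exists>\<Gamma>' e u w. one_contraction \<Gamma>' e u w \<Gamma> \<and> well_attached \<Gamma>' \<and> stable \<Gamma>' \<and> leg \<Gamma>' \<in> verts \<Gamma>'"
  proof (cases "\<exists>v\<in>verts \<Gamma>. 0 < weight \<Gamma> v")
    case True
    then show ?thesis using expand_weight[OF s(1,4,3)] by blast
  next
    case False
    then have w0: "weight \<Gamma> v = 0" if "v \<in> verts \<Gamma>" for v using that by simp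
    have "\<exists>v\<in>verts \<Gamma>. 4 \<le> val \<Gamma> v + (if v = leg \<Gamma> then 1 else 0)"
    proof (rule ccontr)
      assume no: "\<not> ?thesis"
      have "(\<Sum>v\<in>verts \<Gamma>. int (val \<Gamma> v) + 2 * int (weight \<Gamma> v) + (if v = leg \<Gamma> then 1 else 0) - 3) \<le> 0"
      proof (rule sum_nonpos)
        fix v assume v: "v \<in> verts \<Gamma>"
        then have "\<not> 4 \<le> val \<Gamma> v + (if v = leg \<Gamma> then 1 else 0)" using no by blast
        then show "int (val \<Gamma> v) + 2 * int (weight \<Gamma> v) + (if v = leg \<Gamma> then 1 else 0) - 3 \<le> 0"
          using w0[OF v] by (auto split: if_splits)
      qed
      moreover have "(\<Sum>v\<in>verts \<Gamma>. int (weight \<Gamma> v)) = 0" using w0 by simp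
      ultimately show False using stable_bound[OF \<Gamma>] lt by linarith
    qed
    then show ?thesis using expand_valence[OF s(1,4,3)] by blast
  qed
  then show ?thesis using stable_graphs_expand[OF _ \<Gamma>] by blast
qed

section \<open>Flips of trivalent graphs\<close>

lemma pds_iso:
  assumes iso: "wgraph_iso \<Gamma> \<Gamma>' \<phi> \<psi>" and wa: "well_attached \<Gamma>" and E: "E \<subseteq> edges \<Gamma>"
    and a': "\<And>v. v \<in> verts \<Gamma> \<Longrightarrow> a' (\<phi> v) = a v"
  shows "pds \<Gamma> E a \<Gamma>' (\<psi> ` E) a' \<phi> (inv_into (edges \<Gamma>) \<psi>)"
proof -
  have \<phi>: "bij_betw \<phi> (verts \<Gamma>) (verts \<Gamma>')" and \<psi>: "inj_on \<psi> (edges \<Gamma>)"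
    using iso by (auto simp: wgraph_iso_def graph_iso_def bij_betw_def)
  have im: "inv_into (edges \<Gamma>) \<psi> ` \<psi> ` E = E" using \<psi> E by (rule inv_into_image_cancel)
  have "a' v' = (\<Sum>v\<in>{v \<in> verts \<Gamma>. \<phi> v = v'}. a v)" if v': "v' \<in> verts \<Gamma>'" for v'
  proof -
    have "v' \<in> \<phi> ` verts \<Gamma>" using v' \<phi> by (simp add: bij_betw_def)
    then obtain v where v: "v' = \<phi> v" "v \<in> verts \<Gamma>" by (rule imageE)
    then have "{v \<in> verts \<Gamma>. \<phi> v = v'} = {v}" using \<phi> by (auto simp: bij_betw_def inj_on_def)
    then show ?thesis using v a' by simp
  qed
  then show ?thesis
    unfolding pds_def im using wsp_iso[OF iso wa]
    by (auto intro!: exI[of _ "\<lambda>x. att \<Gamma> x False"])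
qed

text \<open>Sorting by neighbour swaps: each entry of \<open>ys\<close> in turn is moved to the
  front, and the prefix \<open>pre\<close> records the part already in place.\<close>

lemma closed_under_permutation:
  assumes swap: "\<And>xs a b ys. Q (xs @ a # b # ys) \<Longrightarrow> Q (xs @ b # a # ys)"
    and "mset xs = mset ys" "Q xs"
  shows "Q ys"
proof -
  have front: "Q (pre @ y # xs1 @ xs2)" if "Q (pre @ xs1 @ y # xs2)" for pre xs1 y xs2
    using that
  proof (induction xs1 arbitrary: xs2 rule: rev_induct)
    case (snoc x xs1)
    then have "Q ((pre @ xs1) @ x # y # xs2)" by simp
    then have "Q ((pre @ xs1) @ y # x # xs2)" by (rule swap)
    then show ?case using snoc.IH[of "x # xs2"] by simp
  qed simp
  have "Q (pre @ ys)" if "Q (pre @ xs)" "mset xs = mset ys" for pre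
    using that
  proof (induction ys arbitrary: pre xs)
    case (Cons y ys)
    then have "y \<in> set xs" by (metis list.set_intros(1) set_mset_mset)
    then obtain xs1 xs2 where xs: "xs = xs1 @ y # xs2" by (auto simp: in_set_conv_decomp)
    then have "Q ((pre @ [y]) @ xs1 @ xs2)" using front[of pre xs1 y xs2] Cons.prems(1) by simp
    moreover have "mset (xs1 @ xs2) = mset ys" using Cons.prems(2) xs by simp
    ultimately have "Q ((pre @ [y]) @ ys)" by (rule Cons.IH)
    then show ?case by simp
  qed simp
  from this[of "[]"] show ?thesis using assms by simp
qed

section \<open>Objects of the universal poset, top objects and flips\<close>

locale universal_pol =
  fixes g :: nat and d :: int and \<mu> :: "(nat, nat) wgraph \<Rightarrow> nat \<Rightarrow> real"
  assumes g: "g \<ge> 1" and univ: "universal_polarization g d \<mu>"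
begin

lemma mu_total: "\<Gamma> \<in> stable_graphs g \<Longrightarrow> (\<Sum>v\<in>verts \<Gamma>. \<mu> \<Gamma> v) = real_of_int d"
  using univ by (simp add: universal_polarization_def)

lemma mu_push:
  assumes "\<Gamma> \<in> stable_graphs g" "\<Gamma>' \<in> stable_graphs g" "wsp \<Gamma> \<Gamma>' \<phi> \<epsilon>" "v' \<in> verts \<Gamma>'"
  shows "\<mu> \<Gamma>' v' = (\<Sum>v\<in>{v \<in> verts \<Gamma>. \<phi> v = v'}. \<mu> \<Gamma> v)"
  using univ assms wspecialization_iff[OF stable_graphsD(2)[OF assms(1)], of \<Gamma>' \<phi> \<epsilon>]
  unfolding universal_polarization_def pushforward_def by blast

definition obj :: "(nat, nat) wgraph \<Rightarrow> nat set \<Rightarrow> (nat \<Rightarrow> int) \<Rightarrow> bool" where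
  "obj \<Gamma> E a \<longleftrightarrow> \<Gamma> \<in> stable_graphs g \<and> qd d \<Gamma> (\<mu> \<Gamma>) E a"

lemma objD:
  assumes "obj \<Gamma> E a"
  shows "\<Gamma> \<in> stable_graphs g" "qd d \<Gamma> (\<mu> \<Gamma>) E a" "E \<subseteq> edges \<Gamma>" "well_attached \<Gamma>" "leg \<Gamma> \<in> verts \<Gamma>"
    "finite (edges \<Gamma>)" "finite E" "finite (verts \<Gamma>)"
  using assms stable_graphsD[of \<Gamma> g] by (auto simp: obj_def qd_def well_attached_def intro: finite_subset)

lemma obj_pds:
  assumes o: "obj \<Gamma> E a" and \<Gamma>': "\<Gamma>' \<in> stable_graphs g" and E': "E' \<subseteq> edges \<Gamma>'" and p: "pds \<Gamma> E a \<Gamma>' E' a' \<phi> \<epsilon>"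
  shows "obj \<Gamma>' E' a'"
proof -
  have "wsp \<Gamma> \<Gamma>' \<phi> \<epsilon>" using p by (simp add: pds_def)
  note push = mu_push[OF objD(1)[OF o] \<Gamma>' this]
  show ?thesis using \<Gamma>' qd_pds[OF p objD(2)[OF o] objD(4)[OF o] E' objD(5)[OF o] push] by (simp add: obj_def)
qed

lemma obj_lift:
  assumes oc: "one_contraction \<Gamma> e u w \<Gamma>'" and \<Gamma>: "\<Gamma> \<in> stable_graphs g" and o: "obj \<Gamma>' E a"
  shows "\<exists>b. obj \<Gamma> E b \<and> pds \<Gamma> E b \<Gamma>' E a (merge u w) id"
proof -
  note s = stable_graphsD[OF \<Gamma>]
  show ?thesis
    using qd_lift[OF oc s(2,3) objD(2)[OF o] mu_total[OF objD(1)[OF o]]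
        mu_push[OF \<Gamma> objD(1)[OF o] wsp_oc[OF oc s(2)]]] \<Gamma> by (auto simp: obj_def)
qed

text \<open>The first bound comes from connectedness outside \<open>E\<close>, the second from
  stability; their sum gives \<open>4g - 2\<close>, attained only with zero weights.\<close>

lemma obj_bounds:
  assumes o: "obj \<Gamma> E a"
  shows "(\<Sum>v\<in>verts \<Gamma>. int (weight \<Gamma> v)) + int (card E) \<le> int g"
    "(\<Sum>v\<in>verts \<Gamma>. int (weight \<Gamma> v)) + int (card (edges \<Gamma>)) + 2 \<le> 3 * int g"
    "card (edges \<Gamma>) + card E \<le> 4 * g - 2"
proof -
  note s = objD[OF o]
  have "card E + card (verts \<Gamma>) \<le> card (edges \<Gamma>) + 1"
    by (rule card_exceptional_le[OF s(4,5,2) mu_total[OF s(1)]])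
  then show 1: "(\<Sum>v\<in>verts \<Gamma>. int (weight \<Gamma> v)) + int (card E) \<le> int g"
    using stable_graphsD(5)[OF s(1)] by linarith
  show 2: "(\<Sum>v\<in>verts \<Gamma>. int (weight \<Gamma> v)) + int (card (edges \<Gamma>)) + 2 \<le> 3 * int g"
    by (rule stable_edges_le[OF s(1)])
  have "0 \<le> (\<Sum>v\<in>verts \<Gamma>. int (weight \<Gamma> v))" by (simp add: sum_nonneg)
  then show "card (edges \<Gamma>) + card E \<le> 4 * g - 2" using 1 2 by linarith
qed

definition top_obj :: "(nat, nat) wgraph \<times> nat set \<times> (nat \<Rightarrow> int) \<Rightarrow> bool" where
  "top_obj = (\<lambda>(\<Gamma>, E, a). obj \<Gamma> E a \<and> card (edges \<Gamma>) + card E = 4 * g - 2)"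

text \<open>Equality in both bounds leaves no weight and no stability excess, so every vertex is
  trivalent when the leg is counted.\<close>

lemma topD:
  assumes t: "top_obj (\<Gamma>, E, a)"
  shows "obj \<Gamma> E a" "card E = g" "card (edges \<Gamma>) = 3 * g - 2" "card (verts \<Gamma>) = 2 * g - 1"
    "\<And>v. v \<in> verts \<Gamma> \<Longrightarrow> weight \<Gamma> v = 0"
    "\<And>v. v \<in> verts \<Gamma> \<Longrightarrow> val \<Gamma> v + (if v = leg \<Gamma> then 1 else 0) = 3"
proof -
  show o: "obj \<Gamma> E a" using t by (simp add: top_obj_def)
  have c: "card (edges \<Gamma>) + card E = 4 * g - 2" using t by (simp add: top_obj_def)
  note s = objD[OF o] and b = obj_bounds[OF o]
  have nn: "0 \<le> (\<Sum>v\<in>verts \<Gamma>. int (weight \<Gamma> v))" by (simp add: sum_nonneg)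
  have W: "(\<Sum>v\<in>verts \<Gamma>. int (weight \<Gamma> v)) = 0" and E: "card E = g" and e: "card (edges \<Gamma>) = 3 * g - 2"
    using b nn c g by linarith+
  show "card E = g" "card (edges \<Gamma>) = 3 * g - 2" by fact+
  show "card (verts \<Gamma>) = 2 * g - 1" using stable_graphsD(5)[OF s(1)] W e g by linarith
  show w: "weight \<Gamma> v = 0" if "v \<in> verts \<Gamma>" for v
    using W sum_nonneg_eq_0_iff[OF s(8), of "\<lambda>v. int (weight \<Gamma> v)"] that by simp
  have "(\<Sum>v\<in>verts \<Gamma>. int (val \<Gamma> v) + 2 * int (weight \<Gamma> v) + (if v = leg \<Gamma> then 1 else 0) - 3) = 0"
    using stable_bound[OF s(1)] W e g by linarith
  then have "\<forall>v\<in>verts \<Gamma>. int (val \<Gamma> v) + 2 * int (weight \<Gamma> v) + (if v = leg \<Gamma> then 1 else 0) - 3 = 0"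
    by (subst (asm) sum_nonneg_eq_0_iff[OF s(8) stable_excess_nonneg[OF s(1)]])
  then show "val \<Gamma> v + (if v = leg \<Gamma> then 1 else 0) = 3" if "v \<in> verts \<Gamma>" for v
    using w that by (force split: if_splits)
qed

text \<open>\<open>common\<close> is a step through an element of codimension one;
  \<open>iso\<close> changes only the representative and becomes an equality in the
  quotient.\<close>

inductive adj :: "(nat, nat) wgraph \<times> nat set \<times> (nat \<Rightarrow> int) \<Rightarrow> (nat, nat) wgraph \<times> nat set \<times> (nat \<Rightarrow> int) \<Rightarrow> bool" where
  common: "top_obj (\<Gamma>, E, a) \<Longrightarrow> top_obj (\<Gamma>', E', a') \<Longrightarrow> obj \<Delta> F b \<Longrightarrow> Suc (card (edges \<Delta>) + card F) = 4 * g - 2 \<Longrightarrow>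
     pds \<Gamma> E a \<Delta> F b \<phi> \<epsilon> \<Longrightarrow> pds \<Gamma>' E' a' \<Delta> F b \<phi>' \<epsilon>' \<Longrightarrow> adj (\<Gamma>, E, a) (\<Gamma>', E', a')"
| iso: "top_obj (\<Gamma>, E, a) \<Longrightarrow> top_obj (\<Gamma>', \<psi> ` E, a') \<Longrightarrow> wgraph_iso \<Gamma> \<Gamma>' \<phi> \<psi> \<Longrightarrow> (\<And>v. v \<in> verts \<Gamma> \<Longrightarrow> a' (\<phi> v) = a v) \<Longrightarrow>
     adj (\<Gamma>, E, a) (\<Gamma>', \<psi> ` E, a')"

definition swap_halves :: "(nat, nat) wgraph \<Rightarrow> nat \<times> bool \<Rightarrow> nat \<times> bool \<Rightarrow> (nat, nat) wgraph" where
  "swap_halves \<Gamma> p q = \<Gamma>\<lparr>att := (\<lambda>x b. if (x, b) = p then att \<Gamma> (fst q) (snd q)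
     else if (x, b) = q then att \<Gamma> (fst p) (snd p) else att \<Gamma> x b)\<rparr>"

lemma swap_halves_simps [simp]:
  "verts (swap_halves \<Gamma> p q) = verts \<Gamma>" "edges (swap_halves \<Gamma> p q) = edges \<Gamma>"
  "leg (swap_halves \<Gamma> p q) = leg \<Gamma>" "weight (swap_halves \<Gamma> p q) = weight \<Gamma>"
  by (simp_all add: swap_halves_def)

lemma att_swap_halves:
  "att (swap_halves \<Gamma> p q) x b = (if (x, b) = p then att \<Gamma> (fst q) (snd q)
     else if (x, b) = q then att \<Gamma> (fst p) (snd p) else att \<Gamma> x b)"
  by (simp add: swap_halves_def)

lemma swap_halves_sym: "swap_halves \<Gamma> p q = swap_halves \<Gamma> q p"
  by (auto simp: swap_halves_def fun_eq_iff intro!: arg_cong[where f = "\<lambda>t. \<Gamma>\<lparr>att := t\<rparr>"])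

text \<open>Merging \<open>u\<close> and \<open>w\<close> forgets at which of them a half-edge sits,
  so the graph and its swapped version contract to the same graph. The divisor pushed forward to it
  lifts to the swapped graph by \<open>obj_lift\<close>.\<close>

lemma flip:
  assumes t: "top_obj (\<Gamma>, E, a)" and e: "e \<in> edges \<Gamma>" "e \<notin> E" and u: "att \<Gamma> e False = u" and w: "att \<Gamma> e True = w"
    and ne: "u \<noteq> w" and p: "p \<in> halves \<Gamma> u" "fst p \<noteq> e" and q: "q \<in> halves \<Gamma> w" "fst q \<noteq> e"
  shows "\<exists>a'. top_obj (swap_halves \<Gamma> p q, E, a') \<and> adj (\<Gamma>, E, a) (swap_halves \<Gamma> p q, E, a')"
proof -
  note o = topD(1)[OF t]
  note s = objD[OF o]
  let ?\<Gamma>' = "swap_halves \<Gamma> p q"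
  define \<Delta> where "\<Delta> = contract_edge \<Gamma> e"
  have pq: "att \<Gamma> (fst p) (snd p) = u" "att \<Gamma> (fst q) (snd q) = w" "fst p \<in> edges \<Gamma>" "fst q \<in> edges \<Gamma>"
    using p q by (auto simp: halves_def)
  have pnq: "p \<noteq> q" using pq ne by auto
  have oc: "one_contraction \<Gamma> e u w \<Delta>"
    using one_contraction_contract_edge[OF e(1)] u w by (simp add: \<Delta>_def)
  have att': "att ?\<Gamma>' x b = (if (x, b) = p then w else if (x, b) = q then u else att \<Gamma> x b)" for x b
    by (simp add: att_swap_halves pq)
  have oc': "one_contraction ?\<Gamma>' e u w \<Delta>"
    unfolding one_contraction_def
  proof (intro conjI ballI allI)
    show "att ?\<Gamma>' e False = u" "att ?\<Gamma>' e True = w" using p q u w by (auto simp: att')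
    show "att \<Delta> x b = merge u w (att ?\<Gamma>' x b)" if "x \<in> edges \<Delta>" for x b
    proof -
      have "att \<Delta> x b = merge u w (att \<Gamma> x b)" using oc_att[OF oc s(4) that] .
      then show ?thesis using pq by (auto simp: att' merge_def)
    qed
  qed (use oc in \<open>auto simp: one_contraction_def\<close>)
  have \<Delta>: "\<Delta> \<in> stable_graphs g" by (rule stable_graphs_oc[OF oc s(1)])
  have uw: "u \<in> verts \<Gamma>" "w \<in> verts \<Gamma>" by (rule oc_uw[OF oc s(4)])+
  have wa': "well_attached ?\<Gamma>'"
    using s(4,6,8) uw att_in_verts[OF s(4)] by (auto simp: well_attached_def ends_eq att')
  have fh: "finite (halves \<Gamma> v)" for v by (rule finite_halves[OF s(6)])
  have valu: "val ?\<Gamma>' u = val \<Gamma> u"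
  proof -
    have "halves ?\<Gamma>' u = insert q (halves \<Gamma> u - {p})"
      using pq pnq ne by (auto simp: halves_def att' split: if_splits)
    moreover have "q \<notin> halves \<Gamma> u" using pq ne by (auto simp: halves_def)
    ultimately show ?thesis using p(1) fh card_Suc_Diff1[OF fh p(1)] by (simp add: val_halves)
  qed
  have valw: "val ?\<Gamma>' w = val \<Gamma> w"
  proof -
    have "halves ?\<Gamma>' w = insert p (halves \<Gamma> w - {q})"
      using pq pnq ne by (auto simp: halves_def att' split: if_splits)
    moreover have "p \<notin> halves \<Gamma> w" using pq ne by (auto simp: halves_def)
    ultimately show ?thesis using q(1) fh card_Suc_Diff1[OF fh q(1)] by (simp add: val_halves)
  qed
  have valv: "val ?\<Gamma>' v = val \<Gamma> v" if "v \<noteq> u" "v \<noteq> w" for v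
  proof -
    have "halves ?\<Gamma>' v = halves \<Gamma> v" using pq that by (auto simp: halves_def att' split: if_splits)
    then show ?thesis by (simp add: val_halves)
  qed
  have "val ?\<Gamma>' v = val \<Gamma> v" for v using valu valw valv by metis
  then have "stable ?\<Gamma>'" using stable_graphsD(4)[OF s(1)] by (simp add: stable_def)
  then have \<Gamma>': "?\<Gamma>' \<in> stable_graphs g"
    using stable_graphs_expand[OF oc' \<Delta> wa'] s(5) by simp
  define b where "b v = (\<Sum>x\<in>{x \<in> verts \<Gamma>. merge u w x = v}. a x)" for v
  have pd: "pds \<Gamma> E a \<Delta> E b (merge u w) id" unfolding b_def by (rule pds_contract[OF oc s(4)])
  have E\<Delta>: "E \<subseteq> edges \<Delta>" using s(3) e(2) oc_simps(4)[OF oc s(4)] by auto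
  have ob: "obj \<Delta> E b" by (rule obj_pds[OF o \<Delta> E\<Delta> pd])
  obtain a' where a': "obj ?\<Gamma>' E a'" "pds ?\<Gamma>' E a' \<Delta> E b (merge u w) id"
    using obj_lift[OF oc' \<Gamma>' ob] by blast
  have t': "top_obj (?\<Gamma>', E, a')" using a'(1) t by (simp add: top_obj_def)
  have "Suc (card (edges \<Delta>)) = card (edges \<Gamma>)"
    using card_Suc_Diff1[OF s(6) e(1)] oc_simps(4)[OF oc s(4)] by simp
  then have "Suc (card (edges \<Delta>) + card E) = 4 * g - 2" using t by (simp add: top_obj_def)
  then have "adj (\<Gamma>, E, a) (?\<Gamma>', E, a')" using adj.common[OF t t' ob _ pd a'(2)] by blast
  then show ?thesis using t' by blast
qed

section \<open>Hamiltonian paths\<close>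

text \<open>\<open>conf\<close> describes a path \<open>vs\<close> of non-exceptional edges \<open>es\<close> starting at the leg, together
  with a list \<open>hs\<close> of the half-edges at the path that do not belong to \<open>es\<close>: one at every
  vertex and two at the last one.  Flipping an edge of the path swaps neighbours in \<open>hs\<close>.\<close>

definition conf :: "(nat, nat) wgraph \<Rightarrow> nat set \<Rightarrow> nat list \<Rightarrow> nat list \<Rightarrow> (nat \<times> bool) list \<Rightarrow> bool" where
  "conf \<Gamma> E vs es hs \<longleftrightarrow> length vs = Suc (length es) \<and> length hs = Suc (Suc (length es)) \<and>
     distinct vs \<and> distinct es \<and> distinct hs \<and> vs ! 0 = leg \<Gamma> \<and> set vs \<subseteq> verts \<Gamma> \<and> set es \<subseteq> edges \<Gamma> - E \<and>
     (\<forall>i<length es. ends \<Gamma> (es ! i) = {vs ! i, vs ! Suc i}) \<and>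
     (\<forall>i<length hs. fst (hs ! i) \<in> edges \<Gamma> - set es \<and>
        att \<Gamma> (fst (hs ! i)) (snd (hs ! i)) = vs ! min i (length es))"

lemma confD:
  assumes "conf \<Gamma> E vs es hs"
  shows "length vs = Suc (length es)" "length hs = Suc (Suc (length es))" "distinct vs" "distinct es" "distinct hs"
    "vs ! 0 = leg \<Gamma>" "set vs \<subseteq> verts \<Gamma>" "set es \<subseteq> edges \<Gamma> - E"
    "\<And>i. i < length es \<Longrightarrow> ends \<Gamma> (es ! i) = {vs ! i, vs ! Suc i}"
    "\<And>i. i < length hs \<Longrightarrow> fst (hs ! i) \<in> edges \<Gamma> - set es"
    "\<And>i. i < length hs \<Longrightarrow> att \<Gamma> (fst (hs ! i)) (snd (hs ! i)) = vs ! min i (length es)"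
  using assms by (auto simp: conf_def)

lemma conf_ends:
  assumes c: "conf \<Gamma> E vs es hs" and "f \<in> set es"
  shows "ends \<Gamma> f \<subseteq> set vs"
proof -
  obtain i where "f = es ! i" "i < length es" using assms(2) by (metis in_set_conv_nth)
  then show ?thesis using confD(1,9)[OF c] by auto
qed

lemma conf_half:
  assumes c: "conf \<Gamma> E vs es hs" and "h \<in> set hs"
  shows "fst h \<in> edges \<Gamma> - set es" "att \<Gamma> (fst h) (snd h) \<in> set vs"
proof -
  obtain i where i: "h = hs ! i" "i < length hs" using assms(2) by (metis in_set_conv_nth)
  then show "fst h \<in> edges \<Gamma> - set es" using confD(10)[OF c] by blast
  have "min i (length es) < length vs" using confD(1)[OF c] by simp
  then show "att \<Gamma> (fst h) (snd h) \<in> set vs" using confD(11)[OF c i(2)] i(1) by simp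
qed

text \<open>Trivalence gives \<open>3 * length vs - 1\<close> half-edges at the path, the
  \<open>1\<close> being the leg, and the path edges use \<open>2 * length es\<close> of them. The
  \<open>length es + 2\<close> left over are as many as \<open>hs\<close> has entries.\<close>

lemma conf_halves:
  assumes t: "top_obj (\<Gamma>, E, a)" and c: "conf \<Gamma> E vs es hs"
  shows "set hs = {(x, b). x \<in> edges \<Gamma> - set es \<and> att \<Gamma> x b \<in> set vs}"
proof -
  note s = objD[OF topD(1)[OF t]] and cd = confD[OF c]
  let ?H = "{(x, b). x \<in> edges \<Gamma> \<and> att \<Gamma> x b \<in> set vs}" and ?A = "{(x, b). x \<in> edges \<Gamma> - set es \<and> att \<Gamma> x b \<in> set vs}"
  have H: "?H = (\<Union>v\<in>set vs. halves \<Gamma> v)" by (auto simp: halves_def)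
  have leg: "leg \<Gamma> \<in> set vs" using cd(1,6) by (metis nth_mem zero_less_Suc)
  have "card ?H = (\<Sum>v\<in>set vs. val \<Gamma> v)"
    unfolding H val_halves by (rule card_UN_disjoint) (use finite_halves[OF s(6)] in \<open>auto simp: halves_def\<close>)
  then have "card ?H + 1 = (\<Sum>v\<in>set vs. val \<Gamma> v + (if v = leg \<Gamma> then 1 else 0))"
    using leg by (simp add: sum.distrib)
  also have "\<dots> = (\<Sum>v\<in>set vs. 3)"
  proof (rule sum.cong[OF refl])
    fix v assume "v \<in> set vs"
    then show "val \<Gamma> v + (if v = leg \<Gamma> then 1 else 0) = 3" using topD(6)[OF t, of v] cd(7) by blast
  qed
  also have "\<dots> = 3 * length vs" using distinct_card[OF cd(3)] by simp
  finally have cH: "card ?H = 3 * length es + 2" using cd(1) by simp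
  have sub: "set es \<times> UNIV \<subseteq> ?H"
  proof
    fix h :: "nat \<times> bool" assume h: "h \<in> set es \<times> UNIV"
    then have "ends \<Gamma> (fst h) \<subseteq> set vs" by (intro conf_ends[OF c]) auto
    then have "att \<Gamma> (fst h) (snd h) \<in> set vs" using att_in_ends[of \<Gamma> "fst h" "snd h"] by blast
    then show "h \<in> ?H" using h cd(8) by auto
  qed
  have A: "?A = ?H - set es \<times> UNIV" by auto
  have fA: "finite ?H" unfolding H using finite_halves[OF s(6)] by simp
  have "card (set es \<times> (UNIV :: bool set)) = 2 * length es" using distinct_card[OF cd(4)] by (simp add: card_cartesian_product)
  then have "card ?A = length es + 2" unfolding A using card_Diff_subset[OF _ sub] cH by simp
  moreover have "card (set hs) = length es + 2" using distinct_card[OF cd(5)] cd(2) by simp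
  moreover have "set hs \<subseteq> ?A"
    using conf_half[OF c] by (auto simp: case_prod_beta)
  ultimately show ?thesis using fA A by (intro card_subset_eq) auto
qed

text \<open>Neighbours in \<open>hs\<close> sit at the two ends of a path edge, which is flipped.
  Only the last two entries share a vertex, and for them the graph stays as it is.\<close>

lemma conf_swap:
  assumes t: "top_obj (\<Gamma>, E, a)" and c: "conf \<Gamma> E vs es (xs @ p # q # ys)"
  shows "\<exists>\<Gamma>' a'. adj\<^sup>*\<^sup>* (\<Gamma>, E, a) (\<Gamma>', E, a') \<and> top_obj (\<Gamma>', E, a') \<and> conf \<Gamma>' E vs es (xs @ q # p # ys) \<and>
     edges \<Gamma>' = edges \<Gamma> \<and> verts \<Gamma>' = verts \<Gamma> \<and> (\<forall>x b. (x, b) \<notin> {p, q} \<longrightarrow> att \<Gamma>' x b = att \<Gamma> x b)"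
proof -
  note cd = confD[OF c] and s = objD[OF topD(1)[OF t]]
  let ?hs = "xs @ p # q # ys" and ?hs' = "xs @ q # p # ys"
  define i where "i = length xs"
  have i: "i < length ?hs" "Suc i < length ?hs" "?hs ! i = p" "?hs ! Suc i = q" by (auto simp: i_def nth_append)
  have i': "?hs' ! i = q" "?hs' ! Suc i = p" by (auto simp: i_def nth_append)
  have other: "?hs' ! j = ?hs ! j" if "j \<noteq> i" "j \<noteq> Suc i" for j
    using that by (auto simp: i_def nth_append nth_Cons' )
  have il: "i \<le> length es" using i(2) cd(2) by simp
  have p: "fst p \<in> edges \<Gamma> - set es" "att \<Gamma> (fst p) (snd p) = vs ! i" using cd(10,11)[OF i(1)] i(3) il by auto
  have q: "fst q \<in> edges \<Gamma> - set es" "att \<Gamma> (fst q) (snd q) = vs ! min (Suc i) (length es)" using cd(10,11)[OF i(2)] i(4) by auto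
  have pq: "p \<noteq> q" using cd(5) by auto
  show ?thesis
  proof (cases "i = length es")
    case True
    have "conf \<Gamma> E vs es ?hs'"
      unfolding conf_def
    proof (intro conjI allI impI)
      fix j assume j: "j < length ?hs'"
      consider "j = i" | "j = Suc i" | "j \<noteq> i" "j \<noteq> Suc i" by blast
      then show "fst (?hs' ! j) \<in> edges \<Gamma> - set es" 
        using cd(10)[of j] j p q i' other[of j] by cases auto
      consider "j = i" | "j = Suc i" | "j \<noteq> i" "j \<noteq> Suc i" by blast
      then show "att \<Gamma> (fst (?hs' ! j)) (snd (?hs' ! j)) = vs ! min j (length es)"
        using cd(11)[of j] j p q i' other[of j] True by cases auto
    qed (use cd in auto)
    then show ?thesis using t by blast
  next
    case False
    then have il: "i < length es" using il by simp
    let ?e = "es ! i"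
    have e: "?e \<in> edges \<Gamma>" "?e \<notin> E" using cd(8) il by (auto dest: nth_mem)
    have ne: "vs ! i \<noteq> vs ! Suc i" using cd(1,3) il by (simp add: nth_eq_iff_index_eq)
    have en: "{att \<Gamma> ?e False, att \<Gamma> ?e True} = {vs ! i, vs ! Suc i}" using cd(9)[OF il] by (simp add: ends_eq)
    have q2: "att \<Gamma> (fst q) (snd q) = vs ! Suc i" using q(2) il by (simp add: min_def)
    have nep: "fst p \<noteq> ?e" "fst q \<noteq> ?e" using p(1) q(1) il by auto
    have ph: "p \<in> halves \<Gamma> (vs ! i)" "q \<in> halves \<Gamma> (vs ! Suc i)" using p q q2 by (auto simp: halves_def case_prod_beta)
    let ?\<Gamma>' = "swap_halves \<Gamma> p q"
    \<comment> \<open>\<open>flip\<close> orients the edge by its half-edge labels; for the opposite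
      orientation \<open>p\<close> and \<open>q\<close> exchange their roles.\<close>
    have "\<exists>a'. top_obj (?\<Gamma>', E, a') \<and> adj (\<Gamma>, E, a) (?\<Gamma>', E, a')"
    proof (cases "att \<Gamma> ?e False = vs ! i")
      case True
      then have "att \<Gamma> ?e True = vs ! Suc i" using en ne by (auto simp: doubleton_eq_iff)
      from flip[OF t e True this ne ph(1) nep(1) ph(2) nep(2)] show ?thesis .
    next
      case False
      then have a: "att \<Gamma> ?e False = vs ! Suc i" "att \<Gamma> ?e True = vs ! i" using en by (auto simp: doubleton_eq_iff)
      from flip[OF t e a ne[symmetric] ph(2) nep(2) ph(1) nep(1)] show ?thesis
        unfolding swap_halves_sym[of \<Gamma> q p] .
    qed
    then obtain a' where a': "top_obj (?\<Gamma>', E, a')" "adj (\<Gamma>, E, a) (?\<Gamma>', E, a')" by blast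
    have att': "att ?\<Gamma>' x b = (if (x, b) = p then vs ! Suc i else if (x, b) = q then vs ! i else att \<Gamma> x b)" for x b
      by (simp add: att_swap_halves p q2)
    have "conf ?\<Gamma>' E vs es ?hs'"
      unfolding conf_def
    proof (intro conjI allI impI)
      fix j assume j: "j < length es"
      then have "es ! j \<noteq> fst p" "es ! j \<noteq> fst q" using p(1) q(1) by (auto dest: nth_mem)
      then have "ends ?\<Gamma>' (es ! j) = ends \<Gamma> (es ! j)" by (auto simp: ends_eq att')
      then show "ends ?\<Gamma>' (es ! j) = {vs ! j, vs ! Suc j}" using cd(9)[OF j] by simp
    next
      fix j assume j: "j < length ?hs'"
      consider "j = i" | "j = Suc i" | "j \<noteq> i" "j \<noteq> Suc i" by blast
      then show "fst (?hs' ! j) \<in> edges ?\<Gamma>' - set es" 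
        using cd(10)[of j] j p q i' other[of j] by cases auto
      consider "j = i" | "j = Suc i" | "j \<noteq> i" "j \<noteq> Suc i" by blast
      then show "att ?\<Gamma>' (fst (?hs' ! j)) (snd (?hs' ! j)) = vs ! min j (length es)"
      proof cases
        case 1
        then show ?thesis using il pq i' by (simp add: att')
      next
        case 2
        then show ?thesis using il i' by (simp add: att' min_def)
      next
        case 3
        have "j < length ?hs" using j by simp
        then have "?hs ! j \<noteq> ?hs ! i" "?hs ! j \<noteq> ?hs ! Suc i"
          using 3 nth_eq_iff_index_eq[OF cd(5) _ i(1), of j] nth_eq_iff_index_eq[OF cd(5) _ i(2), of j] by blast+
        then have "?hs ! j \<noteq> p" "?hs ! j \<noteq> q" unfolding i(3,4) by blast+
        then show ?thesis using cd(11)[of j] j other[OF 3] by (simp add: att')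
      qed
    qed (use cd in auto)
    moreover have "\<forall>x b. (x, b) \<notin> {p, q} \<longrightarrow> att ?\<Gamma>' x b = att \<Gamma> x b" by (simp add: att')
    ultimately show ?thesis using a' by (intro exI[of _ ?\<Gamma>'] exI[of _ a'] conjI) auto
  qed
qed

text \<open>That \<open>att\<close> changes only on the listed half-edges is carried along, since
  extending a path needs the far end of an edge to stay in place.\<close>

lemma conf_permute:
  assumes t: "top_obj (\<Gamma>, E, a)" and c: "conf \<Gamma> E vs es hs" and hs': "mset hs = mset hs'"
  shows "\<exists>\<Gamma>' a'. adj\<^sup>*\<^sup>* (\<Gamma>, E, a) (\<Gamma>', E, a') \<and> top_obj (\<Gamma>', E, a') \<and> conf \<Gamma>' E vs es hs' \<and>
     edges \<Gamma>' = edges \<Gamma> \<and> verts \<Gamma>' = verts \<Gamma> \<and> (\<forall>x b. (x, b) \<notin> set hs \<longrightarrow> att \<Gamma>' x b = att \<Gamma> x b)"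
proof -
  define Q where "Q = (\<lambda>hs'. mset hs' = mset hs \<and> (\<exists>\<Gamma>' a'. adj\<^sup>*\<^sup>* (\<Gamma>, E, a) (\<Gamma>', E, a') \<and> top_obj (\<Gamma>', E, a') \<and> conf \<Gamma>' E vs es hs' \<and>
     edges \<Gamma>' = edges \<Gamma> \<and> verts \<Gamma>' = verts \<Gamma> \<and> (\<forall>x b. (x, b) \<notin> set hs \<longrightarrow> att \<Gamma>' x b = att \<Gamma> x b)))"
  have "Q hs'"
  proof (rule closed_under_permutation[of Q, OF _ hs'])
    show "Q hs" using t c by (auto simp: Q_def)
    fix xs p q ys assume "Q (xs @ p # q # ys)"
    then obtain \<Gamma>1 a1 where 1: "mset (xs @ p # q # ys) = mset hs" "adj\<^sup>*\<^sup>* (\<Gamma>, E, a) (\<Gamma>1, E, a1)" "top_obj (\<Gamma>1, E, a1)"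
      "conf \<Gamma>1 E vs es (xs @ p # q # ys)" "edges \<Gamma>1 = edges \<Gamma>" "verts \<Gamma>1 = verts \<Gamma>" "\<forall>x b. (x, b) \<notin> set hs \<longrightarrow> att \<Gamma>1 x b = att \<Gamma> x b"
      unfolding Q_def by blast
    obtain \<Gamma>2 a2 where 2: "adj\<^sup>*\<^sup>* (\<Gamma>1, E, a1) (\<Gamma>2, E, a2)" "top_obj (\<Gamma>2, E, a2)" "conf \<Gamma>2 E vs es (xs @ q # p # ys)"
      "edges \<Gamma>2 = edges \<Gamma>1" "verts \<Gamma>2 = verts \<Gamma>1" "\<forall>x b. (x, b) \<notin> {p, q} \<longrightarrow> att \<Gamma>2 x b = att \<Gamma>1 x b"
      using conf_swap[OF 1(3,4)] by blast
    have "set hs = set (xs @ p # q # ys)" using 1(1) by (metis set_mset_mset)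
    then have "{p, q} \<subseteq> set hs" by auto
    then have "\<forall>x b. (x, b) \<notin> set hs \<longrightarrow> att \<Gamma>2 x b = att \<Gamma> x b" using 1(7) 2(6) by (metis subsetD)
    moreover have "adj\<^sup>*\<^sup>* (\<Gamma>, E, a) (\<Gamma>2, E, a2)" using 1(2) 2(1) by (rule rtranclp_trans)
    moreover have "mset (xs @ q # p # ys) = mset hs" using 1(1) by (simp add: add_mset_commute)
    ultimately show "Q (xs @ q # p # ys)"
      unfolding Q_def using 2(2-5) 1(5,6) by (intro conjI exI[of _ \<Gamma>2] exI[of _ a2]) auto
  qed
  then show ?thesis by (simp add: Q_def)
qed

text \<open>The vertex of the leg has valence \<open>2\<close>, so the path without edges has
  exactly the two free half-edges that \<open>conf\<close> asks for.\<close>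

lemma conf_start:
  assumes t: "top_obj (\<Gamma>, E, a)"
  shows "\<exists>hs. conf \<Gamma> E [leg \<Gamma>] [] hs"
proof -
  note s = objD[OF topD(1)[OF t]]
  have "card (halves \<Gamma> (leg \<Gamma>)) = 2" using topD(6)[OF t s(5)] by (simp add: val_halves)
  then obtain p q where pq: "halves \<Gamma> (leg \<Gamma>) = {p, q}" "p \<noteq> q" by (auto simp: card_2_iff)
  then have "p \<in> halves \<Gamma> (leg \<Gamma>)" "q \<in> halves \<Gamma> (leg \<Gamma>)" by auto
  then have "conf \<Gamma> E [leg \<Gamma>] [] [p, q]"
    using pq(2) s(5) by (auto simp: conf_def halves_def less_Suc_eq)
  then show ?thesis by blast
qed

text \<open>Some non-exceptional edge \<open>f\<close> leaves the path, but perhaps from the middle.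
  Permuting the half-edges moves its near end to the last vertex, and the path continues along
  \<open>f\<close>.\<close>

lemma conf_extend:
  assumes t: "top_obj (\<Gamma>, E, a)" and c: "conf \<Gamma> E vs es hs" and lt: "length vs < card (verts \<Gamma>)"
  shows "\<exists>\<Gamma>' a' vs' es' hs'. adj\<^sup>*\<^sup>* (\<Gamma>, E, a) (\<Gamma>', E, a') \<and> top_obj (\<Gamma>', E, a') \<and> conf \<Gamma>' E vs' es' hs' \<and>
     length vs' = Suc (length vs)"
proof -
  note cd = confD[OF c] and s = objD[OF topD(1)[OF t]]
  have "card (set vs) < card (verts \<Gamma>)" using lt distinct_card[OF cd(3)] by simp
  then have "set vs \<subset> verts \<Gamma>" using cd(7) by auto
  moreover have "set vs \<noteq> {}" using cd(1) by auto
  ultimately obtain f where f: "f \<in> edges \<Gamma> - E" "ends \<Gamma> f \<inter> set vs \<noteq> {}" "ends \<Gamma> f - set vs \<noteq> {}"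
    using linkedD[OF linked_nonexceptional[OF s(4,5,2) mu_total[OF s(1)]], of "set vs"] by auto
  then have "crosses \<Gamma> f (set vs)" using crosses_iff[of \<Gamma> f "set vs"] by simp
  then obtain b where b: "att \<Gamma> f b \<in> set vs" "att \<Gamma> f (\<not> b) \<notin> set vs"
    unfolding crosses_def by (metis (full_types))
  have fes: "f \<notin> set es" using conf_ends[OF c, of f] f(3) by auto
  have fb: "(f, b) \<in> set hs" using conf_halves[OF t c] f(1) fes b(1) by auto
  have fnb: "(f, \<not> b) \<notin> set hs" using conf_half(2)[OF c] b(2) by force
  \<comment> \<open>The last entry of the list is attached at the last vertex of the path; the far
    half of \<open>f\<close> is not listed and stays outside.\<close>
  define hs1 where "hs1 = remove1 (f, b) hs @ [(f, b)]"
  have m1: "mset hs = mset hs1" using fb by (simp add: hs1_def)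
  obtain \<Gamma>' a' where G': "adj\<^sup>*\<^sup>* (\<Gamma>, E, a) (\<Gamma>', E, a')" "top_obj (\<Gamma>', E, a')" "conf \<Gamma>' E vs es hs1"
    "edges \<Gamma>' = edges \<Gamma>" "verts \<Gamma>' = verts \<Gamma>" "\<forall>x b. (x, b) \<notin> set hs \<longrightarrow> att \<Gamma>' x b = att \<Gamma> x b"
    using conf_permute[OF t c m1] by blast
  note cd' = confD[OF G'(3)] and s' = objD[OF topD(1)[OF G'(2)]]
  define x where "x = att \<Gamma>' f (\<not> b)"
  have xvs: "x \<notin> set vs" using G'(6) fnb b(2) by (simp add: x_def)
  have xV: "x \<in> verts \<Gamma>'" using att_in_verts[OF s'(4)] f(1) G'(4) by (simp add: x_def)
  have leg: "leg \<Gamma>' \<in> set vs" using cd'(1,6) by (metis nth_mem zero_less_Suc)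
  then have "card (halves \<Gamma>' x) = 3" using topD(6)[OF G'(2) xV] xvs by (auto simp: val_halves split: if_splits)
  moreover have fx: "(f, \<not> b) \<in> halves \<Gamma>' x" using f(1) G'(4) by (simp add: halves_def x_def)
  ultimately have "card (halves \<Gamma>' x - {(f, \<not> b)}) = 2" using finite_halves[OF s'(6)] by simp
  then obtain p q where pq: "halves \<Gamma>' x - {(f, \<not> b)} = {p, q}" "p \<noteq> q" by (auto simp: card_2_iff)
  have len: "length (remove1 (f, b) hs) = Suc (length es)" using cd'(2) by (simp add: hs1_def)
  have fbk: "att \<Gamma>' f b = vs ! length es"
    using cd'(11)[of "Suc (length es)"] cd'(2) len by (simp add: hs1_def nth_append)
  have hp: "h \<notin> set hs1 \<and> fst h \<in> edges \<Gamma>' \<and> fst h \<notin> set (es @ [f]) \<and> att \<Gamma>' (fst h) (snd h) = x" if "h \<in> {p, q}" for h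
  proof -
    have h: "h \<in> halves \<Gamma>' x" "h \<noteq> (f, \<not> b)" using that pq(1) by auto
    then have 1: "fst h \<in> edges \<Gamma>'" "att \<Gamma>' (fst h) (snd h) = x" by (auto simp: halves_def)
    have "h \<notin> set hs1" using conf_half(2)[OF G'(3), of h] 1 xvs by auto
    moreover have "fst h \<notin> set es" using conf_ends[OF G'(3), of "fst h"] 1 xvs att_in_ends[of \<Gamma>' "fst h" "snd h"] by auto
    moreover have "fst h \<noteq> f"
    proof
      assume "fst h = f"
      then have "h = (f, b)" using h(2) by (cases h) auto
      then have "x = vs ! length es" using 1(2) fbk by simp
      then have "x \<in> set vs" using cd'(1) nth_mem[of "length es" vs] by simp
      then show False using xvs by simp
    qed
    ultimately show ?thesis using 1 by simp
  qed
  \<comment> \<open>Once \<open>(f, b)\<close> belongs to the path, one entry per old vertex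
    remains; the two other half-edges of the new vertex \<open>x\<close>, which is not the leg,
    complete the list.\<close>
  let ?hs = "remove1 (f, b) hs @ [p, q]"
  have r: "h \<in> set hs1 \<and> fst h \<noteq> f" if "h \<in> set (remove1 (f, b) hs)" for h
  proof -
    have "h \<in> set hs1" using that by (simp add: hs1_def)
    moreover have "h \<noteq> (f, b)" using that cd(5) by auto
    moreover have "h \<noteq> (f, \<not> b)" using that fnb notin_set_remove1 by metis
    moreover have "h = (f, b) \<or> h = (f, \<not> b)" if "fst h = f" using that by (cases h) auto
    ultimately show ?thesis by blast
  qed
  have "conf \<Gamma>' E (vs @ [x]) (es @ [f]) ?hs"
    unfolding conf_def
  proof (intro conjI allI impI)
    show "distinct ?hs" using pq(2) hp cd(5) by (auto simp: hs1_def)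
    show "set (es @ [f]) \<subseteq> edges \<Gamma>' - E" using cd'(8) f(1) G'(4) by auto
    show "distinct (es @ [f])" using cd'(4) fes by simp
    fix i assume i: "i < length (es @ [f])"
    show "ends \<Gamma>' ((es @ [f]) ! i) = {(vs @ [x]) ! i, (vs @ [x]) ! Suc i}"
    proof (cases "i = length es")
      case True
      have "ends \<Gamma>' f = {att \<Gamma>' f b, att \<Gamma>' f (\<not> b)}" by (cases b) (auto simp: ends_eq)
      then show ?thesis using True cd'(1) fbk by (simp add: nth_append x_def)
    next
      case False
      then show ?thesis using i cd'(1,9) by (simp add: nth_append)
    qed
  next
    fix i assume i: "i < length ?hs"
    have cases: "(i < Suc (length es) \<and> ?hs ! i = remove1 (f, b) hs ! i) \<or> (i \<ge> Suc (length es) \<and> ?hs ! i \<in> {p, q})"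
    proof (cases "i < Suc (length es)")
      case False
      then have "?hs ! i \<in> set [p, q]" using i len nth_mem[of "i - Suc (length es)" "[p, q]"] by (simp add: nth_append)
      then show ?thesis using False by simp
    qed (use len in \<open>simp add: nth_append\<close>)
    have rmem: "remove1 (f, b) hs ! i \<in> set (remove1 (f, b) hs)" if "i < Suc (length es)" using that len by simp
    show "fst (?hs ! i) \<in> edges \<Gamma>' - set (es @ [f])"
      using cases hp r rmem conf_half(1)[OF G'(3)] by (metis DiffE DiffI Un_iff empty_iff insert_iff set_append list.set(1) list.set(2))
    show "att \<Gamma>' (fst (?hs ! i)) (snd (?hs ! i)) = (vs @ [x]) ! min i (length (es @ [f]))"
    proof (cases "i < Suc (length es)")
      case True
      then have "?hs ! i = hs1 ! i" using len by (simp add: hs1_def nth_append)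
      then show ?thesis using True cd'(11)[of i] cd'(1,2) by (simp add: nth_append min_def)
    next
      case False
      then have "?hs ! i \<in> {p, q}" using cases by simp
      then show ?thesis using hp False cd'(1) by (simp add: nth_append min_def)
    qed
  qed (use cd' xvs xV len in \<open>auto simp: nth_append\<close>)
  then show ?thesis using G'(1,2) by fastforce
qed

lemma conf_full:
  assumes t: "top_obj (\<Gamma>, E, a)"
  shows "\<exists>\<Gamma>' a' vs es hs. adj\<^sup>*\<^sup>* (\<Gamma>, E, a) (\<Gamma>', E, a') \<and> top_obj (\<Gamma>', E, a') \<and> conf \<Gamma>' E vs es hs \<and> length vs = 2 * g - 1"
proof -
  have "n < 2 * g - 1 \<Longrightarrow> \<exists>\<Gamma>' a' vs es hs. adj\<^sup>*\<^sup>* (\<Gamma>, E, a) (\<Gamma>', E, a') \<and> top_obj (\<Gamma>', E, a') \<and> conf \<Gamma>' E vs es hs \<and> length vs = Suc n" for n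
  proof (induction n)
    case 0
    obtain hs where "conf \<Gamma> E [leg \<Gamma>] [] hs" using conf_start[OF t] by blast
    then show ?case using t by (intro exI[of _ \<Gamma>] exI[of _ a] exI[of _ "[leg \<Gamma>]"] exI[of _ "[]"] exI[of _ hs]) simp
  next
    case (Suc n)
    then obtain \<Gamma>1 a1 vs es hs where 1: "adj\<^sup>*\<^sup>* (\<Gamma>, E, a) (\<Gamma>1, E, a1)" "top_obj (\<Gamma>1, E, a1)" "conf \<Gamma>1 E vs es hs" "length vs = Suc n" by auto
    have "length vs < card (verts \<Gamma>1)" using 1(4) Suc.prems topD(4)[OF 1(2)] by simp
    from conf_extend[OF 1(2,3) this] obtain \<Gamma>2 a2 vs' es' hs' where
      2: "adj\<^sup>*\<^sup>* (\<Gamma>1, E, a1) (\<Gamma>2, E, a2)" "top_obj (\<Gamma>2, E, a2)" "conf \<Gamma>2 E vs' es' hs'" "length vs' = Suc (length vs)" by blast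
    show ?case
      using rtranclp_trans[OF 1(1) 2(1)] 2(2,3,4) 1(4)
      by (intro exI[of _ \<Gamma>2] exI[of _ a2] exI[of _ vs'] exI[of _ es'] exI[of _ hs'] conjI) simp_all
  qed
  from this[of "2 * g - 2"] show ?thesis using g by (simp add: Suc_diff_Suc numeral_2_eq_2)
qed

text \<open>The target order of the free half-edges: the two halves of each exceptional edge stand
  next to each other, \<open>False\<close> before \<open>True\<close>. It depends only on
  \<open>el\<close>, so two graphs in this order match position by position.\<close>

definition pairing :: "nat list \<Rightarrow> (nat \<times> bool) list" where
  "pairing el = map (\<lambda>j. (el ! (j div 2), odd j)) [0..<2 * length el]"

lemma set_pairing: "set (pairing el) = set el \<times> UNIV"
proof (intro equalityI subsetI)
  fix h assume "h \<in> set (pairing el)"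
  then obtain j where j: "j < 2 * length el" "h = (el ! (j div 2), odd j)" by (auto simp: pairing_def)
  have "j div 2 < length el" using j(1) by linarith
  then show "h \<in> set el \<times> UNIV" using j(2) by simp
next
  fix h :: "nat \<times> bool" assume "h \<in> set el \<times> UNIV"
  then obtain i b where i: "i < length el" "h = (el ! i, b)" by (cases h) (auto simp: in_set_conv_nth)
  let ?j = "2 * i + of_bool b"
  have "?j < 2 * length el" "h = (el ! (?j div 2), odd ?j)" using i by (cases b; simp)+
  then show "h \<in> set (pairing el)" unfolding pairing_def set_map by (intro image_eqI[of _ _ ?j]) simp_all
qed

lemma distinct_pairing: "distinct el \<Longrightarrow> distinct (pairing el)"
proof (rule card_distinct)
  assume "distinct el"
  then show "card (set (pairing el)) = length (pairing el)"
    unfolding set_pairing by (simp add: card_cartesian_product distinct_card pairing_def)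
qed

definition normal_form :: "(nat, nat) wgraph \<Rightarrow> nat set \<Rightarrow> nat list \<Rightarrow> nat list \<Rightarrow> nat list \<Rightarrow> bool" where
  "normal_form \<Gamma> E vs es el \<longleftrightarrow> conf \<Gamma> E vs es (pairing el) \<and> length vs = 2 * g - 1 \<and> set vs = verts \<Gamma> \<and>
     set es = edges \<Gamma> - E \<and> set el = E \<and> distinct el"

text \<open>A path through all \<open>2g - 1\<close> vertices uses \<open>2g - 2\<close> edges,
  which are all the non-exceptional ones. So the half-edges off the path are those of
  \<open>E\<close>, and they can be brought into any order.\<close>

lemma reach_normal_form:
  assumes t: "top_obj (\<Gamma>, E, a)"
  shows "\<exists>\<Gamma>' a' vs es el. adj\<^sup>*\<^sup>* (\<Gamma>, E, a) (\<Gamma>', E, a') \<and> top_obj (\<Gamma>', E, a') \<and> normal_form \<Gamma>' E vs es el"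
proof -
  obtain \<Gamma>1 a1 vs es hs where 1: "adj\<^sup>*\<^sup>* (\<Gamma>, E, a) (\<Gamma>1, E, a1)" "top_obj (\<Gamma>1, E, a1)" "conf \<Gamma>1 E vs es hs" "length vs = 2 * g - 1"
    using conf_full[OF t] by blast
  note cd = confD[OF 1(3)] and s = objD[OF topD(1)[OF 1(2)]] and td = topD[OF 1(2)]
  have vs: "set vs = verts \<Gamma>1" using distinct_card[OF cd(3)] 1(4) td(4) cd(7) s(8) by (intro card_subset_eq) auto
  have es: "set es = edges \<Gamma>1 - E"
  proof (rule card_subset_eq)
    have "card (edges \<Gamma>1 - E) = 3 * g - 2 - g" using card_Diff_subset[OF s(7,3)] td(2,3) by simp
    then show "card (set es) = card (edges \<Gamma>1 - E)" using distinct_card[OF cd(4)] cd(1) 1(4) g by simp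
  qed (use s(6) cd(8) in auto)
  obtain el where el: "set el = E" "distinct el" using s(7) finite_distinct_list by blast
  have "set hs = E \<times> UNIV"
    unfolding conf_halves[OF 1(2,3)] es vs using s(3) att_in_verts[OF s(4)] by auto
  then have "mset hs = mset (pairing el)"
    using set_eq_iff_mset_eq_distinct[OF cd(5) distinct_pairing[OF el(2)]] set_pairing el(1) by simp
  then obtain \<Gamma>2 a2 where 2: "adj\<^sup>*\<^sup>* (\<Gamma>1, E, a1) (\<Gamma>2, E, a2)" "top_obj (\<Gamma>2, E, a2)" "conf \<Gamma>2 E vs es (pairing el)"
    "edges \<Gamma>2 = edges \<Gamma>1" "verts \<Gamma>2 = verts \<Gamma>1"
    using conf_permute[OF 1(2,3)] by blast
  have "normal_form \<Gamma>2 E vs es el" using 2 vs es el 1(4) by (simp add: normal_form_def)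
  then show ?thesis using 1(1) 2(1,2) rtranclp_trans[OF 1(1) 2(1)] by blast
qed

section \<open>Any two normal forms are isomorphic\<close>

lemma list_bij:
  assumes "length xs = length ys" "distinct xs" "distinct ys"
  obtains f where "bij_betw f (set xs) (set ys)" "\<And>i. i < length xs \<Longrightarrow> f (xs ! i) = ys ! i"
proof -
  let ?f = "\<lambda>x. the (map_of (zip xs ys) x)"
  have f: "?f (xs ! i) = ys ! i" if "i < length xs" for i
    using map_of_zip_nth[OF assms(1,2)] that assms(1) by simp
  have "bij_betw ?f (set xs) (set ys)"
    unfolding bij_betw_def
  proof
    show "inj_on ?f (set xs)"
      using f assms by (auto simp: inj_on_def in_set_conv_nth nth_eq_iff_index_eq)
    show "?f ` set xs = set ys"
      using f assms(1) by (force simp: set_conv_nth image_iff)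
  qed
  with f show ?thesis using that by blast
qed

text \<open>On a Hamiltonian path, \<open>gam\<close> of a set of initial vertices lies in the half-open interval
  \<open>(0, 1]\<close>, which determines the sums of \<open>a\<close> over initial vertices.\<close>

lemma normal_form_unique:
  assumes t: "top_obj (\<Gamma>, E, a)" and t': "top_obj (\<Gamma>, E, b)" and nf: "normal_form \<Gamma> E vs es el" and v: "v \<in> verts \<Gamma>"
  shows "a v = b v"
proof -
  have c: "conf \<Gamma> E vs es (pairing el)" and es: "set es = edges \<Gamma> - E" and vs: "set vs = verts \<Gamma>"
    using nf by (auto simp: normal_form_def)
  note cd = confD[OF c] and s = objD[OF topD(1)[OF t]] and s' = objD[OF topD(1)[OF t']]
  let ?X = "\<lambda>i. set (take i vs)"
  have interval: "0 < gam \<Gamma> (\<mu> \<Gamma>) E x (?X (Suc i)) \<and> gam \<Gamma> (\<mu> \<Gamma>) E x (?X (Suc i)) \<le> 1"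
    if i: "i < length es" and o: "obj \<Gamma> E x" for i x
  proof -
    note so = objD[OF o]
    have Q: "qs \<Gamma> (leg \<Gamma>) (\<mu> \<Gamma>) E x" using so(2) by (simp add: qd_def)
    have mem: "vs ! j \<in> ?X (Suc i) \<longleftrightarrow> j \<le> i" if "j < length vs" for j
    proof
      assume "vs ! j \<in> ?X (Suc i)"
      then obtain l where "l < Suc i" "l < length vs" "vs ! j = vs ! l" by (auto simp: in_set_conv_nth)
      then show "j \<le> i" using nth_eq_iff_index_eq[OF cd(3) that, of l] by simp
    next
      assume "j \<le> i"
      then have "take (Suc i) vs ! j = vs ! j" "j < length (take (Suc i) vs)" using that by simp_all
      then show "vs ! j \<in> ?X (Suc i)" by (metis nth_mem)
    qed
    have sub: "?X (Suc i) \<subseteq> verts \<Gamma>" using set_take_subset vs by fastforce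
    have "vs ! Suc i \<in> verts \<Gamma>" using vs cd(1) i nth_mem[of "Suc i" vs] by simp
    moreover have "vs ! Suc i \<notin> ?X (Suc i)" using mem[of "Suc i"] cd(1) i by simp
    ultimately have X: "?X (Suc i) \<subset> verts \<Gamma>" using sub by blast
    have leg: "leg \<Gamma> \<in> ?X (Suc i)" using mem[of 0] cd(1,6) by simp
    then have Y: "verts \<Gamma> - ?X (Suc i) \<subset> verts \<Gamma>" using sub by blast
    \<comment> \<open>All non-exceptional edges lie on the path, and the only one leaving an initial
      segment is the edge that follows it.\<close>
    have "cut \<Gamma> (?X (Suc i)) - E \<subseteq> {es ! i}"
    proof
      fix f assume f: "f \<in> cut \<Gamma> (?X (Suc i)) - E"
      then have "f \<in> set es" using es by (auto simp: cut_def)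
      then obtain j where j: "f = es ! j" "j < length es" by (metis in_set_conv_nth)
      have "{vs ! j, vs ! Suc j} \<inter> ?X (Suc i) \<noteq> {}" "{vs ! j, vs ! Suc j} - ?X (Suc i) \<noteq> {}"
        using f cd(9)[OF j(2)] j(1) by (auto simp: cut_def)
      then have "j = i" using mem[of j] mem[of "Suc j"] j(2) cd(1) by auto
      then show "f \<in> {es ! i}" using j by simp
    qed
    then have "card (cut \<Gamma> (?X (Suc i)) - E) \<le> card {es ! i}" by (intro card_mono) auto
    then have "gam \<Gamma> (\<mu> \<Gamma>) E x (?X (Suc i)) + gam \<Gamma> (\<mu> \<Gamma>) E x (verts \<Gamma> - ?X (Suc i)) \<le> 1"
      using gam_compl[OF so(4,3) sub qd_gam_verts[OF so(2,4) mu_total[OF so(1)]]] by simp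
    then show ?thesis using qsD(2)[OF Q X leg] qsD(1)[OF Q Y] by linarith
  qed
  \<comment> \<open>Two reals in an interval of length one that is open at one end cannot differ by
    a nonzero integer.\<close>
  have int_eq: "m = n" if "real_of_int m - real_of_int n = x - y" "0 < x \<and> x \<le> 1" "0 < y \<and> y \<le> 1" for m n x y
    using that by linarith
  have sum_eq: "(\<Sum>v\<in>?X i. a v) = (\<Sum>v\<in>?X i. b v)" if "i \<le> length vs" for i
  proof -
    consider "i = 0" | j where "i = Suc j" "j < length es" | "i = length vs" using \<open>i \<le> length vs\<close> cd(1) by (cases i) force+
    then show ?thesis
    proof cases
      case 2
      have "real_of_int (\<Sum>v\<in>?X i. a v) - real_of_int (\<Sum>v\<in>?X i. b v) = gam \<Gamma> (\<mu> \<Gamma>) E a (?X i) - gam \<Gamma> (\<mu> \<Gamma>) E b (?X i)"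
        by (simp add: gam_def sum_subtractf)
      then show ?thesis unfolding 2(1)
        by (rule int_eq) (rule interval[OF 2(2) topD(1)[OF t]], rule interval[OF 2(2) topD(1)[OF t']])
    next
      case 3
      then show ?thesis using s(2) s'(2) vs by (simp add: qd_def)
    qed simp
  qed
  obtain i where i: "v = vs ! i" "i < length vs" using v vs by (metis in_set_conv_nth)
  have "?X (Suc i) = insert v (?X i)" using i by (auto simp: take_Suc_conv_app_nth)
  moreover have "v \<notin> ?X i"
    using i cd(3) by (auto simp: in_set_conv_nth nth_eq_iff_index_eq)
  ultimately show ?thesis using sum_eq[of i] sum_eq[of "Suc i"] i by simp
qed

text \<open>Matching vertices, path edges and exceptional edges by position is an isomorphism, since
  the position in \<open>pairing\<close> determines the attachment. The transported divisor is again
  a top divisor on the target, and \<open>normal_form_unique\<close> identifies it with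
  \<open>a'\<close>.\<close>

lemma normal_forms_adj:
  assumes t: "top_obj (\<Gamma>, E, a)" and nf: "normal_form \<Gamma> E vs es el"
    and t': "top_obj (\<Gamma>', E', a')" and nf': "normal_form \<Gamma>' E' vs' es' el'"
  shows "adj (\<Gamma>, E, a) (\<Gamma>', E', a')"
proof -
  have c: "conf \<Gamma> E vs es (pairing el)" and es: "set es = edges \<Gamma> - E" and vs: "set vs = verts \<Gamma>" "length vs = 2 * g - 1"
    and el: "set el = E" "distinct el" using nf by (auto simp: normal_form_def)
  have c': "conf \<Gamma>' E' vs' es' (pairing el')" and es': "set es' = edges \<Gamma>' - E'" and vs': "set vs' = verts \<Gamma>'" "length vs' = 2 * g - 1"
    and el': "set el' = E'" "distinct el'" using nf' by (auto simp: normal_form_def)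
  note cd = confD[OF c] and cd' = confD[OF c'] and s = objD[OF topD(1)[OF t]] and s' = objD[OF topD(1)[OF t']]
  have len: "length es = length es'" "length vs = length vs'" using cd(1) cd'(1) vs(2) vs'(2) by auto
  have lenel: "length el = length el'" using distinct_card[OF el(2)] distinct_card[OF el'(2)] el(1) el'(1) topD(2)[OF t] topD(2)[OF t'] by simp
  obtain \<phi> where \<phi>: "bij_betw \<phi> (set vs) (set vs')" "\<And>i. i < length vs \<Longrightarrow> \<phi> (vs ! i) = vs' ! i"
    using list_bij[OF len(2) cd(3) cd'(3)] by blast
  have dist: "distinct (es @ el)" "distinct (es' @ el')" using cd(4) cd'(4) el el' es es' by auto
  obtain \<psi> where \<psi>: "bij_betw \<psi> (set (es @ el)) (set (es' @ el'))" "\<And>i. i < length (es @ el) \<Longrightarrow> \<psi> ((es @ el) ! i) = (es' @ el') ! i"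
    using list_bij[OF _ dist] len lenel by auto
  have \<psi>es: "\<psi> (es ! i) = es' ! i" if "i < length es" for i using \<psi>(2)[of i] that len by (simp add: nth_append)
  have \<psi>el: "\<psi> (el ! i) = el' ! i" if "i < length el" for i using \<psi>(2)[of "length es + i"] that len by (simp add: nth_append)
  have ed: "set (es @ el) = edges \<Gamma>" "set (es' @ el') = edges \<Gamma>'" using es es' el el' s(3) s'(3) by auto
  have att: "att \<Gamma>' (el' ! i) b = \<phi> (att \<Gamma> (el ! i) b)" if i: "i < length el" for i b
  proof -
    let ?j = "2 * i + of_bool b"
    have j: "?j < 2 * length el" "?j div 2 = i" "odd ?j = b" using i by (cases b; simp)+
    then have p: "pairing el ! ?j = (el ! i, b)" "pairing el' ! ?j = (el' ! i, b)" and l: "?j < length (pairing el)" "?j < length (pairing el')"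
      using lenel by (simp_all add: pairing_def)
    have "att \<Gamma> (el ! i) b = vs ! min ?j (length es)" using cd(11)[OF l(1)] p(1) by simp
    moreover have "att \<Gamma>' (el' ! i) b = vs' ! min ?j (length es)" using cd'(11)[OF l(2)] p(2) len by simp
    ultimately show ?thesis using \<phi>(2)[of "min ?j (length es)"] cd(1) by simp
  qed
  have iso: "wgraph_iso \<Gamma> \<Gamma>' \<phi> \<psi>"
    unfolding wgraph_iso_def graph_iso_def
  proof (intro conjI ballI)
    show "bij_betw \<phi> (verts \<Gamma>) (verts \<Gamma>')" using \<phi>(1) vs vs' by simp
    show "bij_betw \<psi> (edges \<Gamma>) (edges \<Gamma>')" using \<psi>(1) ed by simp
    show "\<phi> (leg \<Gamma>) = leg \<Gamma>'" using \<phi>(2)[of 0] cd(1,6) cd'(6) by simp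
    show "weight \<Gamma>' (\<phi> v) = weight \<Gamma> v" if "v \<in> verts \<Gamma>" for v
    proof -
      have "\<phi> v \<in> verts \<Gamma>'" using that \<phi>(1) vs vs' by (auto simp: bij_betw_def)
      then show ?thesis using topD(5)[OF t that] topD(5)[OF t'] by simp
    qed
    fix e assume "e \<in> edges \<Gamma>"
    then consider "e \<in> set es" | "e \<in> set el" using ed by auto
    then show "ends \<Gamma>' (\<psi> e) = \<phi> ` ends \<Gamma> e"
    proof cases
      case 1
      then obtain i where i: "e = es ! i" "i < length es" by (metis in_set_conv_nth)
      then show ?thesis using cd(1,9) cd'(9) \<psi>es \<phi>(2) len by simp
    next
      case 2
      then obtain i where i: "e = el ! i" "i < length el" by (metis in_set_conv_nth)
      then show ?thesis using \<psi>el att by (simp add: ends_eq)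
    qed
  qed
  have E': "\<psi> ` E = E'"
  proof -
    have "\<psi> ` set el = set el'" using \<psi>el lenel by (force simp: set_conv_nth image_iff)
    then show ?thesis using el el' by simp
  qed
  define b where "b v' = a (inv_into (verts \<Gamma>) \<phi> v')" for v'
  have b: "b (\<phi> v) = a v" if "v \<in> verts \<Gamma>" for v
    using that \<phi>(1) vs by (simp add: b_def bij_betw_def)
  have pd: "pds \<Gamma> E a \<Gamma>' E' b \<phi> (inv_into (edges \<Gamma>) \<psi>)"
    using pds_iso[OF iso s(4,3), of b a] b E' by simp
  have "obj \<Gamma>' E' b" by (rule obj_pds[OF topD(1)[OF t] s'(1,3) pd])
  then have "top_obj (\<Gamma>', E', b)" using t' by (simp add: top_obj_def)
  from normal_form_unique[OF this t' nf'] have "b v = a' v" if "v \<in> verts \<Gamma>'" for v using that by blast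
  then have "a' (\<phi> v) = a v" if "v \<in> verts \<Gamma>" for v
  proof -
    have "\<phi> v \<in> verts \<Gamma>'" using that \<phi>(1) vs vs' by (auto simp: bij_betw_def)
    with \<open>\<And>v. v \<in> verts \<Gamma>' \<Longrightarrow> b v = a' v\<close> show ?thesis using b[OF that] by simp
  qed
  then show ?thesis using adj.iso[OF t, of \<Gamma>' \<psi> a' \<phi>] t' iso E' by simp
qed

end

section \<open>Isomorphisms\<close>

lemma wgraph_iso_id: "wgraph_iso \<Gamma> \<Gamma> id id"
  by (simp add: wgraph_iso_def graph_iso_def)

lemma wgraph_iso_comp:
  assumes i1: "wgraph_iso \<Gamma> \<Gamma>' \<phi> \<psi>" and i2: "wgraph_iso \<Gamma>' \<Gamma>'' \<phi>' \<psi>'"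
  shows "wgraph_iso \<Gamma> \<Gamma>'' (\<phi>' \<circ> \<phi>) (\<psi>' \<circ> \<psi>)"
proof -
  have b: "bij_betw \<phi> (verts \<Gamma>) (verts \<Gamma>')" "bij_betw \<phi>' (verts \<Gamma>') (verts \<Gamma>'')"
    "bij_betw \<psi> (edges \<Gamma>) (edges \<Gamma>')" "bij_betw \<psi>' (edges \<Gamma>') (edges \<Gamma>'')"
    using i1 i2 by (auto simp: wgraph_iso_def graph_iso_def)
  have "\<phi> v \<in> verts \<Gamma>'" if "v \<in> verts \<Gamma>" for v using b(1) that by (auto simp: bij_betw_def)
  moreover have "\<psi> e \<in> edges \<Gamma>'" if "e \<in> edges \<Gamma>" for e using b(3) that by (auto simp: bij_betw_def)
  ultimately show ?thesis
    using i1 i2 bij_betw_trans[OF b(1,2)] bij_betw_trans[OF b(3,4)]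
    by (simp add: wgraph_iso_def graph_iso_def image_comp)
qed

lemma wgraph_iso_inv:
  assumes i: "wgraph_iso \<Gamma> \<Gamma>' \<phi> \<psi>" and wa: "well_attached \<Gamma>" and leg: "leg \<Gamma> \<in> verts \<Gamma>"
  shows "wgraph_iso \<Gamma>' \<Gamma> (inv_into (verts \<Gamma>) \<phi>) (inv_into (edges \<Gamma>) \<psi>)"
proof -
  let ?f = "inv_into (verts \<Gamma>) \<phi>" and ?h = "inv_into (edges \<Gamma>) \<psi>"
  have b: "bij_betw \<phi> (verts \<Gamma>) (verts \<Gamma>')" "bij_betw \<psi> (edges \<Gamma>) (edges \<Gamma>')"
    and en: "\<And>e. e \<in> edges \<Gamma> \<Longrightarrow> ends \<Gamma>' (\<psi> e) = \<phi> ` ends \<Gamma> e" and w: "\<And>v. v \<in> verts \<Gamma> \<Longrightarrow> weight \<Gamma>' (\<phi> v) = weight \<Gamma> v"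
    and l: "\<phi> (leg \<Gamma>) = leg \<Gamma>'"
    using i by (auto simp: wgraph_iso_def graph_iso_def)
  have inj: "inj_on \<phi> (verts \<Gamma>)" using b(1) by (simp add: bij_betw_def)
  show ?thesis
    unfolding wgraph_iso_def graph_iso_def
  proof (intro conjI ballI)
    show "bij_betw ?f (verts \<Gamma>') (verts \<Gamma>)" "bij_betw ?h (edges \<Gamma>') (edges \<Gamma>)"
      using b by (simp_all add: bij_betw_inv_into)
    show "?f (leg \<Gamma>') = leg \<Gamma>" using inj leg by (simp flip: l)
    show "weight \<Gamma> (?f v) = weight \<Gamma>' v" if "v \<in> verts \<Gamma>'" for v
    proof -
      have "?f v \<in> verts \<Gamma>" "\<phi> (?f v) = v" using b(1) that by (auto simp: bij_betw_def f_inv_into_f inv_into_into)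
      then show ?thesis using w by metis
    qed
    show "ends \<Gamma> (?h e) = ?f ` ends \<Gamma>' e" if "e \<in> edges \<Gamma>'" for e
    proof -
      have h: "?h e \<in> edges \<Gamma>" "\<psi> (?h e) = e" using b(2) that by (auto simp: bij_betw_def f_inv_into_f inv_into_into)
      then have "ends \<Gamma>' e = \<phi> ` ends \<Gamma> (?h e)" using en by metis
      moreover have "ends \<Gamma> (?h e) \<subseteq> verts \<Gamma>" using wa h(1) by (simp add: well_attached_def)
      ultimately show ?thesis using inv_into_image_cancel[OF inj] by simp
    qed
  qed
qed

lemma equiv_graph_iso_rel: "equiv (stable_graphs g) (graph_iso_rel g)"
proof (rule equivI)
  show "graph_iso_rel g \<subseteq> stable_graphs g \<times> stable_graphs g" by (auto simp: graph_iso_rel_def)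
  show "refl_on (stable_graphs g) (graph_iso_rel g)"
    using wgraph_iso_id by (auto simp: refl_on_def graph_iso_rel_def)
  show "sym (graph_iso_rel g)"
    using wgraph_iso_inv stable_graphsD(2,3) by (fastforce simp: sym_def graph_iso_rel_def)
  show "trans (graph_iso_rel g)"
    using wgraph_iso_comp by (fastforce simp: trans_def graph_iso_rel_def)
qed

section \<open>The universal poset\<close>

definition triple_rank :: "triple \<Rightarrow> nat" where
  "triple_rank = (\<lambda>(\<Gamma>, (E, D)). card (edges \<Gamma>) + card E)"

definition triple_spec :: "triple \<Rightarrow> triple \<Rightarrow> bool" where
  "triple_spec = (\<lambda>(\<Gamma>, p) (\<Gamma>', p'). \<exists>\<phi> \<epsilon>. pd_specialization \<Gamma> p \<Gamma>' p' \<phi> \<epsilon>)"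

lemma triple_rank_pdiv [simp]: "triple_rank (\<Gamma>, pdiv \<Gamma> E a) = card (edges \<Gamma>) + card E"
  by (simp add: triple_rank_def pdiv_def)

context universal_pol
begin

abbreviation "T \<equiv> QD_triples g d \<mu>"
abbreviation "I \<equiv> triple_iso_rel g d \<mu>"

lemma QD_obj:
  assumes "\<Gamma> \<in> stable_graphs g"
  shows "p \<in> QD d \<Gamma> (\<mu> \<Gamma>) \<longleftrightarrow> (\<exists>E a. p = pdiv \<Gamma> E a \<and> obj \<Gamma> E a)"
  using QD_iff[OF stable_graphsD(2)[OF assms] mu_total[OF assms]] assms by (auto simp: obj_def)

lemma T_pdiv: "obj \<Gamma> E a \<Longrightarrow> (\<Gamma>, pdiv \<Gamma> E a) \<in> T"
  using QD_obj[of \<Gamma>] objD(1)[of \<Gamma> E a] by (auto simp: QD_triples_def)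

lemma TE:
  assumes "t \<in> T"
  obtains \<Gamma> E a where "t = (\<Gamma>, pdiv \<Gamma> E a)" "obj \<Gamma> E a"
  using assms QD_obj by (auto simp: QD_triples_def)

lemma triple_spec_pdiv:
  assumes "obj \<Gamma> E a" "obj \<Gamma>' E' a'"
  shows "triple_spec (\<Gamma>, pdiv \<Gamma> E a) (\<Gamma>', pdiv \<Gamma>' E' a') \<longleftrightarrow> (\<exists>\<phi> \<epsilon>. pds \<Gamma> E a \<Gamma>' E' a' \<phi> \<epsilon>)"
  unfolding triple_spec_def case_prod_conv pd_specialization_pdiv[OF objD(4,3)[OF assms(1)] objD(3)[OF assms(2)]]
  by (rule refl)

lemma I_pdiv:
  assumes o: "obj \<Gamma> E a" "obj \<Gamma>' E' a'"
  shows "((\<Gamma>, pdiv \<Gamma> E a), (\<Gamma>', pdiv \<Gamma>' E' a')) \<in> I \<longleftrightarrow>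
    (\<exists>\<phi> \<psi>. wgraph_iso \<Gamma> \<Gamma>' \<phi> \<psi> \<and> E' = \<psi> ` E \<and> (\<forall>v\<in>verts \<Gamma>. a' (\<phi> v) = a v))"
proof -
  have tr: "pd_transport \<Gamma> \<Gamma>' (\<phi>, \<psi>) (pdiv \<Gamma> E a) = pdiv \<Gamma>' E' a' \<longleftrightarrow> E' = \<psi> ` E \<and> (\<forall>v\<in>verts \<Gamma>. a' (\<phi> v) = a v)"
    if iso: "wgraph_iso \<Gamma> \<Gamma>' \<phi> \<psi>" for \<phi> \<psi>
  proof -
    let ?b = "\<lambda>w. a (inv_into (verts \<Gamma>) \<phi> w)"
    have \<phi>: "bij_betw \<phi> (verts \<Gamma>) (verts \<Gamma>')" using iso by (simp add: wgraph_iso_def graph_iso_def)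
    then have b: "?b (\<phi> v) = a v" if "v \<in> verts \<Gamma>" for v using that by (simp add: bij_betw_def)
    have "pd_transport \<Gamma> \<Gamma>' (\<phi>, \<psi>) (pdiv \<Gamma> E a) = pdiv \<Gamma>' (\<psi> ` E) ?b"
      by (rule pd_transport_pdiv[OF iso objD(4,3)[OF o(1)]]) (rule b)
    moreover have "verts \<Gamma>' = \<phi> ` verts \<Gamma>" using \<phi> by (simp add: bij_betw_def)
    ultimately show ?thesis using b by (auto simp: pdiv_eq_iff)
  qed
  show ?thesis
    by (simp add: triple_iso_rel_def T_pdiv[OF o(1)] T_pdiv[OF o(2)] tr cong: conj_cong)
qed

lemma I_sub: "(s, t) \<in> I \<Longrightarrow> s \<in> T \<and> t \<in> T"
  by (auto simp: triple_iso_rel_def)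

lemma I_imp_spec:
  assumes "(s, t) \<in> I"
  shows "triple_spec s t \<and> triple_rank t = triple_rank s"
proof -
  have st: "s \<in> T" "t \<in> T" using I_sub[OF assms] by auto
  obtain \<Gamma> E a where s: "s = (\<Gamma>, pdiv \<Gamma> E a)" "obj \<Gamma> E a" using TE[OF st(1)] .
  obtain \<Gamma>' E' a' where t: "t = (\<Gamma>', pdiv \<Gamma>' E' a')" "obj \<Gamma>' E' a'" using TE[OF st(2)] .
  obtain \<phi> \<psi> where i: "wgraph_iso \<Gamma> \<Gamma>' \<phi> \<psi>" "E' = \<psi> ` E" "\<forall>v\<in>verts \<Gamma>. a' (\<phi> v) = a v"
    using assms I_pdiv[OF s(2) t(2)] s(1) t(1) by auto
  have "triple_spec s t"
    using pds_iso[OF i(1) objD(4,3)[OF s(2)], of a' a] i(2,3) s t triple_spec_pdiv[OF s(2) t(2)] by auto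
  moreover have \<psi>: "bij_betw \<psi> (edges \<Gamma>) (edges \<Gamma>')" using i(1) by (simp add: wgraph_iso_def graph_iso_def)
  then have "card (edges \<Gamma>') = card (edges \<Gamma>)" by (simp add: bij_betw_same_card)
  moreover have "card E' = card E" unfolding i(2)
    using \<psi> objD(3)[OF s(2)] by (intro card_image) (auto simp: bij_betw_def intro: inj_on_subset)
  ultimately show ?thesis using s t by simp
qed

text \<open>Edges and exceptional edges are counted separately and neither number can grow, so equal
  ranks mean equality of both: \<open>\<epsilon>\<close> is a bijection on edges and on exceptional
  edges.\<close>

lemma spec_imp_I:
  assumes st: "s \<in> T" "t \<in> T" and sp: "triple_spec s t"
  shows "triple_rank t \<le> triple_rank s" "triple_rank t = triple_rank s \<Longrightarrow> (s, t) \<in> I"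
proof -
  obtain \<Gamma> E a where s: "s = (\<Gamma>, pdiv \<Gamma> E a)" "obj \<Gamma> E a" using TE[OF st(1)] .
  obtain \<Gamma>' E' a' where t: "t = (\<Gamma>', pdiv \<Gamma>' E' a')" "obj \<Gamma>' E' a'" using TE[OF st(2)] .
  obtain \<phi> \<epsilon> where p: "pds \<Gamma> E a \<Gamma>' E' a' \<phi> \<epsilon>" using sp triple_spec_pdiv[OF s(2) t(2)] s(1) t(1) by auto
  note so = objD[OF s(2)] and to = objD[OF t(2)]
  have w: "wsp \<Gamma> \<Gamma>' \<phi> \<epsilon>" and sub: "\<epsilon> ` E' \<subseteq> E" using p by (auto simp: pds_def)
  have gs: "gspec \<Gamma> \<Gamma>' \<phi> \<epsilon>" using w by (simp add: wsp_def)
  have inj: "inj_on \<epsilon> (edges \<Gamma>')" using gspec_inj[OF gs] .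
  have injE: "inj_on \<epsilon> E'" using inj to(3) by (rule inj_on_subset)
  have ce: "card (edges \<Gamma>') \<le> card (edges \<Gamma>)"
    using inj gs so(6) by (intro card_inj_on_le[of \<epsilon>]) (auto simp: gspec_def)
  have cE: "card E' \<le> card E" using injE sub so(7) by (intro card_inj_on_le[of \<epsilon>]) auto
  show "triple_rank t \<le> triple_rank s" using ce cE s t by simp
  assume "triple_rank t = triple_rank s"
  then have c: "card (edges \<Gamma>') = card (edges \<Gamma>)" "card E' = card E" using ce cE s t by auto
  note iso = wsp_imp_iso[OF w so(4) c(1)]
  have E: "\<epsilon> ` E' = E" using card_image[OF injE] c(2) sub so(7) by (intro card_subset_eq) auto
  have "inv_into (edges \<Gamma>') \<epsilon> ` E = E'" using inv_into_image_cancel[OF inj to(3)] E by simp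
  moreover have "a' (\<phi> v) = a v" if v: "v \<in> verts \<Gamma>" for v
  proof -
    have "inj_on \<phi> (verts \<Gamma>)" using iso(1) by (simp add: wgraph_iso_def graph_iso_def bij_betw_def)
    then have "{u \<in> verts \<Gamma>. \<phi> u = \<phi> v} = {v}" using v by (auto simp: inj_on_def)
    then show ?thesis using p gspec_in(2)[OF gs v] E by (auto simp: pds_def)
  qed
  ultimately show "(s, t) \<in> I" using I_pdiv[OF s(2) t(2)] iso(1) s(1) t(1) by auto
qed

lemma triple_spec_trans:
  assumes "s \<in> T" "t \<in> T" "u \<in> T" "triple_spec s t" "triple_spec t u"
  shows "triple_spec s u"
proof -
  obtain \<Gamma> E a where s: "s = (\<Gamma>, pdiv \<Gamma> E a)" "obj \<Gamma> E a" using TE[OF assms(1)] .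
  obtain \<Gamma>' E' a' where t: "t = (\<Gamma>', pdiv \<Gamma>' E' a')" "obj \<Gamma>' E' a'" using TE[OF assms(2)] .
  obtain \<Gamma>'' E'' a'' where u: "u = (\<Gamma>'', pdiv \<Gamma>'' E'' a'')" "obj \<Gamma>'' E'' a''" using TE[OF assms(3)] .
  obtain \<phi> \<epsilon> where p: "pds \<Gamma> E a \<Gamma>' E' a' \<phi> \<epsilon>" using assms(4) triple_spec_pdiv[OF s(2) t(2)] s(1) t(1) by auto
  obtain \<phi>' \<epsilon>' where p': "pds \<Gamma>' E' a' \<Gamma>'' E'' a'' \<phi>' \<epsilon>'" using assms(5) triple_spec_pdiv[OF t(2) u(2)] t(1) u(1) by auto
  from pds_comp[OF p p' objD(4,3)[OF s(2)] objD(3)[OF t(2)] objD(3)[OF u(2)]]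
  show ?thesis using triple_spec_pdiv[OF s(2) u(2)] s(1) u(1) by auto
qed

text \<open>An isomorphism is in particular a specialization, so \<open>obj_pds\<close> yields the
  quasistability of the transported divisor.\<close>

lemma transport_iso:
  assumes o: "obj \<Gamma> E a" and \<Gamma>': "\<Gamma>' \<in> stable_graphs g" and iso: "wgraph_iso \<Gamma> \<Gamma>' \<phi> \<psi>"
  shows "pd_transport \<Gamma> \<Gamma>' (\<phi>, \<psi>) (pdiv \<Gamma> E a) \<in> QD d \<Gamma>' (\<mu> \<Gamma>')"
    and "((\<Gamma>, pdiv \<Gamma> E a), (\<Gamma>', pd_transport \<Gamma> \<Gamma>' (\<phi>, \<psi>) (pdiv \<Gamma> E a))) \<in> I"
proof -
  let ?b = "\<lambda>w. a (inv_into (verts \<Gamma>) \<phi> w)"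
  note s = objD[OF o]
  have bij: "bij_betw \<phi> (verts \<Gamma>) (verts \<Gamma>')" "bij_betw \<psi> (edges \<Gamma>) (edges \<Gamma>')"
    using iso by (auto simp: wgraph_iso_def graph_iso_def)
  have b: "?b (\<phi> v) = a v" if "v \<in> verts \<Gamma>" for v using that bij(1) by (simp add: bij_betw_def)
  have tr: "pd_transport \<Gamma> \<Gamma>' (\<phi>, \<psi>) (pdiv \<Gamma> E a) = pdiv \<Gamma>' (\<psi> ` E) ?b"
    by (rule pd_transport_pdiv[OF iso s(4,3)]) (rule b)
  have "\<psi> ` E \<subseteq> edges \<Gamma>'" using bij(2) s(3) by (auto simp: bij_betw_def)
  moreover have "pds \<Gamma> E a \<Gamma>' (\<psi> ` E) ?b \<phi> (inv_into (edges \<Gamma>) \<psi>)"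
    by (rule pds_iso[OF iso s(4,3)]) (rule b)
  ultimately have o': "obj \<Gamma>' (\<psi> ` E) ?b" by (rule obj_pds[OF o \<Gamma>'])
  then show "pd_transport \<Gamma> \<Gamma>' (\<phi>, \<psi>) (pdiv \<Gamma> E a) \<in> QD d \<Gamma>' (\<mu> \<Gamma>')"
    unfolding tr using QD_obj[OF \<Gamma>'] by blast
  show "((\<Gamma>, pdiv \<Gamma> E a), (\<Gamma>', pd_transport \<Gamma> \<Gamma>' (\<phi>, \<psi>) (pdiv \<Gamma> E a))) \<in> I"
    unfolding tr I_pdiv[OF o o'] using iso b by blast
qed

lemma equiv_I: "equiv T I"
proof (rule equivI)
  show "I \<subseteq> T \<times> T" using I_sub by auto
  show "refl_on T I"
  proof (rule refl_onI)
    fix t assume "t \<in> T"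
    then obtain \<Gamma> E a where t: "t = (\<Gamma>, pdiv \<Gamma> E a)" "obj \<Gamma> E a" by (rule TE)
    then show "(t, t) \<in> I" using I_pdiv[OF t(2) t(2)] wgraph_iso_id by fastforce
  qed
  show "sym I"
  proof (rule symI)
    fix s t assume st: "(s, t) \<in> I"
    then have T: "s \<in> T" "t \<in> T" using I_sub by auto
    obtain \<Gamma> E a where s: "s = (\<Gamma>, pdiv \<Gamma> E a)" "obj \<Gamma> E a" using TE[OF T(1)] .
    obtain \<Gamma>' E' a' where t: "t = (\<Gamma>', pdiv \<Gamma>' E' a')" "obj \<Gamma>' E' a'" using TE[OF T(2)] .
    obtain \<phi> \<psi> where i: "wgraph_iso \<Gamma> \<Gamma>' \<phi> \<psi>" "E' = \<psi> ` E" "\<forall>v\<in>verts \<Gamma>. a' (\<phi> v) = a v"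
      using st I_pdiv[OF s(2) t(2)] s(1) t(1) by auto
    note so = objD[OF s(2)]
    have bij: "bij_betw \<phi> (verts \<Gamma>) (verts \<Gamma>')" "inj_on \<psi> (edges \<Gamma>)"
      using i(1) by (auto simp: wgraph_iso_def graph_iso_def bij_betw_def)
    have "E = inv_into (edges \<Gamma>) \<psi> ` E'" using inv_into_image_cancel[OF bij(2) so(3)] i(2) by simp
    moreover have "a (inv_into (verts \<Gamma>) \<phi> v) = a' v" if "v \<in> verts \<Gamma>'" for v
      using i(3) bij(1) that by (metis bij_betw_def bij_betw_inv_into_right inv_into_into)
    ultimately show "(t, s) \<in> I"
      using I_pdiv[OF t(2) s(2)] wgraph_iso_inv[OF i(1) so(4,5)] s(1) t(1) by auto
  qed
  show "trans I"
  proof (rule transI)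
    fix s t u assume st: "(s, t) \<in> I" and tu: "(t, u) \<in> I"
    then have T: "s \<in> T" "t \<in> T" "u \<in> T" using I_sub by auto
    \<comment> \<open>Composing as specializations and comparing ranks replaces a composition of the
      isomorphisms and their transports.\<close>
    show "(s, u) \<in> I"
      using triple_spec_trans[OF T] I_imp_spec[OF st] I_imp_spec[OF tu] spec_imp_I(2)[OF T(1,3)] by simp
  qed
qed

text \<open>One vertex of weight \<open>g\<close> carrying the leg: it is stable because
  \<open>2g + 1 \<ge> 3\<close>, and the empty set, its only proper subset, has value
  \<open>0\<close>.\<close>

lemma T_nonempty: "T \<noteq> {}"
proof -
  define \<Gamma> :: "(nat, nat) wgraph" where "\<Gamma> = \<lparr>verts = {0}, edges = {}, att = \<lambda>_ _. 0, weight = \<lambda>_. g, leg = 0\<rparr>"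
  have c: "finite_connected_graph \<Gamma>"
    by (simp add: finite_connected_graph_def \<Gamma>_def)
  have "stable \<Gamma>" using g by (simp add: stable_def \<Gamma>_def)
  moreover have "genus \<Gamma> = int g" using genus_connected[OF c] by (simp add: \<Gamma>_def)
  ultimately have \<Gamma>: "\<Gamma> \<in> stable_graphs g" using c by (simp add: stable_graphs_def \<Gamma>_def)
  have "qs \<Gamma> (leg \<Gamma>) (\<mu> \<Gamma>) {} (\<lambda>_. d)"
    unfolding qs_def
  proof (intro allI impI)
    fix X assume "X \<subset> verts \<Gamma>"
    then have "X = {}" by (auto simp: \<Gamma>_def)
    then show "0 \<le> gam \<Gamma> (\<mu> \<Gamma>) {} (\<lambda>_. d) X \<and> (leg \<Gamma> \<in> X \<longrightarrow> 0 < gam \<Gamma> (\<mu> \<Gamma>) {} (\<lambda>_. d) X)"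
      by (simp add: gam_empty)
  qed
  then have "obj \<Gamma> {} (\<lambda>_. d)" using \<Gamma> by (simp add: obj_def qd_def) (simp add: \<Gamma>_def)
  then show ?thesis using T_pdiv by blast
qed

lemma contract_obj:
  assumes o: "obj \<Gamma> E a" and e: "e \<in> edges \<Gamma>" "e \<notin> E"
  shows "\<exists>\<Delta> u w. one_contraction \<Gamma> e u w \<Delta> \<and> obj \<Delta> E (\<lambda>v. \<Sum>x\<in>{x \<in> verts \<Gamma>. merge u w x = v}. a x) \<and>
     Suc (card (edges \<Delta>)) = card (edges \<Gamma>)"
proof -
  note s = objD[OF o]
  have oc: "one_contraction \<Gamma> e (att \<Gamma> e False) (att \<Gamma> e True) (contract_edge \<Gamma> e)"
    by (rule one_contraction_contract_edge[OF e(1)])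
  note ocs = oc_simps[OF oc s(4)]
  have "E \<subseteq> edges (contract_edge \<Gamma> e)" using s(3) e(2) ocs(4) by auto
  from obj_pds[OF o stable_graphs_oc[OF oc s(1)] this pds_contract[OF oc s(4)]]
  have "obj (contract_edge \<Gamma> e) E (\<lambda>v. \<Sum>x\<in>{x \<in> verts \<Gamma>. merge (att \<Gamma> e False) (att \<Gamma> e True) x = v}. a x)" .
  moreover have "Suc (card (edges (contract_edge \<Gamma> e))) = card (edges \<Gamma>)"
    using card_Suc_Diff1[OF s(6) e(1)] ocs(4) by simp
  ultimately show ?thesis using oc by blast
qed

text \<open>Lost exceptional vertices are removed before any edge is contracted, because contracting
  an edge lowers the rank by one only if it carries no exceptional vertex. Once \<open>E\<close> is
  the image of \<open>E'\<close>, every lost edge is of that kind.\<close>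

lemma triple_between:
  assumes st: "s \<in> T" "t \<in> T" and sp: "triple_spec s t" and less: "triple_rank t < triple_rank s"
  shows "\<exists>z\<in>T. triple_spec s z \<and> triple_spec z t \<and> Suc (triple_rank z) = triple_rank s"
proof -
  obtain \<Gamma> E a where s: "s = (\<Gamma>, pdiv \<Gamma> E a)" "obj \<Gamma> E a" using TE[OF st(1)] .
  obtain \<Gamma>' E' a' where t: "t = (\<Gamma>', pdiv \<Gamma>' E' a')" "obj \<Gamma>' E' a'" using TE[OF st(2)] .
  obtain \<phi> \<epsilon> where p: "pds \<Gamma> E a \<Gamma>' E' a' \<phi> \<epsilon>" using sp triple_spec_pdiv[OF s(2) t(2)] s(1) t(1) by auto
  note so = objD[OF s(2)] and to = objD[OF t(2)]
  have gs: "gspec \<Gamma> \<Gamma>' \<phi> \<epsilon>" and sub: "\<epsilon> ` E' \<subseteq> E" using p by (auto simp: pds_def wsp_def)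
  show ?thesis
  proof (cases "E \<subseteq> \<epsilon> ` E'")
    case False
    then obtain e where e: "e \<in> E" "e \<notin> \<epsilon> ` E'" by blast
    obtain b where b: "pds \<Gamma> E a \<Gamma> (E - {e}) b id id" "pds \<Gamma> (E - {e}) b \<Gamma>' E' a' \<phi> \<epsilon>"
      using pds_factor_exceptional[OF p so(4,3) e] by blast
    have ob: "obj \<Gamma> (E - {e}) b" by (rule obj_pds[OF s(2) so(1) _ b(1)]) (use so(3) in auto)
    have "Suc (card (E - {e})) = card E" by (rule card_Suc_Diff1[OF so(7) e(1)])
    then show ?thesis
      using b triple_spec_pdiv[OF s(2) ob] triple_spec_pdiv[OF ob t(2)] s(1) t(1) T_pdiv[OF ob]
      by (intro bexI[of _ "(\<Gamma>, pdiv \<Gamma> (E - {e}) b)"]) auto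
  next
    case True
    then have E: "E = \<epsilon> ` E'" using sub by blast
    have "card E = card E'" unfolding E using inj_on_subset[OF gspec_inj[OF gs] to(3)] by (rule card_image)
    then have "card (edges \<Gamma>') < card (edges \<Gamma>)" using less s(1) t(1) by simp
    moreover have "card (\<epsilon> ` edges \<Gamma>') = card (edges \<Gamma>')" using gspec_inj[OF gs] by (rule card_image)
    ultimately have "\<epsilon> ` edges \<Gamma>' \<noteq> edges \<Gamma>" by auto
    then obtain e where e: "e \<in> edges \<Gamma>" "e \<notin> \<epsilon> ` edges \<Gamma>'" using gs by (auto simp: gspec_def)
    then have eE: "e \<notin> E" using E to(3) by auto
    obtain \<Delta> u w where \<Delta>: "one_contraction \<Gamma> e u w \<Delta>" "obj \<Delta> E (\<lambda>v. \<Sum>x\<in>{x \<in> verts \<Gamma>. merge u w x = v}. a x)"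
      "Suc (card (edges \<Delta>)) = card (edges \<Gamma>)"
      using contract_obj[OF s(2) e(1) eE] by blast
    have "triple_spec s (\<Delta>, pdiv \<Delta> E (\<lambda>v. \<Sum>x\<in>{x \<in> verts \<Gamma>. merge u w x = v}. a x))"
      unfolding s(1) triple_spec_pdiv[OF s(2) \<Delta>(2)] using pds_contract[OF \<Delta>(1) so(4)] by blast
    moreover have "triple_spec (\<Delta>, pdiv \<Delta> E (\<lambda>v. \<Sum>x\<in>{x \<in> verts \<Gamma>. merge u w x = v}. a x)) t"
      unfolding t(1) triple_spec_pdiv[OF \<Delta>(2) t(2)] using pds_factor_contract[OF p so(4,3,5) eE e(2) \<Delta>(1)] by blast
    ultimately show ?thesis
      using \<Delta>(3) s(1) T_pdiv[OF \<Delta>(2)]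
      by (intro bexI[of _ "(\<Delta>, pdiv \<Delta> E (\<lambda>v. \<Sum>x\<in>{x \<in> verts \<Gamma>. merge u w x = v}. a x))"]) auto
  qed
qed

text \<open>Either an exceptional vertex is dropped into one end of its edge, or there is none and
  an arbitrary edge is contracted.\<close>

lemma triple_down:
  assumes t: "t \<in> T" and pos: "0 < triple_rank t"
  shows "\<exists>z\<in>T. triple_spec t z \<and> Suc (triple_rank z) = triple_rank t"
proof -
  obtain \<Gamma> E a where s: "t = (\<Gamma>, pdiv \<Gamma> E a)" "obj \<Gamma> E a" using TE[OF t] .
  note so = objD[OF s(2)]
  show ?thesis
  proof (cases "E = {}")
    case False
    then obtain e where e: "e \<in> E" by blast
    let ?b = "\<lambda>v. a v - (if v = att \<Gamma> e False then 1 else 0)"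
    have p: "pds \<Gamma> E a \<Gamma> (E - {e}) ?b id id" by (rule pds_drop[OF so(4) e]) simp
    have ob: "obj \<Gamma> (E - {e}) ?b" by (rule obj_pds[OF s(2) so(1) _ p]) (use so(3) in auto)
    have "Suc (card (E - {e})) = card E" by (rule card_Suc_Diff1[OF so(7) e])
    then show ?thesis
      using p triple_spec_pdiv[OF s(2) ob] s(1) T_pdiv[OF ob]
      by (intro bexI[of _ "(\<Gamma>, pdiv \<Gamma> (E - {e}) ?b)"]) auto
  next
    case True
    then have "edges \<Gamma> \<noteq> {}" using pos s(1) by auto
    then obtain e where e: "e \<in> edges \<Gamma>" "e \<notin> E" using True by blast
    obtain \<Delta> u w where \<Delta>: "one_contraction \<Gamma> e u w \<Delta>" "obj \<Delta> E (\<lambda>v. \<Sum>x\<in>{x \<in> verts \<Gamma>. merge u w x = v}. a x)"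
      "Suc (card (edges \<Delta>)) = card (edges \<Gamma>)"
      using contract_obj[OF s(2) e] by blast
    have "triple_spec t (\<Delta>, pdiv \<Delta> E (\<lambda>v. \<Sum>x\<in>{x \<in> verts \<Gamma>. merge u w x = v}. a x))"
      unfolding s(1) triple_spec_pdiv[OF s(2) \<Delta>(2)] using pds_contract[OF \<Delta>(1) so(4)] by blast
    then show ?thesis
      using \<Delta>(3) s(1) T_pdiv[OF \<Delta>(2)]
      by (intro bexI[of _ "(\<Delta>, pdiv \<Delta> E (\<lambda>v. \<Sum>x\<in>{x \<in> verts \<Gamma>. merge u w x = v}. a x))"]) auto
  qed
qed

text \<open>Below \<open>3g - 2\<close> edges the graph can be expanded and the divisor lifted. At
  \<open>3g - 2\<close> edges the weights vanish, so a rank below \<open>4g - 2\<close> means that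
  \<open>E\<close> is smaller than the first Betti number, and another edge can be
  subdivided.\<close>

lemma triple_up:
  assumes t: "t \<in> T" and less: "triple_rank t < 4 * g - 2"
  shows "\<exists>z\<in>T. triple_spec z t \<and> triple_rank t < triple_rank z"
proof -
  obtain \<Gamma> E a where s: "t = (\<Gamma>, pdiv \<Gamma> E a)" "obj \<Gamma> E a" using TE[OF t] .
  note so = objD[OF s(2)] and bounds = obj_bounds[OF s(2)]
  show ?thesis
  proof (cases "card (edges \<Gamma>) + 2 < 3 * g")
    case True
    obtain \<Gamma>' e u w where \<Gamma>': "\<Gamma>' \<in> stable_graphs g" "one_contraction \<Gamma>' e u w \<Gamma>"
      using stable_graphs_expandable[OF so(1) True] by blast
    obtain b where b: "obj \<Gamma>' E b" "pds \<Gamma>' E b \<Gamma> E a (merge u w) id" using obj_lift[OF \<Gamma>'(2,1) s(2)] by blast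
    note s' = objD[OF b(1)]
    have "card (edges \<Gamma>) < card (edges \<Gamma>')"
      using oc_simps(1,4)[OF \<Gamma>'(2) s'(4)] card_Suc_Diff1[OF s'(6)] by (metis lessI)
    then show ?thesis
      using b triple_spec_pdiv[OF b(1) s(2)] s(1) T_pdiv[OF b(1)]
      by (intro bexI[of _ "(\<Gamma>', pdiv \<Gamma>' E b)"]) auto
  next
    case False
    have nn: "0 \<le> (\<Sum>v\<in>verts \<Gamma>. int (weight \<Gamma> v))" by (simp add: sum_nonneg)
    have ce: "card (edges \<Gamma>) + 2 = 3 * g" and W: "(\<Sum>v\<in>verts \<Gamma>. int (weight \<Gamma> v)) = 0" using bounds(2) nn False by linarith+
    then have "card E < g" using less s(1) by simp
    then have "card E + card (verts \<Gamma>) \<le> card (edges \<Gamma>)" using stable_graphsD(5)[OF so(1)] W ce by linarith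
    from qd_add_exceptional[OF so(4,5,2) mu_total[OF so(1)] this]
    obtain e b where e: "e \<in> edges \<Gamma>" "e \<notin> E" "qd d \<Gamma> (\<mu> \<Gamma>) (insert e E) b" "pds \<Gamma> (insert e E) b \<Gamma> E a id id" by blast
    have ob: "obj \<Gamma> (insert e E) b" using e(3) so(1) by (simp add: obj_def)
    then show ?thesis
      using e(2,4) so(7) triple_spec_pdiv[OF ob s(2)] s(1) T_pdiv[OF ob]
      by (intro bexI[of _ "(\<Gamma>, pdiv \<Gamma> (insert e E) b)"]) auto
  qed
qed

sublocale gp: graded_preorder T I triple_spec triple_rank "4 * g - 2"
proof
  show "equiv T I" by (rule equiv_I)
  show "T \<noteq> {}" by (rule T_nonempty)
  show "triple_rank t \<le> 4 * g - 2" if "t \<in> T" for t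
    using that obj_bounds(3) by (elim TE) simp
  show "triple_spec s t" if "(s, t) \<in> I" for s t
    using I_imp_spec[OF that] by (rule conjunct1)
qed (fact triple_spec_trans spec_imp_I triple_between triple_down triple_up)+

lemma QD_univ_eq: "QD_univ g d \<mu> = T // I"
  by (simp add: QD_univ_def)

lemma QD_univ_le_eq: "QD_univ_le g d \<mu> = gp.le"
  unfolding QD_univ_le_def gp.le_def QD_univ_eq by (simp add: triple_spec_def case_prod_beta)

lemma triple_class_eq: "triple_class g d \<mu> t = I `` {t}"
  by (simp add: triple_class_def)

section \<open>Connectedness in codimension one\<close>

definition step_rel :: "triple rel" where
  "step_rel = {(s, t). s \<in> T \<and> t \<in> T \<and> triple_rank s = 4 * g - 2 \<and> triple_rank t = 4 * g - 2 \<and>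
        ((s, t) \<in> I \<or> (\<exists>x\<in>T. Suc (triple_rank x) = 4 * g - 2 \<and> triple_spec s x \<and> triple_spec t x))}"

lemma sym_step_rel: "sym step_rel"
  using gp.I_sym by (auto simp: step_rel_def sym_def)

lemma top_rank:
  assumes "top_obj (\<Gamma>, E, a)"
  shows "(\<Gamma>, pdiv \<Gamma> E a) \<in> T" "triple_rank (\<Gamma>, pdiv \<Gamma> E a) = 4 * g - 2"
  using assms T_pdiv by (auto simp: top_obj_def)

lemma adj_step:
  assumes "adj s t"
  shows "((fst s, pdiv (fst s) (fst (snd s)) (snd (snd s))), (fst t, pdiv (fst t) (fst (snd t)) (snd (snd t)))) \<in> step_rel"
  using assms
proof cases
  case (common \<Gamma> E a \<Gamma>' E' a' \<Delta> F b \<phi> \<epsilon> \<phi>' \<epsilon>')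
  have "triple_spec (\<Gamma>, pdiv \<Gamma> E a) (\<Delta>, pdiv \<Delta> F b)" "triple_spec (\<Gamma>', pdiv \<Gamma>' E' a') (\<Delta>, pdiv \<Delta> F b)"
    using triple_spec_pdiv[OF topD(1)[OF common(3)] common(5)] triple_spec_pdiv[OF topD(1)[OF common(4)] common(5)] common(7,8) by blast+
  then show ?thesis
    using common(1,2,6) top_rank[OF common(3)] top_rank[OF common(4)] T_pdiv[OF common(5)]
    by (auto simp: step_rel_def intro!: bexI[of _ "(\<Delta>, pdiv \<Delta> F b)"])
next
  case (iso \<Gamma> E a \<Gamma>' \<psi> a' \<phi>)
  have "((\<Gamma>, pdiv \<Gamma> E a), (\<Gamma>', pdiv \<Gamma>' (\<psi> ` E) a')) \<in> I"
    using I_pdiv[OF topD(1)[OF iso(3)] topD(1)[OF iso(4)]] iso(5,6) by blast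
  then show ?thesis
    using iso(1,2) top_rank[OF iso(3)] top_rank[OF iso(4)] by (simp add: step_rel_def)
qed

lemma adj_steps:
  assumes "adj\<^sup>*\<^sup>* s t"
  shows "((fst s, pdiv (fst s) (fst (snd s)) (snd (snd s))), (fst t, pdiv (fst t) (fst (snd t)) (snd (snd t)))) \<in> step_rel\<^sup>*"
  using assms by (induction rule: rtranclp_induct) (auto intro: rtrancl_into_rtrancl adj_step)

text \<open>The normal forms reached from the two ends are adjacent; the second walk is traversed
  backwards by symmetry of \<open>step_rel\<close>.\<close>

lemma top_connected:
  assumes s: "top_obj (\<Gamma>, E, a)" and t: "top_obj (\<Gamma>', E', a')"
  shows "((\<Gamma>, pdiv \<Gamma> E a), (\<Gamma>', pdiv \<Gamma>' E' a')) \<in> step_rel\<^sup>*"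
proof -
  obtain \<Gamma>1 a1 vs1 es1 el1 where 1: "adj\<^sup>*\<^sup>* (\<Gamma>, E, a) (\<Gamma>1, E, a1)" "top_obj (\<Gamma>1, E, a1)" "normal_form \<Gamma>1 E vs1 es1 el1"
    using reach_normal_form[OF s] by blast
  obtain \<Gamma>2 a2 vs2 es2 el2 where 2: "adj\<^sup>*\<^sup>* (\<Gamma>', E', a') (\<Gamma>2, E', a2)" "top_obj (\<Gamma>2, E', a2)" "normal_form \<Gamma>2 E' vs2 es2 el2"
    using reach_normal_form[OF t] by blast
  have "adj (\<Gamma>1, E, a1) (\<Gamma>2, E', a2)" by (rule normal_forms_adj[OF 1(2,3) 2(2,3)])
  with 1(1) have "adj\<^sup>*\<^sup>* (\<Gamma>, E, a) (\<Gamma>2, E', a2)" by simp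
  then have "((\<Gamma>, pdiv \<Gamma> E a), (\<Gamma>2, pdiv \<Gamma>2 E' a2)) \<in> step_rel\<^sup>*" using adj_steps by fastforce
  moreover have "((\<Gamma>', pdiv \<Gamma>' E' a'), (\<Gamma>2, pdiv \<Gamma>2 E' a2)) \<in> step_rel\<^sup>*" using adj_steps[OF 2(1)] by simp
  then have "((\<Gamma>2, pdiv \<Gamma>2 E' a2), (\<Gamma>', pdiv \<Gamma>' E' a')) \<in> step_rel\<^sup>*"
    using sym_rtrancl[OF sym_step_rel] by (meson symD)
  ultimately show ?thesis by (rule rtrancl_trans)
qed

lemma connected_QD: "connected_in_codim1 (T // I) gp.le"
proof (rule gp.connected_in_codim1_quotient)
  fix s t assume st: "s \<in> T" "t \<in> T" and r: "triple_rank s = 4 * g - 2" "triple_rank t = 4 * g - 2"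
  obtain \<Gamma> E a where s: "s = (\<Gamma>, pdiv \<Gamma> E a)" "obj \<Gamma> E a" using TE[OF st(1)] .
  obtain \<Gamma>' E' a' where t: "t = (\<Gamma>', pdiv \<Gamma>' E' a')" "obj \<Gamma>' E' a'" using TE[OF st(2)] .
  have "top_obj (\<Gamma>, E, a)" "top_obj (\<Gamma>', E', a')" using s t r by (simp_all add: top_obj_def)
  from top_connected[OF this] show "(s, t) \<in> {(s, t). s \<in> T \<and> t \<in> T \<and> triple_rank s = 4 * g - 2 \<and> triple_rank t = 4 * g - 2 \<and>
        ((s, t) \<in> I \<or> (\<exists>x\<in>T. Suc (triple_rank x) = 4 * g - 2 \<and> triple_spec s x \<and> triple_spec t x))}\<^sup>*"
    unfolding s(1) t(1) step_rel_def .
qed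

section \<open>The forgetful map\<close>

lemma graph_class_eq_iff:
  assumes "\<Gamma> \<in> stable_graphs g" "\<Gamma>' \<in> stable_graphs g"
  shows "graph_class g \<Gamma> = graph_class g \<Gamma>' \<longleftrightarrow> (\<exists>\<phi> \<psi>. wgraph_iso \<Gamma> \<Gamma>' \<phi> \<psi>)"
  unfolding graph_class_def using eq_equiv_class_iff[OF equiv_graph_iso_rel assms] assms
  by (simp add: graph_iso_rel_def)

text \<open>\<open>forget\<close> extracts the element of a set of graph classes; that set is a
  singleton since isomorphic triples have isomorphic graphs.\<close>

lemma forget_class:
  assumes "(\<Gamma>, p) \<in> T"
  shows "forget g (I `` {(\<Gamma>, p)}) = graph_class g \<Gamma>"
proof -
  have cl: "graph_class g (fst t) = graph_class g \<Gamma>" if "((\<Gamma>, p), t) \<in> I" for t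
  proof -
    have "\<exists>\<phi> \<psi>. wgraph_iso \<Gamma> (fst t) \<phi> \<psi>"
      using that by (cases t) (simp add: triple_iso_rel_def, blast)
    moreover have "\<Gamma> \<in> stable_graphs g" "fst t \<in> stable_graphs g"
      using that by (auto simp: triple_iso_rel_def QD_triples_def)
    ultimately show ?thesis using graph_class_eq_iff[of \<Gamma> "fst t"] by simp
  qed
  have "(\<lambda>(\<Gamma>, p). graph_class g \<Gamma>) ` (I `` {(\<Gamma>, p)}) = {graph_class g \<Gamma>}"
  proof (intro equalityI subsetI)
    fix C assume "C \<in> (\<lambda>(\<Gamma>, p). graph_class g \<Gamma>) ` (I `` {(\<Gamma>, p)})"
    then obtain t where "C = graph_class g (fst t)" "((\<Gamma>, p), t) \<in> I" by (auto simp: case_prod_beta)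
    then show "C \<in> {graph_class g \<Gamma>}" using cl by simp
  next
    fix C assume "C \<in> {graph_class g \<Gamma>}"
    then show "C \<in> (\<lambda>(\<Gamma>, p). graph_class g \<Gamma>) ` (I `` {(\<Gamma>, p)})"
      using gp.I_refl[OF assms] by (intro image_eqI[of _ _ "(\<Gamma>, p)"]) simp_all
  qed
  then show ?thesis by (simp add: forget_def)
qed

lemma forget_in_SG:
  assumes "A \<in> T // I"
  shows "forget g A \<in> SG g"
proof -
  obtain t where t: "t \<in> T" "A = I `` {t}" using assms by (elim quotientE)
  obtain \<Gamma> E a where s: "t = (\<Gamma>, pdiv \<Gamma> E a)" "obj \<Gamma> E a" using TE[OF t(1)] .
  then have "forget g A = graph_iso_rel g `` {\<Gamma>}" using forget_class t by (simp add: graph_class_def)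
  then show ?thesis using objD(1)[OF s(2)] by (simp add: SG_def quotientI)
qed

lemma forget_mono:
  assumes "(B, A) \<in> gp.le"
  shows "(forget g B, forget g A) \<in> SG_le g"
proof -
  obtain s t where st: "s \<in> T" "t \<in> T" "A = I `` {s}" "B = I `` {t}" "triple_spec s t" using assms by (rule gp.leE)
  obtain \<Gamma> E a where s: "s = (\<Gamma>, pdiv \<Gamma> E a)" "obj \<Gamma> E a" using TE[OF st(1)] .
  obtain \<Gamma>' E' a' where t: "t = (\<Gamma>', pdiv \<Gamma>' E' a')" "obj \<Gamma>' E' a'" using TE[OF st(2)] .
  obtain \<phi> \<epsilon> where "wsp \<Gamma> \<Gamma>' \<phi> \<epsilon>" using st(5) triple_spec_pdiv[OF s(2) t(2)] s(1) t(1) by (auto simp: pds_def)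
  then have "wspecialization \<Gamma> \<Gamma>' \<phi> \<epsilon>" unfolding wspecialization_iff[OF objD(4)[OF s(2)]] .
  moreover have "forget g A = graph_class g \<Gamma>" "forget g B = graph_class g \<Gamma>'"
    using forget_class st s(1) t(1) by auto
  moreover have "\<Gamma> \<in> graph_class g \<Gamma>" "\<Gamma>' \<in> graph_class g \<Gamma>'"
    using equiv_class_self[OF equiv_graph_iso_rel] objD(1)[OF s(2)] objD(1)[OF t(2)] by (auto simp: graph_class_def)
  moreover have "forget g A \<in> SG g" "forget g B \<in> SG g" using forget_in_SG st gp.class_in by auto
  ultimately show ?thesis unfolding SG_le_def by auto
qed

text \<open>Closed sets are lower sets, so monotonicity of \<open>forget\<close> is all that is
  needed.\<close>

lemma forget_continuous: "continuous_map (poset_topology (T // I) gp.le) (poset_topology (SG g) (SG_le g)) (forget g)"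
  unfolding continuous_map_closedin closedin_poset_topology topspace_poset_topology
proof (intro conjI allI impI)
  show "forget g \<in> T // I \<rightarrow> SG g" using forget_in_SG by auto
  fix C assume C: "lower_set (SG g) (SG_le g) C"
  show "lower_set (T // I) gp.le {x \<in> T // I. forget g x \<in> C}"
    unfolding lower_set_def
  proof (intro conjI ballI impI)
    fix x y assume "x \<in> {x \<in> T // I. forget g x \<in> C}" "y \<in> T // I" "(y, x) \<in> gp.le"
    then show "y \<in> {x \<in> T // I. forget g x \<in> C}"
      using C forget_mono[of y x] forget_in_SG[of y] by (auto simp: lower_set_def)
  qed auto
qed

section \<open>The fibres\<close>

context
  fixes \<Gamma> assumes \<Gamma>: "\<Gamma> \<in> stable_graphs g"
begin

lemma QD_T: "p \<in> QD d \<Gamma> (\<mu> \<Gamma>) \<longleftrightarrow> (\<Gamma>, p) \<in> T"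
  using \<Gamma> by (simp add: QD_triples_def)

text \<open>With the graph fixed, isomorphisms of triples are exactly transports along
  automorphisms. Orbits thus become traces of isomorphism classes, which makes
  \<open>fibre_map\<close> well defined and injective.\<close>

lemma Aut_orbit_eq:
  assumes p: "p \<in> QD d \<Gamma> (\<mu> \<Gamma>)"
  shows "Aut_orbit \<Gamma> p = {p'. ((\<Gamma>, p), (\<Gamma>, p')) \<in> I}"
proof (intro equalityI subsetI)
  fix p' assume "p' \<in> Aut_orbit \<Gamma> p"
  then obtain \<phi> \<psi> where i: "wgraph_iso \<Gamma> \<Gamma> \<phi> \<psi>" "p' = pd_transport \<Gamma> \<Gamma> (\<phi>, \<psi>) p"
    by (auto simp: Aut_orbit_def Aut_def)
  obtain E a where "p = pdiv \<Gamma> E a" "obj \<Gamma> E a" using p QD_obj[OF \<Gamma>] by blast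
  then show "p' \<in> {p'. ((\<Gamma>, p), (\<Gamma>, p')) \<in> I}" using transport_iso(2)[OF _ \<Gamma> i(1)] i(2) by auto
next
  fix p' assume "p' \<in> {p'. ((\<Gamma>, p), (\<Gamma>, p')) \<in> I}"
  then show "p' \<in> Aut_orbit \<Gamma> p" by (force simp: triple_iso_rel_def Aut_orbit_def Aut_def)
qed

text \<open>Orbits are sets, so a representative has to be chosen; \<open>fibre_map_orbit\<close>
  shows that the class does not depend on it.\<close>

definition fibre_map :: "(nat, nat) pseudo_divisor set \<Rightarrow> triple set" where
  "fibre_map P = I `` {(\<Gamma>, SOME p. p \<in> P)}"

lemma fibre_map_orbit:
  assumes p: "p \<in> QD d \<Gamma> (\<mu> \<Gamma>)"
  shows "fibre_map (Aut_orbit \<Gamma> p) = I `` {(\<Gamma>, p)}"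
proof -
  have "p \<in> Aut_orbit \<Gamma> p" using gp.I_refl p QD_T unfolding Aut_orbit_eq[OF p] by blast
  then have "(SOME p'. p' \<in> Aut_orbit \<Gamma> p) \<in> Aut_orbit \<Gamma> p" by (rule someI)
  then have "((\<Gamma>, p), (\<Gamma>, SOME p'. p' \<in> Aut_orbit \<Gamma> p)) \<in> I" unfolding Aut_orbit_eq[OF p] by blast
  then show ?thesis unfolding fibre_map_def using gp.class_eq by blast
qed

lemma fibre_map_bij:
  "bij_betw fibre_map (QD_mod_Aut d \<Gamma> (\<mu> \<Gamma>)) {A \<in> T // I. forget g A = graph_class g \<Gamma>}"
  unfolding bij_betw_def
proof
  show "inj_on fibre_map (QD_mod_Aut d \<Gamma> (\<mu> \<Gamma>))"
  proof (rule inj_onI)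
    fix P Q assume "P \<in> QD_mod_Aut d \<Gamma> (\<mu> \<Gamma>)" "Q \<in> QD_mod_Aut d \<Gamma> (\<mu> \<Gamma>)" and eq: "fibre_map P = fibre_map Q"
    then obtain p q where p: "p \<in> QD d \<Gamma> (\<mu> \<Gamma>)" "P = Aut_orbit \<Gamma> p" and q: "q \<in> QD d \<Gamma> (\<mu> \<Gamma>)" "Q = Aut_orbit \<Gamma> q"
      by (auto simp: QD_mod_Aut_def)
    then have "I `` {(\<Gamma>, p)} = I `` {(\<Gamma>, q)}" using eq fibre_map_orbit by simp
    then show "P = Q" unfolding p(2) q(2) Aut_orbit_eq[OF p(1)] Aut_orbit_eq[OF q(1)] by blast
  qed
  show "fibre_map ` QD_mod_Aut d \<Gamma> (\<mu> \<Gamma>) = {A \<in> T // I. forget g A = graph_class g \<Gamma>}"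
  proof (intro equalityI subsetI)
    fix A assume "A \<in> fibre_map ` QD_mod_Aut d \<Gamma> (\<mu> \<Gamma>)"
    then obtain p where p: "p \<in> QD d \<Gamma> (\<mu> \<Gamma>)" "A = I `` {(\<Gamma>, p)}"
      using fibre_map_orbit by (auto simp: QD_mod_Aut_def)
    then show "A \<in> {A \<in> T // I. forget g A = graph_class g \<Gamma>}"
      using QD_T forget_class gp.class_in by simp
  next
    fix A assume A: "A \<in> {A \<in> T // I. forget g A = graph_class g \<Gamma>}"
    then obtain t where t: "t \<in> T" "A = I `` {t}" by (auto elim!: quotientE)
    obtain \<Gamma>' E a where s: "t = (\<Gamma>', pdiv \<Gamma>' E a)" "obj \<Gamma>' E a" using TE[OF t(1)] .
    have "graph_class g \<Gamma>' = graph_class g \<Gamma>" using A t s(1) forget_class by simp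
    then obtain \<phi> \<psi> where i: "wgraph_iso \<Gamma>' \<Gamma> \<phi> \<psi>" using graph_class_eq_iff[OF objD(1)[OF s(2)] \<Gamma>] by blast
    \<comment> \<open>A triple over an isomorphic graph is moved onto \<open>\<Gamma>\<close>
      itself, which gives surjectivity.\<close>
    let ?p = "pd_transport \<Gamma>' \<Gamma> (\<phi>, \<psi>) (pdiv \<Gamma>' E a)"
    have p: "?p \<in> QD d \<Gamma> (\<mu> \<Gamma>)" "(t, (\<Gamma>, ?p)) \<in> I" using transport_iso[OF s(2) \<Gamma> i] s(1) by auto
    then have "A = fibre_map (Aut_orbit \<Gamma> ?p)" using fibre_map_orbit[OF p(1)] gp.class_eq[OF p(2)] t(2) by simp
    then show "A \<in> fibre_map ` QD_mod_Aut d \<Gamma> (\<mu> \<Gamma>)" using p(1) by (auto simp: QD_mod_Aut_def)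
  qed
qed

text \<open>A specialization from \<open>\<Gamma>\<close> to itself is an automorphism; transporting the target back along
  it turns a specialization over it into one over the identity.\<close>

lemma spec_over_id:
  assumes p: "p \<in> QD d \<Gamma> (\<mu> \<Gamma>)" and p': "p' \<in> QD d \<Gamma> (\<mu> \<Gamma>)" and sp: "triple_spec (\<Gamma>, p) (\<Gamma>, p')"
  shows "\<exists>q\<in>Aut_orbit \<Gamma> p'. (q, p) \<in> QD_le d \<Gamma> (\<mu> \<Gamma>)"
proof -
  obtain E a where e: "p = pdiv \<Gamma> E a" "obj \<Gamma> E a" using p QD_obj[OF \<Gamma>] by blast
  obtain E' a' where e': "p' = pdiv \<Gamma> E' a'" "obj \<Gamma> E' a'" using p' QD_obj[OF \<Gamma>] by blast
  obtain \<phi> \<epsilon> where pd: "pds \<Gamma> E a \<Gamma> E' a' \<phi> \<epsilon>" using sp triple_spec_pdiv[OF e(2) e'(2)] e(1) e'(1) by auto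
  note so = objD[OF e(2)] and so' = objD[OF e'(2)]
  obtain t where w: "wsp \<Gamma> \<Gamma> \<phi> \<epsilon>" and sub: "\<epsilon> ` E' \<subseteq> E" and t: "\<forall>e\<in>E. t e \<in> ends \<Gamma> e"
    and a': "\<And>v'. v' \<in> verts \<Gamma> \<Longrightarrow> a' v' = (\<Sum>v\<in>{v \<in> verts \<Gamma>. \<phi> v = v'}. a v) - int (card {e \<in> E - \<epsilon> ` E'. \<phi> (t e) = v'})"
    using pd by (auto simp: pds_def)
  have iso: "wgraph_iso \<Gamma> \<Gamma> \<phi> (inv_into (edges \<Gamma>) \<epsilon>)" by (rule wsp_imp_iso(1)[OF w so(4) refl])
  have gs: "gspec \<Gamma> \<Gamma> \<phi> \<epsilon>" using w by (simp add: wsp_def)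
  have inj: "inj_on \<phi> (verts \<Gamma>)" using iso by (simp add: wgraph_iso_def graph_iso_def bij_betw_def)
  \<comment> \<open>The target is pulled back along \<open>\<phi>\<close>; its exceptional edges
    become the image of \<open>E'\<close> under \<open>\<epsilon>\<close>.\<close>
  let ?b = "\<lambda>v. a' (\<phi> v)"
  have pd': "pds \<Gamma> E a \<Gamma> (\<epsilon> ` E') ?b id id"
    unfolding pds_def
  proof (intro conjI wsp_refl exI[of _ t] t ballI)
    fix v assume v: "v \<in> verts \<Gamma>"
    have "{u \<in> verts \<Gamma>. \<phi> u = \<phi> v} = {u \<in> verts \<Gamma>. id u = v}" using inj v by (auto simp: inj_on_def)
    moreover have "t e \<in> verts \<Gamma>" if "e \<in> E" for e using t that so(3,4) by (auto simp: well_attached_def)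
    then have "{e \<in> E - \<epsilon> ` E'. \<phi> (t e) = \<phi> v} = {e \<in> E - id ` \<epsilon> ` E'. id (t e) = v}"
      using inj v by (auto simp: inj_on_def)
    ultimately show "a' (\<phi> v) = (\<Sum>u\<in>{u \<in> verts \<Gamma>. id u = v}. a u) - int (card {e \<in> E - id ` \<epsilon> ` E'. id (t e) = v})"
      using a'[OF gspec_in(2)[OF gs v]] by simp
  qed (use sub in auto)
  have sub': "\<epsilon> ` E' \<subseteq> edges \<Gamma>" using sub so(3) by blast
  have ob: "obj \<Gamma> (\<epsilon> ` E') ?b" by (rule obj_pds[OF e(2) \<Gamma> sub' pd'])
  let ?q = "pdiv \<Gamma> (\<epsilon> ` E') ?b"
  have q: "?q \<in> QD d \<Gamma> (\<mu> \<Gamma>)" using ob QD_obj[OF \<Gamma>] by blast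
  have "E' = inv_into (edges \<Gamma>) \<epsilon> ` \<epsilon> ` E'"
    using inv_into_image_cancel[OF gspec_inj[OF gs] so'(3)] by simp
  then have "((\<Gamma>, ?q), (\<Gamma>, p')) \<in> I" unfolding e'(1) I_pdiv[OF ob e'(2)] using iso by blast
  then have "?q \<in> Aut_orbit \<Gamma> p'" unfolding Aut_orbit_eq[OF p'] using gp.I_sym by blast
  moreover have "pd_specialization \<Gamma> p \<Gamma> ?q id id"
    unfolding e(1) pd_specialization_pdiv[OF so(4,3) sub'] by (rule pd')
  then have "(?q, p) \<in> QD_le d \<Gamma> (\<mu> \<Gamma>)" using p q by (simp add: QD_le_def)
  ultimately show ?thesis by blast
qed

text \<open>The order of the quotient asks for specializations over the identity, that of the
  universal poset for arbitrary ones; \<open>spec_over_id\<close> bridges the gap by moving the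
  target within its orbit.\<close>

lemma fibre_map_le:
  assumes P: "P \<in> QD_mod_Aut d \<Gamma> (\<mu> \<Gamma>)" and P': "P' \<in> QD_mod_Aut d \<Gamma> (\<mu> \<Gamma>)"
  shows "(P', P) \<in> QD_mod_Aut_le d \<Gamma> (\<mu> \<Gamma>) \<longleftrightarrow> (fibre_map P', fibre_map P) \<in> gp.le"
proof -
  obtain p where p: "p \<in> QD d \<Gamma> (\<mu> \<Gamma>)" "P = Aut_orbit \<Gamma> p" using P by (auto simp: QD_mod_Aut_def)
  obtain p' where p': "p' \<in> QD d \<Gamma> (\<mu> \<Gamma>)" "P' = Aut_orbit \<Gamma> p'" using P' by (auto simp: QD_mod_Aut_def)
  have T: "(\<Gamma>, p) \<in> T" "(\<Gamma>, p') \<in> T" using p(1) p'(1) QD_T by auto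
  have "(fibre_map P', fibre_map P) \<in> gp.le \<longleftrightarrow> triple_spec (\<Gamma>, p) (\<Gamma>, p')"
    unfolding p(2) p'(2) fibre_map_orbit[OF p(1)] fibre_map_orbit[OF p'(1)] by (rule gp.le_class_iff[OF T])
  also have "\<dots> \<longleftrightarrow> (\<exists>q'\<in>P'. \<exists>q\<in>P. (q', q) \<in> QD_le d \<Gamma> (\<mu> \<Gamma>))"
  proof
    assume "triple_spec (\<Gamma>, p) (\<Gamma>, p')"
    moreover have "p \<in> P" unfolding p(2) Aut_orbit_eq[OF p(1)] using gp.I_refl[OF T(1)] by blast
    ultimately show "\<exists>q'\<in>P'. \<exists>q\<in>P. (q', q) \<in> QD_le d \<Gamma> (\<mu> \<Gamma>)"
      using spec_over_id[OF p(1) p'(1)] p'(2) by blast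
  next
    assume "\<exists>q'\<in>P'. \<exists>q\<in>P. (q', q) \<in> QD_le d \<Gamma> (\<mu> \<Gamma>)"
    then obtain q q' where q: "q \<in> P" "q' \<in> P'" "(q', q) \<in> QD_le d \<Gamma> (\<mu> \<Gamma>)" by blast
    have I: "((\<Gamma>, p), (\<Gamma>, q)) \<in> I" "((\<Gamma>, p'), (\<Gamma>, q')) \<in> I"
      using q p p' Aut_orbit_eq by auto
    have "triple_spec (\<Gamma>, q) (\<Gamma>, q')" using q(3) by (auto simp: QD_le_def triple_spec_def)
    then show "triple_spec (\<Gamma>, p) (\<Gamma>, p')"
      using gp.le_class_iff I gp.class_eq gp.I_in by metis
  qed
  finally show ?thesis using P P' by (simp add: QD_mod_Aut_le_def)
qed

end

end

theorem theorem4p15: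
  fixes g :: nat and d :: int and \<mu> :: "(nat, nat) wgraph \<Rightarrow> nat \<Rightarrow> real"
  assumes "g \<ge> 1" and "universal_polarization g d \<mu>"
  shows "pure_dimension (QD_univ g d \<mu>) (QD_univ_le g d \<mu>) (4 * g - 2) \<and>
    connected_in_codim1 (QD_univ g d \<mu>) (QD_univ_le g d \<mu>) \<and>
    continuous_map (poset_topology (QD_univ g d \<mu>) (QD_univ_le g d \<mu>))
                   (poset_topology (SG g) (SG_le g)) (forget g) \<and>
    (\<forall>\<Gamma>\<in>stable_graphs g. \<exists>F.
       bij_betw F (QD_mod_Aut d \<Gamma> (\<mu> \<Gamma>)) {A \<in> QD_univ g d \<mu>. forget g A = graph_class g \<Gamma>} \<and>
       (\<forall>p\<in>QD d \<Gamma> (\<mu> \<Gamma>). F (Aut_orbit \<Gamma> p) = triple_class g d \<mu> (\<Gamma>, p)) \<and>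
       (\<forall>P\<in>QD_mod_Aut d \<Gamma> (\<mu> \<Gamma>). \<forall>P'\<in>QD_mod_Aut d \<Gamma> (\<mu> \<Gamma>).
          (P', P) \<in> QD_mod_Aut_le d \<Gamma> (\<mu> \<Gamma>) \<longleftrightarrow> (F P', F P) \<in> QD_univ_le g d \<mu>))"
proof -
  interpret universal_pol g d \<mu> using assms by unfold_locales
  show ?thesis
    unfolding QD_univ_eq QD_univ_le_eq
  proof (intro conjI ballI)
    show "pure_dimension (T // I) gp.le (4 * g - 2)" by (rule gp.pure_dimension)
    show "connected_in_codim1 (T // I) gp.le" by (rule connected_QD)
    show "continuous_map (poset_topology (T // I) gp.le) (poset_topology (SG g) (SG_le g)) (forget g)"
      by (rule forget_continuous)
    fix \<Gamma> assume \<Gamma>: "\<Gamma> \<in> stable_graphs g"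
    show "\<exists>F. bij_betw F (QD_mod_Aut d \<Gamma> (\<mu> \<Gamma>)) {A \<in> T // I. forget g A = graph_class g \<Gamma>} \<and>
       (\<forall>p\<in>QD d \<Gamma> (\<mu> \<Gamma>). F (Aut_orbit \<Gamma> p) = triple_class g d \<mu> (\<Gamma>, p)) \<and>
       (\<forall>P\<in>QD_mod_Aut d \<Gamma> (\<mu> \<Gamma>). \<forall>P'\<in>QD_mod_Aut d \<Gamma> (\<mu> \<Gamma>).
          (P', P) \<in> QD_mod_Aut_le d \<Gamma> (\<mu> \<Gamma>) \<longleftrightarrow> (F P', F P) \<in> gp.le)"
      using fibre_map_bij[OF \<Gamma>] fibre_map_orbit[OF \<Gamma>] fibre_map_le[OF \<Gamma>]
      by (intro exI[of _ "fibre_map \<Gamma>"]) (simp add: triple_class_eq)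
  qed
qed

end
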